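(* Let $m>1$ be an integer, $q=2^m$, and let $B$ be a set with $q^3+1$ elements. Let $G'$ be a group acting faithfully on $B$, and assume that $G'$ contains a subgroup isomorphic to $\mathbf{U}_3(q)=\mathrm{PSU}_3(\mathbb{F}_q)$. Then the $G'$-module $Q_B$ is very simple.
   Context: For a finite set $B$ of odd cardinality, $\mathbb{F}_2^B$ is the $\mathbb{F}_2$-vector space of maps $h:B\to\mathbb{F}_2$, on which a permutation $s$ of $B$ acts by $(sh)(b)=h(s^{-1}(b))$; $Q_B=\{h:B\to\mathbb{F}_2\mid \sum_{b\in B}h(b)=0\}$ is the invariant hyperplane, a module for any group acting on $B$. A representation $\rho:G\to\mathrm{Aut}_{F}(V)$ over a field $F$ is called very simple if for every $F$-subalgebra $R\subseteq\mathrm{End}_F(V)$ containing the identity and satisfying $\rho(\sigma)R\rho(\sigma)^{-1}\subseteq R$ for all $\sigma\in G$, either $R=F\cdot\mathrm{Id}$ or $R=\mathrm{End}_F(V)$. $\mathbf{U}_3(q)=\mathrm{PSU}_3(\mathbb{F}_q)$ is the quotient by its center of $\mathrm{SU}_3(\mathbb{F}_q)$, the group of matrices in $\mathrm{SL}_3(\mathbb{F}_{q^2})$ preserving a nondegenerate Hermitian form on $\mathbb{F}_{q^2}^3$ with respect to $a\mapsto a^q$. *)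

theory Defs
  imports "HOL-Analysis.Analysis" "HOL-Algebra.Group_Action" "HOL-Library.Z2"
begin

section \<open>The groups SU_3 and PSU_3 = U_3(q)\<close>

text \<open>Entrywise Frobenius a |-> a^q on a matrix.\<close>
definition frob_mat :: "nat \<Rightarrow> 'k::field^'n^'m \<Rightarrow> 'k^'n^'m" where
  "frob_mat q A = (\<chi> i j. (A $ i $ j) ^ q)"

text \<open>A 3x3 matrix J (Gram matrix of the form h(x,y) = x^T J y^(q)) is Hermitian
  w.r.t. a |-> a^q and nondegenerate.\<close>
definition nondeg_hermitian :: "nat \<Rightarrow> 'k::field^3^3 \<Rightarrow> bool" where
  "nondeg_hermitian q J \<longleftrightarrow> transpose J = frob_mat q J \<and> det J \<noteq> 0"

text \<open>SU_3: matrices of determinant 1 preserving the form given by J.\<close>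
definition SU3 :: "nat \<Rightarrow> 'k::field^3^3 \<Rightarrow> ('k^3^3) set" where
  "SU3 q J = {A. det A = 1 \<and> transpose A ** J ** frob_mat q A = J}"

definition SU3_group :: "nat \<Rightarrow> 'k::field^3^3 \<Rightarrow> ('k^3^3) monoid" where
  "SU3_group q J = \<lparr>carrier = SU3 q J, mult = (**), one = mat 1\<rparr>"

definition group_center :: "('a, 'm) monoid_scheme \<Rightarrow> 'a set" where
  "group_center G = {z \<in> carrier G. \<forall>g \<in> carrier G. z \<otimes>\<^bsub>G\<^esub> g = g \<otimes>\<^bsub>G\<^esub> z}"

definition PSU3_group :: "nat \<Rightarrow> 'k::field^3^3 \<Rightarrow> ('k^3^3) set monoid" where
  "PSU3_group q J = SU3_group q J Mod group_center (SU3_group q J)"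

section \<open>The module Q_B over F_2 (F_2 = type bit)\<close>

text \<open>Maps h : B -> F_2, represented as functions vanishing outside B, with sum zero.\<close>
definition QB :: "'b set \<Rightarrow> ('b \<Rightarrow> bit) set" where
  "QB B = {h. (\<forall>x. x \<notin> B \<longrightarrow> h x = 0) \<and> sum h B = 0}"

text \<open>(s h)(b) = h(s^-1 b) for a permutation s of B.\<close>
definition perm_act :: "'b set \<Rightarrow> ('b \<Rightarrow> 'b) \<Rightarrow> ('b \<Rightarrow> bit) \<Rightarrow> ('b \<Rightarrow> bit)" where
  "perm_act B s h = (\<lambda>b. if b \<in> B then h (inv_into B s b) else 0)"

text \<open>The representation of G on Q_B induced by the action phi of G on B.\<close>
definition rep_QB :: "'b set \<Rightarrow> ('g \<Rightarrow> 'b \<Rightarrow> 'b) \<Rightarrow> 'g \<Rightarrow> ('b \<Rightarrow> bit) \<Rightarrow> ('b \<Rightarrow> bit)" where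
  "rep_QB B \<phi> \<sigma> = (\<lambda>h \<in> QB B. perm_act B (\<phi> \<sigma>) h)"

text \<open>End_{F_2}(V) for an F_2-subspace V: additive (hence F_2-linear) maps V -> V.\<close>
definition End_F2 :: "('b \<Rightarrow> bit) set \<Rightarrow> (('b \<Rightarrow> bit) \<Rightarrow> ('b \<Rightarrow> bit)) set" where
  "End_F2 V = {f \<in> V \<rightarrow>\<^sub>E V. \<forall>u \<in> V. \<forall>v \<in> V. f (\<lambda>x. u x + v x) = (\<lambda>x. f u x + f v x)}"

text \<open>Very simple: every unital F_2-subalgebra R of End(V) stable under conjugation
  by rho(G) is F_2 Id or End(V).\<close>
definition very_simple_F2 ::
  "('g, 'm) monoid_scheme \<Rightarrow> ('b \<Rightarrow> bit) set \<Rightarrow> ('g \<Rightarrow> ('b \<Rightarrow> bit) \<Rightarrow> ('b \<Rightarrow> bit)) \<Rightarrow> bool" where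
  "very_simple_F2 G V \<rho> \<longleftrightarrow>
     (\<forall>R. R \<subseteq> End_F2 V
        \<and> (\<lambda>v \<in> V. v) \<in> R
        \<and> (\<forall>c::bit. \<forall>f \<in> R. (\<lambda>v \<in> V. (\<lambda>b. c * f v b)) \<in> R)
        \<and> (\<forall>f \<in> R. \<forall>g \<in> R. (\<lambda>v \<in> V. (\<lambda>x. f v x + g v x)) \<in> R)
        \<and> (\<forall>f \<in> R. \<forall>g \<in> R. compose V f g \<in> R)
        \<and> (\<forall>\<sigma> \<in> carrier G. \<forall>f \<in> R. compose V (\<rho> \<sigma>) (compose V f (\<rho> (inv\<^bsub>G\<^esub> \<sigma>))) \<in> R)
      \<longrightarrow> R = {(\<lambda>v \<in> V. (\<lambda>b. c * v b)) | c::bit. True} \<or> R = End_F2 V)"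

end

theory Submission
  imports Defs "HOL-Algebra.Sylow" "HOL-Library.Function_Algebras"
    "HOL-Number_Theory.Residues" "HOL-Computational_Algebra.Polynomial"
begin

text \<open>
  Write S for SU_3(q). Every subgroup of S of index at most q^3 is S itself: if a proper subgroup M of this
  kind meets some conjugate of the Sylow 2-subgroup U trivially, then the fixed points of a generic torus
  element pair off the q^3 + 1 isotropic lines, whose number is odd; otherwise M contains involutions fixing
  each isotropic line, so M is transitive, and counting the elements of its point stabiliser leaves only
  q = 8 and |M| = 513 * 72, which the elements of order 19 exclude. Consequently any nontrivial action of S
  on q^3 + 1 points is the one on isotropic lines.

  Let R be a unital algebra of endomorphisms of Q_B normalised by S. Non-isomorphic simple R-submodules are
  independent, so the stabiliser in S of an isomorphism class has index at most dim Q_B = q^3; hence all simple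
  submodules are isomorphic, their number is odd, and U stabilises one of them, W. The only nonzero U-fixed
  vector of Q_B is the complement of the point fixed by U, so the U-fixed endomorphisms of W are 0 and 1. This
  forces the endomorphism ring of W to be commutative and then, since S has no subgroup of index 2, to be F_2.
  Comparing the conjugates of W, which are indexed by B, shows that W is either all of Q_B, so that R is the
  full endomorphism ring by density, or a line, so that R consists of scalars.
\<close>

text \<open>The number q^3 occurs in two roles: it is the dimension of Q_B, hence a bound for the
  number of pairwise non-isomorphic simple submodules, and it is the number of isotropic lines other
  than a given one. One statement on subgroups of index at most q^3 therefore serves twice, to
  recognise the given action and to show that S fixes every isomorphism class. For transitive M it
  is proved by counting: the elements of M fixing a line split into a diagonal part of order c, a
  part of order a modulo the center of U, and a part of order Q in that center, and index at most
  q^3 means q^2 - 1 <= c a Q. For q = 8 the values c = 9, a = 4, Q = 2 give 72 against 63 and pass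
  all divisibility conditions. The argument runs in SU_3, whose elements are explicit matrices; it
  reaches G' through the quotient by the center, and what is carried over is that the action on B is
  nontrivial. The assumption m > 1 enters as q >= 4: there must be a diagonal element acting on U
  without nontrivial fixed points, and an element of F_q other than 0 and 1.\<close>

section \<open>Group actions, orbits, and fixed points of p-groups\<close>

definition acts_on :: "('g, 'm) monoid_scheme \<Rightarrow> 'g set \<Rightarrow> 'x set \<Rightarrow> ('g \<Rightarrow> 'x \<Rightarrow> 'x) \<Rightarrow> bool" where
  "acts_on G H X a \<longleftrightarrow> (\<forall>g\<in>H. \<forall>x\<in>X. a g x \<in> X) \<and> (\<forall>x\<in>X. a \<one>\<^bsub>G\<^esub> x = x)
     \<and> (\<forall>g\<in>H. \<forall>h\<in>H. \<forall>x\<in>X. a (g \<otimes>\<^bsub>G\<^esub> h) x = a g (a h x))"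

context group
begin

lemma acts_on_subset: "acts_on G H X a \<Longrightarrow> K \<subseteq> H \<Longrightarrow> acts_on G K X a"
  unfolding acts_on_def by blast

lemma acts_on_inv:
  assumes "acts_on G H X a" "subgroup H G" "g \<in> H" "x \<in> X"
  shows "a (inv g) (a g x) = x" "a g (a (inv g) x) = x"
proof -
  have "inv g \<in> H" "g \<in> carrier G"
    using subgroup.m_inv_closed[OF assms(2,3)] subgroup.mem_carrier[OF assms(2,3)] by simp_all
  then show "a (inv g) (a g x) = x" "a g (a (inv g) x) = x"
    using assms unfolding acts_on_def by (metis l_inv, metis r_inv)
qed

lemma acts_on_inj:
  assumes "acts_on G H X a" "subgroup H G" "g \<in> H"
  shows "inj_on (a g) X"
  by (rule inj_on_inverseI[of _ "a (inv g)"]) (simp add: acts_on_inv[OF assms])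

lemma acts_on_image:
  assumes "acts_on G H X a" "subgroup H G" "g \<in> H"
  shows "a g ` X = X"
proof
  show "a g ` X \<subseteq> X" using assms unfolding acts_on_def by blast
  show "X \<subseteq> a g ` X"
  proof
    fix x assume x: "x \<in> X"
    have "inv g \<in> H" by (rule subgroup.m_inv_closed[OF assms(2,3)])
    then have "a (inv g) x \<in> X" using assms x unfolding acts_on_def by blast
    then show "x \<in> a g ` X" using acts_on_inv(2)[OF assms x] by force
  qed
qed

text \<open>\<open>acts_on\<close> leaves the values outside H and X free, so one map serves for
  every subgroup and every invariant subset; restricting it to X turns it into the extensional
  \<open>group_action\<close>, for which orbits can be counted.\<close>

lemma acts_on_group_action:
  assumes "acts_on G H X a" "subgroup H G"
  shows "group_action (G\<lparr>carrier := H\<rparr>) X (\<lambda>g. restrict (a g) X)"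
proof -
  have grp: "group (G\<lparr>carrier := H\<rparr>)" by (rule subgroup.subgroup_is_group[OF assms(2) is_group])
  have bij: "restrict (a g) X \<in> Bij X" if "g \<in> H" for g
    unfolding Bij_def bij_betw_def
    using acts_on_inj[OF assms that] acts_on_image[OF assms that] by (auto simp: inj_on_def)
  have "(\<lambda>g. restrict (a g) X) \<in> hom (G\<lparr>carrier := H\<rparr>) (BijGroup X)"
    using bij assms(1) unfolding hom_def BijGroup_def acts_on_def
    by (auto simp: compose_def fun_eq_iff)
  then show ?thesis
    unfolding group_action_def group_hom_def group_hom_axioms_def
    using grp group_BijGroup by blast
qed

lemma acts_on_orbit_stabilizer:
  assumes "acts_on G H X a" "subgroup H G" "x \<in> X"
  shows "card ((\<lambda>g. a g x) ` H) * card {g\<in>H. a g x = x} = card H"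
proof -
  interpret A: group_action "G\<lparr>carrier := H\<rparr>" X "\<lambda>g. restrict (a g) X"
    by (rule acts_on_group_action[OF assms(1,2)])
  have "orbit (G\<lparr>carrier := H\<rparr>) (\<lambda>g. restrict (a g) X) x = (\<lambda>g. a g x) ` H"
    unfolding orbit_def using assms(3) by auto
  moreover have "stabilizer (G\<lparr>carrier := H\<rparr>) (\<lambda>g. restrict (a g) X) x = {g\<in>H. a g x = x}"
    unfolding stabilizer_def using assms(3) by auto
  ultimately show ?thesis using A.orbit_stabilizer_theorem[OF assms(3)] by (simp add: order_def)
qed

text \<open>Every orbit of H has p-power size, so an orbit that is not a single fixed point
  contributes a multiple of p. The difference of the two numbers is summed orbit by orbit, as an
  integer.\<close>

lemma p_group_fixed_points:
  assumes p: "prime p" "card H = p ^ n" and ac: "acts_on G H X a" and H: "subgroup H G" and fin: "finite X"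
  shows "[card X = card {x\<in>X. \<forall>h\<in>H. a h x = x}] (mod p)"
proof -
  interpret A: group_action "G\<lparr>carrier := H\<rparr>" X "\<lambda>g. restrict (a g) X"
    by (rule acts_on_group_action[OF ac H])
  let ?F = "{x\<in>X. \<forall>h\<in>H. a h x = x}"
  let ?O = "orbits (G\<lparr>carrier := H\<rparr>) X (\<lambda>g. restrict (a g) X)"
  have orb: "orbit (G\<lparr>carrier := H\<rparr>) (\<lambda>g. restrict (a g) X) x = (\<lambda>g. a g x) ` H" if "x \<in> X" for x
    unfolding orbit_def using that by auto
  have one: "\<one> \<in> H" using H by (simp add: subgroup.one_closed)
  have finO: "finite ?O" unfolding orbits_def using fin by simp
  have split: "int (card X) - int (card ?F) = (\<Sum>o1\<in>?O. \<Sum>x\<in>o1. if x \<in> ?F then 0 else 1)"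
  proof -
    have "(\<Sum>o1\<in>?O. \<Sum>x\<in>o1. if x \<in> ?F then 0 else 1) = (\<Sum>x\<in>X. if x \<in> ?F then 0 else (1::int))"
      by (rule A.disjoint_sum[OF fin])
    also have "\<dots> = (\<Sum>x\<in>X - ?F. 1)"
      by (rule sum.mono_neutral_cong_right) (use fin in auto)
    also have "\<dots> = int (card (X - ?F))" by simp
    also have "\<dots> = int (card X) - int (card ?F)"
      using fin by (subst card_Diff_subset) (auto simp: of_nat_diff card_mono)
    finally show ?thesis by simp
  qed
  have key: "int p dvd (\<Sum>x\<in>o1. if x \<in> ?F then 0 else 1)" if o1: "o1 \<in> ?O" for o1
  proof -
    obtain x where x: "x \<in> X" "o1 = (\<lambda>g. a g x) ` H" using o1 orb unfolding orbits_def by blast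
    show ?thesis
    proof (cases "card o1 = 1")
      case True
      then obtain y where y: "o1 = {y}" using card_1_singletonE by blast
      have "x \<in> o1" using x one ac unfolding acts_on_def by force
      then have "y = x" using y by simp
      then have "x \<in> ?F" using x y by auto
      then show ?thesis using y \<open>y = x\<close> by simp
    next
      case False
      have "card o1 dvd p ^ n" using acts_on_orbit_stabilizer[OF ac H x(1)] x(2) p(2) by (metis dvd_triv_left)
      then obtain i where i: "card o1 = p ^ i" using p(1) divides_primepow_nat by blast
      then have "p dvd card o1" using False by (cases i) auto
      moreover have nF: "y \<notin> ?F" if y: "y \<in> o1" for y
      proof
        assume yF: "y \<in> ?F"
        obtain g where g: "g \<in> H" "y = a g x" using y x by blast
        have "inv g \<in> H" by (rule subgroup.m_inv_closed[OF H g(1)])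
        then have "x = y" using acts_on_inv(1)[OF ac H g(1) x(1)] yF g by auto
        then have "o1 = {x}" using x yF one by auto
        then show False using False by simp
      qed
      have "(\<Sum>x\<in>o1. if x \<in> ?F then 0 else 1) = (\<Sum>x\<in>o1. 1::int)"
        by (rule sum.cong[OF refl]) (simp add: nF del: mem_Collect_eq)
      ultimately show ?thesis by simp
    qed
  qed
  have "int p dvd int (card X) - int (card ?F)" unfolding split by (rule dvd_sum) (rule key)
  then have "[int (card X) = int (card ?F)] (mod int p)" by (simp add: cong_iff_dvd_diff)
  then show ?thesis using cong_int_iff by blast
qed

end

section \<open>Modules over an algebra normalised by a group\<close>

text \<open>The elements of R only name endomorphisms of V: the closure conditions ask for some element of R
  with the right values on V, so the values outside V play no role.\<close>

locale stable_algebra = group S for S :: "('g, 'x) monoid_scheme" (structure) +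
  fixes V :: "'v::ab_group_add set" and \<rho> :: "'g \<Rightarrow> 'v \<Rightarrow> 'v"
    and R :: "'r set" and ap :: "'r \<Rightarrow> 'v \<Rightarrow> 'v" (infixr \<open>\<star>\<close> 75)
  assumes char2: "(x::'v) + x = 0"
    and finS: "finite (carrier S)"
    and finV: "finite V" and V0: "0 \<in> V" and Vadd: "x \<in> V \<Longrightarrow> y \<in> V \<Longrightarrow> x + y \<in> V"
    and rho_acts: "acts_on S (carrier S) V \<rho>"
    and rho_add: "g \<in> carrier S \<Longrightarrow> x \<in> V \<Longrightarrow> y \<in> V \<Longrightarrow> \<rho> g (x + y) = \<rho> g x + \<rho> g y"
    and R_closed: "r \<in> R \<Longrightarrow> x \<in> V \<Longrightarrow> r \<star> x \<in> V"
    and R_add: "r \<in> R \<Longrightarrow> x \<in> V \<Longrightarrow> y \<in> V \<Longrightarrow> r \<star> (x + y) = r \<star> x + r \<star> y"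
    and R_one: "\<exists>i\<in>R. \<forall>v\<in>V. i \<star> v = v"
    and R_plus: "r \<in> R \<Longrightarrow> s \<in> R \<Longrightarrow> \<exists>t\<in>R. \<forall>v\<in>V. t \<star> v = r \<star> v + s \<star> v"
    and R_comp: "r \<in> R \<Longrightarrow> s \<in> R \<Longrightarrow> \<exists>t\<in>R. \<forall>v\<in>V. t \<star> v = r \<star> s \<star> v"
    and R_conj: "g \<in> carrier S \<Longrightarrow> r \<in> R \<Longrightarrow> \<exists>t\<in>R. \<forall>v\<in>V. t \<star> v = \<rho> g (r \<star> \<rho> (inv g) v)"
begin

text \<open>Over F_2 an additively closed set containing 0 is a subspace.\<close>

definition subsp :: "'v set \<Rightarrow> bool" where
  "subsp D \<longleftrightarrow> 0 \<in> D \<and> D \<subseteq> V \<and> (\<forall>x\<in>D. \<forall>y\<in>D. x + y \<in> D)"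

definition rsub :: "'v set \<Rightarrow> bool" where
  "rsub D \<longleftrightarrow> subsp D \<and> (\<forall>r\<in>R. \<forall>x\<in>D. r \<star> x \<in> D)"

definition simple :: "'v set \<Rightarrow> bool" where
  "simple D \<longleftrightarrow> rsub D \<and> D \<noteq> {0} \<and> (\<forall>A. rsub A \<longrightarrow> A \<subseteq> D \<longrightarrow> A = {0} \<or> A = D)"

text \<open>The target stays V, so that maps onto different submodules can be added and compared; f
  is constrained on A alone.\<close>

definition rhom :: "'v set \<Rightarrow> ('v \<Rightarrow> 'v) \<Rightarrow> bool" where
  "rhom A f \<longleftrightarrow> (\<forall>x\<in>A. f x \<in> V) \<and> (\<forall>x\<in>A. \<forall>y\<in>A. f (x + y) = f x + f y)
     \<and> (\<forall>r\<in>R. \<forall>x\<in>A. f (r \<star> x) = r \<star> (f x))"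

definition riso :: "'v set \<Rightarrow> 'v set \<Rightarrow> ('v \<Rightarrow> 'v) \<Rightarrow> bool" where
  "riso A A' f \<longleftrightarrow> rhom A f \<and> bij_betw f A A'"

definition iso_mod :: "'v set \<Rightarrow> 'v set \<Rightarrow> bool" where
  "iso_mod A A' \<longleftrightarrow> (\<exists>f. riso A A' f)"

lemma add_cancel [simp]: "(x::'v) + (x + y) = y"
  using char2 by (metis add.assoc add_0)

lemma add_eq_0_iff2: "(x::'v) + y = 0 \<longleftrightarrow> x = y"
  using char2 by (metis add_cancel add.right_neutral)

lemma rho_closed: "g \<in> carrier S \<Longrightarrow> x \<in> V \<Longrightarrow> \<rho> g x \<in> V"
  using rho_acts unfolding acts_on_def by blast

lemma rho_one: "x \<in> V \<Longrightarrow> \<rho> \<one> x = x"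
  using rho_acts unfolding acts_on_def by blast

lemma rho_mult: "g \<in> carrier S \<Longrightarrow> h \<in> carrier S \<Longrightarrow> x \<in> V \<Longrightarrow> \<rho> (g \<otimes> h) x = \<rho> g (\<rho> h x)"
  using rho_acts unfolding acts_on_def by blast

lemma rho_inv: "g \<in> carrier S \<Longrightarrow> x \<in> V \<Longrightarrow> \<rho> (inv g) (\<rho> g x) = x"
  "g \<in> carrier S \<Longrightarrow> x \<in> V \<Longrightarrow> \<rho> g (\<rho> (inv g) x) = x"
  using acts_on_inv[OF rho_acts subgroup_self] by blast+

lemma rho_zero: "g \<in> carrier S \<Longrightarrow> \<rho> g 0 = 0"
  using rho_add[of g 0 0] V0 by simp

lemma rho_inj: "g \<in> carrier S \<Longrightarrow> inj_on (\<rho> g) V"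
  by (rule acts_on_inj[OF rho_acts subgroup_self])

lemma R_zero: "r \<in> R \<Longrightarrow> r \<star> 0 = 0"
  using R_add[of r 0 0] V0 by simp

text \<open>The form of the conjugation hypothesis that moves r past g: r g = g t with t in R.
  Translates of submodules are submodules for this reason.\<close>

lemma R_conj': 
  assumes "g \<in> carrier S" "r \<in> R"
  shows "\<exists>t\<in>R. \<forall>v\<in>V. r \<star> (\<rho> g v) = \<rho> g (t \<star> v)"
proof -
  obtain t where t: "t \<in> R" "\<forall>v\<in>V. t \<star> v = \<rho> (inv g) (r \<star> (\<rho> (inv (inv g)) v))"
    using R_conj[of "inv g" r] assms by auto
  then have "\<forall>v\<in>V. \<rho> g (t \<star> v) = r \<star> (\<rho> g v)" using assms rho_inv rho_closed R_closed by simp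
  then show ?thesis using t(1) by metis
qed

lemma subspD: assumes "subsp D" shows "0 \<in> D" "\<And>x. x \<in> D \<Longrightarrow> x \<in> V" "\<And>x y. x \<in> D \<Longrightarrow> y \<in> D \<Longrightarrow> x + y \<in> D"
    "finite D"
  using assms finV unfolding subsp_def by (auto intro: finite_subset)

lemma rsubD: assumes "rsub D" shows "subsp D" "\<And>r x. r \<in> R \<Longrightarrow> x \<in> D \<Longrightarrow> r \<star> x \<in> D"
  using assms unfolding rsub_def by auto

lemma simpleD: assumes "simple D" shows "rsub D" "subsp D" "D \<noteq> {0}" "\<And>A. rsub A \<Longrightarrow> A \<subseteq> D \<Longrightarrow> A = {0} \<or> A = D"
  using assms unfolding simple_def rsub_def by auto

lemma rsub_V: "rsub V" unfolding rsub_def subsp_def using V0 Vadd R_closed by auto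

lemma rsub_0: "rsub {0}" unfolding rsub_def subsp_def using V0 R_zero by auto

lemma rsub_Int: "rsub A \<Longrightarrow> rsub B \<Longrightarrow> rsub (A \<inter> B)"
  unfolding rsub_def subsp_def by auto

lemma simple_Int: "simple A \<Longrightarrow> rsub B \<Longrightarrow> A \<inter> B = {0} \<or> A \<subseteq> B"
  using simpleD(4)[of A "A \<inter> B"] rsub_Int simpleD(1) by blast

lemma rhomD: assumes "rhom A f" shows "\<And>x. x \<in> A \<Longrightarrow> f x \<in> V" "\<And>x y. x \<in> A \<Longrightarrow> y \<in> A \<Longrightarrow> f (x + y) = f x + f y"
    "\<And>r x. r \<in> R \<Longrightarrow> x \<in> A \<Longrightarrow> f (r \<star> x) = r \<star> (f x)"
  using assms unfolding rhom_def by auto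

lemma rhom_zero: assumes "rhom A f" "subsp A" shows "f 0 = 0"
  using rhomD(2)[OF assms(1), of 0 0] subspD(1)[OF assms(2)] by simp

lemma rhom_image: assumes "rhom A f" "rsub A" shows "rsub (f ` A)"
  unfolding rsub_def subsp_def
proof (intro conjI ballI)
  note A = rsubD(1)[OF assms(2)]
  show "0 \<in> f ` A" using rhom_zero[OF assms(1) A] subspD(1)[OF A] by force
  show "f ` A \<subseteq> V" using rhomD(1)[OF assms(1)] by blast
  show "x + y \<in> f ` A" if "x \<in> f ` A" "y \<in> f ` A" for x y
    using that rhomD(2)[OF assms(1), symmetric] subspD(3)[OF A] by auto
  show "r \<star> x \<in> f ` A" if "r \<in> R" "x \<in> f ` A" for r x
    using that rhomD(3)[OF assms(1), symmetric] rsubD(2)[OF assms(2)] by auto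
qed

lemma rhom_vimage: assumes "rhom A f" "rsub A" "rsub B" shows "rsub {x\<in>A. f x \<in> B}"
  unfolding rsub_def subsp_def
  using rhom_zero[OF assms(1) rsubD(1)[OF assms(2)]] rhomD[OF assms(1)] subspD[OF rsubD(1)[OF assms(2)]]
    subspD[OF rsubD(1)[OF assms(3)]] rsubD(2)[OF assms(2)] rsubD(2)[OF assms(3)]
  by auto

lemma rhom_inj: assumes "rhom A f" "subsp A" "\<And>x. x \<in> A \<Longrightarrow> f x = 0 \<Longrightarrow> x = 0" shows "inj_on f A"
proof (rule inj_onI)
  fix x y assume xy: "x \<in> A" "y \<in> A" "f x = f y"
  then have "f (x + y) = 0" using rhomD(2)[OF assms(1)] char2 by simp
  then have "x + y = 0" using assms(3) subspD(3)[OF assms(2)] xy by blast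
  then show "x = y" by (simp add: add_eq_0_iff2)
qed

text \<open>The kernel is a submodule of the simple A, so it is 0 as soon as one value is nonzero;
  submodules of the image pull back to submodules of A.\<close>

lemma schur: assumes "simple A" "rhom A f" "x \<in> A" "f x \<noteq> 0"
  shows "inj_on f A" "simple (f ` A)" "riso A (f ` A) f"
proof -
  note A = simpleD[OF assms(1)]
  have "rsub {x\<in>A. f x \<in> {0}}" by (rule rhom_vimage[OF assms(2) A(1) rsub_0])
  then have "{x\<in>A. f x \<in> {0}} = {0} \<or> {x\<in>A. f x \<in> {0}} = A" by (rule A(4)) auto
  then have "{x\<in>A. f x \<in> {0}} = {0}" using assms(3,4) by blast
  then show inj: "inj_on f A" by (intro rhom_inj[OF assms(2) A(2)]) blast
  then show "riso A (f ` A) f" unfolding riso_def using assms(2) by (simp add: bij_betw_def)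
  show "simple (f ` A)" unfolding simple_def
  proof (intro conjI allI impI)
    show "rsub (f ` A)" by (rule rhom_image[OF assms(2) A(1)])
    show "f ` A \<noteq> {0}" using assms(3,4) by blast
    fix B assume B: "rsub B" "B \<subseteq> f ` A"
    have "rsub {x\<in>A. f x \<in> B}" by (rule rhom_vimage[OF assms(2) A(1) B(1)])
    then have "{x\<in>A. f x \<in> B} = {0} \<or> {x\<in>A. f x \<in> B} = A" by (rule A(4)) auto
    moreover have B': "B = f ` {x\<in>A. f x \<in> B}" using B(2) by auto
    ultimately show "B = {0} \<or> B = f ` A"
    proof (elim disjE)
      assume "{x\<in>A. f x \<in> B} = {0}"
      then have "B = f ` {0}" using B' by simp
      then show ?thesis using rhom_zero[OF assms(2) A(2)] by simp
    next
      assume "{x\<in>A. f x \<in> B} = A"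
      then have "B = f ` A" using B' by simp
      then show ?thesis by simp
    qed
  qed
qed

lemma rhom_comp: assumes "rhom A f" "rhom B h" "f ` A \<subseteq> B" shows "rhom A (\<lambda>x. h (f x))"
  using assms unfolding rhom_def by (auto simp: image_subset_iff)

lemma rhom_id: "rsub A \<Longrightarrow> rhom A (\<lambda>x. x)"
  unfolding rhom_def rsub_def subsp_def by auto

lemma riso_comp: assumes "riso A B f" "riso B C h" shows "riso A C (\<lambda>x. h (f x))"
  using assms rhom_comp[of A f B h] bij_betw_trans[of f A B h C] unfolding riso_def
  by (auto simp: comp_def bij_betw_def)

lemma riso_inv: assumes "riso A B f" "rsub A" shows "riso B A (inv_into A f)"
proof -
  have f: "rhom A f" "bij_betw f A B" using assms(1) unfolding riso_def by auto
  then have inj: "inj_on f A" and im: "f ` A = B" by (auto simp: bij_betw_def)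
  note A = rsubD[OF assms(2)] subspD[OF rsubD(1)[OF assms(2)]]
  have "rhom B (inv_into A f)" unfolding rhom_def
  proof (intro conjI ballI)
    show "inv_into A f x \<in> V" if "x \<in> B" for x using that im A(4) by (metis inv_into_into)
    show "inv_into A f (x + y) = inv_into A f x + inv_into A f y" if xy: "x \<in> B" "y \<in> B" for x y
    proof -
      obtain x' y' where "x = f x'" "y = f y'" "x' \<in> A" "y' \<in> A" using xy im by auto
      then show ?thesis using inj A rhomD(2)[OF f(1), symmetric] by simp
    qed
    show "inv_into A f (r \<star> x) = r \<star> (inv_into A f x)" if xy: "r \<in> R" "x \<in> B" for r x
    proof -
      obtain x' where "x = f x'" "x' \<in> A" using xy im by auto
      then show ?thesis using inj A xy rhomD(3)[OF f(1), symmetric] by simp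
    qed
  qed
  then show ?thesis unfolding riso_def using bij_betw_inv_into[OF f(2)] by simp
qed

lemma iso_refl: "rsub A \<Longrightarrow> iso_mod A A"
  unfolding iso_mod_def riso_def using rhom_id by (auto intro!: exI[of _ "\<lambda>x. x"] simp: bij_betw_def)

lemma iso_sym: "rsub A \<Longrightarrow> iso_mod A B \<Longrightarrow> iso_mod B A"
  unfolding iso_mod_def using riso_inv by blast

lemma iso_trans: "iso_mod A B \<Longrightarrow> iso_mod B C \<Longrightarrow> iso_mod A C"
  unfolding iso_mod_def using riso_comp by blast

lemma rsub_rho: assumes "g \<in> carrier S" "rsub A" shows "rsub (\<rho> g ` A)"
  unfolding rsub_def subsp_def
proof (intro conjI ballI)
  note A = rsubD[OF assms(2)] subspD[OF rsubD(1)[OF assms(2)]]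
  show "0 \<in> \<rho> g ` A" using rho_zero[OF assms(1)] A(3) by force
  show "\<rho> g ` A \<subseteq> V" using rho_closed[OF assms(1)] A(4) by blast
  show "x + y \<in> \<rho> g ` A" if "x \<in> \<rho> g ` A" "y \<in> \<rho> g ` A" for x y
    using that rho_add[OF assms(1), symmetric] A by auto
  show "r \<star> x \<in> \<rho> g ` A" if r: "r \<in> R" "x \<in> \<rho> g ` A" for r x
  proof -
    obtain y where y: "y \<in> A" "x = \<rho> g y" using r by blast
    obtain t where "t \<in> R" "\<forall>v\<in>V. r \<star> (\<rho> g v) = \<rho> g (t \<star> v)" using R_conj'[OF assms(1) r(1)] by blast
    then show ?thesis using y A by auto
  qed
qed

lemma rho_inv_image: "g \<in> carrier S \<Longrightarrow> A \<subseteq> V \<Longrightarrow> \<rho> (inv g) ` \<rho> g ` A = A"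
  "g \<in> carrier S \<Longrightarrow> A \<subseteq> V \<Longrightarrow> \<rho> g ` \<rho> (inv g) ` A = A"
  using rho_inv by (force simp: image_image subset_iff)+

lemma rho_mult_image: "g \<in> carrier S \<Longrightarrow> h \<in> carrier S \<Longrightarrow> A \<subseteq> V \<Longrightarrow> \<rho> (g \<otimes> h) ` A = \<rho> g ` \<rho> h ` A"
  using rho_mult by (force simp: image_image subset_iff)

lemma rsub_subset: "rsub A \<Longrightarrow> A \<subseteq> V" unfolding rsub_def subsp_def by auto

lemma simple_rho: assumes "g \<in> carrier S" "simple A" shows "simple (\<rho> g ` A)"
  unfolding simple_def
proof (intro conjI allI impI)
  note A = simpleD[OF assms(2)]
  show "rsub (\<rho> g ` A)" by (rule rsub_rho[OF assms(1) A(1)])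
  have A_V: "A \<subseteq> V" using rsub_subset A(1) by blast
  show "\<rho> g ` A \<noteq> {0}"
  proof
    assume "\<rho> g ` A = {0}"
    then have "\<rho> (inv g) ` \<rho> g ` A = {0}" using rho_zero assms(1) by simp
    then show False using rho_inv_image(1)[OF assms(1) A_V] A(3) by simp
  qed
  fix B assume B: "rsub B" "B \<subseteq> \<rho> g ` A"
  have "rsub (\<rho> (inv g) ` B)" using rsub_rho B assms(1) by simp
  moreover have "\<rho> (inv g) ` B \<subseteq> A" using image_mono[OF B(2), of "\<rho> (inv g)"] rho_inv_image(1)[OF assms(1) A_V] by simp
  ultimately have "\<rho> (inv g) ` B = {0} \<or> \<rho> (inv g) ` B = A" by (rule A(4))
  then show "B = {0} \<or> B = \<rho> g ` A"
    using rho_inv_image(2)[OF assms(1) rsub_subset[OF B(1)]] rho_zero[OF assms(1)] by force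
qed

text \<open>Although g itself is not R-linear, g f g^-1 is: r passes g at the price of becoming some
  t in R, t passes f, and it turns back into r when it passes g again.\<close>

lemma rhom_rho: assumes g: "g \<in> carrier S" and A: "rsub A" and f: "rhom A f"
  shows "rhom (\<rho> g ` A) (\<lambda>x. \<rho> g (f (\<rho> (inv g) x)))"
  unfolding rhom_def
proof (intro conjI ballI)
  have AV: "x \<in> V" if "x \<in> A" for x using that rsub_subset A by blast
  note A' = rsubD[OF A] subspD[OF rsubD(1)[OF A]]
  show "\<rho> g (f (\<rho> (inv g) x)) \<in> V" if "x \<in> \<rho> g ` A" for x
    using that g rho_inv(1) AV rhomD(1)[OF f] rho_closed by auto
  show "\<rho> g (f (\<rho> (inv g) (x + y))) = \<rho> g (f (\<rho> (inv g) x)) + \<rho> g (f (\<rho> (inv g) y))"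
    if xy: "x \<in> \<rho> g ` A" "y \<in> \<rho> g ` A" for x y
  proof -
    obtain x' y' where "x = \<rho> g x'" "y = \<rho> g y'" "x' \<in> A" "y' \<in> A" using xy by auto
    then show ?thesis using g AV rho_add[OF g, symmetric] rho_inv(1) rhomD[OF f] A'(5) by simp
  qed
  show "\<rho> g (f (\<rho> (inv g) (r \<star> x))) = r \<star> (\<rho> g (f (\<rho> (inv g) x)))" if r: "r \<in> R" "x \<in> \<rho> g ` A" for r x
  proof -
    obtain x' where x': "x = \<rho> g x'" "x' \<in> A" using r by auto
    obtain t where t: "t \<in> R" "\<forall>v\<in>V. r \<star> (\<rho> g v) = \<rho> g (t \<star> v)" using R_conj'[OF g r(1)] by blast
    show ?thesis using x' t g AV rho_inv(1) rhomD[OF f] A'(2) by simp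
  qed
qed

lemma riso_rho: assumes g: "g \<in> carrier S" and A: "rsub A" and f: "riso A B f" and B: "B \<subseteq> V"
  shows "riso (\<rho> g ` A) (\<rho> g ` B) (\<lambda>x. \<rho> g (f (\<rho> (inv g) x)))"
proof -
  have f': "rhom A f" "inj_on f A" "f ` A = B" using f unfolding riso_def bij_betw_def by auto
  have AV: "A \<subseteq> V" using rsub_subset A by blast
  have "inj_on (\<lambda>x. \<rho> g (f (\<rho> (inv g) x))) (\<rho> g ` A)"
  proof (rule inj_onI)
    fix x y assume xy: "x \<in> \<rho> g ` A" "y \<in> \<rho> g ` A" "\<rho> g (f (\<rho> (inv g) x)) = \<rho> g (f (\<rho> (inv g) y))"
    obtain x' y' where x': "x = \<rho> g x'" "y = \<rho> g y'" "x' \<in> A" "y' \<in> A" using xy by auto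
    then have "\<rho> g (f x') = \<rho> g (f y')" using xy(3) AV g rho_inv(1) by (simp add: subset_iff)
    then have "f x' = f y'" using inj_onD[OF rho_inj[OF g]] rhomD(1)[OF f'(1)] x' by blast
    then show "x = y" using f'(2) x' inj_onD by metis
  qed
  moreover have "(\<lambda>x. \<rho> g (f (\<rho> (inv g) x))) ` (\<rho> g ` A) = \<rho> g ` B"
  proof -
    have "(\<lambda>x. \<rho> g (f (\<rho> (inv g) x))) ` (\<rho> g ` A) = \<rho> g ` f ` \<rho> (inv g) ` \<rho> g ` A" by (simp only: image_image)
    then show ?thesis using rho_inv_image(1)[OF g AV] f'(3) by simp
  qed
  ultimately show ?thesis unfolding riso_def bij_betw_def using rhom_rho[OF g A f'(1)] by simp
qed

lemma iso_rho: "g \<in> carrier S \<Longrightarrow> rsub A \<Longrightarrow> iso_mod A B \<Longrightarrow> B \<subseteq> V \<Longrightarrow> iso_mod (\<rho> g ` A) (\<rho> g ` B)"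
  unfolding iso_mod_def using riso_rho by blast

text \<open>Sums are indexed by a list, so that independence can be shown by adding one summand at a
  time.\<close>

primrec lsum :: "'v set list \<Rightarrow> 'v set" where
  "lsum [] = {0}"
| "lsum (Y # Ys) = {y + x | y x. y \<in> Y \<and> x \<in> lsum Ys}"

lemma rsub_lsum: "\<forall>Y\<in>set Ys. rsub Y \<Longrightarrow> rsub (lsum Ys)"
proof (induction Ys)
  case Nil then show ?case using rsub_0 by simp
next
  case (Cons Y Ys)
  then have Y: "rsub Y" and L: "rsub (lsum Ys)" by auto
  note Y' = rsubD[OF Y] subspD[OF rsubD(1)[OF Y]] and L' = rsubD[OF L] subspD[OF rsubD(1)[OF L]]
  show ?case unfolding rsub_def subsp_def
  proof (intro conjI ballI)
    show "0 \<in> lsum (Y # Ys)" using Y'(3) L'(3) by force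
    show "lsum (Y # Ys) \<subseteq> V" using Vadd Y'(4) L'(4) by auto
    show "x + y \<in> lsum (Y # Ys)" if xy: "x \<in> lsum (Y # Ys)" "y \<in> lsum (Y # Ys)" for x y
    proof -
      obtain a b c d where h: "x = a + b" "y = c + d" "a \<in> Y" "c \<in> Y" "b \<in> lsum Ys" "d \<in> lsum Ys"
        using xy by auto
      have "x + y = (a + c) + (b + d)" using h(1,2) by (simp add: algebra_simps)
      moreover have "a + c \<in> Y" "b + d \<in> lsum Ys" using h Y'(5) L'(5) by auto
      ultimately show ?thesis by (simp only: lsum.simps) blast
    qed
    show "r \<star> x \<in> lsum (Y # Ys)" if r: "r \<in> R" "x \<in> lsum (Y # Ys)" for r x
    proof -
      obtain a b where h: "x = a + b" "a \<in> Y" "b \<in> lsum Ys" using r by auto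
      have "r \<star> x = r \<star> a + r \<star> b" using h r(1) Y'(4) L'(4) R_add by simp
      moreover have "r \<star> a \<in> Y" "r \<star> b \<in> lsum Ys" using h r(1) Y'(2) L'(2) by auto
      ultimately show ?thesis by (simp only: lsum.simps) blast
    qed
  qed
qed

lemma lsum_least: "\<forall>Y\<in>set Ys. Y \<subseteq> D \<Longrightarrow> subsp D \<Longrightarrow> lsum Ys \<subseteq> D"
proof (induction Ys)
  case Nil then show ?case using subspD(1) by simp
next
  case (Cons Y Ys)
  then have "Y \<subseteq> D" "lsum Ys \<subseteq> D" by auto
  then show ?case using subspD(3)[OF Cons.prems(2)] by auto
qed

lemma lsum_upper: "\<forall>Y\<in>set Ys. rsub Y \<Longrightarrow> Y \<in> set Ys \<Longrightarrow> Y \<subseteq> lsum Ys"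
proof (induction Ys)
  case (Cons Z Ys)
  then have Z: "rsub Z" and L: "rsub (lsum Ys)" using rsub_lsum by auto
  have 0: "0 \<in> Z" "0 \<in> lsum Ys" using subspD(1)[OF rsubD(1)] Z L by auto
  show ?case
  proof
    fix y assume y: "y \<in> Y"
    show "y \<in> lsum (Z # Ys)"
    proof (cases "Y = Z")
      case True then show ?thesis using 0 y by force
    next
      case False then have "y \<in> lsum Ys" using Cons y by auto
      then show ?thesis using 0 by force
    qed
  qed
qed simp

text \<open>If Z is not already in the sum N of the tail, then N meets Y and Z in 0, and the
  projection of Z along N to Y is a nonzero homomorphism of simple modules, hence an
  isomorphism.\<close>

lemma simple_in_lsum:
  "\<forall>Y\<in>set Ys. simple Y \<Longrightarrow> simple Z \<Longrightarrow> Z \<subseteq> lsum Ys \<Longrightarrow> \<exists>Y\<in>set Ys. iso_mod Z Y"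
proof (induction Ys)
  case Nil
  then show ?case using simpleD(3)[of Z] subspD(1)[OF simpleD(2), of Z] by auto
next
  case (Cons Y Ys)
  let ?N = "lsum Ys"
  have Y: "simple Y" and N: "rsub ?N" using Cons.prems rsub_lsum simpleD(1) by auto
  have Z: "simple Z" by fact
  show ?case
  proof (cases "Z \<subseteq> ?N")
    case True then show ?thesis using Cons by auto
  next
    case False
    then have ZN: "Z \<inter> ?N = {0}" using simple_Int[OF Z N] by blast
    note N' = rsubD[OF N] subspD[OF rsubD(1)[OF N]]
    note Y' = rsubD[OF simpleD(1)[OF Y]] subspD[OF simpleD(2)[OF Y]]
    note Z' = rsubD[OF simpleD(1)[OF Z]] subspD[OF simpleD(2)[OF Z]]
    have YN: "Y \<inter> ?N = {0}"
    proof (rule ccontr)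
      assume "Y \<inter> ?N \<noteq> {0}"
      then have "Y \<subseteq> ?N" using simple_Int[OF Y N] by blast
      then have "lsum (Y # Ys) \<subseteq> ?N" using N' by auto
      then show False using False Cons.prems(3) by blast
    qed
    \<comment> \<open>The Y-component of z: in characteristic 2 the condition z - y in N reads z + y
      in N.\<close>
    define f where "f z = (SOME y. y \<in> Y \<and> z + y \<in> ?N)" for z
    have f: "f z \<in> Y" "z + f z \<in> ?N" if "z \<in> Z" for z
    proof -
      obtain y x where yx: "z = y + x" "y \<in> Y" "x \<in> ?N" using Cons.prems(3) \<open>z \<in> Z\<close> by auto
      have "z + y = y + (y + x)" using yx(1) by (simp only: add.commute)
      then have "y \<in> Y \<and> z + y \<in> ?N" using yx(2,3) by simp
      then show "f z \<in> Y" "z + f z \<in> ?N" unfolding f_def by (rule someI2; blast)+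
    qed
    have uniq: "f z = y" if "z \<in> Z" "y \<in> Y" "z + y \<in> ?N" for z y
    proof -
      have "(z + f z) + (z + y) \<in> ?N" using N' f that by blast
      then have "f z + y \<in> ?N" by (simp add: add.assoc add.left_commute)
      then have "f z + y \<in> Y \<inter> ?N" using Y' f that by blast
      then show ?thesis using YN by (simp add: add_eq_0_iff2)
    qed
    have hom: "rhom Z f" unfolding rhom_def
    proof (intro conjI ballI)
      show "f x \<in> V" if "x \<in> Z" for x using that f Y' by blast
      show "f (x + y) = f x + f y" if "x \<in> Z" "y \<in> Z" for x y
      proof (rule uniq)
        have "(x + f x) + (y + f y) \<in> ?N" using N' f that by blast
        then show "x + y + (f x + f y) \<in> ?N" by (simp add: algebra_simps)
      qed (use that f Y'(2,5) Z'(2,5) in simp_all)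
      show "f (r \<star> x) = r \<star> (f x)" if "r \<in> R" "x \<in> Z" for r x
      proof (rule uniq)
        have "r \<star> (x + f x) \<in> ?N" using N' f that by blast
        then show "r \<star> x + r \<star> (f x) \<in> ?N" using R_add that f Y' Z' by simp
      qed (use that f Y'(2,5) Z'(2,5) in simp_all)
    qed
    obtain z where z: "z \<in> Z" "z \<noteq> 0" using simpleD(3)[OF Z] Z'(3) by blast
    have "f z \<noteq> 0"
    proof
      assume "f z = 0" then have "z \<in> ?N" using f(2)[OF z(1)] by simp
      then show False using ZN z by blast
    qed
    note sch = schur[OF Z hom z(1) this]
    have "f ` Z \<subseteq> Y" using f by blast
    then have "f ` Z = Y" using simpleD(4)[OF Y, of "f ` Z"] simpleD(1,3)[OF sch(2)] by blast
    then have "iso_mod Z Y" unfolding iso_mod_def using sch(3) by auto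
    then show ?thesis by simp
  qed
qed

lemma card_ge_2: "subsp Y \<Longrightarrow> Y \<noteq> {0} \<Longrightarrow> 2 \<le> card Y"
proof -
  assume Y: "subsp Y" "Y \<noteq> {0}"
  then obtain y where "y \<in> Y" "y \<noteq> 0" using subspD(1)[OF Y(1)] by blast
  then have "{0, y} \<subseteq> Y" "card {0,y} = 2" using subspD(1)[OF Y(1)] by auto
  then show ?thesis using card_mono subspD(4)[OF Y(1)] by metis
qed

text \<open>By \<open>simple_in_lsum\<close> each summand meets the sum of the later ones in 0, so
  the sum is direct and every summand at least doubles the size.\<close>

lemma lsum_card:
  "\<forall>Y\<in>set Ys. simple Y \<Longrightarrow> sorted_wrt (\<lambda>A B. \<not> iso_mod A B) Ys \<Longrightarrow> 2 ^ length Ys \<le> card (lsum Ys)"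
proof (induction Ys)
  case (Cons Y Ys)
  let ?N = "lsum Ys"
  have Y: "simple Y" and N: "rsub ?N" using Cons.prems rsub_lsum simpleD(1) by auto
  note N' = subspD[OF rsubD(1)[OF N]] and Y' = subspD[OF simpleD(2)[OF Y]]
  have "\<not> Y \<subseteq> ?N" using simple_in_lsum[OF _ Y, of Ys] Cons.prems by auto
  then have YN: "Y \<inter> ?N = {0}" using simple_Int[OF Y N] by blast
  have "inj_on (\<lambda>(y, x). y + x) (Y \<times> ?N)"
  proof (rule inj_onI, clarify)
    fix a b c d assume h: "a \<in> Y" "b \<in> ?N" "c \<in> Y" "d \<in> ?N" "a + b = c + d"
    have "c + a = c + ((a + b) + b)" using char2[of b] by (simp add: add.assoc)
    also have "\<dots> = d + b" using h(5) by (simp add: add.assoc)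
    finally have "c + a = d + b" .
    moreover have "c + a \<in> Y" "d + b \<in> ?N" using N' Y' h by blast+
    ultimately have "c + a \<in> Y \<inter> ?N" by simp
    then have "c = a" using YN by (simp add: add_eq_0_iff2)
    then show "a = c \<and> b = d" using h(5) by simp
  qed
  moreover have "lsum (Y # Ys) = (\<lambda>(y, x). y + x) ` (Y \<times> ?N)" by auto
  ultimately have "card (lsum (Y # Ys)) = card Y * card ?N"
    by (simp only: card_image card_cartesian_product)
  moreover have "2 \<le> card Y" using card_ge_2 simpleD(2,3)[OF Y] by blast
  moreover have "2 ^ length Ys \<le> card ?N" using Cons by auto
  ultimately show ?case by (simp only: length_Cons power_Suc mult_le_mono)
qed simp

end

section \<open>Parity and fixed vectors of 2-groups\<close>

lemma even_card_involution:
  assumes "finite A" "\<And>x. x \<in> A \<Longrightarrow> \<sigma> x \<in> A" "\<And>x. x \<in> A \<Longrightarrow> \<sigma> (\<sigma> x) = x" "\<And>x. x \<in> A \<Longrightarrow> \<sigma> x \<noteq> x"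
  shows "even (card A)"
  using assms
proof (induction "card A" arbitrary: A rule: less_induct)
  case less
  show ?case
  proof (cases "A = {}")
    case False
    then obtain x where x: "x \<in> A" by blast
    let ?A = "A - {x, \<sigma> x}"
    have c2: "card {x, \<sigma> x} = 2" using less.prems(4)[OF x] by auto
    have sub: "{x, \<sigma> x} \<subseteq> A" using x less.prems(2) by auto
    then have c: "card A = card ?A + 2" using c2 less.prems(1) card_mono[of A "{x, \<sigma> x}"]
      by (simp add: card_Diff_subset)
    have "even (card ?A)"
    proof (rule less.hyps)
      show "\<sigma> y \<in> ?A" if "y \<in> ?A" for y
      proof -
        have "\<sigma> y \<noteq> x" using that less.prems(3)[of y] by auto
        moreover have "\<sigma> y \<noteq> \<sigma> x" using that less.prems(3)[of y] less.prems(3)[of x] x by auto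
        ultimately show ?thesis using that less.prems(2) by auto
      qed
    qed (use c less.prems in auto)
    then show ?thesis using c by simp
  qed simp
qed

text \<open>The number of cosets of L in K is even, since translation by an element outside L moves
  every coset; so the number of H-fixed cosets is even as well. L is one of them, hence there is
  another. This supplies nonzero fixed vectors of 2-groups in quotients K/L, stated through a
  representative.\<close>

lemma (in group) fixed_coset:
  fixes K L :: "'w::ab_group_add set"
  assumes char2: "\<And>x::'w. x + x = 0" and H: "subgroup H G" "card H = 2 ^ e"
    and K: "finite K" "\<And>x y. x \<in> K \<Longrightarrow> y \<in> K \<Longrightarrow> x + y \<in> K"
    and L: "L \<subseteq> K" "0 \<in> L" "\<And>x y. x \<in> L \<Longrightarrow> y \<in> L \<Longrightarrow> x + y \<in> L" "L \<noteq> K"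
    and a: "acts_on G H K a" "\<And>u x. u \<in> H \<Longrightarrow> x \<in> L \<Longrightarrow> a u x \<in> L"
      "\<And>u x y. u \<in> H \<Longrightarrow> x \<in> K \<Longrightarrow> y \<in> K \<Longrightarrow> a u (x + y) = a u x + a u y"
  shows "\<exists>k\<in>K - L. \<forall>u\<in>H. a u k + k \<in> L"
proof -
  have cancel: "x + (x + y) = y" for x y :: 'w using char2 by (metis add.assoc add_0)
  define C where "C = (\<lambda>k. (+) k ` L) ` K"
  have aL: "acts_on G H L a" using a L(1) unfolding acts_on_def by blast
  have imL: "a u ` L = L" if "u \<in> H" for u by (rule acts_on_image[OF aL H(1) that])
  have im: "a u ` ((+) k ` L) = (+) (a u k) ` L" if "u \<in> H" "k \<in> K" for u k
  proof -
    have "a u ` ((+) k ` L) = (\<lambda>l. a u k + a u l) ` L"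
      unfolding image_image using a(3) that L(1) by (intro image_cong) auto
    also have "\<dots> = (+) (a u k) ` (a u ` L)" by (simp add: image_image)
    finally show ?thesis using imL[OF that(1)] by simp
  qed
  have aK: "a u k \<in> K" if "u \<in> H" "k \<in> K" for u k using a(1) that unfolding acts_on_def by blast
  have acC: "acts_on G H C (\<lambda>u. image (a u))"
  proof -
    have "a (g \<otimes> h) ` ((+) k ` L) = a g ` a h ` ((+) k ` L)" if "g \<in> H" "h \<in> H" "k \<in> K" for g h k
    proof -
      have "g \<otimes> h \<in> H" using H(1) that subgroup.m_closed by metis
      moreover have "a (g \<otimes> h) k = a g (a h k)" using a(1) that unfolding acts_on_def by blast
      ultimately show ?thesis using im that aK by simp
    qed
    moreover have "a \<one> ` ((+) k ` L) = (+) k ` L" if "k \<in> K" for k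
    proof -
      have "\<one> \<in> H" using H(1) by (rule subgroup.one_closed)
      moreover have "a \<one> k = k" using a(1) that unfolding acts_on_def by blast
      ultimately show ?thesis using im that by simp
    qed
    ultimately show ?thesis unfolding acts_on_def C_def using im aK by auto
  qed
  have finC: "finite C" unfolding C_def using K(1) by simp
  obtain k0 where k0: "k0 \<in> K" "k0 \<notin> L" using L by blast
  have coset_eq: "x + y \<in> L" if xy: "(+) x ` L = (+) y ` L" for x y
  proof -
    have "x + 0 \<in> (+) x ` L" using L(2) by blast
    then obtain l where l: "x + 0 = y + l" "l \<in> L" unfolding xy by auto
    have "x + y = y + (y + l)" using l(1) by (simp add: add.commute)
    then show ?thesis using cancel[of y l] l(2) by simp
  qed
  have "even (card C)"
  proof (rule even_card_involution[OF finC])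
    fix c assume "c \<in> C"
    then obtain k where k: "k \<in> K" "c = (+) k ` L" unfolding C_def by blast
    have e: "(+) k0 ` c = (+) (k0 + k) ` L" using k by (simp add: image_image add.assoc)
    show "(+) k0 ` c \<in> C" using e k k0 K(2) unfolding C_def by auto
    show "(+) k0 ` ((+) k0 ` c) = c" by (simp add: image_image cancel)
    show "(+) k0 ` c \<noteq> c"
    proof
      assume "(+) k0 ` c = c"
      then have "(k0 + k) + k \<in> L" using coset_eq e k by metis
      then show False using k0(2) char2 by (simp add: add.assoc)
    qed
  qed
  moreover have "[card C = card {c\<in>C. \<forall>u\<in>H. a u ` c = c}] (mod 2)"
    by (rule p_group_fixed_points[OF two_is_prime_nat H(2) acC H(1) finC])
  ultimately have ev: "even (card {c\<in>C. \<forall>u\<in>H. a u ` c = c})" by (simp add: cong_def even_iff_mod_2_eq_zero)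
  have K0: "0 \<in> K" using L by blast
  have "(+) 0 ` L \<in> C" using K0 unfolding C_def by blast
  then have L0: "L \<in> {c\<in>C. \<forall>u\<in>H. a u ` c = c}" using imL by simp
  have "{c\<in>C. \<forall>u\<in>H. a u ` c = c} \<noteq> {L}" using ev by (metis One_nat_def card.empty card.insert empty_iff finite.emptyI odd_one)
  then obtain c where c: "c \<in> C" "\<forall>u\<in>H. a u ` c = c" "c \<noteq> L" using L0 by blast
  then obtain k where k: "k \<in> K" "c = (+) k ` L" unfolding C_def by blast
  have "k \<notin> L"
  proof
    assume kL: "k \<in> L"
    have "(+) k ` L = L"
    proof
      show "(+) k ` L \<subseteq> L" using kL L(3) by blast
      show "L \<subseteq> (+) k ` L"
      proof
        fix l assume "l \<in> L" then have "l = k + (k + l)" "k + l \<in> L" using kL L(3) cancel by auto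
        then show "l \<in> (+) k ` L" by blast
      qed
    qed
    then show False using c k by simp
  qed
  moreover have "a u k + k \<in> L" if "u \<in> H" for u
  proof -
    have "(+) (a u k) ` L = (+) k ` L" using c(2) im[OF that k(1)] k(2) that by simp
    then show ?thesis by (rule coset_eq)
  qed
  ultimately show ?thesis using k(1) by blast
qed

section \<open>Simple submodules are isomorphic\<close>

text \<open>V is modelled on the permutation module: v0 is the only nonzero vector fixed by the 2-group U, and
  a subgroup of S of index at most n = dim V is everything.\<close>

locale steinberg_like = stable_algebra S V \<rho> R ap
  for S :: "('g, 'x) monoid_scheme" (structure) and V :: "'v::ab_group_add set" and \<rho> :: "'g \<Rightarrow> 'v \<Rightarrow> 'v"
    and R :: "'r set" and ap :: "'r \<Rightarrow> 'v \<Rightarrow> 'v" (infixr \<open>\<star>\<close> 75) +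
  fixes n e :: nat and U :: "'g set" and v0 :: 'v
  assumes cardV: "card V = 2 ^ n" and n2: "2 \<le> n"
    and irr: "subsp D \<Longrightarrow> D \<noteq> {0} \<Longrightarrow> (\<forall>g\<in>carrier S. \<rho> g ` D \<subseteq> D) \<Longrightarrow> D = V"
    and large_subgroup: "subgroup M S \<Longrightarrow> card (carrier S) \<le> n * card M \<Longrightarrow> M = carrier S"
    and U_sub: "subgroup U S" and cardU: "card U = 2 ^ e"
    and v0: "v0 \<in> V" "v0 \<noteq> 0" and U_v0: "u \<in> U \<Longrightarrow> \<rho> u v0 = v0"
    and U_fixed: "v \<in> V \<Longrightarrow> (\<And>u. u \<in> U \<Longrightarrow> \<rho> u v = v) \<Longrightarrow> v = 0 \<or> v = v0"
begin

lemma U_carrier: "u \<in> U \<Longrightarrow> u \<in> carrier S"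
  using subgroup.mem_carrier[OF U_sub] .

text \<open>\<open>fixed_coset\<close> with L = 0 gives a nonzero U-fixed vector of D, and
  \<open>v0\<close> is the only one in V.\<close>

lemma v0_in: assumes "subsp D" "D \<noteq> {0}" "\<And>u. u \<in> U \<Longrightarrow> \<rho> u ` D \<subseteq> D" shows "v0 \<in> D"
proof -
  note D = subspD[OF assms(1)]
  have "acts_on S U D \<rho>" using rho_acts D(2) assms(3) U_carrier unfolding acts_on_def by blast
  then have "\<exists>k\<in>D - {0}. \<forall>u\<in>U. \<rho> u k + k \<in> {0}"
    by (intro fixed_coset[OF char2 U_sub cardU D(4)]) (use D assms rho_zero U_carrier rho_add in auto)
  then obtain k where "k \<in> D" "k \<noteq> 0" "\<forall>u\<in>U. \<rho> u k = k" by (auto simp: add_eq_0_iff2)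
  then show ?thesis using U_fixed D(2) by metis
qed

text \<open>Pairwise non-isomorphic simple submodules are independent, so the conjugates of Y form at most n
  isomorphism classes and the stabiliser of the class of Y has index at most n.\<close>

lemma conjugates_iso:
  assumes Y: "simple Y" and g: "g \<in> carrier S"
  shows "iso_mod (\<rho> g ` Y) Y"
proof -
  define M where "M = {g \<in> carrier S. iso_mod (\<rho> g ` Y) Y}"
  note Ys = simpleD(1)[OF Y] and YV = rsub_subset[OF simpleD(1)[OF Y]]
  have M: "subgroup M S"
  proof (rule subgroupI)
    show "M \<subseteq> carrier S" unfolding M_def by auto
    have "\<rho> \<one> ` Y = Y" using rho_one YV by force
    then show "M \<noteq> {}" unfolding M_def using iso_refl[OF Ys] by force
    show "inv g \<in> M" if g: "g \<in> M" for g
    proof -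
      have g': "g \<in> carrier S" "iso_mod (\<rho> g ` Y) Y" using g unfolding M_def by auto
      have "iso_mod (\<rho> (inv g) ` \<rho> g ` Y) (\<rho> (inv g) ` Y)"
        by (rule iso_rho) (use g' rsub_rho Ys YV in auto)
      then have "iso_mod Y (\<rho> (inv g) ` Y)" using rho_inv_image(1) g' YV by simp
      then show ?thesis using iso_sym[OF Ys] g' unfolding M_def by auto
    qed
    show "g \<otimes> h \<in> M" if "g \<in> M" "h \<in> M" for g h
    proof -
      have g': "g \<in> carrier S" "iso_mod (\<rho> g ` Y) Y" "h \<in> carrier S" "iso_mod (\<rho> h ` Y) Y" using that unfolding M_def by auto
      have "iso_mod (\<rho> g ` \<rho> h ` Y) (\<rho> g ` Y)"
        by (rule iso_rho) (use g' rsub_rho Ys YV in auto)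
      then have "iso_mod (\<rho> (g \<otimes> h) ` Y) Y" using iso_trans g' rho_mult_image YV by simp
      then show ?thesis using g' unfolding M_def by auto
    qed
  qed
  have finC: "finite (rcosets M)" using finS unfolding RCOSETS_def by simp
  obtain cs where cs: "set cs = rcosets M" "distinct cs" using finite_distinct_list[OF finC] by blast
  define rep where "rep c = (SOME g. g \<in> c)" for c :: "'g set"
  have rep: "rep c \<in> carrier S" "c = M #> rep c" if c: "c \<in> rcosets M" for c
  proof -
    obtain x where x: "x \<in> carrier S" "c = M #> x" using c unfolding RCOSETS_def by blast
    have "x \<in> c" using x rcos_self[OF x(1) M] by simp
    then have "rep c \<in> c" unfolding rep_def by (rule someI)
    then show "rep c \<in> carrier S" using x r_coset_subset_G[OF subgroup.subset[OF M] x(1)] by blast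
    show "c = M #> rep c" using repr_independence[OF _ x(1) M] \<open>rep c \<in> c\<close> x(2) by blast
  qed
  \<comment> \<open>Right cosets M g are matched with g^-1 Y: replacing g by m g with m in M changes
    g^-1 Y only to the isomorphic g^-1 m^-1 Y.\<close>
  define Ys' where "Ys' = map (\<lambda>c. \<rho> (inv (rep c)) ` Y) cs"
  have sm: "\<forall>A\<in>set Ys'. simple A" unfolding Ys'_def using cs(1) rep(1) simple_rho[OF _ Y] by auto
  have noniso: "\<not> iso_mod (\<rho> (inv (rep c)) ` Y) (\<rho> (inv (rep d)) ` Y)"
    if cd: "c \<in> rcosets M" "d \<in> rcosets M" "c \<noteq> d" for c d
  proof
    assume iso: "iso_mod (\<rho> (inv (rep c)) ` Y) (\<rho> (inv (rep d)) ` Y)"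
    have cd': "rep c \<in> carrier S" "rep d \<in> carrier S" using rep cd by auto
    have "iso_mod (\<rho> (rep d) ` \<rho> (inv (rep c)) ` Y) (\<rho> (rep d) ` \<rho> (inv (rep d)) ` Y)"
      by (rule iso_rho[OF cd'(2) _ iso]) (use cd' rsub_rho Ys rsub_subset in auto)
    then have "iso_mod (\<rho> (rep d \<otimes> inv (rep c)) ` Y) Y"
      using rho_inv_image(2) cd' YV rho_mult_image by simp
    then have m: "rep d \<otimes> inv (rep c) \<in> M" unfolding M_def using cd' by simp
    have "rep d = (rep d \<otimes> inv (rep c)) \<otimes> rep c" using cd' by (simp add: m_assoc)
    then have "rep d \<in> M #> rep c" using m unfolding r_coset_def by auto
    then have "M #> rep c = M #> rep d" by (rule repr_independence[OF _ cd'(1) M])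
    then have "c = d" by (rule trans[OF trans[OF rep(2)[OF cd(1)]] rep(2)[OF cd(2), symmetric]])
    then show False using cd(3) by blast
  qed
  have "\<forall>i j. i < j \<longrightarrow> j < length cs \<longrightarrow>
      \<not> iso_mod (\<rho> (inv (rep (cs ! i))) ` Y) (\<rho> (inv (rep (cs ! j))) ` Y)"
  proof (intro allI impI)
    fix i j assume ij: "i < j" "j < length cs"
    have "cs ! i \<in> rcosets M" "cs ! j \<in> rcosets M" using nth_mem[of _ cs] cs(1) ij by auto
    moreover have "cs ! i \<noteq> cs ! j" using cs(2) ij by (simp add: nth_eq_iff_index_eq)
    ultimately show "\<not> iso_mod (\<rho> (inv (rep (cs ! i))) ` Y) (\<rho> (inv (rep (cs ! j))) ` Y)" by (rule noniso)
  qed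
  then have "sorted_wrt (\<lambda>A B. \<not> iso_mod A B) Ys'" unfolding Ys'_def sorted_wrt_iff_nth_less by simp
  then have "2 ^ length Ys' \<le> card (lsum Ys')" by (rule lsum_card[OF sm])
  also have "\<dots> \<le> card V"
  proof -
    have "rsub (lsum Ys')" by (rule rsub_lsum) (use sm simpleD(1) in auto)
    then show ?thesis by (rule card_mono[OF finV rsub_subset])
  qed
  finally have "length cs \<le> n" unfolding cardV Ys'_def by simp
  then have "card (rcosets M) \<le> n" using distinct_card[OF cs(2)] cs(1) by simp
  then have "card (rcosets M) * card M \<le> n * card M" by (rule mult_le_mono1)
  then have "card (carrier S) \<le> n * card M" using lagrange[OF M] by (simp add: order_def)
  then have "M = carrier S" by (rule large_subgroup[OF M])
  then show ?thesis using g unfolding M_def by blast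
qed

lemma exists_simple: assumes "rsub D" "D \<noteq> {0}" shows "\<exists>Y. simple Y \<and> Y \<subseteq> D"
  using assms
proof (induction "card D" arbitrary: D rule: less_induct)
  case less
  show ?case
  proof (cases "simple D")
    case False
    then obtain A where A: "rsub A" "A \<subseteq> D" "A \<noteq> {0}" "A \<noteq> D" unfolding simple_def using less.prems by blast
    then have "card A < card D" using psubset_card_mono[OF subspD(4)[OF rsubD(1)[OF less.prems(1)]]] by blast
    then show ?thesis using less.hyps[of A] A by blast
  qed blast
qed

text \<open>The sum of all translates of Y is S-stable, hence all of V. So Z is isomorphic to one of
  the translates, and these are isomorphic to Y by \<open>conjugates_iso\<close>.\<close>

lemma simple_iso: assumes Y: "simple Y" and Z: "simple Z" shows "iso_mod Z Y"
proof -
  obtain gs where gs: "set gs = carrier S" using finite_list[OF finS] by blast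
  define Ys where "Ys = map (\<lambda>g. \<rho> g ` Y) gs"
  have sm: "\<forall>A\<in>set Ys. simple A" unfolding Ys_def using gs simple_rho[OF _ Y] by auto
  then have rs: "\<forall>A\<in>set Ys. rsub A" using simpleD(1) by blast
  let ?D = "lsum Ys"
  have D: "rsub ?D" by (rule rsub_lsum[OF rs])
  note D' = subspD[OF rsubD(1)[OF D]]
  have YV: "Y \<subseteq> V" using rsub_subset[OF simpleD(1)[OF Y]] .
  have up: "\<rho> g ` Y \<subseteq> ?D" if "g \<in> carrier S" for g
    by (rule lsum_upper[OF rs]) (use that gs in \<open>auto simp: Ys_def\<close>)
  have "?D = V"
  proof (rule irr)
    show "subsp ?D" using rsubD(1)[OF D] .
    have "\<rho> \<one> ` Y = Y" using rho_one YV by force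
    then show "?D \<noteq> {0}" using up[of \<one>] simpleD(3)[OF Y] subspD(1)[OF simpleD(2)[OF Y]] by auto
    show "\<forall>g\<in>carrier S. \<rho> g ` ?D \<subseteq> ?D"
    proof
      fix g assume g: "g \<in> carrier S"
      have "?D \<subseteq> {x\<in>V. \<rho> g x \<in> ?D}"
      proof (rule lsum_least)
        show "\<forall>A\<in>set Ys. A \<subseteq> {x \<in> V. \<rho> g x \<in> ?D}"
        proof
          fix A assume "A \<in> set Ys"
          then obtain h where h: "h \<in> carrier S" "A = \<rho> h ` Y" unfolding Ys_def using gs by auto
          have "\<rho> g ` A \<subseteq> ?D" using up[of "g \<otimes> h"] g h YV by (simp add: rho_mult_image)
          then show "A \<subseteq> {x \<in> V. \<rho> g x \<in> ?D}" using h YV rho_closed by auto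
        qed
        show "subsp {x \<in> V. \<rho> g x \<in> ?D}" unfolding subsp_def
          using V0 Vadd rho_zero[OF g] rho_add[OF g] D'(1,3) by auto
      qed
      then show "\<rho> g ` ?D \<subseteq> ?D" by blast
    qed
  qed
  then have "Z \<subseteq> ?D" using rsub_subset[OF simpleD(1)[OF Z]] by simp
  then obtain A where "A \<in> set Ys" "iso_mod Z A" using simple_in_lsum[OF sm Z] by blast
  moreover then have "iso_mod A Y" using conjugates_iso[OF Y] gs unfolding Ys_def by auto
  ultimately show ?thesis using iso_trans by blast
qed

text \<open>Homomorphisms normalised to be 0 off A, so that there are finitely many of them and
  equality on A is equality of functions; they are going to be counted.\<close>

definition Hom :: "'v set \<Rightarrow> ('v \<Rightarrow> 'v) set" where
  "Hom A = {f. rhom A f \<and> (\<forall>x. x \<notin> A \<longrightarrow> f x = 0)}"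

lemma finite_Hom: "subsp A \<Longrightarrow> finite (Hom A)"
proof -
  assume A: "subsp A"
  have "finite {f. \<forall>x. (x \<in> A \<longrightarrow> f x \<in> V) \<and> (x \<notin> A \<longrightarrow> f x = 0)}"
    by (rule finite_set_of_finite_funs[OF subspD(4)[OF A] finV])
  then show ?thesis by (rule finite_subset[rotated]) (auto simp: Hom_def rhom_def)
qed

lemma Hom_add: assumes "subsp A" "f \<in> Hom A" "h \<in> Hom A" shows "f + h \<in> Hom A"
  using assms unfolding Hom_def rhom_def by (auto simp: Vadd R_add algebra_simps subsp_def)

lemma Hom_restrict: assumes "rsub A" "rhom A f" shows "(\<lambda>x. if x \<in> A then f x else 0) \<in> Hom A"
  using assms rsubD[OF assms(1)] subspD[OF rsubD(1)[OF assms(1)]] unfolding Hom_def rhom_def by auto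

lemma fun_char2: "(f::'v \<Rightarrow> 'v) + f = 0"
  using char2 by (simp add: fun_eq_iff)

text \<open>The nonzero homomorphisms from Y to V number |Hom(Y,V)| - 1, which is odd, and the number of
  simple submodules is this number divided by |Aut Y|.\<close>

lemma odd_simples: "odd (card {Z. simple Z})"
proof -
  obtain Y where Y: "simple Y" using exists_simple[OF rsub_V] v0 by blast
  note Y' = simpleD[OF Y] subspD[OF simpleD(2)[OF Y]]
  define Aut where "Aut = {f \<in> Hom Y - {0}. f ` Y = Y}"
  define fib where "fib Z = {f \<in> Hom Y - {0}. f ` Y = Z}" for Z
  let ?i = "\<lambda>x. if x \<in> Y then x else 0"
  have i: "?i \<in> Hom Y" by (rule Hom_restrict[OF Y'(1) rhom_id[OF Y'(1)]])
  have i0: "?i \<noteq> 0" using Y'(3,5) by (auto simp: fun_eq_iff)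
  have finH: "finite (Hom Y)" by (rule finite_Hom[OF Y'(2)])
  \<comment> \<open>Adding the inclusion of Y in V is a fixed-point-free involution on these
    homomorphisms.\<close>
  have "even (card (Hom Y))"
  proof (rule even_card_involution[OF finH, of "\<lambda>f. f + ?i"])
    show "f + ?i \<in> Hom Y" if "f \<in> Hom Y" for f by (rule Hom_add[OF Y'(2) that i])
    show "f + ?i + ?i = f" for f using fun_char2[of ?i] by (simp only: add.assoc add.right_neutral)
    show "f + ?i \<noteq> f" for f using i0 by simp
  qed
  moreover have z: "0 \<in> Hom Y" unfolding Hom_def rhom_def using V0 R_zero by auto
  moreover have "card (Hom Y) > 0" using z finH card_gt_0_iff by blast
  ultimately have odd: "odd (card (Hom Y - {0}))" using finH
    by (metis card_Suc_Diff1 even_Suc)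
  have cnt: "Hom Y - {0} = (\<Union>Z\<in>{Z. simple Z}. fib Z)"
  proof
    show "Hom Y - {0} \<subseteq> (\<Union>Z\<in>{Z. simple Z}. fib Z)"
    proof
      fix f assume f: "f \<in> Hom Y - {0}"
      then obtain x where "x \<in> Y" "f x \<noteq> 0" unfolding Hom_def by (auto simp: fun_eq_iff)
      then have "simple (f ` Y)" using schur(2)[OF Y] f unfolding Hom_def by blast
      then show "f \<in> (\<Union>Z\<in>{Z. simple Z}. fib Z)" using f unfolding fib_def by blast
    qed
  qed (auto simp: fib_def)
  \<comment> \<open>Composition with a fixed isomorphism from Y to Z turns automorphisms of Y into
    the homomorphisms with image Z.\<close>
  have fibc: "card (fib Z) = card Aut" if Z: "simple Z" for Z
  proof -
    obtain f0 where f0: "riso Y Z f0" using simple_iso[OF Z Y] unfolding iso_mod_def by blast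
    note f1 = riso_inv[OF f0 Y'(1)]
    have f0': "rhom Y f0" "inj_on f0 Y" "f0 ` Y = Z" using f0 unfolding riso_def bij_betw_def by auto
    have f1': "rhom Z (inv_into Y f0)" using f1 unfolding riso_def by simp
    have f00: "f0 0 = 0" using rhom_zero[OF f0'(1) Y'(2)] .
    have f10: "inv_into Y f0 0 = 0" using f00 f0'(2) Y'(5) inv_into_f_f by metis
    let ?F = "\<lambda>f x. if x \<in> Y then f0 (f x) else 0"
    let ?G = "\<lambda>f x. if x \<in> Y then inv_into Y f0 (f x) else 0"
    have "bij_betw ?F Aut (fib Z)"
    proof (rule bij_betw_byWitness[of _ ?G])
      show "\<forall>a\<in>Aut. ?G (?F a) = a"
      proof
        fix a assume a: "a \<in> Aut"
        have "a x \<in> Y" if "x \<in> Y" for x using a that unfolding Aut_def by blast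
        then show "?G (?F a) = a" using f0'(2) a unfolding Aut_def Hom_def by (auto simp: fun_eq_iff)
      qed
      show "\<forall>a\<in>fib Z. ?F (?G a) = a"
      proof
        fix a assume a: "a \<in> fib Z"
        have "a x \<in> f0 ` Y" if "x \<in> Y" for x using a that f0'(3) unfolding fib_def by blast
        then show "?F (?G a) = a" using a unfolding fib_def Hom_def by (auto simp: fun_eq_iff f_inv_into_f)
      qed
      show "?F ` Aut \<subseteq> fib Z"
      proof
        fix h assume "h \<in> ?F ` Aut"
        then obtain a where a: "a \<in> Aut" "h = ?F a" by blast
        have ar: "rhom Y a" "a ` Y = Y" "a \<noteq> 0" using a unfolding Aut_def Hom_def by auto
        have "h \<in> Hom Y" unfolding a(2)
          by (rule Hom_restrict[OF Y'(1)]) (rule rhom_comp[OF ar(1) f0'(1)], use ar in simp)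
        moreover have "h ` Y = f0 ` a ` Y" using a(2) by (auto simp: image_image)
        then have "h ` Y = Z" using ar f0' by simp
        moreover then have "h \<noteq> 0" using simpleD(3)[OF Z] Y'(5) by (auto simp: fun_eq_iff)
        ultimately show "h \<in> fib Z" unfolding fib_def by blast
      qed
      show "?G ` fib Z \<subseteq> Aut"
      proof
        fix h assume "h \<in> ?G ` fib Z"
        then obtain a where a: "a \<in> fib Z" "h = ?G a" by blast
        have ar: "rhom Y a" "a ` Y = Z" "a \<noteq> 0" using a unfolding fib_def Hom_def by auto
        have "h \<in> Hom Y" unfolding a(2)
          by (rule Hom_restrict[OF Y'(1)]) (rule rhom_comp[OF ar(1) f1'], use ar in simp)
        moreover have "h ` Y = inv_into Y f0 ` a ` Y" using a(2) by (auto simp: image_image)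
        then have "h ` Y = Y" using ar f1 unfolding riso_def bij_betw_def by simp
        moreover then have "h \<noteq> 0" using simpleD(3)[OF Y] Y'(5) by (auto simp: fun_eq_iff)
        ultimately show "h \<in> Aut" unfolding Aut_def by blast
      qed
    qed
    then show ?thesis by (simp add: bij_betw_same_card)
  qed
  have fins: "finite {Z. simple Z}"
    by (rule finite_subset[of _ "Pow V"]) (use rsub_subset simpleD(1) finV in auto)
  have "card (Hom Y - {0}) = (\<Sum>Z\<in>{Z. simple Z}. card (fib Z))"
    unfolding cnt by (rule card_UN_disjoint[OF fins]) (use finH in \<open>auto simp: fib_def\<close>)
  also have "\<dots> = card {Z. simple Z} * card Aut" using fibc by simp
  finally show ?thesis using odd by simp
qed

lemma stable_simple: "\<exists>W. simple W \<and> v0 \<in> W \<and> (\<forall>u\<in>U. \<rho> u ` W = W)"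
proof -
  have fins: "finite {Z. simple Z}"
    by (rule finite_subset[of _ "Pow V"]) (use rsub_subset simpleD(1) finV in auto)
  have "acts_on S U {Z. simple Z} (\<lambda>u. image (\<rho> u))"
    unfolding acts_on_def
  proof (intro conjI ballI)
    show "\<rho> g ` x \<in> {Z. simple Z}" if "g \<in> U" "x \<in> {Z. simple Z}" for g x
      using that simple_rho U_carrier by simp
    show "\<rho> \<one> ` x = x" if "x \<in> {Z. simple Z}" for x
    proof -
      have "x \<subseteq> V" using that rsub_subset simpleD(1) by auto
      then show ?thesis using rho_one by force
    qed
    show "\<rho> (g \<otimes> h) ` x = \<rho> g ` \<rho> h ` x" if "g \<in> U" "h \<in> U" "x \<in> {Z. simple Z}" for g h x
      using that rho_mult_image U_carrier rsub_subset simpleD(1) by auto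
  qed
  then have "[card {Z. simple Z} = card {Z\<in>{Z. simple Z}. \<forall>u\<in>U. \<rho> u ` Z = Z}] (mod 2)"
    by (rule p_group_fixed_points[OF two_is_prime_nat cardU _ U_sub fins])
  then have "card {Z\<in>{Z. simple Z}. \<forall>u\<in>U. \<rho> u ` Z = Z} \<noteq> 0"
    using odd_simples by (metis cong_0_iff even_zero)
  then obtain W where W: "simple W" "\<forall>u\<in>U. \<rho> u ` W = W" by (auto simp: card_eq_0_iff)
  then have "v0 \<in> W" by (intro v0_in) (use simpleD in auto)
  then show ?thesis using W by blast
qed

end

section \<open>Endomorphism rings with a 2-group acting\<close>

text \<open>The endomorphism ring of a simple module normalised by U, in abstract form. A finite
  ring without zero divisors is commutative by Wedderburn's theorem; here the 2-group, whose only
  fixed elements are 0 and 1, gives a direct proof and, if the ring is larger than {0, 1}, an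
  element generating the field with four elements.\<close>

locale two_group_ring = group S for S :: "('g, 'x) monoid_scheme" (structure) +
  fixes U :: "'g set" and e :: nat and E :: "'w::ab_group_add set"
    and mu :: "'w \<Rightarrow> 'w \<Rightarrow> 'w" (infixl \<open>\<odot>\<close> 70) and i :: 'w and a :: "'g \<Rightarrow> 'w \<Rightarrow> 'w"
  assumes char2: "(x::'w) + x = 0" and finE: "finite E"
    and E0: "0 \<in> E" and E1: "i \<in> E"
    and E_add: "x \<in> E \<Longrightarrow> y \<in> E \<Longrightarrow> x + y \<in> E"
    and E_mult: "x \<in> E \<Longrightarrow> y \<in> E \<Longrightarrow> x \<odot> y \<in> E"
    and assoc: "x \<in> E \<Longrightarrow> y \<in> E \<Longrightarrow> z \<in> E \<Longrightarrow> x \<odot> y \<odot> z = x \<odot> (y \<odot> z)"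
    and distl: "x \<in> E \<Longrightarrow> y \<in> E \<Longrightarrow> z \<in> E \<Longrightarrow> x \<odot> (y + z) = x \<odot> y + x \<odot> z"
    and distr: "x \<in> E \<Longrightarrow> y \<in> E \<Longrightarrow> z \<in> E \<Longrightarrow> (x + y) \<odot> z = x \<odot> z + y \<odot> z"
    and onel: "x \<in> E \<Longrightarrow> i \<odot> x = x" and oner: "x \<in> E \<Longrightarrow> x \<odot> i = x"
    and nozd: "x \<in> E \<Longrightarrow> y \<in> E \<Longrightarrow> x \<odot> y = 0 \<Longrightarrow> x = 0 \<or> y = 0"
    and U_sub: "subgroup U S" and cardU: "card U = 2 ^ e"
    and acts: "acts_on S U E a"
    and a_add: "u \<in> U \<Longrightarrow> x \<in> E \<Longrightarrow> y \<in> E \<Longrightarrow> a u (x + y) = a u x + a u y"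
    and a_mult: "u \<in> U \<Longrightarrow> x \<in> E \<Longrightarrow> y \<in> E \<Longrightarrow> a u (x \<odot> y) = a u x \<odot> a u y"
    and a_one: "u \<in> U \<Longrightarrow> a u i = i"
    and fixed: "x \<in> E \<Longrightarrow> (\<And>u. u \<in> U \<Longrightarrow> a u x = x) \<Longrightarrow> x = 0 \<or> x = i"
begin

lemma cancel [simp]: "(x::'w) + (x + y) = y"
  using char2 by (metis add.assoc add_0)

lemma add_eq_0: "(x::'w) + y = 0 \<longleftrightarrow> x = y"
  using char2 by (metis cancel add.right_neutral)

lemma a_closed: "u \<in> U \<Longrightarrow> x \<in> E \<Longrightarrow> a u x \<in> E"
  using acts unfolding acts_on_def by blast

lemma a_zero: "u \<in> U \<Longrightarrow> a u 0 = 0"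
  using a_add[of u 0 0] E0 by simp

lemma mult_zero: "x \<in> E \<Longrightarrow> x \<odot> 0 = 0" "x \<in> E \<Longrightarrow> 0 \<odot> x = 0"
  using distl[of x 0 0] distr[of 0 0 x] E0 by simp_all

lemma a_inv: "u \<in> U \<Longrightarrow> x \<in> E \<Longrightarrow> a u (a (inv u) x) = x"
  using acts_on_inv(2)[OF acts U_sub] .

lemma inv_U: "u \<in> U \<Longrightarrow> inv u \<in> U"
  using subgroup.m_inv_closed[OF U_sub] .

definition csub :: "'w set \<Rightarrow> bool" where
  "csub K \<longleftrightarrow> K \<subseteq> E \<and> 0 \<in> K \<and> i \<in> K \<and> (\<forall>x\<in>K. \<forall>y\<in>K. x + y \<in> K \<and> x \<odot> y \<in> K \<and> x \<odot> y = y \<odot> x)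
     \<and> (\<forall>u\<in>U. \<forall>x\<in>K. a u x \<in> K)"

definition cen :: "'w set \<Rightarrow> 'w set" where
  "cen A = {y\<in>E. \<forall>z\<in>A. y \<odot> z = z \<odot> y}"

lemma cen_stable:
  assumes "A \<subseteq> E" "\<And>u x. u \<in> U \<Longrightarrow> x \<in> A \<Longrightarrow> a u x \<in> A" "u \<in> U" "y \<in> cen A"
  shows "a u y \<in> cen A"
proof -
  have y: "y \<in> E" "\<And>z. z \<in> A \<Longrightarrow> y \<odot> z = z \<odot> y" using assms(4) unfolding cen_def by auto
  have "a u y \<odot> z = z \<odot> a u y" if z: "z \<in> A" for z
  proof -
    let ?z = "a (inv u) z"
    have z': "?z \<in> A" "?z \<in> E" "z \<in> E" using assms z inv_U by auto
    have "a u (y \<odot> ?z) = a u (?z \<odot> y)" using y z' by simp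
    then show ?thesis using a_mult[OF assms(3)] y(1) z' a_inv[OF assms(3)] by simp
  qed
  then show ?thesis unfolding cen_def using a_closed assms(3) y(1) by simp
qed

lemma cen_ring: assumes "A \<subseteq> E"
  shows "0 \<in> cen A" "i \<in> cen A" "\<And>x y. x \<in> cen A \<Longrightarrow> y \<in> cen A \<Longrightarrow> x + y \<in> cen A"
    "\<And>x y. x \<in> cen A \<Longrightarrow> y \<in> cen A \<Longrightarrow> x \<odot> y \<in> cen A"
proof -
  show "0 \<in> cen A" unfolding cen_def using mult_zero E0 assms by auto
  show "i \<in> cen A" unfolding cen_def using E1 onel oner assms by auto
  fix x y assume xy: "x \<in> cen A" "y \<in> cen A"
  then have xy': "x \<in> E" "y \<in> E" "\<And>z. z \<in> A \<Longrightarrow> x \<odot> z = z \<odot> x" "\<And>z. z \<in> A \<Longrightarrow> y \<odot> z = z \<odot> y" unfolding cen_def by auto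
  have AE: "z \<in> E" if "z \<in> A" for z using that assms by blast
  show "x + y \<in> cen A" unfolding cen_def using xy' AE E_add by (simp add: distl distr)
  have "x \<odot> y \<odot> z = z \<odot> (x \<odot> y)" if z: "z \<in> A" for z
  proof -
    have "x \<odot> y \<odot> z = x \<odot> (z \<odot> y)" using assoc xy' AE[OF z] z by simp
    also have "\<dots> = (z \<odot> x) \<odot> y" using assoc[of x z y] xy' AE[OF z] z by simp
    finally show ?thesis using assoc xy' AE[OF z] by simp
  qed
  then show "x \<odot> y \<in> cen A" unfolding cen_def using xy' E_mult by simp
qed

text \<open>Take a maximal commutative U-stable subring K and x outside K with ux + x in K for all u. If x does
  not centralise K, then the centraliser L of x in K is proper; choosing k in K - L with uk + k in L, the
  commutator of k and x is U-fixed, hence 0 or 1, so the square of k lies in L. As squaring is bijective on K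
  and on L, this forces k into L.\<close>

lemma commute: assumes "x \<in> E" "y \<in> E" shows "x \<odot> y = y \<odot> x"
proof -
  have c0: "csub {0, i}" unfolding csub_def
    using E0 E1 mult_zero onel char2 a_one a_zero by auto
  have "finite {K. csub K}" by (rule finite_subset[of _ "Pow E"]) (use finE in \<open>auto simp: csub_def\<close>)
  then obtain K where K: "csub K" "\<And>K'. csub K' \<Longrightarrow> K \<subseteq> K' \<Longrightarrow> K' = K"
    using finite_has_maximal[of "{K. csub K}"] c0 by blast
  have K': "K \<subseteq> E" "0 \<in> K" "i \<in> K" "\<And>x y. x \<in> K \<Longrightarrow> y \<in> K \<Longrightarrow> x + y \<in> K"
    "\<And>x y. x \<in> K \<Longrightarrow> y \<in> K \<Longrightarrow> x \<odot> y \<in> K" "\<And>x y. x \<in> K \<Longrightarrow> y \<in> K \<Longrightarrow> x \<odot> y = y \<odot> x"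
    "\<And>u x. u \<in> U \<Longrightarrow> x \<in> K \<Longrightarrow> a u x \<in> K"
    using K(1) unfolding csub_def by auto
  have KE: "z \<in> E" if "z \<in> K" for z using that K'(1) by blast
  have finK: "finite K" using finE K'(1) finite_subset by blast
  have "K = E"
  proof (rule ccontr)
    assume ne: "K \<noteq> E"
    have "\<exists>k\<in>E - K. \<forall>u\<in>U. a u k + k \<in> K"
      by (rule fixed_coset[OF char2 U_sub cardU finE E_add K'(1,2,4) ne acts K'(7) a_add])
    then obtain x where x: "x \<in> E" "x \<notin> K" "\<And>u. u \<in> U \<Longrightarrow> a u x + x \<in> K" by blast
    define L where "L = {k\<in>K. k \<odot> x = x \<odot> k}"
    have ux: "a u x = x + (a u x + x)" for u using char2 by (simp add: add.left_commute)
    have L: "L \<subseteq> K" "0 \<in> L" "\<And>k l. k \<in> L \<Longrightarrow> l \<in> L \<Longrightarrow> k + l \<in> L"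
      unfolding L_def using K' KE x(1) mult_zero by (auto simp: distl distr)
    \<comment> \<open>Here ux = x + f with f in K, and the two terms containing f cancel because K
      is commutative.\<close>
    have conj: "a u k \<odot> x + x \<odot> a u k = a u (k \<odot> x + x \<odot> k)" if uk: "u \<in> U" "k \<in> K" for u k
    proof -
      let ?f = "a u x + x"
      have f: "?f \<in> K" "?f \<in> E" using x(3)[OF uk(1)] KE by auto
      have k: "k \<in> E" "a u k \<in> K" "a u k \<in> E" using uk KE K'(7) by auto
      have "a u (k \<odot> x + x \<odot> k) = a u k \<odot> a u x + a u x \<odot> a u k"
        using a_add a_mult uk k x(1) E_mult by simp
      also have "\<dots> = a u k \<odot> (x + ?f) + (x + ?f) \<odot> a u k" by (simp only: ux[of u, symmetric])
      also have "\<dots> = a u k \<odot> x + a u k \<odot> ?f + (x \<odot> a u k + ?f \<odot> a u k)"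
        using distl[OF k(3) x(1) f(2)] distr[OF x(1) f(2) k(3)] by (simp only:)
      also have "\<dots> = a u k \<odot> x + x \<odot> a u k + (?f \<odot> a u k + ?f \<odot> a u k)"
        using K'(6)[OF k(2) f(1)] by (simp only: ac_simps)
      finally show ?thesis using char2 by simp
    qed
    have Lst: "a u k \<in> L" if uk: "u \<in> U" "k \<in> L" for u k
    proof -
      have "k \<in> K" "k \<odot> x + x \<odot> k = 0" using uk(2) char2 unfolding L_def by auto
      then have "a u k \<odot> x + x \<odot> a u k = 0" using conj[OF uk(1)] a_zero[OF uk(1)] by simp
      then show ?thesis unfolding L_def using K'(7)[OF uk(1)] \<open>k \<in> K\<close> by (simp add: add_eq_0)
    qed
    have "L = K"
    proof (rule ccontr)
      assume ne: "L \<noteq> K"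
      have acK: "acts_on S U K a" using acts K'(1,7) unfolding acts_on_def by blast
      have "\<exists>k\<in>K - L. \<forall>u\<in>U. a u k + k \<in> L"
        by (rule fixed_coset[OF char2 U_sub cardU finK K'(4) L ne acK Lst]) (use a_add KE in auto)
      then obtain k where k: "k \<in> K" "k \<notin> L" "\<And>u. u \<in> U \<Longrightarrow> a u k + k \<in> L" by blast
      let ?d = "k \<odot> x + x \<odot> k"
      have kE: "k \<in> E" using k(1) KE by blast
      have d: "?d \<in> E" using E_add E_mult kE x(1) by simp
      have "a u ?d = ?d" if u: "u \<in> U" for u
      proof -
        let ?l = "a u k + k"
        have l: "?l \<in> E" "?l \<odot> x = x \<odot> ?l" using k(3)[OF u] KE unfolding L_def by auto
        have "a u ?d = a u k \<odot> x + x \<odot> a u k" using conj[OF u k(1)] by simp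
        also have "a u k = k + ?l" using char2 by (simp add: add.left_commute)
        also have "(k + ?l) \<odot> x + x \<odot> (k + ?l) = (k \<odot> x + ?l \<odot> x) + (x \<odot> k + x \<odot> ?l)"
          using distl[OF x(1) kE l(1)] distr[OF kE l(1) x(1)] by (simp only:)
        also have "\<dots> = ?d + (x \<odot> ?l + x \<odot> ?l)" unfolding l(2) by (simp only: ac_simps)
        finally show ?thesis using char2 by simp
      qed
      then have "?d = 0 \<or> ?d = i" using fixed d by blast
      moreover have "?d \<noteq> 0" using k(1,2) unfolding L_def by (simp add: add_eq_0)
      ultimately have di: "?d = i" by blast
      have kx: "k \<odot> x = x \<odot> k + i" using di cancel[of "x \<odot> k" "k \<odot> x"] by (simp add: add.commute)
      have xk: "x \<odot> k \<in> E" using E_mult kE x(1) by simp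
      \<comment> \<open>Moving x past both factors k costs k + k = 0.\<close>
      have "k \<odot> k \<odot> x = k \<odot> (x \<odot> k + i)" using kx assoc[OF kE kE x(1)] by simp
      also have "\<dots> = k \<odot> x \<odot> k + k" using distl[OF kE xk E1] assoc[OF kE x(1) kE] oner[OF kE] by simp
      also have "k \<odot> x \<odot> k = x \<odot> k \<odot> k + k" unfolding kx using distr[OF xk E1 kE] onel[OF kE] by simp
      finally have "k \<odot> k \<odot> x = x \<odot> (k \<odot> k)" using char2 assoc[OF x(1) kE kE] by (simp add: add.assoc)
      then have kkL: "k \<odot> k \<in> L" unfolding L_def using K'(5) k(1) by simp
      have sq: "p = r" if pr: "p \<in> K" "r \<in> K" "p \<odot> p = r \<odot> r" for p r
      proof -
        have pE: "p \<in> E" "r \<in> E" using pr KE by auto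
        have "(p + r) \<odot> (p + r) = (p \<odot> p + r \<odot> p) + (p \<odot> r + r \<odot> r)"
          using distl distr pE E_add by simp
        also have "\<dots> = (p \<odot> p + r \<odot> r) + (p \<odot> r + p \<odot> r)" using K'(6)[OF pr(1,2)] by (simp only: ac_simps)
        also have "\<dots> = 0" using pr(3) char2 by simp
        finally show ?thesis using nozd[of "p + r" "p + r"] pE E_add by (simp add: add_eq_0)
      qed
      have "(\<lambda>l. l \<odot> l) ` L \<subseteq> L"
      proof
        fix z assume "z \<in> (\<lambda>l. l \<odot> l) ` L"
        then obtain l where l: "l \<in> L" "z = l \<odot> l" by blast
        have l': "l \<in> K" "l \<in> E" "l \<odot> x = x \<odot> l" using l(1) KE unfolding L_def by auto
        have "l \<odot> l \<odot> x = l \<odot> x \<odot> l" using assoc[OF l'(2) l'(2) x(1)] assoc[OF l'(2) x(1) l'(2)] l'(3) by simp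
        also have "\<dots> = x \<odot> (l \<odot> l)" unfolding l'(3) by (rule assoc[OF x(1) l'(2) l'(2)])
        finally show "z \<in> L" unfolding L_def using l l' K'(5) by simp
      qed
      moreover have "inj_on (\<lambda>l. l \<odot> l) L" using sq L(1) unfolding inj_on_def by blast
      moreover have "finite L" using finK L(1) finite_subset by blast
      ultimately have "(\<lambda>l. l \<odot> l) ` L = L" using endo_inj_surj by blast
      then obtain l where "l \<in> L" "k \<odot> k = l \<odot> l" using kkL by (metis (no_types, lifting) imageE)
      then have "k = l" using sq k(1) L(1) by blast
      then show False using k(2) \<open>l \<in> L\<close> by blast
    qed
    then have xK: "k \<odot> x = x \<odot> k" if "k \<in> K" for k using that unfolding L_def by blast
    \<comment> \<open>Now x commutes with K, and K is enlarged to the double centraliser of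
      \<open>?A\<close>. The centraliser of \<open>?A\<close> is U-stable, since ux differs from x
      by an element of K, and it contains \<open>?A\<close>; so the double centraliser lies inside
      it and is commutative.\<close>
    let ?A = "insert x K"
    have AE: "?A \<subseteq> E" using x(1) K'(1) by blast
    have ust: "a u y \<in> cen ?A" if uy: "u \<in> U" "y \<in> cen ?A" for u y
    proof -
      have y: "y \<in> E" "y \<in> cen K" "y \<odot> x = x \<odot> y" using uy(2) unfolding cen_def by auto
      have yK: "a u y \<in> cen K" by (rule cen_stable[OF K'(1,7) uy(1) y(2)])
      let ?f = "a u x + x"
      have f: "?f \<in> K" "?f \<in> E" using x(3)[OF uy(1)] KE by auto
      have ay: "a u y \<in> E" using a_closed uy y by blast
      have "a u y \<odot> a u x = a u x \<odot> a u y" using a_mult[OF uy(1)] y x(1) by metis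
      then have "a u y \<odot> (x + ?f) = (x + ?f) \<odot> a u y" by (simp only: ux[of u, symmetric])
      then have "a u y \<odot> x + a u y \<odot> ?f = x \<odot> a u y + ?f \<odot> a u y"
        using distl[OF ay x(1) f(2)] distr[OF x(1) f(2) ay] by (simp only:)
      moreover have "a u y \<odot> ?f = ?f \<odot> a u y" using yK f(1) unfolding cen_def by blast
      ultimately have "a u y \<odot> x = x \<odot> a u y" by (metis add_right_cancel)
      then show ?thesis using yK ay unfolding cen_def by auto
    qed
    have AcA: "?A \<subseteq> cen ?A" unfolding cen_def using AE xK K'(6) by auto
    let ?K = "cen (cen ?A)"
    have cE: "cen ?A \<subseteq> E" unfolding cen_def by blast
    have KcA: "?K \<subseteq> cen ?A" using AcA unfolding cen_def by blast
    have AK: "?A \<subseteq> ?K" using AE unfolding cen_def by auto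
    have "csub ?K" unfolding csub_def
    proof (intro conjI ballI)
      show "?K \<subseteq> E" unfolding cen_def by blast
      show "0 \<in> ?K" "i \<in> ?K" using cen_ring[OF cE] by blast+
      show "x + y \<in> ?K" "x \<odot> y \<in> ?K" if "x \<in> ?K" "y \<in> ?K" for x y using cen_ring[OF cE] that by blast+
      show "x \<odot> y = y \<odot> x" if xy: "x \<in> ?K" "y \<in> ?K" for x y
      proof -
        have "y \<in> cen ?A" using xy(2) KcA by blast
        then show ?thesis using xy(1) unfolding cen_def[of "cen ?A"] by blast
      qed
      show "a u x \<in> ?K" if "u \<in> U" "x \<in> ?K" for u x by (rule cen_stable[OF cE ust that])
    qed
    then have "?K = K" using K(2) AK by blast
    then show False using AK x(2) by blast
  qed
  then show ?thesis using K'(6) assms by blast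
qed

text \<open>A fixed coset modulo {0, 1} gives c with uc = c or uc = c + 1 for all u. Both leave c^2
  + c unchanged, so that element is U-fixed; it is not 0, as c is neither 0 nor 1, so it is 1. Thus
  c generates the field with four elements.\<close>

lemma quadratic: assumes "E \<noteq> {0, i}" shows "\<exists>c\<in>E. c \<odot> c = c + i"
proof -
  have c0: "{0, i} \<subseteq> E" "0 \<in> {0, i}" using E0 E1 by auto
  have "\<exists>k\<in>E - {0, i}. \<forall>u\<in>U. a u k + k \<in> {0, i}"
    by (rule fixed_coset[OF char2 U_sub cardU finE E_add c0])
      (use char2 assms acts a_add a_zero a_one in auto)
  then obtain c where c: "c \<in> E" "c \<noteq> 0" "c \<noteq> i" "\<And>u. u \<in> U \<Longrightarrow> a u c + c = 0 \<or> a u c + c = i" by blast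
  have "a u (c \<odot> c + c) = c \<odot> c + c" if u: "u \<in> U" for u
  proof -
    have e1: "a u (c \<odot> c + c) = a u c \<odot> a u c + a u c" using a_add a_mult u c(1) E_mult by simp
    have "a u c = c \<or> a u c = c + i" using c(4)[OF u] by (metis add.commute cancel add_eq_0)
    then show ?thesis
    proof
      assume "a u c = c + i"
      then have "a u (c \<odot> c + c) = (c \<odot> c + c + (c + i)) + (c + i)" unfolding e1
        using distl[OF E_add[OF c(1) E1] c(1) E1] distr[OF c(1) E1 c(1)] onel oner c(1) E_add[OF c(1) E1] by simp
      then show ?thesis using char2[of "c + i"] by (simp only: add.assoc add.right_neutral)
    qed (use e1 in simp)
  qed
  then have "c \<odot> c + c = 0 \<or> c \<odot> c + c = i" using fixed E_add E_mult c(1) by simp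
  moreover have "c \<odot> c + c \<noteq> 0"
  proof
    assume "c \<odot> c + c = 0"
    then have "c \<odot> (c + i) = 0" using distl[OF c(1) c(1) E1] oner c(1) by simp
    then have "c = 0 \<or> c + i = 0" using nozd c(1) E_add E1 by blast
    then show False using c(2,3) by (simp add: add_eq_0)
  qed
  ultimately have "c \<odot> c + c = i" by blast
  then have "c \<odot> c = c + i" by (metis add.commute cancel)
  then show ?thesis using c(1) by blast
qed

text \<open>By commutativity y^2 + y + 1 factors as (y + c)(y + c + 1).\<close>

lemma quadratic_roots: assumes "c \<in> E" "c \<odot> c = c + i" "y \<in> E" "y \<odot> y = y + i" shows "y = c \<or> y = c + i"
proof -
  have "(y + c) \<odot> (y + (c + i)) = (y \<odot> y + (y \<odot> c + y)) + (c \<odot> y + (c \<odot> c + c))"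
    using assms(1,3) E1 E_add by (simp add: distl distr oner)
  also have "\<dots> = (y + i + (y \<odot> c + y)) + (y \<odot> c + (c + i + c))"
    unfolding assms(2,4) commute[OF assms(1,3)] ..
  also have "\<dots> = (y \<odot> c + y \<odot> c) + ((y + y) + (c + c)) + (i + i)" by (simp only: ac_simps)
  also have "\<dots> = 0" using char2 by simp
  finally have "y + c = 0 \<or> y + (c + i) = 0"
    by (rule nozd[rotated 2]) (intro E_add assms(1,3) E1)+
  then show ?thesis by (simp add: add_eq_0)
qed

end

section \<open>The endomorphism ring of a simple submodule stable under U\<close>

locale steinberg_simple = steinberg_like S V \<rho> R ap n e U v0
  for S :: "('g, 'x) monoid_scheme" (structure) and V :: "'v::ab_group_add set" and \<rho> :: "'g \<Rightarrow> 'v \<Rightarrow> 'v"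
    and R :: "'r set" and ap :: "'r \<Rightarrow> 'v \<Rightarrow> 'v" (infixr \<open>\<star>\<close> 75)
    and n e :: nat and U :: "'g set" and v0 :: 'v +
  fixes W :: "'v set"
  assumes W_simple: "simple W" and v0_W: "v0 \<in> W" and U_W: "u \<in> U \<Longrightarrow> \<rho> u ` W = W"
begin

lemmas W_sub = simpleD(1)[OF W_simple] and W_subsp = simpleD(2)[OF W_simple]

lemma W_V: "x \<in> W \<Longrightarrow> x \<in> V" using rsub_subset[OF W_sub] by blast
lemma W_add: "x \<in> W \<Longrightarrow> y \<in> W \<Longrightarrow> x + y \<in> W" using subspD(3)[OF W_subsp] .
lemma W_0: "0 \<in> W" using subspD(1)[OF W_subsp] .
lemma W_R: "r \<in> R \<Longrightarrow> x \<in> W \<Longrightarrow> r \<star> x \<in> W" using rsubD(2)[OF W_sub] .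
lemma W_U: "u \<in> U \<Longrightarrow> x \<in> W \<Longrightarrow> \<rho> u x \<in> W" using U_W by blast
lemma inv_U: "u \<in> U \<Longrightarrow> inv u \<in> U" using subgroup.m_inv_closed[OF U_sub] .

definition EE :: "('v \<Rightarrow> 'v) set" where
  "EE = {f \<in> Hom W. f ` W \<subseteq> W}"

definition EI :: "'v \<Rightarrow> 'v" where "EI x = (if x \<in> W then x else 0)"

definition Ea :: "'g \<Rightarrow> ('v \<Rightarrow> 'v) \<Rightarrow> 'v \<Rightarrow> 'v" where
  "Ea u f x = (if x \<in> W then \<rho> u (f (\<rho> (inv u) x)) else 0)"

lemma EE_D: assumes "f \<in> EE" shows "rhom W f" "\<And>x. x \<notin> W \<Longrightarrow> f x = 0" "\<And>x. x \<in> W \<Longrightarrow> f x \<in> W" "f 0 = 0" "f \<in> Hom W"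
  "\<And>x y. x \<in> W \<Longrightarrow> y \<in> W \<Longrightarrow> f (x + y) = f x + f y" "\<And>r x. r \<in> R \<Longrightarrow> x \<in> W \<Longrightarrow> f (r \<star> x) = r \<star> f x" "\<And>x. f x \<in> W"
proof -
  show 1: "rhom W f" "\<And>x. x \<notin> W \<Longrightarrow> f x = 0" "\<And>x. x \<in> W \<Longrightarrow> f x \<in> W" "f \<in> Hom W"
    using assms unfolding EE_def Hom_def by auto
  show "f 0 = 0" using rhom_zero[OF 1(1) W_subsp] .
  show "\<And>x y. x \<in> W \<Longrightarrow> y \<in> W \<Longrightarrow> f (x + y) = f x + f y" "\<And>r x. r \<in> R \<Longrightarrow> x \<in> W \<Longrightarrow> f (r \<star> x) = r \<star> f x"
    using rhomD[OF 1(1)] by auto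
  show "f x \<in> W" for x using 1 W_0 by (cases "x \<in> W") auto
qed

lemma EE_I: assumes "rhom W f" "\<And>x. x \<in> W \<Longrightarrow> f x \<in> W" shows "(\<lambda>x. if x \<in> W then f x else 0) \<in> EE"
  using Hom_restrict[OF W_sub assms(1)] assms(2) unfolding EE_def by auto

lemma EE_eq: "f \<in> EE \<Longrightarrow> h \<in> EE \<Longrightarrow> (\<And>x. x \<in> W \<Longrightarrow> f x = h x) \<Longrightarrow> f = h"
  using EE_D(2) by (metis ext)

text \<open>A nonzero endomorphism of a simple module is injective. In particular an element of
  \<open>EE\<close> is determined by its value at \<open>v0\<close>.\<close>

lemma EE_zero_iff: assumes "f \<in> EE" "x \<in> W" "x \<noteq> 0" "f x = 0" shows "f = 0"
proof (rule ccontr)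
  assume "f \<noteq> 0"
  then obtain y where "f y \<noteq> 0" by (auto simp: fun_eq_iff)
  then have "y \<in> W" "f y \<noteq> 0" using EE_D(2)[OF assms(1)] by auto
  then have "inj_on f W" using schur(1)[OF W_simple EE_D(1)[OF assms(1)]] by blast
  then show False using inj_onD[of f W x 0] assms W_0 EE_D(4)[OF assms(1)] by simp
qed

lemma EI_EE: "EI \<in> EE"
  using EE_I[OF rhom_id[OF W_sub]] unfolding EI_def[abs_def] by simp

lemma EE_comp: assumes "f \<in> EE" "h \<in> EE" shows "f \<circ> h \<in> EE"
proof -
  have "rhom W (\<lambda>x. f (h x))"
    by (rule rhom_comp[OF EE_D(1)[OF assms(2)] EE_D(1)[OF assms(1)]]) (use EE_D(8)[OF assms(2)] in blast)
  then have "(\<lambda>x. if x \<in> W then f (h x) else 0) \<in> EE"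
    by (rule EE_I) (rule EE_D(8)[OF assms(1)])
  moreover have "f \<circ> h = (\<lambda>x. if x \<in> W then f (h x) else 0)"
    using EE_D(2)[OF assms(2)] EE_D(4)[OF assms(1)] by (auto simp: fun_eq_iff)
  ultimately show ?thesis by simp
qed

lemma EE_add: "f \<in> EE \<Longrightarrow> h \<in> EE \<Longrightarrow> f + h \<in> EE"
  using Hom_add[OF W_subsp] W_add unfolding EE_def by (auto simp: image_subset_iff)

lemma EE_0: "0 \<in> EE"
  unfolding EE_def Hom_def rhom_def using V0 R_zero W_0 by auto

lemma Ea_EE: assumes u: "u \<in> U" and f: "f \<in> EE" shows "Ea u f \<in> EE"
proof -
  have "rhom (\<rho> u ` W) (\<lambda>x. \<rho> u (f (\<rho> (inv u) x)))"
    by (rule rhom_rho[OF U_carrier[OF u] W_sub EE_D(1)[OF f]])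
  then have "rhom W (\<lambda>x. \<rho> u (f (\<rho> (inv u) x)))" using U_W[OF u] by simp
  then have "(\<lambda>x. if x \<in> W then \<rho> u (f (\<rho> (inv u) x)) else 0) \<in> EE"
    by (rule EE_I) (use W_U u inv_U EE_D(3)[OF f] in auto)
  then show ?thesis unfolding Ea_def[abs_def] .
qed

sublocale ring: two_group_ring S U e EE "(\<circ>)" EI Ea
proof
  show "x + x = 0" for x :: "'v \<Rightarrow> 'v" by (rule fun_char2)
  show "finite EE" using finite_Hom[OF W_subsp] unfolding EE_def by simp
  show "0 \<in> EE" by (rule EE_0)
  show "EI \<in> EE" by (rule EI_EE)
  show "x + y \<in> EE" "x \<circ> y \<in> EE" if "x \<in> EE" "y \<in> EE" for x y using EE_add EE_comp that by auto
  show "x \<circ> y \<circ> z = x \<circ> (y \<circ> z)" for x y z :: "'v \<Rightarrow> 'v" by (rule comp_assoc)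
  show "x \<circ> (y + z) = (x \<circ> y) + (x \<circ> z)" if "x \<in> EE" "y \<in> EE" "z \<in> EE" for x y z
    using EE_D(6)[OF that(1)] EE_D(8)[OF that(2)] EE_D(8)[OF that(3)] by (simp add: fun_eq_iff)
  show "(x + y) \<circ> z = (x \<circ> z) + (y \<circ> z)" for x y z :: "'v \<Rightarrow> 'v" by (simp add: fun_eq_iff)
  show "EI \<circ> x = x" if "x \<in> EE" for x using EE_D(8)[OF that] by (simp add: fun_eq_iff EI_def)
  show "x \<circ> EI = x" if "x \<in> EE" for x using EE_D(2,4)[OF that] by (simp add: fun_eq_iff EI_def)
  show "x = 0 \<or> y = 0" if xy: "x \<in> EE" "y \<in> EE" "x \<circ> y = 0" for x y
  proof (rule ccontr)
    assume "\<not> (x = 0 \<or> y = 0)"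
    then obtain w where w: "y w \<noteq> 0" "x \<noteq> 0" by (auto simp: fun_eq_iff)
    have "x (y w) = 0" using xy(3) by (metis comp_apply zero_fun_apply)
    then show False using EE_zero_iff[OF xy(1) EE_D(8)[OF xy(2), of w] w(1)] w(2) by blast
  qed
  show "acts_on S U EE Ea" unfolding acts_on_def
  proof (intro conjI ballI)
    show "Ea g x \<in> EE" if "g \<in> U" "x \<in> EE" for g x by (rule Ea_EE[OF that])
    show "Ea \<one> x = x" if x: "x \<in> EE" for x
      using rho_one W_V EE_D(2,3)[OF x] by (auto simp: fun_eq_iff Ea_def)
    show "Ea (g \<otimes> h) x = Ea g (Ea h x)" if gh: "g \<in> U" "h \<in> U" "x \<in> EE" for g h x
    proof
      fix w show "Ea (g \<otimes> h) x w = Ea g (Ea h x) w"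
      proof (cases "w \<in> W")
        case True
        have c: "g \<in> carrier S" "h \<in> carrier S" using gh U_carrier by auto
        have w1: "\<rho> (inv g) w \<in> W" using W_U inv_U gh True by blast
        then have w2: "\<rho> (inv h) (\<rho> (inv g) w) \<in> W" using W_U inv_U gh by blast
        have "\<rho> (inv (g \<otimes> h)) w = \<rho> (inv h) (\<rho> (inv g) w)"
          using c W_V[OF True] by (simp add: inv_mult_group rho_mult)
        then show ?thesis using True w1 w2 c rho_mult W_V[OF EE_D(3)[OF gh(3) w2]] by (simp add: Ea_def)
      qed (simp add: Ea_def)
    qed
  qed
  show "Ea u (x + y) = Ea u x + Ea u y" if "u \<in> U" "x \<in> EE" "y \<in> EE" for u x y
    using rho_add[OF U_carrier[OF that(1)]] W_V EE_D(8)[OF that(2)] EE_D(8)[OF that(3)]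
    by (auto simp: fun_eq_iff Ea_def)
  show "Ea u (x \<circ> y) = Ea u x \<circ> Ea u y" if uxy: "u \<in> U" "x \<in> EE" "y \<in> EE" for u x y
  proof
    fix w show "Ea u (x \<circ> y) w = (Ea u x \<circ> Ea u y) w"
    proof (cases "w \<in> W")
      case True
      have "\<rho> u (y (\<rho> (inv u) w)) \<in> W" using W_U uxy EE_D(8) by blast
      then show ?thesis using True rho_inv(1)[OF U_carrier[OF uxy(1)]] W_V EE_D(8)[OF uxy(3)]
        by (simp add: Ea_def)
    qed (use EE_D(4)[OF Ea_EE[OF uxy(1,2)]] in \<open>simp add: Ea_def\<close>)
  qed
  show "Ea u EI = EI" if u: "u \<in> U" for u
    using rho_inv(2)[OF U_carrier[OF u]] W_V W_U[OF inv_U[OF u]] by (auto simp: fun_eq_iff Ea_def EI_def)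
  show "x = 0 \<or> x = EI" if x: "x \<in> EE" and fx: "\<And>u. u \<in> U \<Longrightarrow> Ea u x = x" for x
  proof -
    have "\<rho> u (x v0) = x v0" if u: "u \<in> U" for u
    proof -
      have "Ea u x v0 = x v0" using fx[OF u] by simp
      then show ?thesis using v0_W U_v0[OF inv_U[OF u]] by (simp add: Ea_def)
    qed
    then have "x v0 = 0 \<or> x v0 = v0" using U_fixed W_V EE_D(3)[OF x v0_W] by blast
    then show ?thesis
    proof
      assume "x v0 = 0" then show ?thesis using EE_zero_iff[OF x v0_W v0(2)] by blast
    next
      assume h: "x v0 = v0"
      have "(x + EI) v0 = 0" using h v0_W char2 by (simp add: EI_def)
      then have "x + EI = 0" by (rule EE_zero_iff[OF EE_add[OF x EI_EE] v0_W v0(2)])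
      then have "x = EI" by (metis add.assoc add.right_neutral add_0 fun_char2)
      then show ?thesis by blast
    qed
  qed
qed (simp_all add: cardU subgroup.subset[OF U_sub] subgroup.m_closed[OF U_sub] subgroup.one_closed[OF U_sub] inv_U)

lemma EI_nz: "EI \<noteq> 0"
  using v0_W v0(2) by (auto simp: fun_eq_iff EI_def)

text \<open>As gW may differ from W, an identification \<theta> of the two is needed to compare g c
  g^-1 with c; transported back along \<theta> it becomes c + z. For c a generator of the field with
  four elements, z = 0 means that g fixes c, and z = \<open>EI\<close> that g sends c to the
  conjugate c + 1.\<close>

definition twist :: "('v \<Rightarrow> 'v) \<Rightarrow> 'g \<Rightarrow> ('v \<Rightarrow> 'v) \<Rightarrow> ('v \<Rightarrow> 'v) \<Rightarrow> bool" where
  "twist c g \<theta> z \<longleftrightarrow> riso W (\<rho> g ` W) \<theta> \<and>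
     (\<forall>w\<in>W. \<rho> g (c (\<rho> (inv g) (\<theta> w))) = \<theta> (c w) + \<theta> (z w))"

text \<open>The transported map satisfies the same quadratic equation as c, whose only roots in
  \<open>EE\<close> are c and c + 1.\<close>

lemma twist_exists:
  assumes c: "c \<in> EE" "c \<circ> c = c + EI" and g: "g \<in> carrier S"
  shows "\<exists>\<theta>. twist c g \<theta> 0 \<or> twist c g \<theta> EI"
proof -
  have sg: "simple (\<rho> g ` W)" by (rule simple_rho[OF g W_simple])
  obtain \<theta> where th: "riso W (\<rho> g ` W) \<theta>" using simple_iso[OF sg W_simple] unfolding iso_mod_def by blast
  note thi = riso_inv[OF th W_sub]
  let ?t = "inv_into W \<theta>"
  have th': "rhom W \<theta>" "inj_on \<theta> W" "\<theta> ` W = \<rho> g ` W" using th unfolding riso_def bij_betw_def by auto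
  have ti': "rhom (\<rho> g ` W) ?t" using thi unfolding riso_def by auto
  have tiW: "?t x \<in> W" if "x \<in> \<rho> g ` W" for x using that th'(3) by (metis inv_into_into)
  have tit: "\<theta> (?t x) = x" if "x \<in> \<rho> g ` W" for x using that th'(3) by (metis f_inv_into_f)
  let ?C = "\<lambda>x. \<rho> g (c (\<rho> (inv g) x))"
  have C: "rhom (\<rho> g ` W) ?C" by (rule rhom_rho[OF g W_sub EE_D(1)[OF c(1)]])
  have Cim: "?C x \<in> \<rho> g ` W" for x using EE_D(8)[OF c(1)] by blast
  have r1: "rhom W (\<lambda>w. ?C (\<theta> w))" by (rule rhom_comp[OF th'(1) C]) (use th'(3) in simp)
  have r2: "rhom W (\<lambda>w. ?t (?C (\<theta> w)))" by (rule rhom_comp[OF r1 ti']) (use Cim in blast)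
  define d where "d x = (if x \<in> W then ?t (?C (\<theta> x)) else 0)" for x
  have d: "d \<in> EE" unfolding d_def[abs_def] by (rule EE_I[OF r2]) (rule tiW, rule Cim)
  have thd: "\<theta> (d w) = ?C (\<theta> w)" if "w \<in> W" for w using that tit Cim unfolding d_def by simp
  have thW: "\<theta> w \<in> \<rho> g ` W" if "w \<in> W" for w using that th'(3) by blast
  have giW: "\<rho> (inv g) x \<in> W" if "x \<in> \<rho> g ` W" for x using that rho_inv(1)[OF g] W_V by auto
  have cc: "c (c x) = c x + x" if "x \<in> W" for x
    using c(2) that unfolding fun_eq_iff by (simp add: EI_def)
  have "d \<circ> d = d + EI"
  proof (rule EE_eq)
    show "d \<circ> d \<in> EE" "d + EI \<in> EE" using EE_comp EE_add EI_EE d by auto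
    fix w assume w: "w \<in> W"
    have dw: "d w \<in> W" using EE_D(8)[OF d] .
    let ?y = "\<rho> (inv g) (\<theta> w)"
    have y: "?y \<in> W" using giW thW w by blast
    have "\<theta> (d (d w)) = ?C (?C (\<theta> w))" using thd[OF dw] thd[OF w] by simp
    also have "\<dots> = \<rho> g (c (c ?y))" using rho_inv(1)[OF g] W_V EE_D(8)[OF c(1)] by simp
    also have "\<dots> = \<rho> g (c ?y) + \<rho> g ?y" using cc[OF y] rho_add[OF g] W_V y EE_D(8)[OF c(1)] by simp
    also have "\<rho> g ?y = \<theta> w" using rho_inv(2)[OF g] rhomD(1)[OF th'(1) w] by simp
    also have "\<rho> g (c ?y) + \<theta> w = \<theta> (d w + w)" using thd[OF w] rhomD(2)[OF th'(1) dw w] by simp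
    finally show "(d \<circ> d) w = (d + EI) w"
      using inj_onD[OF th'(2)] EE_D(8)[OF d] W_add[OF dw w] w by (simp add: EI_def)
  qed
  then have "d = c \<or> d = c + EI" using ring.quadratic_roots[OF c d] by blast
  then show ?thesis
  proof
    assume "d = c"
    then have "twist c g \<theta> 0" unfolding twist_def using th thd rhom_zero[OF th'(1) W_subsp] by simp
    then show ?thesis by blast
  next
    assume dc: "d = c + EI"
    have "?C (\<theta> w) = \<theta> (c w) + \<theta> (EI w)" if w: "w \<in> W" for w
      using thd[OF w] dc rhomD(2)[OF th'(1) EE_D(8)[OF c(1), of w] EE_D(8)[OF EI_EE, of w]] by simp
    then have "twist c g \<theta> EI" unfolding twist_def using th by blast
    then show ?thesis by blast
  qed
qed

text \<open>The types add as in a group of order 2: each is 0 or the identity, so it passes through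
  every identification unchanged.\<close>

lemma twist_mult:
  assumes c: "c \<in> EE" and g: "g \<in> carrier S" and h: "h \<in> carrier S"
    and tg: "twist c g \<theta> z" and th: "twist c h \<eta> z'" and z: "z = 0 \<or> z = EI" "z' = 0 \<or> z' = EI"
  shows "twist c (g \<otimes> h) (\<lambda>w. \<rho> g (\<eta> (\<rho> (inv g) (\<theta> w)))) (z + z')"
proof -
  have ig: "riso W (\<rho> g ` W) \<theta>" and ih: "riso W (\<rho> h ` W) \<eta>" using tg th unfolding twist_def by auto
  then have hg: "rhom W \<theta>" "\<theta> ` W = \<rho> g ` W" and hh: "rhom W \<eta>" "\<eta> ` W = \<rho> h ` W"
    unfolding riso_def bij_betw_def by auto
  have WV: "W \<subseteq> V" using W_V by blast
  have hWV: "\<rho> h ` W \<subseteq> V" using rho_closed h W_V by blast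
  have "riso (\<rho> g ` W) (\<rho> g ` \<rho> h ` W) (\<lambda>x. \<rho> g (\<eta> (\<rho> (inv g) x)))"
    by (rule riso_rho[OF g W_sub ih hWV])
  then have iso: "riso W (\<rho> (g \<otimes> h) ` W) (\<lambda>w. \<rho> g (\<eta> (\<rho> (inv g) (\<theta> w))))"
    using riso_comp[OF ig] rho_mult_image[OF g h WV] by simp
  let ?T = "\<lambda>w. \<rho> g (\<eta> (\<rho> (inv g) (\<theta> w)))"
  have zW: "z w \<in> W" "z' w \<in> W" for w using z W_0 by (auto simp: EI_def)
  have thW: "\<theta> w \<in> \<rho> g ` W" if "w \<in> W" for w using that hg(2) by blast
  have giW: "\<rho> (inv g) x \<in> W" if "x \<in> \<rho> g ` W" for x using that rho_inv(1)[OF g] W_V by auto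
  have "\<rho> (g \<otimes> h) (c (\<rho> (inv (g \<otimes> h)) (?T w))) = ?T (c w) + ?T ((z + z') w)" if w: "w \<in> W" for w
  proof -
    let ?y = "\<rho> (inv g) (\<theta> w)"
    have y: "?y \<in> W" using giW thW w by blast
    have hy: "\<eta> ?y \<in> V" using rhomD(1)[OF hh(1) y] .
    have hihy: "\<rho> (inv h) (\<eta> ?y) \<in> V" using rho_closed[OF inv_closed[OF h] hy] .
    have "\<rho> (inv (g \<otimes> h)) (?T w) = \<rho> (inv h) (\<rho> (inv g) (?T w))"
      using g h rho_closed[OF g hy] by (simp add: inv_mult_group rho_mult)
    then have "\<rho> (g \<otimes> h) (c (\<rho> (inv (g \<otimes> h)) (?T w))) = \<rho> g (\<rho> h (c (\<rho> (inv h) (\<eta> ?y))))"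
      using rho_inv(1)[OF g hy] rho_mult[OF g h W_V[OF EE_D(8)[OF c]]] by simp
    also have "\<rho> h (c (\<rho> (inv h) (\<eta> ?y))) = \<eta> (c ?y) + \<eta> (z' ?y)" using th y unfolding twist_def by blast
    also have "c ?y = \<rho> (inv g) (\<rho> g (c ?y))" using rho_inv(1)[OF g W_V[OF EE_D(8)[OF c]]] by simp
    also have "\<rho> g (c ?y) = \<theta> (c w) + \<theta> (z w)" using tg w unfolding twist_def by blast
    also have "\<rho> (inv g) (\<theta> (c w) + \<theta> (z w)) = \<rho> (inv g) (\<theta> (c w)) + \<rho> (inv g) (\<theta> (z w))"
      using rho_add[OF inv_closed[OF g]] rhomD(1)[OF hg(1)] zW EE_D(8)[OF c] by simp
    also have "\<eta> \<dots> = \<eta> (\<rho> (inv g) (\<theta> (c w))) + \<eta> (\<rho> (inv g) (\<theta> (z w)))"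
      using rhomD(2)[OF hh(1)] giW thW zW EE_D(8)[OF c] by simp
    also have "z' ?y = \<rho> (inv g) (\<theta> (z' w))"
      using z(2) y w rho_zero[OF inv_closed[OF g]] rhom_zero[OF hg(1) W_subsp] by (auto simp: EI_def)
    also have "\<rho> g (\<eta> (\<rho> (inv g) (\<theta> (c w))) + \<eta> (\<rho> (inv g) (\<theta> (z w))) + \<eta> (\<rho> (inv g) (\<theta> (z' w)))) = ?T (c w) + (?T (z w) + ?T (z' w))"
      using rho_add[OF g] Vadd rhomD(1)[OF hh(1)] giW thW zW EE_D(8)[OF c] by (simp add: add.assoc)
    also have "?T (z w) + ?T (z' w) = ?T (z w + z' w)"
      using rhomD(2)[OF conjunct1[OF iso[unfolded riso_def]] zW[of w]] by simp
    finally show ?thesis by simp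
  qed
  then show ?thesis unfolding twist_def using iso by blast
qed

text \<open>Otherwise EE contains an element c of the field with four elements; the elements of S that can be
  matched with c (and not with its conjugate c + 1) form a subgroup of index at most 2, hence all of S.\<close>

lemma EE_trivial: "EE = {0, EI}"
proof (rule ccontr)
  assume "EE \<noteq> {0, EI}"
  then obtain c where c: "c \<in> EE" "c \<circ> c = c + EI" using ring.quadratic by blast
  define M where "M = {g \<in> carrier S. \<exists>\<theta>. twist c g \<theta> 0}"
  have WV: "W \<subseteq> V" using W_V by blast
  have zz: "(0::'v \<Rightarrow> 'v) + 0 = 0" by simp
  have mult: "g \<otimes> h \<in> M" if "g \<in> M" "h \<in> M" for g h
    using that twist_mult[OF c(1), of g h _ 0 _ 0] unfolding M_def by fastforce
  have "twist c \<one> (\<lambda>x. x) 0" unfolding twist_def riso_def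
  proof (intro conjI ballI)
    show "rhom W (\<lambda>x. x)" by (rule rhom_id[OF W_sub])
    have "\<rho> \<one> ` W = W" using rho_one WV by force
    then show "bij_betw (\<lambda>x. x) W (\<rho> \<one> ` W)" by (simp add: bij_betw_def)
    show "\<rho> \<one> (c (\<rho> (inv \<one>) w)) = c w + 0 w" if "w \<in> W" for w
      using rho_one W_V that EE_D(8)[OF c(1)] by simp
  qed
  then have one: "\<one> \<in> M" unfolding M_def by blast
  have MS: "M \<subseteq> carrier S" unfolding M_def by blast
  have finM: "finite M" using MS finS finite_subset by blast
  have M: "subgroup M S"
  proof (rule subgroupI[OF MS])
    show "M \<noteq> {}" using one by blast
    show "g \<otimes> h \<in> M" if "g \<in> M" "h \<in> M" for g h using mult that .
    show "inv g \<in> M" if g: "g \<in> M" for g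
    proof -
      have gS: "g \<in> carrier S" using g MS by blast
      have "inj_on (\<lambda>x. g \<otimes> x) M" using gS MS by (auto simp: inj_on_def subset_iff)
      moreover have "(\<lambda>x. g \<otimes> x) ` M \<subseteq> M" using mult g by blast
      ultimately have "(\<lambda>x. g \<otimes> x) ` M = M" using endo_inj_surj[OF finM] by blast
      then obtain x where "x \<in> M" "g \<otimes> x = \<one>" using one by (metis (no_types, lifting) imageE)
      then have "inv g = x" using gS MS by (metis inv_equality inv_inv m_closed subsetD inv_comm)
      then show ?thesis using \<open>x \<in> M\<close> by simp
    qed
  qed
  have "card (carrier S) \<le> 2 * card M"
  proof (cases "M = carrier S")
    case False
    then obtain g where g: "g \<in> carrier S" "g \<notin> M" using MS by blast
    have tg: "\<exists>\<theta>. twist c x \<theta> EI" if "x \<in> carrier S - M" for x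
      using twist_exists[OF c, of x] that unfolding M_def by blast
    \<comment> \<open>The product of two elements of type \<open>EI\<close> has type
      \<open>EI\<close> + \<open>EI\<close> = 0.\<close>
    have "(\<lambda>x. g \<otimes> x) ` (carrier S - M) \<subseteq> M"
    proof clarify
      fix x assume x: "x \<in> carrier S" "x \<notin> M"
      obtain \<theta> \<eta> where "twist c g \<theta> EI" "twist c x \<eta> EI" using tg g x by blast
      from twist_mult[OF c(1) g(1) x(1) this] have "\<exists>\<theta>. twist c (g \<otimes> x) \<theta> (EI + EI)" by blast
      then show "g \<otimes> x \<in> M" unfolding M_def using g(1) x(1) by (simp add: fun_char2)
    qed
    moreover have "inj_on (\<lambda>x. g \<otimes> x) (carrier S - M)" using g(1) by (auto simp: inj_on_def)
    ultimately have "card (carrier S - M) \<le> card M" using card_inj_on_le finM by blast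
    then show ?thesis using card_Diff_subset[OF finM MS] by simp
  qed simp
  also have "\<dots> \<le> n * card M" using n2 by simp
  finally have MS': "M = carrier S" by (rule large_subgroup[OF M])
  \<comment> \<open>For u in U the matching map \<theta> is an automorphism of W, so it commutes
    with c, and the matching condition becomes u c u^-1 = c. But the only U-fixed elements are 0 and
    1.\<close>
  have "Ea u c = c" if u: "u \<in> U" for u
  proof (rule EE_eq[OF Ea_EE[OF u c(1)] c(1)])
    fix x assume x: "x \<in> W"
    obtain \<theta> where th: "twist c u \<theta> 0" using MS' U_carrier[OF u] unfolding M_def by blast
    then have r: "rhom W \<theta>" "\<theta> ` W = W" using U_W[OF u] unfolding twist_def riso_def bij_betw_def by auto
    let ?t = "\<lambda>x. if x \<in> W then \<theta> x else 0"
    have t: "?t \<in> EE" by (rule EE_I[OF r(1)]) (use r(2) in blast)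
    obtain w where w: "w \<in> W" "x = \<theta> w" using r(2) x by blast
    have "\<rho> u (c (\<rho> (inv u) (\<theta> w))) = \<theta> (c w)"
      using th w rhom_zero[OF r(1) W_subsp] unfolding twist_def by simp
    also have "\<dots> = (?t \<circ> c) w" using EE_D(8)[OF c(1)] by simp
    also have "\<dots> = (c \<circ> ?t) w" using ring.commute[OF t c(1)] by simp
    also have "\<dots> = c x" using w by simp
    finally show "Ea u c x = c x" using w x by (simp add: Ea_def)
  qed
  then have "c = 0 \<or> c = EI" using ring.fixed[OF c(1)] by blast
  then show False
  proof
    assume "c = 0" then show False using c(2) EI_nz by (simp add: fun_eq_iff)
  next
    assume "c = EI" then have "EI = EI + EI" using c(2) ring.oner[OF EI_EE] by simp
    then show False using EI_nz by simp
  qed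
qed

lemma end_W: assumes "rhom W f" "f ` W \<subseteq> W" shows "(\<forall>w\<in>W. f w = 0) \<or> (\<forall>w\<in>W. f w = w)"
proof -
  have "(\<lambda>x. if x \<in> W then f x else 0) \<in> EE" by (rule EE_I[OF assms(1)]) (use assms(2) in blast)
  then show ?thesis unfolding EE_trivial by (auto simp: fun_eq_iff EI_def) (metis+)
qed

text \<open>Two isomorphisms differ by an automorphism of W, which is the identity by
  \<open>end_W\<close>. This makes the identifications of W with its translates canonical.\<close>

lemma iso_unique: assumes "riso W A \<theta>" "riso W A \<eta>" "w \<in> W" shows "\<theta> w = \<eta> w"
proof -
  have t: "rhom W \<theta>" "inj_on \<theta> W" "\<theta> ` W = A" and h: "rhom W \<eta>" "inj_on \<eta> W" "\<eta> ` W = A"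
    using assms unfolding riso_def bij_betw_def by auto
  have i: "rhom A (inv_into W \<theta>)" "inv_into W \<theta> ` A = W" using riso_inv[OF assms(1) W_sub] unfolding riso_def bij_betw_def by auto
  have "rhom W (\<lambda>x. inv_into W \<theta> (\<eta> x))" by (rule rhom_comp[OF h(1) i(1)]) (use h in simp)
  moreover have im: "(\<lambda>x. inv_into W \<theta> (\<eta> x)) ` W = W" using i(2) h(3) by (metis image_image)
  ultimately have "(\<forall>w\<in>W. inv_into W \<theta> (\<eta> w) = 0) \<or> (\<forall>w\<in>W. inv_into W \<theta> (\<eta> w) = w)" by (intro end_W) auto
  moreover have "\<not> (\<forall>w\<in>W. inv_into W \<theta> (\<eta> w) = 0)"
  proof
    assume "\<forall>w\<in>W. inv_into W \<theta> (\<eta> w) = 0"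
    then have "(\<lambda>x. inv_into W \<theta> (\<eta> x)) ` W \<subseteq> {0}" by blast
    then show False using im v0_W v0(2) by blast
  qed
  ultimately have "inv_into W \<theta> (\<eta> w) = w" using assms(3) by blast
  moreover have "\<eta> w \<in> \<theta> ` W" using t(3) h(3) assms(3) by blast
  ultimately show ?thesis by (metis f_inv_into_f)
qed

end

section \<open>Annihilators and density\<close>

context stable_algebra
begin

text \<open>A maximal proper subspace has index 2 over F_2, so its complement in D is a single
  coset.\<close>

lemma subsp_split: assumes "subsp D" "D \<noteq> {0}"
  shows "\<exists>D' y. subsp D' \<and> D' \<subset> D \<and> y \<in> D - D' \<and> D = D' \<union> (+) y ` D'"
proof -
  note D = subspD[OF assms(1)]
  let ?P = "{A. subsp A \<and> A \<subset> D}"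
  have "{0} \<in> ?P" using D(1) assms(2) V0 unfolding subsp_def by auto
  then have ne: "?P \<noteq> {}" by blast
  have fin: "finite ?P" by (rule finite_subset[of _ "Pow D"]) (use D(4) in auto)
  obtain A where A0: "A \<in> ?P" "\<forall>b\<in>?P. A \<subseteq> b \<longrightarrow> A = b" using finite_has_maximal[OF fin ne] by blast
  have A: "subsp A" "A \<subset> D" using A0(1) by simp_all
  have Amax: "A = A'" if "subsp A'" "A' \<subset> D" "A \<subseteq> A'" for A' using A0(2) that by simp
  note A' = subspD[OF A(1)]
  obtain y where y: "y \<in> D" "y \<notin> A" using A(2) by blast
  let ?A = "A \<union> (+) y ` A"
  have sub: "?A \<subseteq> D" using A(2) y D(3) by blast
  have e1: "(y + a) + (y + b) = a + b" for a b by (simp add: add.assoc add.left_commute)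
  have e2: "a + (y + b) = y + (a + b)" "(y + a) + b = y + (a + b)" for a b by (simp_all add: ac_simps)
  have "subsp ?A" unfolding subsp_def
  proof (intro conjI ballI)
    show "0 \<in> ?A" using A'(1) by blast
    show "?A \<subseteq> V" using sub D(2) by blast
    show "p + r \<in> ?A" if pr: "p \<in> ?A" "r \<in> ?A" for p r
    proof -
      consider "p \<in> A" "r \<in> A" | b where "p \<in> A" "r = y + b" "b \<in> A" | a where "p = y + a" "a \<in> A" "r \<in> A"
        | a b where "p = y + a" "a \<in> A" "r = y + b" "b \<in> A" using pr by blast
      then show ?thesis
      proof cases
        case 1 then show ?thesis using A'(3) by blast
      next
        case 2 then show ?thesis using A'(3)[of p b] e2(1)[of p b] by blast
      next
        case 3 then show ?thesis using A'(3)[of a r] e2(2)[of a r] by blast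
      next
        case 4
        then have pr: "p + r = a + b" by (simp only: e1)
        show ?thesis unfolding pr using A'(3)[OF 4(2) 4(4)] by blast
      qed
    qed
  qed
  moreover have "?A \<noteq> A"
  proof
    assume "?A = A"
    moreover have "y + 0 \<in> ?A" using A'(1) by blast
    ultimately show False using y(2) by simp
  qed
  ultimately have "\<not> ?A \<subset> D" using Amax[of ?A] by blast
  then have "?A = D" using sub by blast
  then show ?thesis using A(1,2) y by (intro exI[of _ A] exI[of _ y]) auto
qed

definition Ann :: "'v set \<Rightarrow> 'r set" where
  "Ann D = {r\<in>R. \<forall>d\<in>D. r \<star> d = 0}"

lemma Ann_plus: assumes "r \<in> Ann D" "s \<in> Ann D" "D \<subseteq> V" shows "\<exists>t\<in>Ann D. \<forall>v\<in>V. t \<star> v = r \<star> v + s \<star> v"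
proof -
  obtain t where t: "t \<in> R" "\<forall>v\<in>V. t \<star> v = r \<star> v + s \<star> v" using R_plus assms unfolding Ann_def by blast
  then have "t \<in> Ann D" using assms unfolding Ann_def by auto
  then show ?thesis using t by blast
qed

lemma R_null: "\<exists>z\<in>R. \<forall>v\<in>V. z \<star> v = 0"
proof -
  obtain j where "j \<in> R" using R_one by blast
  then obtain t where "t \<in> R" "\<forall>v\<in>V. t \<star> v = j \<star> v + j \<star> v" using R_plus by blast
  then show ?thesis using char2 by auto
qed

lemma Ann_orbit_rsub: assumes "D \<subseteq> V" "x \<in> V" shows "rsub {r \<star> x | r. r \<in> Ann D}"
  unfolding rsub_def subsp_def
proof (intro conjI ballI)
  obtain z where z: "z \<in> R" "\<forall>v\<in>V. z \<star> v = 0" using R_null by blast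
  then have "z \<in> Ann D" using assms unfolding Ann_def by auto
  then show "0 \<in> {r \<star> x | r. r \<in> Ann D}" using z assms by force
  show "{r \<star> x | r. r \<in> Ann D} \<subseteq> V" using R_closed assms unfolding Ann_def by auto
  show "p + s \<in> {r \<star> x | r. r \<in> Ann D}" if ps: "p \<in> {r \<star> x | r. r \<in> Ann D}" "s \<in> {r \<star> x | r. r \<in> Ann D}" for p s
  proof -
    obtain r1 r2 where r: "r1 \<in> Ann D" "p = r1 \<star> x" "r2 \<in> Ann D" "s = r2 \<star> x" using ps by blast
    then obtain t where "t \<in> Ann D" "\<forall>v\<in>V. t \<star> v = r1 \<star> v + r2 \<star> v" using Ann_plus assms(1) by blast
    then show ?thesis using r assms(2) by force
  qed
  show "r \<star> p \<in> {r \<star> x | r. r \<in> Ann D}" if rp: "r \<in> R" "p \<in> {r \<star> x | r. r \<in> Ann D}" for r p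
  proof -
    obtain r1 where r: "r1 \<in> Ann D" "p = r1 \<star> x" using rp by blast
    then obtain t where t: "t \<in> R" "\<forall>v\<in>V. t \<star> v = r \<star> r1 \<star> v" using R_comp[of r r1] rp(1) unfolding Ann_def by blast
    then have "t \<in> Ann D" using r assms rp(1) R_zero unfolding Ann_def by auto
    then show ?thesis using t r assms(2) by force
  qed
qed

text \<open>Jacobson's argument. Let D be spanned by D' and y, and suppose Ann(D) x = 0. Then
  sending r y to r x, for r in Ann(D'), is a well-defined endomorphism of V, because Ann(D') y = V.
  If it is 0, the induction hypothesis for x is contradicted; if it is the identity, the one for x +
  y, which also lies outside D'.\<close>

lemma density_step:
  assumes simp: "simple V" and endo: "\<And>f. rhom V f \<Longrightarrow> (\<forall>v\<in>V. f v = 0) \<or> (\<forall>v\<in>V. f v = v)"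
    and "subsp D" "x \<in> V" "x \<notin> D"
  shows "{r \<star> x | r. r \<in> Ann D} = V"
  using assms(3-5)
proof (induction "card D" arbitrary: D x rule: less_induct)
  case less
  note D = subspD[OF less.prems(1)]
  have DV: "D \<subseteq> V" using D(2) by blast
  have "{r \<star> x | r. r \<in> Ann D} \<noteq> {0}"
  proof
    assume I0: "{r \<star> x | r. r \<in> Ann D} = {0}"
    show False
    proof (cases "D = {0}")
      case True
      obtain j where j: "j \<in> R" "\<forall>v\<in>V. j \<star> v = v" using R_one by blast
      then have "j \<in> Ann D" using True V0 unfolding Ann_def by auto
      then have "x \<in> {r \<star> x | r. r \<in> Ann D}" using j less.prems(2) by force
      then show False using I0 less.prems(3) True by blast
    next
      case False
      obtain D' y where D': "subsp D'" "D' \<subset> D" "y \<in> D - D'" "D = D' \<union> (+) y ` D'"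
        using subsp_split[OF less.prems(1) False] by blast
      have c: "card D' < card D" using psubset_card_mono D'(2) D(4) by blast
      have yV: "y \<in> V" using D'(3) D(2) by blast
      have D'V: "D' \<subseteq> V" using D'(2) DV by blast
      have Iy: "{r \<star> y | r. r \<in> Ann D'} = V" using less.hyps[OF c D'(1) yV] D'(3) by blast
      \<comment> \<open>If r and s agree on y, then r + s kills D' and y, hence D, and therefore
        x.\<close>
      have wd: "r \<star> x = s \<star> x" if rs: "r \<in> Ann D'" "s \<in> Ann D'" "r \<star> y = s \<star> y" for r s
      proof -
        obtain t where t: "t \<in> Ann D'" "\<forall>v\<in>V. t \<star> v = r \<star> v + s \<star> v" using Ann_plus[OF rs(1,2) D'V] by blast
        have ty: "t \<star> y = 0" using t(2) yV rs(3) char2 by simp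
        have "t \<star> (y + d) = 0" if "d \<in> D'" for d
          using R_add[of t y d] t(1) ty that yV D'V unfolding Ann_def by auto
        then have "t \<in> Ann D" using t(1) D'(4) unfolding Ann_def by auto
        then have "t \<star> x = 0" using I0 by blast
        then show ?thesis using t(2) less.prems(2) by (simp add: add_eq_0_iff2)
      qed
      define f where "f v = (SOME r. r \<in> Ann D' \<and> r \<star> y = v) \<star> x" for v
      have f: "f (r \<star> y) = r \<star> x" if r: "r \<in> Ann D'" for r
      proof -
        let ?s = "SOME s. s \<in> Ann D' \<and> s \<star> y = r \<star> y"
        have "?s \<in> Ann D' \<and> ?s \<star> y = r \<star> y" by (rule someI[of _ r]) (use r in simp)
        then show ?thesis unfolding f_def using wd r by blast
      qed
      have ex: "\<exists>r\<in>Ann D'. v = r \<star> y" if "v \<in> V" for v using that Iy by blast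
      have "rhom V f" unfolding rhom_def
      proof (intro conjI ballI)
        show "f v \<in> V" if v: "v \<in> V" for v
        proof -
          obtain r where "r \<in> Ann D'" "v = r \<star> y" using ex[OF v] by blast
          then show ?thesis using f R_closed less.prems(2) unfolding Ann_def by auto
        qed
        show "f (v + w) = f v + f w" if v: "v \<in> V" "w \<in> V" for v w
        proof -
          obtain r s where r: "r \<in> Ann D'" "v = r \<star> y" "s \<in> Ann D'" "w = s \<star> y" using ex v by blast
          then obtain t where t: "t \<in> Ann D'" "\<forall>v\<in>V. t \<star> v = r \<star> v + s \<star> v" using Ann_plus D'V by blast
          then have "v + w = t \<star> y" using r yV by simp
          then show ?thesis using f r t less.prems(2) by simp
        qed
        show "f (r \<star> v) = r \<star> f v" if v: "r \<in> R" "v \<in> V" for r v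
        proof -
          obtain s where s: "s \<in> Ann D'" "v = s \<star> y" using ex v by blast
          then obtain t where t: "t \<in> R" "\<forall>v\<in>V. t \<star> v = r \<star> s \<star> v" using R_comp[of r s] v(1) unfolding Ann_def by blast
          then have "t \<in> Ann D'" using s(1) D'V v(1) R_zero unfolding Ann_def by auto
          moreover have "r \<star> v = t \<star> y" using s t yV by simp
          ultimately show ?thesis using f s t less.prems(2) by simp
        qed
      qed
      then have "(\<forall>v\<in>V. f v = 0) \<or> (\<forall>v\<in>V. f v = v)" by (rule endo)
      then show False
      proof
        assume f0: "\<forall>v\<in>V. f v = 0"
        have "r \<star> x = 0" if "r \<in> Ann D'" for r
        proof -
          have "r \<star> y \<in> V" using Iy that by blast
          then show ?thesis using f[OF that] f0 by simp
        qed
        then have "{r \<star> x | r. r \<in> Ann D'} \<subseteq> {0}" by auto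
        moreover have "{r \<star> x | r. r \<in> Ann D'} = V" using less.hyps[OF c D'(1) less.prems(2)] D'(2) less.prems(3) by blast
        ultimately show False using simpleD(3)[OF simp] V0 by blast
      next
        assume fv: "\<forall>v\<in>V. f v = v"
        have "r \<star> (x + y) = 0" if r: "r \<in> Ann D'" for r
        proof -
          have "r \<star> y \<in> V" using r R_closed yV unfolding Ann_def by blast
          then have "r \<star> x = r \<star> y" using fv f[OF r] by simp
          then show ?thesis using R_add[of r x y] r less.prems(2) yV char2 unfolding Ann_def by simp
        qed
        then have "{r \<star> (x + y) | r. r \<in> Ann D'} \<subseteq> {0}" by auto
        moreover have "x + y \<notin> D'"
        proof
          assume "x + y \<in> D'"
          then have "y + (x + y) \<in> D" using D'(4) by blast
          then show False using less.prems(3) char2[of y] by (simp add: add.left_commute)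
        qed
        then have "{r \<star> (x + y) | r. r \<in> Ann D'} = V" using less.hyps[OF c D'(1) Vadd[OF less.prems(2) yV]] by blast
        ultimately show False using simpleD(3)[OF simp] V0 by blast
      qed
    qed
  qed
  then show ?case using simpleD(4)[OF simp Ann_orbit_rsub[OF DV less.prems(2)]] rsub_subset[OF Ann_orbit_rsub[OF DV less.prems(2)]] by blast
qed

text \<open>Interpolation one dimension at a time: an element that is right on D' is corrected at y
  by an element of Ann(D'), which can take any value there by \<open>density_step\<close>.\<close>

lemma density:
  assumes simp: "simple V" and endo: "\<And>f. rhom V f \<Longrightarrow> (\<forall>v\<in>V. f v = 0) \<or> (\<forall>v\<in>V. f v = v)"
    and f: "\<And>x. x \<in> V \<Longrightarrow> f x \<in> V" "\<And>x y. x \<in> V \<Longrightarrow> y \<in> V \<Longrightarrow> f (x + y) = f x + f y"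
  shows "\<exists>r\<in>R. \<forall>v\<in>V. r \<star> v = f v"
proof -
  have f0: "f 0 = 0" using f(2)[of 0 0] V0 by simp
  have "\<exists>r\<in>R. \<forall>v\<in>D. r \<star> v = f v" if "subsp D" for D
    using that
  proof (induction "card D" arbitrary: D rule: less_induct)
    case less
    note D = subspD[OF less.prems(1)]
    show ?case
    proof (cases "D = {0}")
      case True
      obtain z where "z \<in> R" "\<forall>v\<in>V. z \<star> v = 0" using R_null by blast
      then show ?thesis using True f0 V0 by auto
    next
      case False
      obtain D' y where D': "subsp D'" "D' \<subset> D" "y \<in> D - D'" "D = D' \<union> (+) y ` D'"
        using subsp_split[OF less.prems(1) False] by blast
      have c: "card D' < card D" using psubset_card_mono D'(2) D(4) by blast
      have yV: "y \<in> V" using D'(3) D(2) by blast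
      have D'V: "x \<in> V" if "x \<in> D'" for x using that subspD(2)[OF D'(1)] by blast
      obtain r where r: "r \<in> R" "\<forall>v\<in>D'. r \<star> v = f v" using less.hyps[OF c D'(1)] by blast
      have "{s \<star> y | s. s \<in> Ann D'} = V" by (rule density_step[OF simp endo D'(1) yV]) (use D'(3) in auto)
      moreover have "f y + r \<star> y \<in> V" using f(1) yV r(1) R_closed Vadd by simp
      ultimately obtain s where s: "s \<in> Ann D'" "f y + r \<star> y = s \<star> y" by blast
      then have sR: "s \<in> R" "\<And>d. d \<in> D' \<Longrightarrow> s \<star> d = 0" unfolding Ann_def by auto
      obtain t where t: "t \<in> R" "\<forall>v\<in>V. t \<star> v = r \<star> v + s \<star> v" using R_plus[OF r(1) sR(1)] by blast
      have t1: "t \<star> d = f d" if "d \<in> D'" for d using t(2) D'V[OF that] r(2) sR(2) that by simp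
      have "t \<star> y = r \<star> y + (f y + r \<star> y)" using t(2) yV s(2) by simp
      then have t2: "t \<star> y = f y" by (simp add: add.commute[of "f y"])
      have "t \<star> (y + d) = f (y + d)" if d: "d \<in> D'" for d
        using R_add[OF t(1) yV D'V[OF d]] f(2)[OF yV D'V[OF d]] t1[OF d] t2 by simp
      then have "\<forall>v\<in>D. t \<star> v = f v" using t1 D'(4) by auto
      then show ?thesis using t(1) by blast
    qed
  qed
  then show ?thesis using rsubD(1)[OF rsub_V] by blast
qed

end

section \<open>Functions with values in F_2\<close>

declare add_bit_eq_xor [simp del] mult_bit_eq_and [simp del]

lemma bit_add_self [simp]: "(x::bit) + x = 0"
  by (cases x) simp_all

lemma bit_add_eq_0: "(x::bit) + y = 0 \<longleftrightarrow> x = y"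
  by (cases x; cases y) simp_all

lemma bit_fun_add_self: "(f :: 'b \<Rightarrow> bit) + f = 0"
  by (simp add: fun_eq_iff)

lemma sum_fun_apply: "(\<Sum>b\<in>A. f b) x = (\<Sum>b\<in>A. f b x)" for f :: "'a \<Rightarrow> 'b \<Rightarrow> 'c::comm_monoid_add"
  by (induction A rule: infinite_finite_induct) simp_all

text \<open>Scalar multiplication over F_2 as a case distinction, so that it commutes with every map
  sending 0 to 0.\<close>

definition bsm :: "bit \<Rightarrow> ('b \<Rightarrow> bit) \<Rightarrow> 'b \<Rightarrow> bit" where
  "bsm c v = (if c = 1 then v else 0)"

lemma bsm_simps: "bsm 0 v = 0" "bsm 1 v = v" "bsm c 0 = 0"
  by (simp_all add: bsm_def)

lemma bsm_apply: "bsm c v x = c * v x"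
  by (cases c) (simp_all add: bsm_def)

lemma bsm_add: "bsm c (v + w) = bsm c v + bsm c w" "bsm (c + d) v = bsm c v + bsm d v"
  by (cases c; cases d; simp add: bsm_def bit_fun_add_self)+

section \<open>The permutation module of a 2-transitive group\<close>

text \<open>The intended values are n = q^3 and e = 3 m, with U the unipotent subgroup fixing
  \<open>b0\<close>. Transitivity of U off \<open>b0\<close> and of S on B makes the action
  2-transitive; n is at once the dimension of Q_B and the index bound in
  \<open>large_subgroup\<close>.\<close>

locale two_transitive = group S for S :: "('g, 'x) monoid_scheme" (structure) +
  fixes B :: "'b set" and a :: "'g \<Rightarrow> 'b \<Rightarrow> 'b" and U :: "'g set" and n e :: nat and b0 :: 'b
  assumes finS: "finite (carrier S)" and acts: "acts_on S (carrier S) B a"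
    and finB: "finite B" and cardB: "card B = n + 1" and evn: "even n" and n2: "2 \<le> n"
    and U_sub: "subgroup U S" and cardU: "card U = 2 ^ e" and b0: "b0 \<in> B"
    and U_b0: "u \<in> U \<Longrightarrow> a u b0 = b0"
    and U_trans: "b \<in> B - {b0} \<Longrightarrow> c \<in> B - {b0} \<Longrightarrow> \<exists>u\<in>U. a u b = c"
    and S_trans: "b \<in> B \<Longrightarrow> \<exists>g\<in>carrier S. a g b0 = b"
    and large_subgroup: "subgroup M S \<Longrightarrow> card (carrier S) \<le> n * card M \<Longrightarrow> M = carrier S"
begin

lemma a_closed: "g \<in> carrier S \<Longrightarrow> b \<in> B \<Longrightarrow> a g b \<in> B"
  using acts unfolding acts_on_def by blast

lemma a_one: "b \<in> B \<Longrightarrow> a \<one> b = b"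
  using acts unfolding acts_on_def by blast

lemma a_mult: "g \<in> carrier S \<Longrightarrow> h \<in> carrier S \<Longrightarrow> b \<in> B \<Longrightarrow> a (g \<otimes> h) b = a g (a h b)"
  using acts unfolding acts_on_def by blast

lemma a_inv: "g \<in> carrier S \<Longrightarrow> b \<in> B \<Longrightarrow> a (inv g) (a g b) = b"
  "g \<in> carrier S \<Longrightarrow> b \<in> B \<Longrightarrow> a g (a (inv g) b) = b"
  using acts_on_inv[OF acts subgroup_self] by blast+

lemma a_bij: "g \<in> carrier S \<Longrightarrow> bij_betw (a g) B B"
  unfolding bij_betw_def using acts_on_inj[OF acts subgroup_self] acts_on_image[OF acts subgroup_self] by blast

lemma U_carrier: "u \<in> U \<Longrightarrow> u \<in> carrier S"
  using subgroup.mem_carrier[OF U_sub] .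

definition rh :: "'g \<Rightarrow> ('b \<Rightarrow> bit) \<Rightarrow> 'b \<Rightarrow> bit" where
  "rh g h b = (if b \<in> B then h (a (inv g) b) else 0)"

text \<open>The complement of the point b. It has sum 0 because n is even, whereas the point masses
  \<open>dl\<close> have sum 1 and lie outside Q_B; so the complements serve as the spanning set
  permuted by S.\<close>

definition vv :: "'b \<Rightarrow> 'b \<Rightarrow> bit" where
  "vv b x = (if x \<in> B \<and> x \<noteq> b then 1 else 0)"

definition dl :: "'b \<Rightarrow> 'b \<Rightarrow> bit" where
  "dl b x = (if x = b then 1 else 0)"

lemma QB_D: "h \<in> QB B \<Longrightarrow> x \<notin> B \<Longrightarrow> h x = 0" "h \<in> QB B \<Longrightarrow> sum h B = 0"
  unfolding QB_def by auto

lemma sum_QB: "sum (rh g h) B = sum h B" if g: "g \<in> carrier S" for g h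
proof -
  have "sum (rh g h) B = (\<Sum>b\<in>B. h (a (inv g) b))" by (simp add: rh_def)
  also have "\<dots> = sum h B" by (rule sum.reindex_bij_betw[OF a_bij[OF inv_closed[OF g]]])
  finally show ?thesis .
qed

lemma rh_QB: "g \<in> carrier S \<Longrightarrow> h \<in> QB B \<Longrightarrow> rh g h \<in> QB B"
  using sum_QB[of g h] unfolding QB_def by (auto simp: rh_def)

lemma QB_add: "h \<in> QB B \<Longrightarrow> k \<in> QB B \<Longrightarrow> h + k \<in> QB B"
  unfolding QB_def by (auto simp: sum.distrib)

lemma QB_0: "0 \<in> QB B" unfolding QB_def by auto

lemma finite_QB: "finite (QB B)"
proof -
  have "finite {f. \<forall>x. (x \<in> B \<longrightarrow> f x \<in> {0, 1::bit}) \<and> (x \<notin> B \<longrightarrow> f x = 0)}"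
    by (rule finite_set_of_finite_funs[OF finB]) simp
  moreover have "QB B \<subseteq> {f. \<forall>x. (x \<in> B \<longrightarrow> f x \<in> {0, 1::bit}) \<and> (x \<notin> B \<longrightarrow> f x = 0)}"
  proof
    fix h assume "h \<in> QB B"
    moreover have "h x \<in> {0, 1}" for x by (cases "h x") simp_all
    ultimately show "h \<in> {f. \<forall>x. (x \<in> B \<longrightarrow> f x \<in> {0, 1::bit}) \<and> (x \<notin> B \<longrightarrow> f x = 0)}" unfolding QB_def by blast
  qed
  ultimately show ?thesis using finite_subset by blast
qed

lemma sum_B: "sum (h :: 'b \<Rightarrow> bit) B = h b0 + sum h (B - {b0})"
  using sum.remove[OF finB b0] .

lemma card_B0: "card (B - {b0}) = n" using cardB finB b0 by simp

text \<open>The values off \<open>b0\<close> are free, and the value at \<open>b0\<close> is the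
  parity of their support.\<close>

lemma card_QB: "card (QB B) = 2 ^ n"
proof -
  let ?f = "\<lambda>h. {x\<in>B - {b0}. h x = (1::bit)}"
  let ?g = "\<lambda>A x. if x \<in> A then (1::bit) else if x = b0 then of_nat (card A) else 0"
  have "bij_betw ?f (QB B) (Pow (B - {b0}))"
  proof (rule bij_betw_byWitness[of _ ?g])
    show "\<forall>h\<in>QB B. ?g (?f h) = h"
    proof
      fix h assume h: "h \<in> QB B"
      have "sum h (B - {b0}) = (\<Sum>x\<in>B - {b0}. if x \<in> ?f h then 1 else 0)"
      proof (rule sum.cong[OF refl])
        fix x assume "x \<in> B - {b0}"
        then show "h x = (if x \<in> ?f h then 1 else 0)" by (cases "h x") auto
      qed
      also have "\<dots> = of_nat (card (?f h))"
      proof -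
        have "(B - {b0}) \<inter> ?f h = ?f h" by blast
        then show ?thesis using finB by (subst sum.If_cases) (simp_all add: Collect_mem_eq)
      qed
      finally have s: "h b0 = of_nat (card (?f h))" using QB_D(2)[OF h] sum_B[of h] by (simp add: bit_add_eq_0)
      show "?g (?f h) = h"
      proof
        fix x show "?g (?f h) x = h x"
        proof (cases "x = b0")
          case True then show ?thesis using s by simp
        next
          case False
          then show ?thesis using QB_D(1)[OF h, of x] by (cases "h x") auto
        qed
      qed
    qed
    show "\<forall>A\<in>Pow (B - {b0}). ?f (?g A) = A" by auto
    show "?f ` QB B \<subseteq> Pow (B - {b0})" by auto
    show "?g ` Pow (B - {b0}) \<subseteq> QB B"
    proof clarify
      fix A assume A: "A \<subseteq> B - {b0}"
      have fA: "finite A" using A finB finite_subset by blast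
      have "sum (?g A) (B - {b0}) = (\<Sum>x\<in>A. 1)"
        by (rule sum.mono_neutral_cong_right) (use A finB in auto)
      also have "\<dots> = of_nat (card A)" by simp
      finally have "sum (?g A) (B - {b0}) = of_nat (card A)" .
      moreover have "?g A b0 = of_nat (card A)" using A by auto
      ultimately have "sum (?g A) B = 0" unfolding sum_B[of "?g A"] by (simp only: bit_add_self)
      then show "?g A \<in> QB B" unfolding QB_def using A b0 by auto
    qed
  qed
  then have "card (QB B) = card (Pow (B - {b0}))" by (rule bij_betw_same_card)
  also have "\<dots> = 2 ^ n" using card_Pow[of "B - {b0}"] finB card_B0 by simp
  finally show ?thesis .
qed

lemma rh_acts: "acts_on S (carrier S) (QB B) rh"
  unfolding acts_on_def
proof (intro conjI ballI)
  show "rh g h \<in> QB B" if "g \<in> carrier S" "h \<in> QB B" for g h using rh_QB that .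
  show "rh \<one> h = h" if "h \<in> QB B" for h
    using that QB_D(1) a_one by (auto simp: rh_def fun_eq_iff)
  show "rh (g \<otimes> k) h = rh g (rh k h)" if "g \<in> carrier S" "k \<in> carrier S" "h \<in> QB B" for g k h
    using that a_mult a_closed by (auto simp: rh_def fun_eq_iff inv_mult_group)
qed

lemma rh_add: "rh g (h + k) = rh g h + rh g k"
  by (auto simp: rh_def fun_eq_iff)

lemma rh_vv: "g \<in> carrier S \<Longrightarrow> b \<in> B \<Longrightarrow> rh g (vv b) = vv (a g b)"
  using a_closed a_inv by (auto simp: rh_def vv_def fun_eq_iff)

lemma sum_vv: "b \<in> B \<Longrightarrow> sum (vv b) B = 0"
proof -
  assume b: "b \<in> B"
  have "sum (vv b) B = sum (vv b) (B - {b})" using sum.remove[OF finB b, of "vv b"] by (simp add: vv_def)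
  also have "\<dots> = (\<Sum>x\<in>B - {b}. 1)" by (rule sum.cong) (auto simp: vv_def)
  also have "\<dots> = of_nat (card (B - {b}))" by simp
  also have "card (B - {b}) = n" using cardB finB b by simp
  also have "of_nat n = (0::bit)" using evn by (metis even_of_nat_iff even_zero Z2.bit_eq_iff)
  finally show ?thesis .
qed

lemma vv_QB: "b \<in> B \<Longrightarrow> vv b \<in> QB B"
  using sum_vv unfolding QB_def by (auto simp: vv_def)

lemma vv_nz: "b \<in> B \<Longrightarrow> vv b \<noteq> 0"
proof
  assume b: "b \<in> B" and z: "vv b = 0"
  have "card (B - {b}) = n" using cardB finB b by simp
  then have "B - {b} \<noteq> {}" using n2 by (metis card.empty not_numeral_le_zero)
  then obtain x where "x \<in> B - {b}" by blast
  then have "vv b x = 1" by (simp add: vv_def)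
  then show False using z by simp
qed

text \<open>At x the right-hand side is the sum of h off x, which equals h x because the total sum
  is 0.\<close>

lemma QB_expand: "h \<in> QB B \<Longrightarrow> h = (\<Sum>b\<in>B. bsm (h b) (vv b))"
proof
  fix x assume h: "h \<in> QB B"
  show "h x = (\<Sum>b\<in>B. bsm (h b) (vv b)) x"
  proof (cases "x \<in> B")
    case False then show ?thesis using QB_D(1)[OF h] by (simp add: sum_fun_apply bsm_apply vv_def)
  next
    case True
    have "(\<Sum>b\<in>B. bsm (h b) (vv b)) x = (\<Sum>b\<in>B. h b * vv b x)" by (simp add: sum_fun_apply bsm_apply)
    also have "\<dots> = (\<Sum>b\<in>B - {x}. h b * vv b x)" using sum.remove[OF finB True, of "\<lambda>b. h b * vv b x"] by (simp add: vv_def)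
    also have "\<dots> = sum h (B - {x})" by (rule sum.cong) (use True in \<open>auto simp: vv_def\<close>)
    finally have "(\<Sum>b\<in>B. bsm (h b) (vv b)) x = sum h (B - {x})" .
    moreover have "h x + sum h (B - {x}) = 0" using sum.remove[OF finB True, of h] QB_D(2)[OF h] by simp
    ultimately show ?thesis by (simp add: bit_add_eq_0)
  qed
qed

text \<open>By transitivity of U, h is constant off \<open>b0\<close>; as n is even, these values
  sum to 0, which forces h to vanish at \<open>b0\<close>.\<close>

lemma QB_U_fixed: assumes h: "h \<in> QB B" and fx: "\<And>u. u \<in> U \<Longrightarrow> rh u h = h" shows "h = 0 \<or> h = vv b0"
proof -
  have "card (B - {b0}) = n" using cardB finB b0 by simp
  then have "B - {b0} \<noteq> {}" using n2 by (metis card.empty not_numeral_le_zero)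
  then obtain c where c: "c \<in> B - {b0}" by blast
  have const: "h x = h c" if x: "x \<in> B - {b0}" for x
  proof -
    obtain u where u: "u \<in> U" "a u c = x" using U_trans[OF c x] by blast
    have "h x = rh u h x" using fx[OF u(1)] by simp
    also have "\<dots> = h (a (inv u) x)" using x by (simp add: rh_def)
    also have "a (inv u) x = c" using u a_inv(1)[OF U_carrier[OF u(1)]] c by auto
    finally show ?thesis .
  qed
  have "sum h (B - {b0}) = (\<Sum>x\<in>B - {b0}. h c)" by (rule sum.cong) (use const in auto)
  also have "\<dots> = of_nat n * h c" using card_B0 by simp
  also have "of_nat n = (0::bit)" using evn by (metis even_of_nat_iff even_zero Z2.bit_eq_iff)
  finally have "h b0 = 0" using QB_D(2)[OF h] sum_B[of h] by simp
  then show ?thesis using const QB_D(1)[OF h] by (cases "h c") (auto simp: fun_eq_iff vv_def)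
qed

lemma dl_QB: "b \<in> B \<Longrightarrow> c \<in> B \<Longrightarrow> dl b + dl c \<in> QB B"
proof -
  assume "b \<in> B" "c \<in> B"
  then have "sum (dl b) B = 1" "sum (dl c) B = 1" using finB by (simp_all add: dl_def)
  then show ?thesis unfolding QB_def using \<open>b \<in> B\<close> \<open>c \<in> B\<close> by (auto simp: sum.distrib dl_def)
qed

end

locale perm_algebra = two_transitive S B a U n e b0
  for S :: "('g, 'x) monoid_scheme" (structure) and B :: "'b set" and a :: "'g \<Rightarrow> 'b \<Rightarrow> 'b" and U :: "'g set" and n e :: nat and b0 :: 'b +
  fixes R :: "'r set" and ap :: "'r \<Rightarrow> ('b \<Rightarrow> bit) \<Rightarrow> 'b \<Rightarrow> bit" (infixr \<open>\<star>\<close> 75)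
  assumes R_closed: "r \<in> R \<Longrightarrow> x \<in> QB B \<Longrightarrow> r \<star> x \<in> QB B"
    and R_add: "r \<in> R \<Longrightarrow> x \<in> QB B \<Longrightarrow> y \<in> QB B \<Longrightarrow> r \<star> (x + y) = r \<star> x + r \<star> y"
    and R_one: "\<exists>i\<in>R. \<forall>v\<in>QB B. i \<star> v = v"
    and R_plus: "r \<in> R \<Longrightarrow> s \<in> R \<Longrightarrow> \<exists>t\<in>R. \<forall>v\<in>QB B. t \<star> v = r \<star> v + s \<star> v"
    and R_comp: "r \<in> R \<Longrightarrow> s \<in> R \<Longrightarrow> \<exists>t\<in>R. \<forall>v\<in>QB B. t \<star> v = r \<star> s \<star> v"
    and R_conj: "g \<in> carrier S \<Longrightarrow> r \<in> R \<Longrightarrow> \<exists>t\<in>R. \<forall>v\<in>QB B. t \<star> v = rh g (r \<star> rh (inv g) v)"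
begin

sublocale stable_algebra S "QB B" rh R ap
  by unfold_locales (fact bit_fun_add_self finS finite_QB QB_0 QB_add rh_acts R_closed R_add R_one R_plus R_comp R_conj | rule rh_add)+

lemma subsp_sum: "subsp D \<Longrightarrow> (\<And>b. b \<in> A \<Longrightarrow> f b \<in> D) \<Longrightarrow> sum f A \<in> D"
  by (induction A rule: infinite_finite_induct) (auto simp: subspD)

lemma bsm_subsp: "subsp D \<Longrightarrow> v \<in> D \<Longrightarrow> bsm c v \<in> D"
  using subspD(1) by (cases c) (auto simp: bsm_simps)

text \<open>A nonzero stable subspace contains a nonzero U-fixed vector, hence \<open>vv b0\<close>,
  hence the complements of all points, and these span.\<close>

lemma irreducible: assumes "subsp D" "D \<noteq> {0}" "\<forall>g\<in>carrier S. rh g ` D \<subseteq> D" shows "D = QB B"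
proof -
  note D = subspD[OF assms(1)]
  have "acts_on S U D rh" using rh_acts D(2) assms(3) U_carrier unfolding acts_on_def by blast
  then have "\<exists>k\<in>D - {0}. \<forall>u\<in>U. rh u k + k \<in> {0}"
    by (intro fixed_coset[OF char2 U_sub cardU D(4)]) (use D assms rho_zero U_carrier rh_add in auto)
  then obtain k where k: "k \<in> D" "k \<noteq> 0" "\<And>u. u \<in> U \<Longrightarrow> rh u k = k" by (auto simp: add_eq_0_iff2)
  then have v0: "vv b0 \<in> D" using QB_U_fixed[OF D(2)[OF k(1)]] by blast
  have v: "vv b \<in> D" if b: "b \<in> B" for b
  proof -
    obtain g where g: "g \<in> carrier S" "a g b0 = b" using S_trans[OF b] by blast
    then show ?thesis using rh_vv[OF g(1) b0] v0 assms(3) by force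
  qed
  have "h \<in> D" if h: "h \<in> QB B" for h
  proof -
    have "(\<Sum>b\<in>B. bsm (h b) (vv b)) \<in> D" by (rule subsp_sum[OF assms(1)]) (rule bsm_subsp[OF assms(1) v])
    then show ?thesis using QB_expand[OF h] by simp
  qed
  then show ?thesis using D(2) by blast
qed

sublocale steinberg_like S "QB B" rh R ap n e U "vv b0"
proof unfold_locales
  show "card (QB B) = 2 ^ n" by (rule card_QB)
  show "2 \<le> n" by (rule n2)
  show "D = QB B" if "subsp D" "D \<noteq> {0}" "\<forall>g\<in>carrier S. rh g ` D \<subseteq> D" for D by (rule irreducible[OF that])
  show "M = carrier S" if "subgroup M S" "card (carrier S) \<le> n * card M" for M by (rule large_subgroup[OF that])
  show "card U = 2 ^ e" by (rule cardU)
  show "vv b0 \<in> QB B" "vv b0 \<noteq> 0" using vv_QB vv_nz b0 by auto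
  show "rh u (vv b0) = vv b0" if "u \<in> U" for u using rh_vv U_carrier U_b0 b0 that by simp
  show "v = 0 \<or> v = vv b0" if "v \<in> QB B" "\<And>u. u \<in> U \<Longrightarrow> rh u v = v" for v by (rule QB_U_fixed[OF that])
qed (simp_all add: subgroup.subset[OF U_sub] subgroup.m_closed[OF U_sub] subgroup.one_closed[OF U_sub] subgroup.m_inv_closed[OF U_sub])

text \<open>Let W_b be the submodule generated by the complement of b, and \<theta>_b the unique isomorphism from W
  to W_b. The h with \<Sum> h(b) \<theta>_b = 0 form an S-stable subspace. If it is everything, then all W_b
  coincide, W = V and density gives the full endomorphism ring; if it is 0, then counting dimensions shows
  that W is a line.\<close>

theorem scalar_or_full:
  "(\<forall>r\<in>R. (\<forall>v\<in>QB B. r \<star> v = 0) \<or> (\<forall>v\<in>QB B. r \<star> v = v)) \<or>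
   (\<forall>f. (\<forall>x\<in>QB B. f x \<in> QB B) \<and> (\<forall>x\<in>QB B. \<forall>y\<in>QB B. f (x + y) = f x + f y) \<longrightarrow> (\<exists>r\<in>R. \<forall>v\<in>QB B. r \<star> v = f v))"
proof -
  let ?V = "QB B"
  obtain W where W: "simple W" "vv b0 \<in> W" "\<forall>u\<in>U. rh u ` W = W" using stable_simple by blast
  interpret W: steinberg_simple S "QB B" rh R ap n e U "vv b0" W
    by unfold_locales (use W in auto)
  define Wb where "Wb b = {r \<star> vv b | r. r \<in> R}" for b
  have Wb_alt: "Wb b = {r \<star> vv b | r. r \<in> Ann {}}" for b unfolding Wb_def Ann_def by auto
  have Wb_rsub: "rsub (Wb b)" if "b \<in> B" for b unfolding Wb_alt by (rule Ann_orbit_rsub) (use vv_QB that in auto)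
  have vWb: "vv b \<in> Wb b" if "b \<in> B" for b using R_one vv_QB[OF that] unfolding Wb_def by force
  have WW: "W = Wb b0"
  proof -
    have "Wb b0 \<subseteq> W" unfolding Wb_def using W.W_R W(2) by blast
    moreover have "Wb b0 \<noteq> {0}" using vWb[OF b0] vv_nz[OF b0] by blast
    ultimately show ?thesis using simpleD(4)[OF W(1) Wb_rsub[OF b0]] by blast
  qed
  have rWb1: "rh g ` Wb b \<subseteq> Wb (a g b)" if g: "g \<in> carrier S" and b: "b \<in> B" for g b
  proof
    fix x assume "x \<in> rh g ` Wb b"
    then obtain r where r: "r \<in> R" "x = rh g (r \<star> vv b)" unfolding Wb_def by blast
    obtain t where t: "t \<in> R" "\<forall>v\<in>?V. t \<star> v = rh g (r \<star> rh (inv g) v)" using R_conj[OF g r(1)] by blast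
    have "rh (inv g) (vv (a g b)) = vv b" using rh_vv[OF g b] rho_inv(1)[OF g vv_QB[OF b]] by simp
    then have "t \<star> vv (a g b) = x" using t(2) vv_QB[OF a_closed[OF g b]] r(2) by simp
    then show "x \<in> Wb (a g b)" unfolding Wb_def using t(1) by blast
  qed
  have rWb: "rh g ` Wb b = Wb (a g b)" if g: "g \<in> carrier S" and b: "b \<in> B" for g b
  proof (rule subset_antisym[OF rWb1[OF g b]])
    have "rh (inv g) ` Wb (a g b) \<subseteq> Wb b" using rWb1[OF inv_closed[OF g] a_closed[OF g b]] a_inv(1)[OF g b] by simp
    then have "rh g ` rh (inv g) ` Wb (a g b) \<subseteq> rh g ` Wb b" by blast
    then show "Wb (a g b) \<subseteq> rh g ` Wb b" using rho_inv_image(2)[OF g rsub_subset[OF Wb_rsub[OF a_closed[OF g b]]]] by simp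
  qed
  \<comment> \<open>Some isomorphism is chosen for each b; \<open>iso_unique\<close> makes the
    choice immaterial, which yields the equivariance used below.\<close>
  define \<theta> where "\<theta> b = (SOME t. riso W (Wb b) t)" for b
  have th: "riso W (Wb b) (\<theta> b)" if b: "b \<in> B" for b
  proof -
    obtain g where g: "g \<in> carrier S" "a g b0 = b" using S_trans b by blast
    have "Wb b = rh g ` W" using rWb[OF g(1) b0] WW g(2) by simp
    then have "simple (Wb b)" using simple_rho[OF g(1) W(1)] by simp
    then have "iso_mod W (Wb b)" using simple_iso W(1) by blast
    then show ?thesis unfolding iso_mod_def \<theta>_def by (rule someI_ex)
  qed
  have thh: "rhom W (\<theta> b)" "\<theta> b ` W = Wb b" if "b \<in> B" for b using th[OF that] unfolding riso_def bij_betw_def by auto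
  define \<Phi> where "\<Phi> h w = (\<Sum>b\<in>B. bsm (h b) (\<theta> b w))" for h w
  have Phi_add: "\<Phi> (h + k) w = \<Phi> h w + \<Phi> k w" for h k w
    unfolding \<Phi>_def by (simp add: bsm_add sum.distrib)
  have VV: "subsp ?V" using rsubD(1)[OF rsub_V] .
  have Rsum: "r \<star> sum f A = (\<Sum>b\<in>A. r \<star> f b)" if "r \<in> R" "\<And>b. b \<in> A \<Longrightarrow> f b \<in> ?V" "finite A" for r f and A :: "'b set"
    using that(3,2)
  proof (induction A rule: finite_induct)
    case empty then show ?case using R_zero[OF that(1)] by (simp only: sum.empty)
  next
    case (insert x F)
    then have F: "sum f F \<in> ?V" using subsp_sum[OF VV, of F f] by blast
    have fx: "f x \<in> ?V" and IH: "r \<star> sum f F = (\<Sum>b\<in>F. r \<star> f b)" using insert by auto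
    show ?case by (simp only: sum.insert[OF insert(1,2)] R_add[OF that(1) fx F] IH)
  qed
  have rhsum: "rh g (sum f A) = (\<Sum>b\<in>A. rh g (f b))" if "g \<in> carrier S" "finite A" for g f and A :: "'b set"
    using that(2)
  proof (induction A rule: finite_induct)
    case empty show ?case by (simp only: sum.empty rho_zero[OF that(1)])
  next
    case (insert x F) show ?case by (simp only: sum.insert[OF insert(1,2)] rh_add insert.IH)
  qed
  have Rbsm: "r \<star> bsm c v = bsm c (r \<star> v)" if "r \<in> R" for r c v
    unfolding bsm_def using R_zero[OF that] by (simp only: if_distrib[of "(\<star>) r"])
  have rhbsm: "rh g (bsm c v) = bsm c (rh g v)" if "g \<in> carrier S" for g c v
    unfolding bsm_def using rho_zero[OF that] by (simp only: if_distrib[of "rh g"])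
  have Phi_V: "bsm (h b) (\<theta> b w) \<in> ?V" if "b \<in> B" "w \<in> W" for h b w
    by (rule bsm_subsp[OF VV rhomD(1)[OF thh(1)[OF that(1)] that(2)]])
  have Phi_hom: "rhom W (\<Phi> h)" for h
    unfolding rhom_def
  proof (intro conjI ballI)
    show "\<Phi> h x \<in> ?V" if "x \<in> W" for x unfolding \<Phi>_def by (rule subsp_sum[OF VV Phi_V[OF _ that]])
    show "\<Phi> h (x + y) = \<Phi> h x + \<Phi> h y" if "x \<in> W" "y \<in> W" for x y
    proof -
      have "\<Phi> h (x + y) = (\<Sum>b\<in>B. bsm (h b) (\<theta> b x) + bsm (h b) (\<theta> b y))" unfolding \<Phi>_def
        by (rule sum.cong[OF refl]) (simp only: rhomD(2)[OF thh(1)] that bsm_add)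
      then show ?thesis unfolding \<Phi>_def by (simp add: sum.distrib)
    qed
    show "\<Phi> h (r \<star> x) = r \<star> \<Phi> h x" if "r \<in> R" "x \<in> W" for r x
    proof -
      have "\<Phi> h (r \<star> x) = (\<Sum>b\<in>B. r \<star> bsm (h b) (\<theta> b x))" unfolding \<Phi>_def
        by (rule sum.cong[OF refl]) (simp only: rhomD(3)[OF thh(1)] that Rbsm)
      also have "\<dots> = r \<star> \<Phi> h x" unfolding \<Phi>_def by (rule Rsum[symmetric, OF that(1) Phi_V[OF _ that(2)] finB])
      finally show ?thesis .
    qed
  qed
  define K where "K = {h\<in>?V. \<forall>w\<in>W. \<Phi> h w = 0}"
  have K: "subsp K" unfolding subsp_def
  proof (intro conjI ballI)
    show "0 \<in> K" unfolding K_def \<Phi>_def using QB_0 by (simp add: bsm_simps)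
    show "K \<subseteq> ?V" unfolding K_def by blast
    show "x + y \<in> K" if "x \<in> K" "y \<in> K" for x y using that QB_add Phi_add unfolding K_def by auto
  qed
  have Kst: "rh g ` K \<subseteq> K" if g: "g \<in> carrier S" for g
  proof clarify
    fix h assume h: "h \<in> K"
    then have hV: "h \<in> ?V" and h0: "\<And>w. w \<in> W \<Longrightarrow> \<Phi> h w = 0" unfolding K_def by auto
    \<comment> \<open>Both sides are isomorphisms from W to the same submodule, hence equal. So the
      family \<theta> is equivariant up to one substitution in W that does not depend on b.\<close>
    have thg: "\<theta> (a g b) w = rh g (\<theta> b (rh (inv g) (\<theta> (a g b0) w)))" if b: "b \<in> B" and w: "w \<in> W" for b w
    proof (rule W.iso_unique[OF th[OF a_closed[OF g b]] _ w])
      have "riso (rh g ` W) (rh g ` Wb b) (\<lambda>x. rh g (\<theta> b (rh (inv g) x)))"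
        by (rule riso_rho[OF g W.W_sub th[OF b] rsub_subset[OF Wb_rsub[OF b]]])
      then have "riso (Wb (a g b0)) (Wb (a g b)) (\<lambda>x. rh g (\<theta> b (rh (inv g) x)))"
        using rWb[OF g b] rWb[OF g b0] WW by simp
      then show "riso W (Wb (a g b)) (\<lambda>w. rh g (\<theta> b (rh (inv g) (\<theta> (a g b0) w))))"
        using riso_comp[OF th[OF a_closed[OF g b0]]] by blast
    qed
    have "\<Phi> (rh g h) w = 0" if w: "w \<in> W" for w
    proof -
      let ?y = "rh (inv g) (\<theta> (a g b0) w)"
      have "\<theta> (a g b0) w \<in> rh g ` W" using thh(2)[OF a_closed[OF g b0]] rWb[OF g b0] WW w by blast
      then have y: "?y \<in> W" using rho_inv(1)[OF g] W.W_V by auto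
      have "\<Phi> (rh g h) w = (\<Sum>b\<in>B. bsm (rh g h (a g b)) (\<theta> (a g b) w))"
        unfolding \<Phi>_def by (rule sum.reindex_bij_betw[symmetric, OF a_bij[OF g]])
      also have "\<dots> = (\<Sum>b\<in>B. rh g (bsm (h b) (\<theta> b ?y)))"
      proof (rule sum.cong[OF refl])
        fix b assume b: "b \<in> B"
        have "rh g h (a g b) = h b" using a_closed[OF g b] a_inv(1)[OF g b] by (simp add: rh_def)
        then show "bsm (rh g h (a g b)) (\<theta> (a g b) w) = rh g (bsm (h b) (\<theta> b ?y))"
          using thg[OF b w] rhbsm[OF g] by simp
      qed
      also have "\<dots> = rh g (\<Phi> h ?y)" unfolding \<Phi>_def by (rule rhsum[symmetric, OF g finB])
      also have "\<dots> = 0" using h0[OF y] rho_zero[OF g] by simp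
      finally show ?thesis .
    qed
    then show "rh g h \<in> K" unfolding K_def using rh_QB[OF g hV] by blast
  qed
  show ?thesis
  proof (cases "K = {0}")
    case False
    then have KV: "K = ?V" using irreducible[OF K] Kst by blast
    have eq: "Wb b = W" if b: "b \<in> B" for b
    proof -
      \<comment> \<open>The sum of two point masses isolates \<open>\<theta> b\<close> +
        \<open>\<theta> b0\<close>; its vanishing makes the two maps, and so their images,
        equal.\<close>
      have "dl b + dl b0 \<in> K" using dl_QB[OF b b0] KV by simp
      then have z: "\<Phi> (dl b + dl b0) w = 0" if "w \<in> W" for w using that unfolding K_def by blast
      have Phi_dl: "\<Phi> (dl c) w = \<theta> c w" if c: "c \<in> B" for c w
      proof -
        have "\<Phi> (dl c) w = (\<Sum>b\<in>B. if b = c then \<theta> b w else 0)"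
          unfolding \<Phi>_def by (rule sum.cong) (auto simp: dl_def bsm_simps)
        then show ?thesis using c finB by simp
      qed
      have "\<theta> b w = \<theta> b0 w" if "w \<in> W" for w
        using z[OF that] Phi_add Phi_dl[OF b] Phi_dl[OF b0] by (simp add: add_eq_0_iff2)
      then have "\<theta> b ` W = \<theta> b0 ` W" by (rule image_cong[OF refl])
      then show ?thesis using thh(2)[OF b] thh(2)[OF b0] WW by simp
    qed
    have "W = ?V"
    proof (rule irreducible[OF W.W_subsp])
      show "W \<noteq> {0}" using simpleD(3)[OF W(1)] .
      show "\<forall>g\<in>carrier S. rh g ` W \<subseteq> W"
      proof
        fix g assume g: "g \<in> carrier S"
        have "rh g ` W = Wb (a g b0)" using rWb[OF g b0] WW by simp
        then show "rh g ` W \<subseteq> W" using eq[OF a_closed[OF g b0]] by simp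
      qed
    qed
    then have V: "simple ?V" and E: "\<And>f. rhom ?V f \<Longrightarrow> (\<forall>v\<in>?V. f v = 0) \<or> (\<forall>v\<in>?V. f v = v)"
      using W(1) W.end_W rhomD(1) by (auto simp: image_subset_iff)
    have "\<forall>f. (\<forall>x\<in>?V. f x \<in> ?V) \<and> (\<forall>x\<in>?V. \<forall>y\<in>?V. f (x + y) = f x + f y) \<longrightarrow> (\<exists>r\<in>R. \<forall>v\<in>?V. r \<star> v = f v)"
      using density[OF V E] by blast
    then show ?thesis by blast
  next
    case True
    let ?F = "\<lambda>h. \<Phi> h (vv b0)"
    \<comment> \<open>W is generated by \<open>vv b0\<close>, so a homomorphism on W that vanishes
      there is 0.\<close>
    have F0: "h = 0" if h: "h \<in> ?V" "?F h = 0" for h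
    proof -
      have "\<Phi> h w = 0" if w: "w \<in> W" for w
      proof -
        obtain r where r: "r \<in> R" "w = r \<star> vv b0" using w WW unfolding Wb_def by blast
        then show ?thesis using rhomD(3)[OF Phi_hom r(1) W(2)] h(2) R_zero[OF r(1)] by simp
      qed
      then have "h \<in> K" unfolding K_def using h(1) by blast
      then show ?thesis using True by blast
    qed
    have "inj_on ?F ?V"
    proof (rule inj_onI)
      fix h k assume hk: "h \<in> ?V" "k \<in> ?V" "?F h = ?F k"
      then have "?F (h + k) = 0" using Phi_add char2 by simp
      then have "h + k = 0" using F0 QB_add hk by blast
      then show "h = k" by (simp add: add_eq_0_iff2)
    qed
    moreover have "?F ` ?V \<subseteq> ?V" using rhomD(1)[OF Phi_hom W(2)] by blast
    ultimately have surj: "?F ` ?V = ?V" using endo_inj_surj[OF finite_QB] by blast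
    \<comment> \<open>An injective map of the finite Q_B into itself is onto, so w is the value at
      \<open>vv b0\<close> of some \<open>\<Phi> h\<close>. As \<open>vv b0\<close> generates W,
      that map sends W into W, so it is 0 or the identity.\<close>
    have W2: "w = 0 \<or> w = vv b0" if w: "w \<in> W" for w
    proof -
      have "w \<in> ?F ` ?V" using surj W.W_V[OF w] by simp
      then obtain h where h: "w = \<Phi> h (vv b0)" by blast
      have "\<Phi> h ` W \<subseteq> W"
      proof clarify
        fix x assume "x \<in> W"
        then obtain r where r: "r \<in> R" "x = r \<star> vv b0" using WW unfolding Wb_def by blast
        then have "\<Phi> h x = r \<star> w" using rhomD(3)[OF Phi_hom r(1) W(2)] h by simp
        then show "\<Phi> h x \<in> W" using W.W_R[OF r(1) w] by simp
      qed
      then have "(\<forall>w\<in>W. \<Phi> h w = 0) \<or> (\<forall>w\<in>W. \<Phi> h w = w)" by (rule W.end_W[OF Phi_hom])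
      then show ?thesis using h W(2) by blast
    qed
    have "(\<forall>v\<in>?V. r \<star> v = 0) \<or> (\<forall>v\<in>?V. r \<star> v = v)" if r: "r \<in> R" for r
    proof -
      \<comment> \<open>The only nonzero vector of W is \<open>vv b0\<close>, so
        \<open>\<theta> b\<close> has to send it to \<open>vv b\<close>. The scalar by which r acts
        on \<open>vv b0\<close> is thereby carried to every \<open>vv b\<close>, and these
        span.\<close>
      have thb: "\<theta> b (vv b0) = vv b" if b: "b \<in> B" for b
      proof -
        have "vv b \<in> \<theta> b ` W" using vWb[OF b] thh(2)[OF b] by simp
        then obtain w where w: "w \<in> W" "vv b = \<theta> b w" by blast
        then have "w \<noteq> 0" using vv_nz[OF b] rhom_zero[OF thh(1)[OF b] W.W_subsp] by auto
        then show ?thesis using W2[OF w(1)] w(2) by simp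
      qed
      have rv: "r \<star> vv b = \<theta> b (r \<star> vv b0)" if "b \<in> B" for b
        using rhomD(3)[OF thh(1)[OF that] r W(2)] thb[OF that] by simp
      have exp: "r \<star> v = (\<Sum>b\<in>B. bsm (v b) (r \<star> vv b))" if v: "v \<in> ?V" for v
      proof -
        have "r \<star> v = r \<star> (\<Sum>b\<in>B. bsm (v b) (vv b))" using QB_expand[OF v] by simp
        also have "\<dots> = (\<Sum>b\<in>B. r \<star> bsm (v b) (vv b))" by (rule Rsum[OF r _ finB]) (rule bsm_subsp[OF VV vv_QB])
        finally show ?thesis using Rbsm[OF r] by simp
      qed
      have "r \<star> vv b0 = 0 \<or> r \<star> vv b0 = vv b0" using W2 W.W_R[OF r W(2)] by blast
      then show ?thesis
      proof
        assume z: "r \<star> vv b0 = 0"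
        have "r \<star> vv b = 0" if "b \<in> B" for b using rv[OF that] z rhom_zero[OF thh(1)[OF that] W.W_subsp] by simp
        then have "r \<star> v = 0" if "v \<in> ?V" for v using exp[OF that] by (simp add: bsm_simps)
        then show ?thesis by blast
      next
        assume z: "r \<star> vv b0 = vv b0"
        have "r \<star> vv b = vv b" if "b \<in> B" for b using rv[OF that] z thb[OF that] by simp
        then have "r \<star> v = v" if "v \<in> ?V" for v using exp[OF that] QB_expand[OF that] by simp
        then show ?thesis by blast
      qed
    qed
    then show ?thesis by blast
  qed
qed

end

section \<open>Finite subgroups of the multiplicative group of a field\<close>

lemma card_fibers:
  assumes "finite A" "\<And>y. y \<in> f ` A \<Longrightarrow> card {x\<in>A. f x = y} = k"
  shows "card A = card (f ` A) * k"
proof -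
  have "A = (\<Union>y\<in>f ` A. {x\<in>A. f x = y})" by blast
  then have "card A = card (\<Union>y\<in>f ` A. {x\<in>A. f x = y})" by simp
  also have "\<dots> = (\<Sum>y\<in>f ` A. card {x\<in>A. f x = y})"
    by (rule card_UN_disjoint) (use assms(1) in auto)
  finally show ?thesis using assms(2) by simp
qed

lemma card_roots_of_unity: "n > 0 \<Longrightarrow> card {x::'a::idom. x ^ n = 1} \<le> n"
proof -
  assume n: "n > 0"
  let ?p = "Polynomial.monom (1::'a) n - 1"
  have "Polynomial.coeff ?p n = 1" using n by simp
  then have p0: "?p \<noteq> 0" by (metis Polynomial.coeff_0 zero_neq_one)
  have "{x::'a. x ^ n = 1} = {x. poly ?p x = 0}" by (simp add: Polynomial.poly_monom)
  then have "card {x::'a. x ^ n = 1} \<le> Polynomial.degree ?p" using card_poly_roots_bound[OF p0] by simp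
  also have "\<dots> \<le> n" by (intro Polynomial.degree_diff_le Polynomial.degree_monom_le) simp
  finally show ?thesis .
qed

text \<open>Closure under inverses follows from finiteness, see \<open>Dinv\<close>.\<close>

locale mult_subgroup =
  fixes D :: "'k::field set"
  assumes finD: "finite D" and D1: "1 \<in> D" and D0: "0 \<notin> D" and Dm: "x \<in> D \<Longrightarrow> y \<in> D \<Longrightarrow> x * y \<in> D"
begin

lemma Dinv: "x \<in> D \<Longrightarrow> inverse x \<in> D"
proof -
  assume x: "x \<in> D"
  then have x0: "x \<noteq> 0" using D0 by blast
  then have "inj_on (\<lambda>y. x * y) D" by (simp add: inj_on_def)
  then have "(\<lambda>y. x * y) ` D = D" using endo_inj_surj[OF finD] Dm[OF x] by blast
  then obtain y where "y \<in> D" "x * y = 1" using D1 by (metis imageE)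
  then show ?thesis using x0 by (metis inverse_unique)
qed

text \<open>Multiplication by D is free on nonzero elements, so Y is a disjoint union of cosets of
  full size. Later Y is often the set of nonzero elements of an additive subgroup.\<close>

lemma card_dvd:
  assumes "finite Y" "0 \<notin> Y" "\<And>d y. d \<in> D \<Longrightarrow> y \<in> Y \<Longrightarrow> d * y \<in> Y"
  shows "card D dvd card Y"
proof -
  let ?c = "\<lambda>y. (\<lambda>d. d * y) ` D"
  have Y: "\<Union> (?c ` Y) = Y"
  proof
    show "\<Union> (?c ` Y) \<subseteq> Y" using assms(3) by blast
    show "Y \<subseteq> \<Union> (?c ` Y)"
    proof
      fix y assume "y \<in> Y"
      moreover have "y \<in> ?c y" using D1 by force
      ultimately show "y \<in> \<Union> (?c ` Y)" by blast
    qed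
  qed
  have "card D dvd card (\<Union> (?c ` Y))"
  proof (rule dvd_partition)
    show "finite (\<Union> (?c ` Y))" using Y assms(1) by simp
    show "\<forall>c\<in>?c ` Y. card D dvd card c"
    proof
      fix c assume "c \<in> ?c ` Y"
      then obtain y where y: "y \<in> Y" "c = ?c y" by blast
      then have "inj_on (\<lambda>d. d * y) D" using assms(2) by (auto simp: inj_on_def)
      then show "card D dvd card c" using y card_image by fastforce
    qed
    show "\<forall>c1\<in>?c ` Y. \<forall>c2\<in>?c ` Y. c1 \<noteq> c2 \<longrightarrow> c1 \<inter> c2 = {}"
    proof (intro ballI impI)
      fix c1 c2 assume c: "c1 \<in> ?c ` Y" "c2 \<in> ?c ` Y" "c1 \<noteq> c2"
      then obtain y z where y: "c1 = ?c y" "c2 = ?c z" by blast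
      have sub: "?c y \<subseteq> ?c z" if "d * y = d' * z" "d \<in> D" "d' \<in> D" for d d' y z
      proof clarify
        fix x assume x: "x \<in> D"
        have "d \<noteq> 0" using that D0 by blast
        then have "y = inverse d * d' * z" using that(1) by (simp add: field_simps)
        then have "x * y = (x * (inverse d * d')) * z" by simp
        then show "x * y \<in> ?c z" using Dm Dinv that x by blast
      qed
      show "c1 \<inter> c2 = {}"
      proof (rule ccontr)
        assume "c1 \<inter> c2 \<noteq> {}"
        then obtain d d' where d: "d * y = d' * z" "d \<in> D" "d' \<in> D" using y by auto
        then have "c1 = c2" using sub[OF d] sub[OF d(1)[symmetric] d(3,2)] y by blast
        then show False using c(3) by blast
      qed
    qed
  qed
  then show ?thesis using Y by simp
qed

lemma power_image: "mult_subgroup ((\<lambda>t. t ^ j) ` D)"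
proof
  show "finite ((\<lambda>t. t ^ j) ` D)" using finD by simp
  show "1 \<in> (\<lambda>t. t ^ j) ` D" using D1 by force
  show "0 \<notin> (\<lambda>t. t ^ j) ` D" using D0 by auto
  show "x * y \<in> (\<lambda>t. t ^ j) ` D" if "x \<in> (\<lambda>t. t ^ j) ` D" "y \<in> (\<lambda>t. t ^ j) ` D" for x y
    using that Dm by (auto simp: power_mult_distrib[symmetric])
qed

lemma power_kernel: "mult_subgroup {t\<in>D. t ^ j = 1}"
  by unfold_locales (use finD D1 D0 Dm in \<open>auto simp: power_mult_distrib\<close>)

lemma card_power: "card D = card ((\<lambda>t. t ^ j) ` D) * card {t\<in>D. t ^ j = 1}"
proof (rule card_fibers[OF finD])
  fix y assume "y \<in> (\<lambda>t. t ^ j) ` D"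
  then obtain t where t: "t \<in> D" "y = t ^ j" by blast
  then have t0: "t \<noteq> 0" using D0 by blast
  have "bij_betw (\<lambda>y. t * y) {t\<in>D. t ^ j = 1} {x\<in>D. x ^ j = y}"
  proof (rule bij_betw_byWitness[of _ "\<lambda>y. inverse t * y"])
    show "\<forall>a\<in>{t\<in>D. t ^ j = 1}. inverse t * (t * a) = a" "\<forall>a\<in>{x\<in>D. x ^ j = y}. t * (inverse t * a) = a"
      using t0 by (auto simp: field_simps)
    show "(\<lambda>y. t * y) ` {t\<in>D. t ^ j = 1} \<subseteq> {x\<in>D. x ^ j = y}" using t Dm by (auto simp: power_mult_distrib)
    show "(\<lambda>y. inverse t * y) ` {x\<in>D. x ^ j = y} \<subseteq> {t\<in>D. t ^ j = 1}" using t t0 Dm Dinv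
      by (auto simp: power_mult_distrib power_inverse)
  qed
  then show "card {x\<in>D. x ^ j = y} = card {t\<in>D. t ^ j = 1}" by (simp add: bij_betw_same_card)
qed

end

section \<open>The quadratic extension of the field with q elements\<close>

locale hermitian_field =
  fixes m q :: nat and T :: "'k::{field,finite} itself"
  assumes m1: "1 < m" and q: "q = 2 ^ m" and cardK: "CARD('k) = q ^ 2"
begin

lemma q_ge: "4 \<le> q"
proof -
  have "2 ^ 2 \<le> (2::nat) ^ m" by (rule power_increasing) (use m1 in auto)
  then show ?thesis using q by simp
qed

lemma q_even: "even q" using q m1 by simp

lemma char_K: "CHAR('k) = 2"
proof -
  have "CHAR('k) dvd 2 ^ (m * 2)" using CHAR_dvd_CARD[where 'a = 'k] cardK q by (simp add: power_mult)
  moreover have "prime CHAR('k)" by (rule prime_CHAR_semidom) (rule finite_imp_CHAR_pos, simp)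
  ultimately show ?thesis using prime_dvd_power primes_dvd_imp_eq two_is_prime_nat by blast
qed

lemma add_self [simp]: "(x::'k) + x = 0"
proof -
  have "(of_nat CHAR('k) :: 'k) = 0" by (rule of_nat_CHAR)
  then have "(2::'k) = 0" using char_K by simp
  then show ?thesis by (metis mult_2 mult_zero_left)
qed

lemma uminus_self [simp]: "- (x::'k) = x"
  using add_self[of x] minus_unique by metis

lemma minus_add: "(x::'k) - y = x + y"
  by (metis diff_conv_add_uminus uminus_self)

lemma add_eq_0 [simp]: "(x::'k) + y = 0 \<longleftrightarrow> x = y"
  by (metis add_eq_0_iff uminus_self)

lemma add_cancel [simp]: "(x::'k) + (x + y) = y"
  by (simp add: add.assoc[symmetric])

lemma power_card_minus_1: assumes "x \<noteq> 0" shows "(x::'k) ^ (q^2 - 1) = 1"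
proof -
  let ?U = "UNIV - {0::'k}"
  have c: "card ?U = q^2 - 1" using cardK by simp
  have "bij_betw (\<lambda>y. x * y) ?U ?U"
    by (rule bij_betw_byWitness[of _ "\<lambda>y. inverse x * y"]) (use assms in \<open>auto simp: field_simps\<close>)
  then have "(\<Prod>y\<in>?U. x * y) = \<Prod>?U" using prod.reindex_bij_betw[of "\<lambda>y. x * y" ?U ?U "\<lambda>y. y"] by simp
  then have "x ^ (q^2 - 1) * \<Prod>?U = \<Prod>?U" by (simp add: prod.distrib c)
  moreover have "\<Prod>?U \<noteq> 0" by simp
  ultimately show ?thesis by simp
qed

lemma power_card: "(x::'k) ^ (q^2) = x"
proof (cases "x = 0")
  case False
  have "q^2 = Suc (q^2 - 1)" using q_ge by simp
  then have "x ^ (q^2) = x * x ^ (q^2 - 1)" by (metis power_Suc)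
  then show ?thesis using power_card_minus_1[OF False] by simp
qed (use q_ge in simp)

definition cj :: "'k \<Rightarrow> 'k" where "cj x = x ^ q"

lemma cj_add: "cj (x + y) = cj x + cj y"
  unfolding cj_def using freshmans_dream'[of q m x y] char_K q two_is_prime_nat by simp

lemma cj_mult: "cj (x * y) = cj x * cj y" unfolding cj_def by (rule power_mult_distrib)

lemma cj_inverse: "cj (inverse x) = inverse (cj x)" unfolding cj_def by (rule power_inverse)

lemma cj_divide: "cj (x / y) = cj x / cj y" unfolding cj_def by (rule power_divide)

lemma cj_cj [simp]: "cj (cj x) = x"
proof -
  have "cj (cj x) = x ^ (q^2)" unfolding cj_def by (simp add: power_mult[symmetric] power2_eq_square)
  then show ?thesis by (simp only: power_card)
qed

lemma cj_0 [simp]: "cj 0 = 0" unfolding cj_def using q_ge by simp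

lemma cj_1 [simp]: "cj 1 = 1" unfolding cj_def by simp

lemma cj_eq_0 [simp]: "cj x = 0 \<longleftrightarrow> x = 0" unfolding cj_def using q_ge by simp

definition Fq :: "'k set" where "Fq = {x. cj x = x}"

lemma Fq_0: "0 \<in> Fq" and Fq_1: "1 \<in> Fq" unfolding Fq_def by auto
lemma Fq_add: "x \<in> Fq \<Longrightarrow> y \<in> Fq \<Longrightarrow> x + y \<in> Fq" unfolding Fq_def by (simp add: cj_add)
lemma Fq_mult: "x \<in> Fq \<Longrightarrow> y \<in> Fq \<Longrightarrow> x * y \<in> Fq" unfolding Fq_def by (simp add: cj_mult)
lemma Fq_inverse: "x \<in> Fq \<Longrightarrow> inverse x \<in> Fq" unfolding Fq_def by (simp add: cj_inverse)
lemma Fq_trace: "x + cj x \<in> Fq" unfolding Fq_def by (simp add: cj_add add.commute)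
lemma Fq_norm: "x * cj x \<in> Fq" unfolding Fq_def by (simp add: cj_mult mult.commute)

lemma card_Fq_le: "card Fq \<le> q"
proof -
  have "Fq \<subseteq> insert 0 {x. x ^ (q - 1) = 1}"
  proof
    fix x assume "x \<in> Fq"
    then have "x * x ^ (q - 1) = x" unfolding Fq_def cj_def using q_ge by (simp add: power_eq_if)
    then show "x \<in> insert 0 {x. x ^ (q - 1) = 1}" by auto
  qed
  then have "card Fq \<le> card (insert 0 {x::'k. x ^ (q - 1) = 1})" by (intro card_mono) auto
  also have "\<dots> \<le> Suc (card {x::'k. x ^ (q - 1) = 1})" by (rule card_insert_le_m1) simp_all
  also have "\<dots> \<le> Suc (q - 1)" using card_roots_of_unity[of "q - 1", where 'a = 'k] q_ge by simp
  finally show ?thesis using q_ge by simp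
qed

lemma trace_fiber: "card {b. b + cj b = x + cj x} = card Fq"
proof -
  have "bij_betw ((+) x) Fq {b. b + cj b = x + cj x}"
  proof (rule bij_betw_byWitness[of _ "(+) x"])
    show "(+) x ` Fq \<subseteq> {b. b + cj b = x + cj x}" unfolding Fq_def by (auto simp: cj_add algebra_simps)
    show "(+) x ` {b. b + cj b = x + cj x} \<subseteq> Fq"
    proof clarify
      fix b assume "b + cj b = x + cj x"
      then have "(x + cj x) + (b + cj b) = 0" by simp
      then have "(x + b) + cj (x + b) = 0" by (simp only: cj_add ac_simps)
      then show "x + b \<in> Fq" unfolding Fq_def by simp
    qed
  qed auto
  then show ?thesis using bij_betw_same_card by metis
qed

text \<open>In characteristic 2 the kernel of the trace x + cj x is F_q itself, and the image lies
  in F_q. So q^2 is the product of the orders of image and F_q, the first being at most the second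
  and the second at most q; this leaves equality everywhere.\<close>

lemma card_Fq: "card Fq = q" and trace_range: "(\<lambda>x. x + cj x) ` UNIV = Fq"
proof -
  have im: "(\<lambda>x. x + cj x) ` UNIV \<subseteq> Fq" using Fq_trace by blast
  have fin: "finite Fq" by simp
  have "CARD('k) = card ((\<lambda>x::'k. x + cj x) ` UNIV) * card Fq"
    by (rule card_fibers) (auto simp: trace_fiber)
  then have e: "q * q = card ((\<lambda>x::'k. x + cj x) ` UNIV) * card Fq" using cardK by (simp add: power2_eq_square)
  have le: "card ((\<lambda>x::'k. x + cj x) ` UNIV) \<le> card Fq" by (rule card_mono[OF fin im])
  show c: "card Fq = q"
  proof (rule ccontr)
    assume "card Fq \<noteq> q"
    then have "card Fq < q" using card_Fq_le by simp
    then have "card ((\<lambda>x::'k. x + cj x) ` UNIV) * card Fq < q * q" using le by (intro mult_strict_mono') auto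
    then show False using e by simp
  qed
  then have "card ((\<lambda>x::'k. x + cj x) ` UNIV) = card Fq" using e q_ge by simp
  then show "(\<lambda>x. x + cj x) ` UNIV = Fq" using card_subset_eq[OF fin im] by blast
qed

lemma trace_ex: assumes "c \<in> Fq" shows "\<exists>b. b + cj b = c"
proof -
  have "c \<in> (\<lambda>x. x + cj x) ` UNIV" using assms by (simp only: trace_range)
  then obtain b where "c = b + cj b" by (rule imageE)
  then show ?thesis by (intro exI[of _ b]) simp
qed

lemma trace_count: assumes "c \<in> Fq" shows "card {b. b + cj b = c} = q"
proof -
  obtain b where "b + cj b = c" using trace_ex[OF assms] by blast
  then show ?thesis using trace_fiber[of b] card_Fq by simp
qed

lemma norm_power: "(x::'k) * cj x = x ^ (q + 1)" by (simp add: cj_def)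

sublocale K: mult_subgroup "UNIV - {0::'k}"
  by unfold_locales auto

text \<open>The same squeeze as for the trace: (q - 1)(q + 1) is the product of the orders of image
  and kernel of the norm, which are at most q - 1 and q + 1.\<close>

lemma norm_count: "card {t::'k. t ^ (q + 1) = 1} = q + 1"
  and norm_range: "(\<lambda>t. t ^ (q + 1)) ` (UNIV - {0}) = Fq - {0}"
proof -
  have im: "(\<lambda>t. t ^ (q + 1)) ` (UNIV - {0}) \<subseteq> Fq - {0}"
  proof (rule image_subsetI)
    fix t :: 'k assume "t \<in> UNIV - {0}"
    then show "t ^ (q + 1) \<in> Fq - {0}" using Fq_norm[of t] unfolding norm_power by simp
  qed
  have cF: "card (Fq - {0}) = q - 1" using card_Fq Fq_0 by simp
  have ker: "{t\<in>UNIV - {0::'k}. t ^ (q + 1) = 1} = {t. t ^ (q + 1) = 1}" by auto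
  have e: "q^2 - 1 = card ((\<lambda>t::'k. t ^ (q + 1)) ` (UNIV - {0})) * card {t::'k. t ^ (q + 1) = 1}"
    using K.card_power[of "q + 1"] cardK unfolding ker by simp
  have q2: "q^2 - 1 = (q - 1) * (q + 1)" by (simp add: power2_eq_square algebra_simps)
  have l1: "card ((\<lambda>t::'k. t ^ (q + 1)) ` (UNIV - {0})) \<le> q - 1" using card_mono[OF _ im] cF by simp
  have l2: "card {t::'k. t ^ (q + 1) = 1} \<le> q + 1" by (rule card_roots_of_unity) simp
  show c: "card {t::'k. t ^ (q + 1) = 1} = q + 1"
  proof (rule ccontr)
    assume "card {t::'k. t ^ (q + 1) = 1} \<noteq> q + 1"
    then have "card {t::'k. t ^ (q + 1) = 1} < q + 1" using l2 by simp
    moreover have "0 < q - 1" using q_ge by simp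
    ultimately have "card ((\<lambda>t::'k. t ^ (q + 1)) ` (UNIV - {0})) * card {t::'k. t ^ (q + 1) = 1} < (q - 1) * (q + 1)"
      using l1 by (meson le_less_trans mult_le_mono1 mult_less_mono2)
    then show False using e q2 by simp
  qed
  have "card ((\<lambda>t::'k. t ^ (q + 1)) ` (UNIV - {0})) * (q + 1) = (q - 1) * (q + 1)" using e unfolding c q2 by (rule sym)
  then have "card ((\<lambda>t::'k. t ^ (q + 1)) ` (UNIV - {0})) = q - 1" by (simp only: mult_cancel2) simp
  then have "card ((\<lambda>t::'k. t ^ (q + 1)) ` (UNIV - {0})) = card (Fq - {0})" using cF by simp
  then show "(\<lambda>t. t ^ (q + 1)) ` (UNIV - {0}) = Fq - {0}" using card_subset_eq[OF _ im] by simp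
qed

lemma norm_ex: "c \<in> Fq \<Longrightarrow> \<exists>t. t * cj t = c"
proof -
  assume c: "c \<in> Fq"
  show ?thesis
  proof (cases "c = 0")
    case True then show ?thesis by (intro exI[of _ 0]) simp
  next
    case False
    then have "c \<in> (\<lambda>t. t ^ (q + 1)) ` (UNIV - {0})" using c by (simp only: norm_range) simp
    then obtain t where "c = t ^ (q + 1)" by (rule imageE)
    then have "t * cj t = c" by (simp only: norm_power)
    then show ?thesis by blast
  qed
qed

text \<open>The greatest common divisor of 2q - 1 and q^2 - 1 divides 3, because 4(q^2 - 1) + 3 =
  (2q - 1)(2q + 1).\<close>

lemma cube_root: assumes "(t::'k) ^ (2 * q - 1) = 1" "t \<noteq> 0" shows "t ^ 3 = 1"
proof -
  have "t ^ (4 * (q^2 - 1)) = (t ^ (q^2 - 1)) ^ 4" by (simp only: power_mult[symmetric] mult.commute)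
  then have 1: "t ^ (4 * (q^2 - 1)) = 1" using power_card_minus_1[OF assms(2)] by simp
  have e: "4 * (q^2 - 1) + 3 = (2 * q - 1) * (2 * q + 1)"
  proof -
    obtain k where "q = Suc k" using q_ge by (cases q) auto
    then show ?thesis by (simp add: power2_eq_square algebra_simps)
  qed
  have "t ^ 3 = t ^ (4 * (q^2 - 1) + 3)" using 1 by (simp only: power_add mult_1_left)
  also have "\<dots> = (t ^ (2 * q - 1)) ^ (2 * q + 1)" by (simp only: e power_mult)
  also have "\<dots> = 1" by (simp only: assms(1) power_one)
  finally show ?thesis .
qed

end

section \<open>Orders and conjugates of subgroups\<close>

lemma (in group) card_subgroup_dvd:
  assumes "subgroup A G" "subgroup B G" "A \<subseteq> B" shows "card A dvd card B"
proof -
  have "subgroup A (G\<lparr>carrier := B\<rparr>)" by (rule subgroup_incl[OF assms])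
  then have "card (rcosets\<^bsub>G\<lparr>carrier := B\<rparr>\<^esub> A) * card A = order (G\<lparr>carrier := B\<rparr>)"
    by (rule group.lagrange[OF subgroup.subgroup_is_group[OF assms(2) is_group]])
  then have "card (rcosets\<^bsub>G\<lparr>carrier := B\<rparr>\<^esub> A) * card A = card B" by (simp add: order_def)
  then show ?thesis using dvd_triv_right by metis
qed

lemma (in group) conj_subgroup:
  assumes g: "g \<in> carrier G" and M: "subgroup M G"
  shows "subgroup {x\<in>carrier G. g \<otimes> x \<otimes> inv g \<in> M} G"
    and "card {x\<in>carrier G. g \<otimes> x \<otimes> inv g \<in> M} = card M"
proof -
  let ?M = "{x\<in>carrier G. g \<otimes> x \<otimes> inv g \<in> M}"
  have MG: "x \<in> carrier G" if "x \<in> M" for x using subgroup.mem_carrier[OF M that] .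
  show "subgroup ?M G"
  proof (rule subgroupI)
    show "?M \<subseteq> carrier G" by blast
    have "\<one> \<in> ?M" using g subgroup.one_closed[OF M] by simp
    then show "?M \<noteq> {}" by blast
    show "inv x \<in> ?M" if x: "x \<in> ?M" for x
    proof -
      have "inv (g \<otimes> x \<otimes> inv g) \<in> M" using subgroup.m_inv_closed[OF M] x by blast
      then show ?thesis using g x by (simp add: inv_mult_group m_assoc)
    qed
    show "x \<otimes> y \<in> ?M" if xy: "x \<in> ?M" "y \<in> ?M" for x y
    proof -
      have "(g \<otimes> x \<otimes> inv g) \<otimes> (g \<otimes> y \<otimes> inv g) \<in> M" using subgroup.m_closed[OF M] xy by blast
      moreover have "(g \<otimes> x \<otimes> inv g) \<otimes> (g \<otimes> y \<otimes> inv g) = g \<otimes> (x \<otimes> y) \<otimes> inv g"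
        using g xy by (simp add: m_assoc inv_solve_left')
      ultimately show ?thesis using xy by simp
    qed
  qed
  have "bij_betw (\<lambda>x. g \<otimes> x \<otimes> inv g) ?M M"
  proof (rule bij_betw_byWitness[of _ "\<lambda>x. inv g \<otimes> x \<otimes> g"])
    show "\<forall>x\<in>?M. inv g \<otimes> (g \<otimes> x \<otimes> inv g) \<otimes> g = x" using g by (auto simp: m_assoc inv_solve_left')
    show e: "\<forall>x\<in>M. g \<otimes> (inv g \<otimes> x \<otimes> g) \<otimes> inv g = x" 
    proof
      fix x assume "x \<in> M"
      then have x: "x \<in> carrier G" by (rule MG)
      have "g \<otimes> (inv g \<otimes> x \<otimes> g) \<otimes> inv g = (g \<otimes> inv g) \<otimes> x \<otimes> (g \<otimes> inv g)"
        using g x by (simp only: m_assoc m_closed inv_closed)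
      then show "g \<otimes> (inv g \<otimes> x \<otimes> g) \<otimes> inv g = x" using g x by simp
    qed
    show "(\<lambda>x. g \<otimes> x \<otimes> inv g) ` ?M \<subseteq> M" by blast
    show "(\<lambda>x. inv g \<otimes> x \<otimes> g) ` M \<subseteq> ?M" using e g MG by auto
  qed
  then show "card ?M = card M" by (rule bij_betw_same_card)
qed

section \<open>The unitary group on its isotropic lines\<close>

text \<open>The features of SU_3(q) in the basis with antidiagonal Gram matrix: P is the upper triangular group,
  tp the entry (1,1), U the unipotent group of matrices with rows (1, cj a, b), (0, 1, a), (0, 0, 1), whose
  coordinates a and b are ap and bp, w the antidiagonal permutation matrix, and L the points of a hyperbolic
  line.\<close>

locale unitary3 = hermitian_field m q T + group S
  for m q :: nat and T :: "'k::{field,finite} itself" and S :: "('g, 'x) monoid_scheme" (structure) +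
  fixes Om :: "'o set" and act :: "'g \<Rightarrow> 'o \<Rightarrow> 'o" and pinf po :: 'o and w :: 'g
    and P U Z :: "'g set" and tp ap bp :: "'g \<Rightarrow> 'k" and L :: "'o set"
  assumes finS: "finite (carrier S)" and acts: "acts_on S (carrier S) Om act"
    and card_Om: "card Om = q ^ 3 + 1" and pinf: "pinf \<in> Om" and po: "po \<in> Om" and pinf_po: "pinf \<noteq> po"
    and P_def: "P = {g\<in>carrier S. act g pinf = pinf}"
    and w: "w \<in> carrier S" "act w pinf = po" "w \<otimes> w = \<one>"
    and tp_mult: "g \<in> P \<Longrightarrow> h \<in> P \<Longrightarrow> tp (g \<otimes> h) = tp g * tp h"
    and tp_nz: "g \<in> P \<Longrightarrow> tp g \<noteq> 0"
    and tp_ex: "t \<noteq> 0 \<Longrightarrow> \<exists>h\<in>P. tp h = t \<and> act h po = po"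
    and U_def: "U = {g\<in>P. tp g = 1}"
    and U_regular: "x \<in> Om \<Longrightarrow> x \<noteq> pinf \<Longrightarrow> \<exists>!u. u \<in> U \<and> act u po = x"
    and ap_mult: "u \<in> U \<Longrightarrow> v \<in> U \<Longrightarrow> ap (u \<otimes> v) = ap u + ap v"
    and bp_mult: "u \<in> U \<Longrightarrow> v \<in> U \<Longrightarrow> bp (u \<otimes> v) = bp u + bp v + cj (ap u) * ap v"
    and U_coord: "bij_betw (\<lambda>u. (ap u, bp u)) U {(a, b). b + cj b = a * cj a}"
    and Z_def: "Z = {u\<in>U. ap u = 0}"
    and ap_conj: "p \<in> P \<Longrightarrow> u \<in> U \<Longrightarrow> ap (p \<otimes> u \<otimes> inv p) = tp p ^ (2 * q - 1) * ap u"
    and bp_conj: "p \<in> P \<Longrightarrow> z \<in> Z \<Longrightarrow> bp (p \<otimes> z \<otimes> inv p) = tp p ^ (q + 1) * bp z"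
    and torus_ex: "t \<noteq> 0 \<Longrightarrow> \<exists>u\<in>U. \<exists>v\<in>U. w \<otimes> u \<otimes> w \<otimes> v \<otimes> w \<in> P \<and> tp (w \<otimes> u \<otimes> w \<otimes> v \<otimes> w) = t"
    and w_ex: "\<exists>x\<in>Z. w = x \<otimes> (w \<otimes> x \<otimes> w) \<otimes> x"
    and split_ex: "s \<in> Fq \<Longrightarrow> s \<noteq> 0 \<Longrightarrow> \<exists>x\<in>Z. \<exists>y\<in>Z. x \<otimes> (w \<otimes> y \<otimes> w) \<otimes> x \<otimes> w \<in> P \<and> tp (x \<otimes> (w \<otimes> y \<otimes> w) \<otimes> x \<otimes> w) = s"
    and L: "L \<subseteq> Om" "pinf \<in> L" "card L = q + 1" "z \<in> Z \<Longrightarrow> x \<in> L \<Longrightarrow> act z x \<in> L" "x \<in> L \<Longrightarrow> act w x \<in> L"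
begin

lemma act_closed: "g \<in> carrier S \<Longrightarrow> x \<in> Om \<Longrightarrow> act g x \<in> Om"
  using acts unfolding acts_on_def by blast
lemma act_one: "x \<in> Om \<Longrightarrow> act \<one> x = x"
  using acts unfolding acts_on_def by blast
lemma act_mult: "g \<in> carrier S \<Longrightarrow> h \<in> carrier S \<Longrightarrow> x \<in> Om \<Longrightarrow> act (g \<otimes> h) x = act g (act h x)"
  using acts unfolding acts_on_def by blast
lemma act_inv: "g \<in> carrier S \<Longrightarrow> x \<in> Om \<Longrightarrow> act (inv g) (act g x) = x"
  "g \<in> carrier S \<Longrightarrow> x \<in> Om \<Longrightarrow> act g (act (inv g) x) = x"
  using acts_on_inv[OF acts subgroup_self] by blast+
lemma act_eqD: "g \<in> carrier S \<Longrightarrow> x \<in> Om \<Longrightarrow> y \<in> Om \<Longrightarrow> act g x = act g y \<Longrightarrow> x = y"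
  using act_inv(1) by metis

lemma finOm: "finite Om" using card_Om card.infinite by fastforce

lemma P_carrier: "p \<in> P \<Longrightarrow> p \<in> carrier S" unfolding P_def by blast
lemma U_P: "u \<in> U \<Longrightarrow> u \<in> P" unfolding U_def by blast
lemma U_carrier: "u \<in> U \<Longrightarrow> u \<in> carrier S" using U_P P_carrier by blast
lemma Z_U: "z \<in> Z \<Longrightarrow> z \<in> U" unfolding Z_def by blast
lemma Z_carrier: "z \<in> Z \<Longrightarrow> z \<in> carrier S" using Z_U U_carrier by blast

lemma stab_subgroup: "x \<in> Om \<Longrightarrow> subgroup M S \<Longrightarrow> subgroup {g\<in>M. act g x = x} S"
proof (rule subgroupI)
  assume x: "x \<in> Om" and M: "subgroup M S"
  have MS: "g \<in> carrier S" if "g \<in> M" for g using subgroup.mem_carrier[OF M that] .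
  show "{g\<in>M. act g x = x} \<subseteq> carrier S" using MS by blast
  show "{g\<in>M. act g x = x} \<noteq> {}" using subgroup.one_closed[OF M] act_one[OF x] by blast
  show "inv g \<in> {g\<in>M. act g x = x}" if "g \<in> {g\<in>M. act g x = x}" for g
    using that subgroup.m_inv_closed[OF M] act_inv(1)[OF MS x, of g] by auto
  show "g \<otimes> h \<in> {g\<in>M. act g x = x}" if "g \<in> {g\<in>M. act g x = x}" "h \<in> {g\<in>M. act g x = x}" for g h
    using that subgroup.m_closed[OF M] act_mult[OF MS MS x] by auto
qed

lemma P_sub: "subgroup P S"
  using stab_subgroup[OF pinf subgroup_self] unfolding P_def .

lemma P_mult: "g \<in> P \<Longrightarrow> h \<in> P \<Longrightarrow> g \<otimes> h \<in> P" using subgroup.m_closed[OF P_sub] .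
lemma P_inv: "g \<in> P \<Longrightarrow> inv g \<in> P" using subgroup.m_inv_closed[OF P_sub] .
lemma P_one: "\<one> \<in> P" using subgroup.one_closed[OF P_sub] .

lemma tp_one: "tp \<one> = 1"
proof -
  have "tp \<one> = tp \<one> * tp \<one>" using tp_mult[OF P_one P_one] by simp
  then show ?thesis using tp_nz[OF P_one] by simp
qed

lemma tp_inv: "g \<in> P \<Longrightarrow> tp (inv g) = inverse (tp g)"
proof -
  assume g: "g \<in> P"
  have "tp g * tp (inv g) = 1" using tp_mult[OF g P_inv[OF g]] tp_one P_carrier[OF g] by simp
  then show ?thesis using inverse_unique by metis
qed

lemma U_sub: "subgroup U S"
proof (rule subgroupI)
  show "U \<subseteq> carrier S" using U_carrier by blast
  show "U \<noteq> {}" unfolding U_def using P_one tp_one by blast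
  show "inv g \<in> U" if "g \<in> U" for g using that P_inv tp_inv unfolding U_def by auto
  show "g \<otimes> h \<in> U" if "g \<in> U" "h \<in> U" for g h using that P_mult tp_mult unfolding U_def by auto
qed

lemma U_mult: "g \<in> U \<Longrightarrow> h \<in> U \<Longrightarrow> g \<otimes> h \<in> U" using subgroup.m_closed[OF U_sub] .
lemma U_inv: "g \<in> U \<Longrightarrow> inv g \<in> U" using subgroup.m_inv_closed[OF U_sub] .
lemma U_one: "\<one> \<in> U" using subgroup.one_closed[OF U_sub] .

lemma U_conj: "p \<in> P \<Longrightarrow> u \<in> U \<Longrightarrow> p \<otimes> u \<otimes> inv p \<in> U"
  unfolding U_def using P_mult P_inv tp_mult tp_inv tp_nz by simp

lemma ap_one: "ap \<one> = 0" using ap_mult[OF U_one U_one] by simp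
lemma bp_one: "bp \<one> = 0" using bp_mult[OF U_one U_one] ap_one by simp

lemma ap_inv: "u \<in> U \<Longrightarrow> ap (inv u) = ap u"
proof -
  assume u: "u \<in> U"
  have "ap u + ap (inv u) = 0" using ap_mult[OF u U_inv[OF u]] ap_one U_carrier[OF u] by simp
  then show ?thesis by simp
qed

lemma U_eqI: "u \<in> U \<Longrightarrow> v \<in> U \<Longrightarrow> ap u = ap v \<Longrightarrow> bp u = bp v \<Longrightarrow> u = v"
  using U_coord unfolding bij_betw_def inj_on_def by blast

lemma U_ex: "b + cj b = a * cj a \<Longrightarrow> \<exists>u\<in>U. ap u = a \<and> bp u = b"
proof -
  assume "b + cj b = a * cj a"
  then have "(a, b) \<in> (\<lambda>u. (ap u, bp u)) ` U" using U_coord unfolding bij_betw_def by auto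
  then show ?thesis by auto
qed

lemma U_rel: "u \<in> U \<Longrightarrow> bp u + cj (bp u) = ap u * cj (ap u)"
  using U_coord unfolding bij_betw_def by auto

lemma card_U: "card U = q ^ 3"
proof -
  have "{(a::'k, b). b + cj b = a * cj a} = (SIGMA a:UNIV. {b. b + cj b = a * cj a})" by auto
  then have "card {(a::'k, b). b + cj b = a * cj a} = (\<Sum>a\<in>(UNIV::'k set). card {b. b + cj b = a * cj a})"
    by (simp only:) (rule card_SigmaI, simp_all)
  also have "\<dots> = (\<Sum>a\<in>(UNIV::'k set). q)" using trace_count[OF Fq_norm] by simp
  also have "\<dots> = q ^ 3" using cardK by (simp add: power2_eq_square power3_eq_cube)
  finally show ?thesis using bij_betw_same_card[OF U_coord] by simp
qed

lemma Z_sub: "subgroup Z S"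
proof (rule subgroupI)
  show "Z \<subseteq> carrier S" using Z_carrier by blast
  show "Z \<noteq> {}" unfolding Z_def using U_one ap_one by blast
  show "inv g \<in> Z" if "g \<in> Z" for g using that U_inv ap_inv unfolding Z_def by auto
  show "g \<otimes> h \<in> Z" if "g \<in> Z" "h \<in> Z" for g h using that U_mult ap_mult unfolding Z_def by auto
qed

lemma Z_conj: "p \<in> P \<Longrightarrow> z \<in> Z \<Longrightarrow> p \<otimes> z \<otimes> inv p \<in> Z"
  unfolding Z_def using U_conj ap_conj by auto

lemma bp_Z: "z \<in> Z \<Longrightarrow> bp z \<in> Fq"
  using U_rel[of z] unfolding Z_def Fq_def by auto

lemma bp_Z_mult: "z \<in> Z \<Longrightarrow> u \<in> U \<Longrightarrow> bp (z \<otimes> u) = bp z + bp u"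
  using bp_mult[of z u] unfolding Z_def by auto

lemma bp_Z_inj: "z \<in> Z \<Longrightarrow> z' \<in> Z \<Longrightarrow> bp z = bp z' \<Longrightarrow> z = z'"
  using U_eqI unfolding Z_def by auto

lemma Z_square: "z \<in> Z \<Longrightarrow> z \<otimes> z = \<one>"
  using U_eqI[OF U_mult[OF Z_U Z_U] U_one] ap_mult[OF Z_U Z_U] bp_Z_mult[OF _ Z_U] ap_one bp_one by simp

text \<open>From u outside Z this makes a nontrivial involution of Z, since the norm of
  \<open>ap u\<close> is then nonzero.\<close>

lemma U_square: "u \<in> U \<Longrightarrow> u \<otimes> u \<in> Z \<and> bp (u \<otimes> u) = cj (ap u) * ap u"
  unfolding Z_def using U_mult ap_mult bp_mult by simp

lemma Om_trans: "x \<in> Om \<Longrightarrow> \<exists>g\<in>carrier S. act g pinf = x"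
proof (cases "x = pinf")
  case True
  then show ?thesis using act_one[OF pinf] by blast
next
  case False
  assume "x \<in> Om"
  then obtain u where u: "u \<in> U" "act u po = x" using U_regular False by blast
  have uS: "u \<in> carrier S" by (rule U_carrier[OF u(1)])
  have "act (u \<otimes> w) pinf = x" using act_mult[OF uS w(1) pinf] w(2) u(2) by simp
  then show ?thesis using m_closed[OF uS w(1)] by blast
qed

lemma U_fix: "u \<in> U \<Longrightarrow> x \<in> Om \<Longrightarrow> x \<noteq> pinf \<Longrightarrow> act u x = x \<Longrightarrow> u = \<one>"
proof -
  assume u: "u \<in> U" and x: "x \<in> Om" "x \<noteq> pinf" "act u x = x"
  obtain v where v: "v \<in> U" "act v po = x" using U_regular x by blast
  have "act (u \<otimes> v) po = x" using act_mult[OF U_carrier[OF u] U_carrier[OF v(1)] po] v x by simp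
  then have "u \<otimes> v = v" using U_regular[OF x(1,2)] v U_mult[OF u v(1)] by blast
  then show ?thesis using U_carrier u v by simp
qed

lemma U_pinf: "p \<in> P \<Longrightarrow> act p pinf = pinf" unfolding P_def by blast

lemma card_P: "card P = (q^2 - 1) * q^3"
proof -
  have finP: "finite P" by (rule finite_subset[OF subgroup.subset[OF P_sub] finS])
  have im: "tp ` P = UNIV - {0}"
  proof
    show "tp ` P \<subseteq> UNIV - {0}" using tp_nz by auto
    show "UNIV - {0} \<subseteq> tp ` P"
    proof
      fix t :: 'k assume "t \<in> UNIV - {0}"
      then obtain h where "h \<in> P" "tp h = t" using tp_ex[of t] by auto
      then show "t \<in> tp ` P" by blast
    qed
  qed
  have "card P = card (tp ` P) * q^3"
  proof (rule card_fibers[OF finP])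
    fix t assume "t \<in> tp ` P"
    then obtain h where h: "h \<in> P" "tp h = t" by blast
    have hc: "h \<in> carrier S" using P_carrier h by blast
    have "bij_betw (\<lambda>u. u \<otimes> h) U {x\<in>P. tp x = t}"
    proof (rule bij_betw_byWitness[of _ "\<lambda>x. x \<otimes> inv h"])
      show "\<forall>u\<in>U. u \<otimes> h \<otimes> inv h = u" using hc U_carrier by (simp add: m_assoc)
      show "\<forall>x\<in>{x\<in>P. tp x = t}. x \<otimes> inv h \<otimes> h = x" using hc P_carrier by (simp add: m_assoc)
      show "(\<lambda>u. u \<otimes> h) ` U \<subseteq> {x\<in>P. tp x = t}" unfolding U_def using h P_mult tp_mult by auto
      show "(\<lambda>x. x \<otimes> inv h) ` {x\<in>P. tp x = t} \<subseteq> U" unfolding U_def using h P_mult P_inv tp_mult tp_inv tp_nz by auto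
    qed
    then show "card {x\<in>P. tp x = t} = q^3" using bij_betw_same_card card_U by metis
  qed
  then show ?thesis using im cardK by simp
qed

lemma card_S: "card (carrier S) = (q^3 + 1) * card P"
proof -
  have "(\<lambda>g. act g pinf) ` carrier S = Om" using act_closed pinf Om_trans by blast
  then show ?thesis using acts_on_orbit_stabilizer[OF acts subgroup_self pinf] card_Om unfolding P_def by simp
qed

text \<open>By \<open>torus_ex\<close> words in U and w reach every value of \<open>tp\<close>, and
  U is the kernel of \<open>tp\<close>, so P lies in H. The rest of S consists of elements u w p,
  since U is transitive on the points other than \<open>pinf\<close>.\<close>

lemma P_subset_all:
  assumes H: "subgroup H S" and U: "U \<subseteq> H" and wH: "w \<in> H"
  shows "H = carrier S"
proof -
  have PH: "p \<in> H" if p: "p \<in> P" for p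
  proof -
    obtain u v where uv: "u \<in> U" "v \<in> U" "w \<otimes> u \<otimes> w \<otimes> v \<otimes> w \<in> P" "tp (w \<otimes> u \<otimes> w \<otimes> v \<otimes> w) = tp p"
      using torus_ex[OF tp_nz[OF p]] by blast
    let ?h = "w \<otimes> u \<otimes> w \<otimes> v \<otimes> w"
    have uvH: "u \<in> H" "v \<in> H" using uv(1,2) U by auto
    have hH: "?h \<in> H" by (intro subgroup.m_closed[OF H] wH uvH)
    have "p \<otimes> inv ?h \<in> U" unfolding U_def using P_mult P_inv p uv tp_mult tp_inv tp_nz by simp
    then have "p \<otimes> inv ?h \<otimes> ?h \<in> H" using subgroup.m_closed[OF H _ hH] U by blast
    then show ?thesis using P_carrier[OF p] P_carrier[OF uv(3)] by (simp add: m_assoc)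
  qed
  have "g \<in> H" if g: "g \<in> carrier S" for g
  proof (cases "act g pinf = pinf")
    case True then show ?thesis using PH g unfolding P_def by blast
  next
    case False
    obtain u where u: "u \<in> U" "act u po = act g pinf" using U_regular[OF act_closed[OF g pinf] False] by blast
    have uw: "u \<otimes> w \<in> H" using u U wH subgroup.m_closed[OF H] by auto
    then have uw: "u \<otimes> w \<in> carrier S" "u \<otimes> w \<in> H" using subgroup.mem_carrier[OF H] by auto
    have "act (inv (u \<otimes> w) \<otimes> g) pinf = act (inv (u \<otimes> w)) (act (u \<otimes> w) pinf)"
      using act_mult[OF _ g pinf] act_mult[OF U_carrier[OF u(1)] w(1) pinf] w u uw by simp
    then have "inv (u \<otimes> w) \<otimes> g \<in> P" unfolding P_def using act_inv(1)[OF uw(1) pinf] uw g by simp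
    then have "(u \<otimes> w) \<otimes> (inv (u \<otimes> w) \<otimes> g) \<in> H" by (intro subgroup.m_closed[OF H] uw(2) PH)
    then show ?thesis using uw g by (simp add: m_assoc[symmetric])
  qed
  then show ?thesis using subgroup.subset[OF H] by blast
qed

lemma w_inv: "inv w = w" using w inv_equality by blast

text \<open>Some h in H moves \<open>pinf\<close> to \<open>po\<close>, since U is transitive on the
  other points; then w = h p with p in P. As p normalises U, the conjugate of U by w is its
  conjugate by h and lies in H, and \<open>w_ex\<close> writes w in terms of Z and its conjugate by
  w.\<close>

lemma overgroup_U:
  assumes H: "subgroup H S" and U: "U \<subseteq> H" and HP: "\<not> H \<subseteq> P"
  shows "H = carrier S"
proof (rule P_subset_all[OF H U])
  obtain h where h: "h \<in> H" "h \<notin> P" using HP by blast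
  have hS: "h \<in> carrier S" using subgroup.mem_carrier[OF H h(1)] .
  have "act h pinf \<noteq> pinf" using h hS unfolding P_def by blast
  then obtain u where u: "u \<in> U" "act u po = act h pinf" using U_regular[OF act_closed[OF hS pinf]] by blast
  let ?h = "inv u \<otimes> h"
  have uS: "u \<in> carrier S" using U_carrier u by blast
  have hH: "?h \<in> H" "?h \<in> carrier S" using subgroup.m_closed[OF H] subgroup.m_inv_closed[OF H] u U h uS hS by auto
  have ho: "act ?h pinf = po" using act_mult[OF inv_closed[OF uS] hS pinf] u(2)[symmetric] act_inv(1)[OF uS po] by simp
  let ?p = "inv ?h \<otimes> w"
  have pP: "?p \<in> P" unfolding P_def
    using act_mult[OF inv_closed[OF hH(2)] w(1) pinf] w hH act_inv(1)[OF hH(2) pinf] ho by simp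
  have wp: "w = ?h \<otimes> ?p" using hH w by (simp add: m_assoc[symmetric])
  have conj: "w \<otimes> v \<otimes> w \<in> H" if v: "v \<in> U" for v
  proof -
    have pv: "?p \<otimes> v \<otimes> inv ?p \<in> H" using U_conj[OF pP v] U by blast
    have c: "?p \<in> carrier S" "v \<in> carrier S" using pP P_carrier v U_carrier by auto
    have "w \<otimes> v \<otimes> w = w \<otimes> v \<otimes> inv w" using w_inv by simp
    also have "\<dots> = (?h \<otimes> ?p) \<otimes> v \<otimes> inv (?h \<otimes> ?p)" using wp by simp
    also have "\<dots> = ?h \<otimes> (?p \<otimes> v \<otimes> inv ?p) \<otimes> inv ?h" using hH(2) c by (simp only: inv_mult_group m_assoc m_closed inv_closed)
    finally show ?thesis using subgroup.m_closed[OF H] subgroup.m_inv_closed[OF H] hH(1) pv by simp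
  qed
  obtain x where x: "x \<in> Z" "w = x \<otimes> (w \<otimes> x \<otimes> w) \<otimes> x" using w_ex by blast
  have xH: "x \<in> H" using Z_U[OF x(1)] U by blast
  have "x \<otimes> (w \<otimes> x \<otimes> w) \<otimes> x \<in> H" by (intro subgroup.m_closed[OF H] xH conj Z_U x(1))
  then show "w \<in> H" using x(2) by simp
qed

text \<open>The elements all of whose conjugates lie in M are closed under products and conjugation.
  They include Z, then w by \<open>w_ex\<close>, then by \<open>split_ex\<close> an element p of P
  with entry s other than 0 and 1; the commutators of p with U cover U modulo Z.\<close>

lemma overgroup_Z:
  assumes M: "subgroup M S" and ZM: "\<And>g z. g \<in> carrier S \<Longrightarrow> z \<in> Z \<Longrightarrow> g \<otimes> z \<otimes> inv g \<in> M"
  shows "M = carrier S"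
proof -
  define N where "N = {x\<in>carrier S. \<forall>g\<in>carrier S. g \<otimes> x \<otimes> inv g \<in> M}"
  have Nm: "x \<otimes> y \<in> N" if xy: "x \<in> N" "y \<in> N" for x y
  proof -
    have xyS: "x \<in> carrier S" "y \<in> carrier S" using xy unfolding N_def by auto
    have "g \<otimes> (x \<otimes> y) \<otimes> inv g \<in> M" if g: "g \<in> carrier S" for g
    proof -
      have "(g \<otimes> x \<otimes> inv g) \<otimes> (g \<otimes> y \<otimes> inv g) \<in> M" using subgroup.m_closed[OF M] xy g unfolding N_def by blast
      moreover have "(g \<otimes> x \<otimes> inv g) \<otimes> (g \<otimes> y \<otimes> inv g) = g \<otimes> (x \<otimes> y) \<otimes> inv g"
        using g xyS by (simp add: m_assoc inv_solve_left')
      ultimately show ?thesis by simp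
    qed
    then show ?thesis using xyS unfolding N_def by simp
  qed
  have ZN: "z \<in> N" if "z \<in> Z" for z using that ZM Z_carrier unfolding N_def by blast
  have wZN: "w \<otimes> z \<otimes> w \<in> N" if z: "z \<in> Z" for z
  proof -
    have "g \<otimes> (w \<otimes> z \<otimes> w) \<otimes> inv g \<in> M" if g: "g \<in> carrier S" for g
    proof -
      have "(g \<otimes> w) \<otimes> z \<otimes> inv (g \<otimes> w) \<in> M" using ZM[of "g \<otimes> w"] g w z by blast
      then show ?thesis using g w w_inv Z_carrier[OF z] by (simp add: inv_mult_group m_assoc)
    qed
    then show ?thesis unfolding N_def using w Z_carrier[OF z] by simp
  qed
  obtain x where x: "x \<in> Z" "w = x \<otimes> (w \<otimes> x \<otimes> w) \<otimes> x" using w_ex by blast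
  have "x \<otimes> (w \<otimes> x \<otimes> w) \<otimes> x \<in> N" by (intro Nm ZN wZN x(1))
  then have wN: "w \<in> N" using x(2) by simp
  \<comment> \<open>Here q >= 4 is used: F_q has an element besides 0 and 1.\<close>
  have "card (Fq - {0, 1}) \<noteq> 0"
  proof -
    have "card (Fq - {0, 1}) \<ge> card Fq - card {0, 1::'k}" by (rule diff_card_le_card_Diff) simp
    moreover have "card {0, 1::'k} \<le> 2" by (simp add: card_insert_le_m1)
    ultimately show ?thesis using card_Fq q_ge by linarith
  qed
  then have "Fq - {0, 1} \<noteq> {}" by (metis card.empty)
  then obtain s where s: "s \<in> Fq" "s \<noteq> 0" "s \<noteq> 1" by blast
  obtain x y where xy: "x \<in> Z" "y \<in> Z" "x \<otimes> (w \<otimes> y \<otimes> w) \<otimes> x \<otimes> w \<in> P" "tp (x \<otimes> (w \<otimes> y \<otimes> w) \<otimes> x \<otimes> w) = s"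
    using split_ex[OF s(1,2)] by blast
  define p where "p = x \<otimes> (w \<otimes> y \<otimes> w) \<otimes> x \<otimes> w"
  have p: "p \<in> P" "tp p = s" using xy(3,4) unfolding p_def by auto
  have pN: "p \<in> N" unfolding p_def by (intro Nm ZN wZN wN xy(1,2))
  note p = p pN
  have pS: "p \<in> carrier S" using P_carrier p by blast
  have NM: "x \<in> M" if "x \<in> N" for x
  proof -
    have "\<one> \<otimes> x \<otimes> inv \<one> \<in> M" "x \<in> carrier S" using that unfolding N_def by blast+
    then show ?thesis by simp
  qed
  \<comment> \<open>As s^q = s, conjugation by p multiplies \<open>ap\<close> by s itself.\<close>
  have sk: "s ^ (2 * q - 1) = s"
  proof -
    have "s ^ (2 * q - 1) * s = s ^ (2 * q)" using q_ge by (simp add: power_eq_if)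
    also have "\<dots> = (s ^ q) ^ 2" by (metis mult.commute power_mult)
    also have "s ^ q = s" using s(1) unfolding Fq_def cj_def by simp
    finally show ?thesis using s(2) by (simp add: power2_eq_square)
  qed
  have "U \<subseteq> M"
  proof
    fix v assume v: "v \<in> U"
    \<comment> \<open>Chosen so that the commutator of p with u has first coordinate s a + a =
      \<open>ap v\<close>.\<close>
    let ?a = "ap v / (s + 1)"
    have s1: "s + 1 \<noteq> 0" using s(3) by simp
    obtain b where "b + cj b = ?a * cj ?a" using trace_ex[OF Fq_norm] by blast
    then obtain u where u: "u \<in> U" "ap u = ?a" using U_ex by blast
    have uS: "u \<in> carrier S" using U_carrier u by blast
    let ?c = "p \<otimes> u \<otimes> inv p \<otimes> inv u"
    have cU: "?c \<in> U" by (intro U_mult U_conj U_inv p(1) u(1))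
    have "ap ?c = s * ?a + ?a" using ap_mult[OF U_conj[OF p(1) u(1)] U_inv[OF u(1)]] ap_conj[OF p(1) u(1)] sk p(2) u ap_inv by simp
    also have "\<dots> = (s + 1) * ?a" by (simp only: distrib_right mult_1_left)
    also have "\<dots> = ap v" using s1 by simp
    finally have ac: "ap ?c = ap v" .
    have "u \<otimes> p \<otimes> inv u \<in> M" using p(3) uS unfolding N_def by blast
    then have "inv (u \<otimes> p \<otimes> inv u) \<in> M" by (rule subgroup.m_inv_closed[OF M])
    then have "p \<otimes> inv (u \<otimes> p \<otimes> inv u) \<in> M" by (rule subgroup.m_closed[OF M NM[OF p(3)]])
    then have cM: "?c \<in> M" using pS uS by (simp add: inv_mult_group m_assoc)
    have "ap (inv ?c \<otimes> v) = 0" using ap_mult[OF U_inv[OF cU] v] ap_inv[OF cU] ac by simp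
    then have "inv ?c \<otimes> v \<in> Z" unfolding Z_def using U_mult[OF U_inv[OF cU] v] by simp
    then have "inv ?c \<otimes> v \<in> M" using NM ZN by blast
    then have "?c \<otimes> (inv ?c \<otimes> v) \<in> M" using subgroup.m_closed[OF M cM] by blast
    then show "v \<in> M" using U_carrier[OF cU] U_carrier[OF v] by (simp add: m_assoc[symmetric])
  qed
  then show ?thesis using P_subset_all[OF M _ NM[OF wN]] by blast
qed

end

section \<open>Generic elements of P and complements of U\<close>

context unitary3
begin

lemma subgroup_orbit:
  assumes M: "subgroup M S" and tr: "\<And>x. x \<in> Om \<Longrightarrow> \<exists>g\<in>M. act g pinf = x" and x: "x \<in> Om"
  shows "(q^3 + 1) * card {g\<in>M. act g x = x} = card M"
proof -
  have ac: "acts_on S M Om act" by (rule acts_on_subset[OF acts subgroup.subset[OF M]])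
  have MS: "g \<in> carrier S" if "g \<in> M" for g using subgroup.mem_carrier[OF M that] .
  have "(\<lambda>g. act g x) ` M = Om"
  proof
    show "(\<lambda>g. act g x) ` M \<subseteq> Om" using act_closed[OF MS x] by blast
    show "Om \<subseteq> (\<lambda>g. act g x) ` M"
    proof
      fix y assume "y \<in> Om"
      then obtain g where g: "g \<in> M" "act g pinf = y" using tr by blast
      obtain h where h: "h \<in> M" "act h pinf = x" using tr x by blast
      have "act (g \<otimes> inv h) x = y"
        using act_mult[OF MS[OF g(1)] inv_closed[OF MS[OF h(1)]] x] act_inv(1)[OF MS[OF h(1)] pinf] h g by simp
      moreover have "g \<otimes> inv h \<in> M" by (intro subgroup.m_closed[OF M] subgroup.m_inv_closed[OF M] g h)
      ultimately show "y \<in> (\<lambda>g. act g x) ` M" by blast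
    qed
  qed
  then show ?thesis using acts_on_orbit_stabilizer[OF ac M x] card_Om by simp
qed

lemma U_act_eqD:
  assumes u: "u \<in> U" and v: "v \<in> U" and e: "act u po = act v po" shows "u = v"
proof -
  have c: "u \<in> carrier S" "v \<in> carrier S" using U_carrier u v by auto
  have "act (inv v \<otimes> u) po = act (inv v) (act v po)" using act_mult[OF inv_closed[OF c(2)] c(1) po] e by simp
  then have "act (inv v \<otimes> u) po = po" using act_inv(1)[OF c(2) po] by simp
  then have "inv v \<otimes> u = \<one>" using U_fix[OF U_mult[OF U_inv[OF v] u] po] pinf_po by simp
  then show ?thesis using c by (metis inv_equality inv_inv inv_closed)
qed

text \<open>At most 1 + (q + 1) + 3 elements are excluded, the last three by
  \<open>cube_root\<close>, and this is less than q^2 for q >= 4.\<close>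

lemma generic_ex: "\<exists>t::'k. t \<noteq> 0 \<and> t ^ (q + 1) \<noteq> 1 \<and> t ^ (2 * q - 1) \<noteq> 1"
proof (rule ccontr)
  assume "\<not> ?thesis"
  then have "UNIV \<subseteq> {0::'k} \<union> {t. t ^ (q + 1) = 1} \<union> {t. t ^ 3 = 1}"
    using cube_root by auto
  then have "CARD('k) \<le> card ({0::'k} \<union> {t. t ^ (q + 1) = 1} \<union> {t. t ^ 3 = 1})" by (intro card_mono) auto
  also have "\<dots> \<le> card ({0::'k} \<union> {t. t ^ (q + 1) = 1}) + card {t::'k. t ^ 3 = 1}" by (rule card_Un_le)
  also have "\<dots> \<le> card {0::'k} + card {t::'k. t ^ (q + 1) = 1} + card {t::'k. t ^ 3 = 1}"
    by (intro add_mono card_Un_le) simp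
  also have "\<dots> \<le> 1 + (q + 1) + 3" using card_roots_of_unity[of 3, where 'a = 'k] norm_count by simp
  finally have "q^2 \<le> q + 5" using cardK by simp
  moreover have "4 * q \<le> q^2" using q_ge by (simp add: power2_eq_square)
  ultimately show False using q_ge by linarith
qed

text \<open>An element of P acts on U by conjugation without nontrivial fixed points when its diagonal
  entry is generic; hence the map sending v to the inverse of v times its conjugate is a bijection of U.\<close>

lemma generic_fixed_point:
  assumes p: "p \<in> P" and t1: "tp p ^ (q + 1) \<noteq> 1" and t2: "tp p ^ (2 * q - 1) \<noteq> 1"
  shows "\<exists>!x. x \<in> Om \<and> x \<noteq> pinf \<and> act p x = x"
proof -
  have pS: "p \<in> carrier S" using P_carrier p by blast
  let ?f = "\<lambda>v. inv v \<otimes> (p \<otimes> v \<otimes> inv p)"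
  have fU: "?f v \<in> U" if "v \<in> U" for v by (intro U_mult U_inv U_conj that p)
  \<comment> \<open>If v and v' have the same image, then v' v^-1 commutes with p. Its coordinate
    \<open>ap\<close> vanishes because the factor with exponent 2q - 1 is not 1, and then
    \<open>bp\<close> because the one with exponent q + 1 is not 1.\<close>
  have "inj_on ?f U"
  proof (rule inj_onI)
    fix v v' assume v: "v \<in> U" "v' \<in> U" and e: "?f v = ?f v'"
    have vS: "v \<in> carrier S" "v' \<in> carrier S" using U_carrier v by auto
    let ?c = "p \<otimes> v \<otimes> inv p" and ?c' = "p \<otimes> v' \<otimes> inv p"
    have cS: "?c \<in> carrier S" "?c' \<in> carrier S" using vS pS by auto
    let ?x = "v' \<otimes> inv v"
    have xU: "?x \<in> U" by (intro U_mult U_inv v)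
    have "v' \<otimes> ?f v = v' \<otimes> ?f v'" using e by simp
    then have "?x \<otimes> ?c = ?c'" using vS cS by (simp add: m_assoc[symmetric])
    then have "?x = ?c' \<otimes> inv ?c" using vS cS xU U_carrier by (metis inv_solve_right)
    also have "\<dots> = p \<otimes> ?x \<otimes> inv p" using vS pS by (simp add: inv_mult_group m_assoc inv_solve_left')
    finally have xx: "p \<otimes> ?x \<otimes> inv p = ?x" by simp
    have "tp p ^ (2 * q - 1) * ap ?x = ap ?x" using ap_conj[OF p xU] xx by simp
    then have a0: "ap ?x = 0" using t2 by simp
    then have xZ: "?x \<in> Z" unfolding Z_def using xU by simp
    have "tp p ^ (q + 1) * bp ?x = bp ?x" using bp_conj[OF p xZ] xx by simp
    then have "bp ?x = 0" using t1 by simp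
    then have "?x = \<one>" using U_eqI[OF xU U_one] a0 ap_one bp_one by simp
    then show "v = v'" using vS by (metis inv_equality inv_inv inv_closed)
  qed
  moreover have "finite U" using finite_subset[OF subgroup.subset[OF U_sub] finS] .
  ultimately have fb: "?f ` U = U" and inj: "inj_on ?f U" using endo_inj_surj[of U ?f] fU by blast+
  \<comment> \<open>Here p = \<open>u0\<close> h with h fixing \<open>po\<close>. A point v
    \<open>po\<close> is fixed by p exactly when \<open>?f v\<close> is the inverse of
    \<open>u0\<close>, so bijectivity of \<open>?f\<close> gives existence and uniqueness.\<close>
  obtain h where h: "h \<in> P" "tp h = tp p" "act h po = po" using tp_ex[OF tp_nz[OF p]] by blast
  have hS: "h \<in> carrier S" using P_carrier h by blast
  define u0 where "u0 = p \<otimes> inv h"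
  have u0: "u0 \<in> U" unfolding u0_def U_def using P_mult[OF p P_inv[OF h(1)]] tp_mult[OF p P_inv[OF h(1)]] tp_inv[OF h(1)] tp_nz[OF p] h by simp
  have u0S: "u0 \<in> carrier S" using U_carrier u0 by blast
  have ph: "p = u0 \<otimes> h" unfolding u0_def using pS hS by (simp add: m_assoc)
  have key: "act p (act v po) = act v po \<longleftrightarrow> ?f v = inv u0" if v: "v \<in> U" for v
  proof -
    have vS: "v \<in> carrier S" using U_carrier v by blast
    let ?c = "p \<otimes> v \<otimes> inv p"
    have cS: "?c \<in> carrier S" using vS pS by auto
    have "act p (act v po) = act (p \<otimes> v) po" using act_mult pS vS po by simp
    also have "p \<otimes> v = ?c \<otimes> p" using pS vS by (simp add: m_assoc)
    also have "\<dots> = (?c \<otimes> u0) \<otimes> h" unfolding m_assoc[OF cS u0S hS] ph[symmetric] ..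
    also have "act \<dots> po = act (?c \<otimes> u0) po" using act_mult[of "?c \<otimes> u0" h po] cS u0S hS po h by simp
    finally have 1: "act p (act v po) = act (?c \<otimes> u0) po" .
    have cU: "?c \<otimes> u0 \<in> U" by (intro U_mult U_conj p v u0)
    have vn: "act v po \<noteq> pinf"
    proof
      assume "act v po = pinf"
      then have "act v po = act v pinf" using U_pinf[OF U_P[OF v]] by simp
      then show False using act_eqD[OF vS po pinf] pinf_po by simp
    qed
    have "act (?c \<otimes> u0) po = act v po \<longleftrightarrow> ?c \<otimes> u0 = v"
      using U_act_eqD[OF cU v] by auto
    also have "\<dots> \<longleftrightarrow> ?f v = inv u0"
    proof
      assume "?c \<otimes> u0 = v"
      then have "?c = v \<otimes> inv u0" using cS u0S vS by (metis inv_solve_right)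
      then show "?f v = inv u0" using vS u0S by (simp add: m_assoc[symmetric])
    next
      assume "?f v = inv u0"
      then have "v \<otimes> ?f v \<otimes> u0 = v \<otimes> inv u0 \<otimes> u0" by simp
      then show "?c \<otimes> u0 = v" using vS cS u0S by (simp add: m_assoc[symmetric]) (simp add: m_assoc)
    qed
    finally show ?thesis using 1 by simp
  qed
  have "inv u0 \<in> ?f ` U" using fb U_inv[OF u0] by simp
  then obtain v where v: "v \<in> U" "?f v = inv u0" by (metis (no_types, lifting) imageE)
  have vS: "v \<in> carrier S" using U_carrier v by blast
  show ?thesis
  proof (rule ex1I[of _ "act v po"])
    have "act v po \<noteq> pinf"
    proof
      assume "act v po = pinf"
      then have "act v po = act v pinf" using U_pinf[OF U_P[OF v(1)]] by simp
      then show False using act_eqD[OF vS po pinf] pinf_po by simp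
    qed
    then show "act v po \<in> Om \<and> act v po \<noteq> pinf \<and> act p (act v po) = act v po"
      using act_closed[OF vS po] key[OF v(1)] v(2) by simp
    fix x assume x: "x \<in> Om \<and> x \<noteq> pinf \<and> act p x = x"
    then obtain v' where v': "v' \<in> U" "act v' po = x" using U_regular by blast
    then have "?f v' = inv u0" using key[OF v'(1)] x by simp
    then have "v' = v" using inj_onD[OF inj, of v' v] v v' by simp
    then show "x = act v po" using v' by simp
  qed
qed

text \<open>Otherwise S = UM and the intersection of M with P is a complement of U in P, so it contains a
  generic element. Hence the stabiliser in M of any point fixes exactly one other point, and this pairs off
  an odd number of points.\<close>

lemma no_complement:
  assumes M: "subgroup M S" and UM: "\<And>u. u \<in> U \<Longrightarrow> u \<in> M \<Longrightarrow> u = \<one>"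
    and card: "card (carrier S) \<le> q^3 * card M"
  shows False
proof -
  have MS: "g \<in> carrier S" if "g \<in> M" for g using subgroup.mem_carrier[OF M that] .
  have Mm: "g \<otimes> h \<in> M" if "g \<in> M" "h \<in> M" for g h using subgroup.m_closed[OF M that] .
  have Mi: "inv g \<in> M" if "g \<in> M" for g using subgroup.m_inv_closed[OF M that] .
  have finM: "finite M" using finite_subset[OF subgroup.subset[OF M] finS] .
  \<comment> \<open>U and M meet trivially, so the products u x are distinct, and by the bound on
    the index they fill S.\<close>
  have inj: "inj_on (\<lambda>(u, x). u \<otimes> x) (U \<times> M)"
  proof (rule inj_onI, clarify)
    fix u x v y assume h: "u \<in> U" "x \<in> M" "v \<in> U" "y \<in> M" "u \<otimes> x = v \<otimes> y"
    have c: "u \<in> carrier S" "v \<in> carrier S" "x \<in> carrier S" "y \<in> carrier S" using h U_carrier MS by auto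
    have "inv v \<otimes> u = y \<otimes> inv x"
    proof -
      have "inv v \<otimes> (u \<otimes> x) = y" using h(5) c by (simp add: m_assoc[symmetric])
      then show ?thesis using c by (metis inv_solve_right m_assoc m_closed inv_closed)
    qed
    moreover have "inv v \<otimes> u \<in> U" by (intro U_mult U_inv h)
    moreover have "y \<otimes> inv x \<in> M" by (intro Mm Mi h)
    ultimately have e: "inv v \<otimes> u = \<one>" "y \<otimes> inv x = \<one>" using UM by auto
    have "u = v" using e(1) c by (metis inv_equality inv_inv inv_closed)
    moreover have "y = x" using e(2) c by (metis inv_equality inv_inv inv_closed)
    ultimately show "u = v \<and> x = y" by simp
  qed
  have "card ((\<lambda>(u, x). u \<otimes> x) ` (U \<times> M)) = q^3 * card M"
    using card_image[OF inj] card_U by (simp add: card_cartesian_product)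
  moreover have sub: "(\<lambda>(u, x). u \<otimes> x) ` (U \<times> M) \<subseteq> carrier S" using U_carrier MS by auto
  moreover have "card ((\<lambda>(u, x). u \<otimes> x) ` (U \<times> M)) \<le> card (carrier S)" by (rule card_mono[OF finS sub])
  ultimately have eq: "card (carrier S) = q^3 * card M" and UMS: "(\<lambda>(u, x). u \<otimes> x) ` (U \<times> M) = carrier S"
    using card card_subset_eq[OF finS sub] by auto
  have tr: "\<exists>g\<in>M. act g pinf = x" if x: "x \<in> Om" for x
  proof -
    obtain g where g: "g \<in> carrier S" "act g pinf = x" using Om_trans[OF x] by blast
    have "inv g \<in> (\<lambda>(u, x). u \<otimes> x) ` (U \<times> M)" using UMS g(1) by simp
    then obtain u y where uy: "u \<in> U" "y \<in> M" "inv g = u \<otimes> y" by auto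
    have c: "u \<in> carrier S" "y \<in> carrier S" using uy U_carrier MS by auto
    have "g = inv y \<otimes> inv u" using uy(3) g(1) c by (metis inv_inv inv_mult_group)
    then have "act (inv y) pinf = x" using g(2) act_mult[OF inv_closed[OF c(2)] inv_closed[OF c(1)] pinf]
        U_pinf[OF P_inv[OF U_P[OF uy(1)]]] by simp
    then show ?thesis using Mi[OF uy(2)] by blast
  qed
  have q0: "q > 0" using q_ge by simp
  have cM: "card M = (q^3 + 1) * (q^2 - 1)"
  proof -
    have "q^3 * card M = q^3 * ((q^3 + 1) * (q^2 - 1))" using eq card_S card_P by (simp add: algebra_simps)
    then show ?thesis using q0 by simp
  qed
  define st where "st x = {g\<in>M. act g x = x}" for x
  have cst: "card (st x) = q^2 - 1" if "x \<in> Om" for x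
  proof -
    have "(q^3 + 1) * card (st x) = (q^3 + 1) * (q^2 - 1)" using subgroup_orbit[OF M tr that] cM unfolding st_def by simp
    then show ?thesis by (simp only: mult_cancel1) simp
  qed
  have stP: "st pinf = M \<inter> P" unfolding st_def P_def using MS by blast
  have inj_tp: "inj_on tp (M \<inter> P)"
  proof (rule inj_onI)
    fix x y assume h: "x \<in> M \<inter> P" "y \<in> M \<inter> P" "tp x = tp y"
    have c: "x \<in> carrier S" "y \<in> carrier S" using h P_carrier by auto
    have "x \<otimes> inv y \<in> U" unfolding U_def using h P_mult P_inv tp_mult tp_inv tp_nz by auto
    moreover have "x \<otimes> inv y \<in> M" using h Mm Mi by blast
    ultimately have "x \<otimes> inv y = \<one>" by (rule UM)
    then show "x = y" using c by (metis inv_equality inv_inv inv_closed)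
  qed
  \<comment> \<open>M \<inter> P has order q^2 - 1, and \<open>tp\<close> is injective on it because
    its kernel is U \<inter> M. So every nonzero value occurs, and M \<inter> P is
    commutative.\<close>
  have tp_im: "tp ` (M \<inter> P) = UNIV - {0}"
  proof (rule card_subset_eq)
    show "tp ` (M \<inter> P) \<subseteq> UNIV - {0}" using tp_nz by auto
    show "card (tp ` (M \<inter> P)) = card (UNIV - {0::'k})" using card_image[OF inj_tp] cst[OF pinf] stP cardK by simp
  qed simp
  have comm: "x \<otimes> y = y \<otimes> x" if "x \<in> M \<inter> P" "y \<in> M \<inter> P" for x y
  proof (rule inj_onD[OF inj_tp])
    show "tp (x \<otimes> y) = tp (y \<otimes> x)" using tp_mult that by (simp add: mult.commute)
    show "x \<otimes> y \<in> M \<inter> P" "y \<otimes> x \<in> M \<inter> P" using that Mm P_mult by auto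
  qed
  obtain t :: 'k where t: "t \<noteq> 0" "t ^ (q + 1) \<noteq> 1" "t ^ (2 * q - 1) \<noteq> 1" using generic_ex by blast
  have "t \<in> tp ` (M \<inter> P)" using tp_im t by simp
  then obtain p where p: "p \<in> M \<inter> P" "tp p = t" by blast
  \<comment> \<open>A generic p has a unique fixed point besides \<open>pinf\<close>, and the
    commutative group M \<inter> P containing p must fix that point too.\<close>
  have ex1: "\<exists>!y. y \<in> Om \<and> y \<noteq> pinf \<and> (\<forall>g\<in>st pinf. act g y = y)"
  proof -
    have pP: "p \<in> P" "p \<in> M" using p by auto
    obtain y where y: "y \<in> Om" "y \<noteq> pinf" "act p y = y" and un: "\<And>z. z \<in> Om \<Longrightarrow> z \<noteq> pinf \<Longrightarrow> act p z = z \<Longrightarrow> z = y"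
      using generic_fixed_point[OF pP(1)] p(2) t by blast
    have "act g y = y" if g: "g \<in> st pinf" for g
    proof (rule un)
      have gS: "g \<in> carrier S" "act g pinf = pinf" "g \<in> M \<inter> P" using g MS stP unfolding st_def by auto
      show "act g y \<in> Om" using act_closed[OF gS(1) y(1)] .
      show "act g y \<noteq> pinf" using act_eqD[OF gS(1) y(1) pinf] gS(2) y(2) by auto
      have "act p (act g y) = act (p \<otimes> g) y" using act_mult[OF P_carrier[OF pP(1)] gS(1) y(1)] by simp
      also have "p \<otimes> g = g \<otimes> p" using comm p gS by blast
      also have "act (g \<otimes> p) y = act g y" using act_mult[OF gS(1) P_carrier[OF pP(1)] y(1)] y(3) by simp
      finally show "act p (act g y) = act g y" .
    qed
    moreover have "p \<in> st pinf" using stP p by blast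
    ultimately show ?thesis using y un by (intro ex1I[of _ y]) blast+
  qed
  have ex1': "\<exists>!y. y \<in> Om \<and> y \<noteq> x \<and> (\<forall>g\<in>st x. act g y = y)" if x: "x \<in> Om" for x
  proof -
    obtain k where k: "k \<in> M" "act k pinf = x" using tr[OF x] by blast
    have kS: "k \<in> carrier S" "inv k \<in> carrier S" using MS k by auto
    have kx: "act (inv k) x = pinf" using k(2) act_inv(1)[OF kS(1) pinf] by simp
    have conj: "inv k \<otimes> g \<otimes> k \<in> st pinf" if g: "g \<in> st x" for g
    proof -
      have g': "g \<in> M" "act g x = x" "g \<in> carrier S" using g MS unfolding st_def by auto
      have "act (inv k \<otimes> g \<otimes> k) pinf = act (inv k) (act g (act k pinf))" using kS g' pinf act_closed by (simp add: act_mult)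
      then show ?thesis unfolding st_def using k g' kx Mm Mi by simp
    qed
    have conj2: "k \<otimes> g \<otimes> inv k \<in> st x" if g: "g \<in> st pinf" for g
    proof -
      have g': "g \<in> M" "act g pinf = pinf" "g \<in> carrier S" using g MS unfolding st_def by auto
      have "act (k \<otimes> g \<otimes> inv k) x = act k (act g (act (inv k) x))" using kS g' x act_closed by (simp add: act_mult)
      then show ?thesis unfolding st_def using k g' kx Mm Mi by simp
    qed
    obtain y where y: "y \<in> Om" "y \<noteq> pinf" "\<And>g. g \<in> st pinf \<Longrightarrow> act g y = y"
      and un: "\<And>z. z \<in> Om \<Longrightarrow> z \<noteq> pinf \<Longrightarrow> (\<And>g. g \<in> st pinf \<Longrightarrow> act g z = z) \<Longrightarrow> z = y" using ex1 by (metis (no_types, lifting))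
    show ?thesis
    proof (rule ex1I[of _ "act k y"])
      have "act g (act k y) = act k y" if g: "g \<in> st x" for g
      proof -
        have gS: "g \<in> carrier S" using g MS unfolding st_def by blast
        have "act k (act (inv k \<otimes> g \<otimes> k) y) = act k y" using y(3)[OF conj[OF g]] by simp
        moreover have "act (inv k \<otimes> g \<otimes> k) y = act (inv k) (act g (act k y))" using kS gS y(1) act_closed by (simp add: act_mult)
        ultimately show ?thesis using act_inv(2)[OF kS(1)] act_closed gS kS y(1) by simp
      qed
      moreover have "act k y \<noteq> x" using act_eqD[OF kS(1) y(1) pinf] k(2) y(2) by auto
      ultimately show "act k y \<in> Om \<and> act k y \<noteq> x \<and> (\<forall>g\<in>st x. act g (act k y) = act k y)"
        using act_closed[OF kS(1) y(1)] by blast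
      fix z assume z: "z \<in> Om \<and> z \<noteq> x \<and> (\<forall>g\<in>st x. act g z = z)"
      have "act (inv k) z = y"
      proof (rule un)
        show "act (inv k) z \<in> Om" using act_closed kS z by blast
        show "act (inv k) z \<noteq> pinf" using act_eqD[OF kS(2), of z x] kx z x by auto
        fix g assume g: "g \<in> st pinf"
        have gS: "g \<in> carrier S" using g MS unfolding st_def by blast
        have "act (k \<otimes> g \<otimes> inv k) z = z" using conj2[OF g] z by blast
        moreover have "act (k \<otimes> g \<otimes> inv k) z = act k (act g (act (inv k) z))" using kS gS z act_closed by (simp add: act_mult)
        ultimately have "act (inv k) (act k (act g (act (inv k) z))) = act (inv k) z" by simp
        then show "act g (act (inv k) z) = act (inv k) z" using act_inv(1)[OF kS(1)] act_closed gS kS z by simp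
      qed
      then show "z = act k y" using act_inv(2)[OF kS(1)] z by auto
    qed
  qed
  define \<sigma> where "\<sigma> x = (THE y. y \<in> Om \<and> y \<noteq> x \<and> (\<forall>g\<in>st x. act g y = y))" for x
  have sig: "\<sigma> x \<in> Om" "\<sigma> x \<noteq> x" "\<And>g. g \<in> st x \<Longrightarrow> act g (\<sigma> x) = \<sigma> x" if "x \<in> Om" for x
    using theI'[OF ex1'[OF that]] unfolding \<sigma>_def[symmetric] by blast+
  have sigu: "\<sigma> x = y" if "x \<in> Om" "y \<in> Om" "y \<noteq> x" "\<And>g. g \<in> st x \<Longrightarrow> act g y = y" for x y
    unfolding \<sigma>_def by (rule the1_equality[OF ex1'[OF that(1)]]) (use that in blast)
  have "even (card Om)"
  proof (rule even_card_involution[OF finOm])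
    fix x assume x: "x \<in> Om"
    show "\<sigma> x \<in> Om" "\<sigma> x \<noteq> x" using sig[OF x] by auto
    \<comment> \<open>Both stabilisers have order q^2 - 1, so the inclusion is an equality and the
      pairing is symmetric.\<close>
    have "st x \<subseteq> st (\<sigma> x)" using sig(3)[OF x] unfolding st_def by blast
    moreover have "finite (st (\<sigma> x))" unfolding st_def using finM by simp
    moreover have "card (st x) = card (st (\<sigma> x))" using cst x sig(1)[OF x] by simp
    ultimately have eq: "st x = st (\<sigma> x)" using card_subset_eq by blast
    show "\<sigma> (\<sigma> x) = x"
    proof (rule sigu[OF sig(1)[OF x] x])
      show "x \<noteq> \<sigma> x" using sig(2)[OF x] by simp
      fix g assume "g \<in> st (\<sigma> x)"
      then have "g \<in> st x" using eq by simp
      then show "act g x = x" unfolding st_def by simp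
    qed
  qed
  then show False using card_Om q_even by simp
qed

end

text \<open>Euclid on the exponents: 2^(r + k) - 1 = 2^r (2^k - 1) + (2^r - 1).\<close>

lemma pow2_minus_1_dvd:
  assumes "1 \<le> k" "(2^k - 1 :: nat) dvd 2^n - 1" shows "k dvd n"
  using assms(2)
proof (induction n rule: less_induct)
  case (less n)
  show ?case
  proof (cases "n < k")
    case True
    then have "(2::nat)^n < 2^k" by simp
    then have "(2::nat)^n - 1 < 2^k - 1" by (simp add: diff_less_mono)
    then have "(2::nat)^n - 1 = 0" using less.prems dvd_imp_le by (metis gr0I leD)
    moreover have "(2::nat) ^ 1 \<le> 2 ^ n" if "n \<noteq> 0" using that by (intro power_increasing) auto
    ultimately have "n = 0" by fastforce
    then show ?thesis by simp
  next
    case False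
    define r where "r = n - k"
    have n: "n = r + k" using False unfolding r_def by simp
    have "(2::nat)^n - 1 = 2^r * (2^k - 1) + (2^r - 1)"
    proof -
      have "(2::nat)^n = 2^r * 2^k" using n by (simp add: power_add)
      moreover have "(2::nat)^r * 2^k \<ge> 2^r" by simp
      moreover have "(2::nat)^r \<ge> 1" by simp
      ultimately show ?thesis by (simp add: algebra_simps)
    qed
    then have "(2^k - 1 :: nat) dvd 2^r - 1" using less.prems by (metis dvd_add_right_iff dvd_triv_right)
    then have "k dvd r" using less.IH[of r] n assms(1) by simp
    then show ?thesis using n by simp
  qed
qed

section \<open>Subgroups of small index\<close>

text \<open>Q, a and c will be the orders of M \<inter> Z, of the image of M \<inter> U in U/Z, and
  of the image of M \<inter> P under \<open>tp\<close>. Within the last group c2 counts the elements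
  of norm 1, and d and \<kappa> are the orders of image and kernel of t^(2q - 1). The last
  hypothesis is the index bound. With q = Q^l, size excludes a = 1; for l >= 3 it leaves Q = 2 and q
  = 8; for l = 2 divisibility makes c too small.\<close>

lemma index_arithmetic:
  fixes q Q a c c2 d \<kappa> m k j :: nat
  assumes q: "q = 2^m" and Q: "Q = 2^k" "1 \<le> k" "k < m" "Q - 1 dvd q - 1"
    and a: "a = 2^j" "a \<le> Q * Q" and c: "c = (Q - 1) * c2" "c2 dvd q + 1"
    and d: "c = d * \<kappa>" "d dvd a - 1" "\<kappa> \<le> 3" "q mod 3 = 1 \<Longrightarrow> \<kappa> = 1"
    and le: "q * q - 1 \<le> c * a * Q"
  shows "q = 8 \<and> Q = 2 \<and> c = 9 \<and> a = 4"
proof -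
  have km: "k dvd m" using pow2_minus_1_dvd[OF Q(2)] Q(1,4) q by simp
  then obtain l where l: "m = k * l" by blast
  have l2: "2 \<le> l" using Q(3) l by (cases l; cases "l - 1") auto
  have Q2: "2 \<le> Q" using Q(1,2) power_increasing[of 1 k "2::nat"] by simp
  have qQ: "Q * Q \<le> q"
  proof -
    have "Q * Q = 2 ^ (k * 2)" using Q(1) by (simp add: power_mult power2_eq_square)
    also have "\<dots> \<le> 2 ^ m" by (rule power_increasing) (use l l2 in auto)
    finally show ?thesis using q by simp
  qed
  have q0: "4 \<le> q" using qQ mult_le_mono[OF Q2 Q2] by simp
  have qq: "q * q - 1 = (q - 1) * (q + 1)" by (simp add: algebra_simps)
  show ?thesis
  proof (cases "a = 1")
    case True
    have "c2 \<le> q + 1" using c(2) by (rule dvd_imp_le) simp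
    then have "((Q - 1) * Q) * c2 \<le> ((Q - 1) * Q) * (q + 1)" by (rule mult_le_mono2)
    moreover have "c * a * Q = ((Q - 1) * Q) * c2" using True c(1) by (simp only: mult_1_right mult_ac)
    ultimately have "c * a * Q \<le> ((Q - 1) * Q) * (q + 1)" by (simp only:)
    then have "(q - 1) * (q + 1) \<le> ((Q - 1) * Q) * (q + 1)" using le qq by linarith
    then have "q - 1 \<le> (Q - 1) * Q" by (simp only: mult_le_cancel2)
    then have "q - 1 \<le> Q * Q - Q" by (simp add: diff_mult_distrib)
    moreover have "Q \<le> Q * Q" using Q2 by simp
    ultimately have False using qQ Q2 by linarith
    then show ?thesis ..
  next
    case False
    then have a2: "2 \<le> a" "1 \<le> j" using a(1) by (cases j; simp)+
    have da: "d \<le> a - 1" using d(2) a2 by (intro dvd_imp_le) auto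
    have "l = 2 \<or> 3 \<le> l" using l2 by auto
    then show ?thesis
    proof
      \<comment> \<open>Now Q^3 <= q, while c <= 3(a - 1) and a <= Q^2. The index bound then puts
        Q^6 - 1 below 3 Q^5, which is impossible for Q >= 4.\<close>
      assume l3: "3 \<le> l"
      have qQ3: "Q * Q * Q \<le> q"
      proof -
        have "Q * Q * Q = 2 ^ (k * 3)" using Q(1) by (simp add: power_mult power3_eq_cube)
        also have "\<dots> \<le> 2 ^ m" by (rule power_increasing) (use l l3 in auto)
        finally show ?thesis using q by simp
      qed
      have c3: "c \<le> 3 * (a - 1)" using d(1,3) da by (metis mult.commute mult_le_mono)
      have aQ: "(a - 1) * a \<le> (Q * Q - 1) * (Q * Q)" using a(2) by (intro mult_le_mono) auto
      have "c * a * Q \<le> 3 * ((a - 1) * a) * Q" using c3 by (simp add: mult_le_mono1 mult.assoc[symmetric])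
      also have "\<dots> \<le> 3 * ((Q * Q - 1) * (Q * Q)) * Q" using aQ by (intro mult_le_mono1 mult_le_mono2)
      finally have le2: "q * q - 1 \<le> 3 * ((Q * Q - 1) * (Q * Q)) * Q" using le by linarith
      have "k = 1"
      proof (rule ccontr)
        assume "k \<noteq> 1"
        then have "(2::nat) ^ 2 \<le> 2 ^ k" by (intro power_increasing) (use Q(2) in auto)
        then have Q4: "4 \<le> Q" using Q(1) by simp
        define X where "X = Q * Q * Q * Q * Q"
        have "Q * X \<le> q * q" unfolding X_def using mult_le_mono[OF qQ3 qQ3] by (simp add: mult_ac)
        moreover have "4 * X \<le> Q * X" using Q4 by simp
        moreover have "3 * ((Q * Q - 1) * (Q * Q)) * Q \<le> 3 * X"
        proof -
          have "(Q * Q - 1) * (Q * Q) * Q \<le> (Q * Q) * (Q * Q) * Q" by (intro mult_le_mono1) simp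
          then show ?thesis unfolding X_def by (simp add: mult_ac)
        qed
        moreover have "X \<ge> 4" unfolding X_def using Q4 by (metis Q2 dvd_imp_le dvd_triv_right le_trans mult_eq_0_iff not_gr0 not_numeral_le_zero)
        ultimately show False using le2 by linarith
      qed
      then have Qe: "Q = 2" using Q(1) by simp
      \<comment> \<open>For Q = 2 the bound is 3 (4 - 1) 4 2 = 72.\<close>
      have "q * q \<le> 73" using le2 Qe by simp
      then have "q < 9" using mult_le_mono[of 9 q 9 q] by (cases "q < 9") auto
      then have q8: "q = 8"
      proof -
        have "m < 4"
        proof (rule ccontr)
          assume "\<not> m < 4"
          then have "(2::nat)^4 \<le> 2^m" by (intro power_increasing) auto
          then show False using q \<open>q < 9\<close> by simp
        qed
        moreover have "m \<ge> 3" using l l3 \<open>k = 1\<close> by simp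
        ultimately have "m = 3" by simp
        then show ?thesis using q by simp
      qed
      have a4: "a \<le> 4" using a(2) Qe by simp
      have "c = c2" using c(1) Qe by simp
      then have c9: "c dvd 9" using c(2) q8 by simp
      then have "c \<le> 9" by (rule dvd_imp_le) simp
      have le3: "63 \<le> c * a * 2" using le q8 Qe by simp
      have "j = 1 \<or> j = 2"
      proof -
        have "j < 3"
        proof (rule ccontr)
          assume "\<not> j < 3"
          then have "(2::nat)^3 \<le> 2^j" by (intro power_increasing) auto
          then show False using a(1) a4 by simp
        qed
        then show ?thesis using a2 by auto
      qed
      then have aa: "a = 2 \<or> a = 4" using a(1) by auto
      have "a \<noteq> 2" using le3 \<open>c \<le> 9\<close> by auto
      then have ae: "a = 4" using aa by simp
      then have "8 \<le> c" using le3 by simp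
      then have "c = 8 \<or> c = 9" using \<open>c \<le> 9\<close> by auto
      then have "c = 9" using c9 by auto
      then show ?thesis using q8 Qe ae by simp
    next
      assume l2: "l = 2"
      have qe: "q = Q * Q" using q l l2 Q(1) by (simp add: power_mult power2_eq_square)
      \<comment> \<open>For q = Q^2 one has q = 1 modulo 3, so t^(2q - 1) has trivial kernel and c
        itself divides a - 1.\<close>
      have "q = 4 ^ k" using qe Q(1) by (simp add: power_mult_distrib[symmetric])
      moreover have "(4::nat) ^ k mod 3 = 1" by (induction k) (simp_all add: mod_mult_eq[of 4 3, symmetric])
      ultimately have "\<kappa> = 1" using d(4) by simp
      then have cd: "c dvd a - 1" using d(1,2) by simp
      have "Q - 1 dvd a - 1" using cd c(1) by (metis dvd_mult_left)
      then have "k dvd j" using pow2_minus_1_dvd[OF Q(2)] Q(1) a(1) by simp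
      then obtain i where i: "j = k * i" by blast
      have "j \<le> k * 2"
      proof (rule ccontr)
        assume "\<not> j \<le> k * 2"
        then have "(2::nat) ^ (k * 2) < 2 ^ j" by simp
        then show False using a Q(1) by (simp add: power_mult power2_eq_square)
      qed
      then have "i \<le> 2" using i Q(2) by simp
      moreover have "i \<noteq> 0" using i a2 by auto
      ultimately have "i = 1 \<or> i = 2" by auto
      \<comment> \<open>For a = Q, the number (Q - 1) c2 divides Q - 1. For a = Q^2, c2 divides Q +
        1, hence Q^2 - 1, as well as q + 1 = Q^2 + 1; so it divides 2, and it is odd since q + 1
        is.\<close>
      then have c21: "c2 = 1"
      proof
        assume "i = 1"
        then have "a = Q" using i a(1) Q(1) by simp
        then have "(Q - 1) * c2 dvd (Q - 1) * 1" using cd c(1) by simp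
        moreover have "0 < Q - 1" using Q2 by simp
        ultimately have "c2 dvd 1" by (metis dvd_mult_cancel)
        then show ?thesis by simp
      next
        assume "i = 2"
        then have "a = Q * Q" using i a(1) Q(1) by (simp add: power_mult power2_eq_square)
        then have "(Q - 1) * c2 dvd (Q - 1) * (Q + 1)" using cd c(1) by (simp add: algebra_simps)
        moreover have "0 < Q - 1" using Q2 by simp
        ultimately have c2Q: "c2 dvd Q + 1" by (metis dvd_mult_cancel)
        then have "c2 dvd (Q + 1) * (Q - 1)" by (rule dvd_mult2)
        then have "c2 dvd Q * Q - 1" by (simp add: algebra_simps)
        moreover have "c2 dvd Q * Q + 1" using c(2) qe by simp
        ultimately have "c2 dvd (Q * Q + 1) - (Q * Q - 1)" by (rule dvd_diff_nat[rotated])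
        moreover have "(Q * Q + 1) - (Q * Q - 1) = 2" using Q2 by (cases "Q * Q") auto
        ultimately have "c2 dvd 2" by simp
        then have "c2 = 1 \<or> c2 = 2" using two_is_prime_nat prime_nat_iff by blast
        moreover have "c2 \<noteq> 2"
        proof
          assume "c2 = 2"
          then have "even (q + 1)" using c(2) by simp
          moreover have "even q" using q Q(2,3) by simp
          ultimately show False by simp
        qed
        ultimately show ?thesis by simp
      qed
      have "q * q - 1 \<le> (Q - 1) * (Q * Q) * Q"
      proof -
        have "c * a * Q \<le> (Q - 1) * (Q * Q) * Q" using c(1) c21 a(2) by (intro mult_le_mono1) (simp add: mult_le_mono2)
        then show ?thesis using le by linarith
      qed
      also have "\<dots> = q * q - Q * Q * Q" unfolding qe by (simp add: diff_mult_distrib mult.assoc)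
      finally have "q * q - 1 \<le> q * q - Q * Q * Q" .
      moreover have "Q * Q * Q \<le> q * q" using qe Q2 by simp
      moreover have "8 \<le> Q * Q * Q" using mult_le_mono[OF mult_le_mono[OF Q2 Q2] Q2] by simp
      ultimately have False by linarith
      then show ?thesis ..
    qed
  qed
qed

section \<open>Pairs of involutions\<close>

context group
begin

lemma pow_swap: assumes "x \<in> carrier G" "y \<in> carrier G"
  shows "x \<otimes> (y \<otimes> x) [^] (k::nat) = (x \<otimes> y) [^] k \<otimes> x"
proof (induction k)
  case (Suc k)
  have "x \<otimes> (y \<otimes> x) [^] Suc k = (x \<otimes> (y \<otimes> x) [^] k) \<otimes> (y \<otimes> x)" using assms by (simp add: m_assoc)
  also have "\<dots> = (x \<otimes> y) [^] k \<otimes> (x \<otimes> y) \<otimes> x" unfolding Suc using assms by (simp add: m_assoc)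
  finally show ?case by simp
qed (use assms in simp)

lemma involution_pair:
  assumes x: "x \<in> carrier G" "x \<otimes> x = \<one>" and y: "y \<in> carrier G" "y \<otimes> y = \<one>"
  shows "inv ((x \<otimes> y) [^] (k::nat)) = (y \<otimes> x) [^] k"
proof -
  have "inv x = x" "inv y = y" using assms inv_equality by auto
  then have "inv (x \<otimes> y) = y \<otimes> x" using assms by (simp add: inv_mult_group)
  then show ?thesis using nat_pow_inv[of "x \<otimes> y" k] x(1) y(1) by simp
qed

text \<open>In the dihedral group of x and y the rotation c = x y is inverted by x, so conjugating x
  by c^l gives c^(2l) x = c^-1 x = y.\<close>

lemma involutions_conj_odd:
  assumes x: "x \<in> carrier G" "x \<otimes> x = \<one>" and y: "y \<in> carrier G" "y \<otimes> y = \<one>"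
    and odd: "(x \<otimes> y) [^] (2 * l + 1 :: nat) = \<one>"
  shows "(x \<otimes> y) [^] l \<otimes> x \<otimes> inv ((x \<otimes> y) [^] l) = y"
proof -
  let ?c = "x \<otimes> y"
  have c: "?c \<in> carrier G" using x y by simp
  have "?c [^] l \<otimes> x \<otimes> inv (?c [^] l) = ?c [^] l \<otimes> (x \<otimes> (y \<otimes> x) [^] l)"
    using involution_pair[OF assms(1-4), of l] x y by (simp add: m_assoc)
  also have "\<dots> = (?c [^] l \<otimes> ?c [^] l) \<otimes> x" unfolding pow_swap[OF x(1) y(1)] using x y by (simp add: m_assoc)
  also have "?c [^] l \<otimes> ?c [^] l = ?c [^] (2 * l)" using c by (simp add: nat_pow_mult mult_2)
  also have "?c [^] (2 * l) = inv ?c"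
  proof -
    have "?c [^] (2 * l) \<otimes> ?c = \<one>" using odd by simp
    then show ?thesis using inv_equality[of "?c [^] (2 * l)" ?c] c by simp
  qed
  also have "inv ?c = y \<otimes> x" using involution_pair[OF assms(1-4), of 1] x y by simp
  also have "y \<otimes> x \<otimes> x = y" using x y by (simp add: m_assoc)
  finally show ?thesis .
qed

text \<open>Conjugation by x or y sends c^l, for c = x y, to its inverse (y x)^l, which here equals
  c^l: the middle rotation of a dihedral group is central.\<close>

lemma involutions_even:
  assumes x: "x \<in> carrier G" "x \<otimes> x = \<one>" and y: "y \<in> carrier G" "y \<otimes> y = \<one>"
    and ev: "(x \<otimes> y) [^] (2 * l :: nat) = \<one>"
  defines "t \<equiv> (x \<otimes> y) [^] l"
  shows "t \<otimes> t = \<one>" "x \<otimes> t = t \<otimes> x" "y \<otimes> t = t \<otimes> y"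
proof -
  have c: "x \<otimes> y \<in> carrier G" using x y by simp
  have tS: "t \<in> carrier G" unfolding t_def using c by simp
  show tt: "t \<otimes> t = \<one>" unfolding t_def using c ev by (simp add: nat_pow_mult mult_2)
  then have "inv t = t" using inv_equality tS by blast
  then have t2: "(y \<otimes> x) [^] l = t" using involution_pair[OF assms(1-4), of l] unfolding t_def by simp
  show "x \<otimes> t = t \<otimes> x" using pow_swap[OF x(1) y(1), of l] t2 unfolding t_def by simp
  show "y \<otimes> t = t \<otimes> y" using pow_swap[OF y(1) x(1), of l] t2 unfolding t_def by simp
qed

end

context unitary3
begin

text \<open>Moved to \<open>pinf\<close>, t has a diagonal entry of square 1, which is 1 in
  characteristic 2; so it lies in U, where only the identity fixes a second point.\<close>

lemma involution_fix_unique: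
  assumes t: "t \<in> carrier S" "t \<otimes> t = \<one>" and x: "x \<in> Om" "act t x = x" and y: "y \<in> Om" "act t y = y" and ne: "x \<noteq> y"
  shows "t = \<one>"
proof -
  obtain g where g: "g \<in> carrier S" "act g pinf = x" using Om_trans[OF x(1)] by blast
  have gi: "inv g \<in> carrier S" using g by simp
  let ?t = "inv g \<otimes> t \<otimes> g"
  have tS: "?t \<in> carrier S" using g t by simp
  have "act ?t pinf = pinf"
    using act_mult g t x pinf act_closed act_inv(1)[OF g(1) pinf] by simp
  then have tP: "?t \<in> P" unfolding P_def using tS by simp
  have "?t \<otimes> ?t = inv g \<otimes> t \<otimes> (g \<otimes> inv g) \<otimes> t \<otimes> g" using g(1) t(1) by (simp only: m_assoc m_closed inv_closed)
  also have "\<dots> = inv g \<otimes> (t \<otimes> t) \<otimes> g" using g(1) t(1) by (simp del: t add: m_assoc)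
  also have "\<dots> = \<one>" using t g by simp
  finally have "?t \<otimes> ?t = \<one>" .
  then have "tp ?t * tp ?t = 1" using tp_mult[OF tP tP] tp_one by simp
  then have "(tp ?t + 1) * (tp ?t + 1) = 0" by (simp add: algebra_simps)
  then have "tp ?t = 1" by simp
  then have tU: "?t \<in> U" unfolding U_def using tP by simp
  let ?y = "act (inv g) y"
  have yO: "?y \<in> Om" using act_closed gi y by blast
  have yn: "?y \<noteq> pinf"
  proof
    assume "?y = pinf"
    then have "act g ?y = x" using g by simp
    then show False using act_inv(2)[OF g(1) y(1)] ne by simp
  qed
  have "act ?t ?y = ?y" using act_mult[OF _ g(1) yO] act_mult[OF gi t(1)] act_inv(2)[OF g(1) y(1)] y t gi by simp
  then have "?t = \<one>" using U_fix[OF tU yO yn] by blast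
  then have "g \<otimes> ?t \<otimes> inv g = \<one>" using g by simp
  moreover have "g \<otimes> ?t \<otimes> inv g = (g \<otimes> inv g) \<otimes> t \<otimes> (g \<otimes> inv g)" using g t by (simp only: m_assoc m_closed inv_closed)
  ultimately show ?thesis using g t by simp
qed

text \<open>If x y had even order, its middle power t would commute with x and y and so preserve
  their unique fixed points p and r; with two fixed points t would be trivial. Hence x y has odd
  order, and x and y are conjugate in the dihedral group they generate.\<close>

lemma involutions_conj:
  assumes M: "subgroup M S" and x: "x \<in> M" "x \<noteq> \<one>" "x \<otimes> x = \<one>" "p \<in> Om" "act x p = p"
    and y: "y \<in> M" "y \<noteq> \<one>" "y \<otimes> y = \<one>" "r \<in> Om" "act y r = r" and ne: "p \<noteq> r"
  shows "\<exists>h\<in>M. h \<otimes> x \<otimes> inv h = y"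
proof -
  have xS: "x \<in> carrier S" and yS: "y \<in> carrier S" using x y subgroup.mem_carrier[OF M] by auto
  let ?c = "x \<otimes> y"
  have c: "?c \<in> carrier S" using xS yS by simp
  have cM: "?c \<in> M" using subgroup.m_closed[OF M x(1) y(1)] .
  have pM: "?c [^] (k::nat) \<in> M" for k
    by (induction k) (use subgroup.one_closed[OF M] subgroup.m_closed[OF M] cM in auto)
  let ?N = "ord ?c"
  have N1: "1 \<le> ?N" using ord_ge_1[OF finS c] .
  have Ne: "?c [^] ?N = \<one>" using pow_ord_eq_1[OF c] .
  show ?thesis
  proof (cases "even ?N")
    case False
    then obtain l where "?N = 2 * l + 1" by (rule oddE)
    then have "?c [^] l \<otimes> x \<otimes> inv (?c [^] l) = y" using involutions_conj_odd[OF xS x(3) yS y(3), of l] Ne by simp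
    then show ?thesis using pM by blast
  next
    case True
    then obtain l where l: "?N = 2 * l" by (rule evenE)
    let ?t = "?c [^] l"
    have tS: "?t \<in> carrier S" using c by simp
    note tt = involutions_even[OF xS x(3) yS y(3), of l, OF Ne[unfolded l]]
    have "?t \<noteq> \<one>"
    proof
      assume "?t = \<one>"
      then have "?N dvd l" using pow_eq_id[OF c] by simp
      then show False using l N1 dvd_imp_le[of ?N l] by (cases l) auto
    qed
    moreover have "act ?t p = p"
    proof (rule ccontr)
      assume n: "act ?t p \<noteq> p"
      have tp': "act ?t p \<in> Om" using act_closed[OF tS x(4)] .
      have "act x (act ?t p) = act (x \<otimes> ?t) p" using act_mult[OF xS tS x(4)] by simp
      also have "\<dots> = act ?t p" unfolding tt(2) using act_mult[OF tS xS x(4)] x(5) by simp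
      finally have "x = \<one>" using involution_fix_unique[OF xS x(3) tp' _ x(4,5) n] by blast
      then show False using x(2) by blast
    qed
    moreover have "act ?t r = r"
    proof (rule ccontr)
      assume n: "act ?t r \<noteq> r"
      have tp': "act ?t r \<in> Om" using act_closed[OF tS y(4)] .
      have "act y (act ?t r) = act (y \<otimes> ?t) r" using act_mult[OF yS tS y(4)] by simp
      also have "\<dots> = act ?t r" unfolding tt(3) using act_mult[OF tS yS y(4)] y(5) by simp
      finally have "y = \<one>" using involution_fix_unique[OF yS y(3) tp' _ y(4,5) n] by blast
      then show False using y(2) by blast
    qed
    ultimately have False using involution_fix_unique[OF tS tt(1) x(4) _ y(4) _ ne] by blast
    then show ?thesis ..
  qed
qed

text \<open>Gleason's parity argument: each point is the only fixed point of some involution of M, so an orbit of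
  M is odd, by an involution fixing a point inside, and even, by one fixing a point outside.\<close>

lemma transitive_if_involutions:
  assumes M: "subgroup M S" and inv: "\<And>g. g \<in> carrier S \<Longrightarrow> \<exists>z\<in>Z. z \<noteq> \<one> \<and> g \<otimes> z \<otimes> inv g \<in> M"
    and x: "x \<in> Om"
  shows "\<exists>g\<in>M. act g pinf = x"
proof -
  have MS: "g \<in> carrier S" if "g \<in> M" for g using subgroup.mem_carrier[OF M that] .
  define O1 where "O1 = (\<lambda>g. act g pinf) ` M"
  have O1: "O1 \<subseteq> Om" unfolding O1_def using act_closed MS pinf by blast
  have fin: "finite O1" using finite_subset[OF O1 finOm] .
  have O1s: "act g y \<in> O1" if g: "g \<in> M" and y: "y \<in> O1" for g y
  proof -
    obtain h where h: "h \<in> M" "y = act h pinf" using y unfolding O1_def by blast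
    have "act g y = act (g \<otimes> h) pinf" using act_mult[OF MS[OF g] MS[OF h(1)] pinf] h by simp
    then show ?thesis unfolding O1_def using subgroup.m_closed[OF M g h(1)] by blast
  qed
  have ex: "\<exists>t\<in>M. t \<noteq> \<one> \<and> t \<otimes> t = \<one> \<and> act t y = y" if y: "y \<in> Om" for y
  proof -
    obtain g where g: "g \<in> carrier S" "act g pinf = y" using Om_trans[OF y] by blast
    obtain z where z: "z \<in> Z" "z \<noteq> \<one>" "g \<otimes> z \<otimes> inv g \<in> M" using inv[OF g(1)] by blast
    have zS: "z \<in> carrier S" using Z_carrier z by blast
    let ?t = "g \<otimes> z \<otimes> inv g"
    have "?t \<otimes> ?t = g \<otimes> (z \<otimes> z) \<otimes> inv g" using g zS by (simp add: m_assoc inv_solve_left')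
    then have "?t \<otimes> ?t = \<one>" using Z_square[OF z(1)] g by simp
    moreover have "?t \<noteq> \<one>"
    proof
      assume "?t = \<one>"
      then have "g \<otimes> z = g" using g zS by (metis inv_inv inv_equality inv_closed m_closed)
      then show False using z(2) g zS by (metis l_cancel_one')
    qed
    moreover have "act ?t y = y"
    proof -
      have "act (inv g) y = pinf" using act_inv(1)[OF g(1) pinf] g(2) by simp
      then have "act ?t y = act g (act z pinf)" using act_mult g(1) zS y pinf act_closed by simp
      then show ?thesis using U_pinf[OF U_P[OF Z_U[OF z(1)]]] g(2) by simp
    qed
    ultimately show ?thesis using z(3) by blast
  qed
  have tinv: "act t (act t y) = y" if "t \<in> M" "t \<otimes> t = \<one>" "y \<in> Om" for t y
    using act_mult[OF MS[OF that(1)] MS[OF that(1)] that(3)] that(2) act_one[OF that(3)] by simp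
  show ?thesis
  proof (rule ccontr)
    assume "\<not> ?thesis"
    then have xO: "x \<notin> O1" unfolding O1_def by blast
    obtain t where t: "t \<in> M" "t \<noteq> \<one>" "t \<otimes> t = \<one>" "act t x = x" using ex[OF x] by blast
    have "even (card O1)"
    proof (rule even_card_involution[OF fin])
      fix y assume y: "y \<in> O1"
      then have yO: "y \<in> Om" using O1 by blast
      show "act t y \<in> O1" by (rule O1s[OF t(1) y])
      show "act t (act t y) = y" by (rule tinv[OF t(1,3) yO])
      show "act t y \<noteq> y"
      proof
        assume "act t y = y"
        moreover have "y \<noteq> x" using y xO by blast
        ultimately have "t = \<one>" by (intro involution_fix_unique[OF MS[OF t(1)] t(3) yO _ x t(4)])
        then show False using t(2) by blast
      qed
    qed
    moreover have pO: "pinf \<in> O1" unfolding O1_def using subgroup.one_closed[OF M] act_one[OF pinf] by force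
    obtain s where s: "s \<in> M" "s \<noteq> \<one>" "s \<otimes> s = \<one>" "act s pinf = pinf" using ex[OF pinf] by blast
    have "even (card (O1 - {pinf}))"
    proof (rule even_card_involution)
      show "finite (O1 - {pinf})" using fin by simp
      fix y assume y: "y \<in> O1 - {pinf}"
      then have yO: "y \<in> Om" using O1 by blast
      show "act s (act s y) = y" by (rule tinv[OF s(1,3) yO])
      have "act s y \<noteq> pinf" using act_eqD[OF MS[OF s(1)] yO pinf] s(4) y by auto
      then show "act s y \<in> O1 - {pinf}" using O1s[OF s(1)] y by blast
      show "act s y \<noteq> y"
      proof
        assume "act s y = y"
        then have "s = \<one>" using y by (intro involution_fix_unique[OF MS[OF s(1)] s(3) yO _ pinf s(4)]) auto
        then show False using s(2) by blast
      qed
    qed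
    moreover have "card O1 = Suc (card (O1 - {pinf}))" using card_Suc_Diff1[OF fin pO] by simp
    ultimately show False by simp
  qed
qed

end

section \<open>A proper subgroup with an involution at every isotropic line\<close>

locale unitary3_subgroup = unitary3 m q T S Om act pinf po w P U Z tp ap bp L
  for m q :: nat and T :: "'k::{field,finite} itself" and S :: "('g, 'x) monoid_scheme" (structure)
    and Om :: "'o set" and act :: "'g \<Rightarrow> 'o \<Rightarrow> 'o" and pinf po :: 'o and w :: 'g
    and P U Z :: "'g set" and tp ap bp :: "'g \<Rightarrow> 'k" and L :: "'o set" +
  fixes M :: "'g set"
  assumes M: "subgroup M S" and MnS: "M \<noteq> carrier S"
    and card_le: "card (carrier S) \<le> q^3 * card M"
    and conjZ: "\<And>g. g \<in> carrier S \<Longrightarrow> \<exists>z\<in>Z. z \<noteq> \<one> \<and> g \<otimes> z \<otimes> inv g \<in> M"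
begin

lemma MS: "g \<in> M \<Longrightarrow> g \<in> carrier S" using subgroup.mem_carrier[OF M] .
lemma Mm: "g \<in> M \<Longrightarrow> h \<in> M \<Longrightarrow> g \<otimes> h \<in> M" using subgroup.m_closed[OF M] .
lemma Mi: "g \<in> M \<Longrightarrow> inv g \<in> M" using subgroup.m_inv_closed[OF M] .
lemma M1: "\<one> \<in> M" using subgroup.one_closed[OF M] .
lemma finM: "finite M" using finite_subset[OF subgroup.subset[OF M] finS] .

lemma M_trans: "x \<in> Om \<Longrightarrow> \<exists>g\<in>M. act g pinf = x"
  by (rule transitive_if_involutions[OF M conjZ])

text \<open>Three layers of the point stabiliser in M: \<open>A\<close> is M \<inter> Z inside F_q,
  \<open>Ab\<close> the image of M \<inter> U in U/Z, which \<open>ap\<close> identifies with the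
  additive group of the field with q^2 elements, and \<open>C\<close> the group of diagonal
  entries.\<close>

definition A where "A = bp ` (Z \<inter> M)"
definition Ab where "Ab = ap ` (U \<inter> M)"
definition C where "C = tp ` (P \<inter> M)"

lemma C_sub: "mult_subgroup C"
proof
  show "finite C" unfolding C_def using finM by simp
  show "1 \<in> C" unfolding C_def using P_one M1 tp_one by force
  show "0 \<notin> C" unfolding C_def using tp_nz by auto
  show "x * y \<in> C" if xy: "x \<in> C" "y \<in> C" for x y
  proof -
    obtain g h where gh: "g \<in> P" "g \<in> M" "h \<in> P" "h \<in> M" "x = tp g" "y = tp h" using xy unfolding C_def by blast
    then have "x * y = tp (g \<otimes> h)" "g \<otimes> h \<in> P \<inter> M" using tp_mult P_mult Mm by auto
    then show ?thesis unfolding C_def by blast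
  qed
qed

interpretation C: mult_subgroup C by (rule C_sub)

lemma A_Fq: "A \<subseteq> Fq" unfolding A_def using bp_Z by blast

lemma A_0: "0 \<in> A"
  unfolding A_def using M1 bp_one subgroup.one_closed[OF Z_sub] by force

lemma card_A: "card A = card (Z \<inter> M)"
  unfolding A_def by (rule card_image) (use bp_Z_inj in \<open>auto simp: inj_on_def\<close>)

lemma A_nontrivial: "\<exists>x\<in>A. x \<noteq> 0"
proof -
  obtain z where z: "z \<in> Z" "z \<noteq> \<one>" "\<one> \<otimes> z \<otimes> inv \<one> \<in> M" using conjZ[OF one_closed] by blast
  then have zM: "z \<in> M" using Z_carrier by simp
  have "bp z \<noteq> 0" using bp_Z_inj[OF z(1) subgroup.one_closed[OF Z_sub]] z(2) bp_one by auto
  then show ?thesis unfolding A_def using z(1) zM by blast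
qed

text \<open>An involution of M at \<open>po\<close> is conjugate in M to every nontrivial element of
  M \<inter> Z, by \<open>involutions_conj\<close>. So any two of the latter are conjugate in M, by
  an element that has to preserve their common fixed point \<open>pinf\<close>; it lies in P and
  scales \<open>bp\<close> by t^(q + 1).\<close>

lemma A_transitive: assumes x: "x \<in> A" "x \<noteq> 0" and y: "y \<in> A" "y \<noteq> 0"
  shows "\<exists>t\<in>C. y = t ^ (q + 1) * x"
proof -
  obtain z where z: "z \<in> Z" "z \<in> M" "x = bp z" using x(1) unfolding A_def by blast
  obtain z' where z': "z' \<in> Z" "z' \<in> M" "y = bp z'" using y(1) unfolding A_def by blast
  have ne: "z \<noteq> \<one>" "z' \<noteq> \<one>" using z z' x y bp_one by auto
  obtain v where v: "v \<in> Z" "v \<noteq> \<one>" "w \<otimes> v \<otimes> inv w \<in> M" using conjZ[OF w(1)] by blast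
  have vS: "v \<in> carrier S" using Z_carrier v by blast
  let ?y = "w \<otimes> v \<otimes> inv w"
  have ySS: "?y \<otimes> ?y = \<one>"
  proof -
    have "?y \<otimes> ?y = w \<otimes> (v \<otimes> v) \<otimes> inv w" using w vS by (simp add: m_assoc inv_solve_left')
    then show ?thesis using Z_square[OF v(1)] w by simp
  qed
  have yn: "?y \<noteq> \<one>"
  proof
    assume "?y = \<one>"
    then have "w \<otimes> v = w" using w vS by (metis inv_inv inv_equality inv_closed m_closed)
    then show False using v(2) w vS by (metis l_cancel_one')
  qed
  have yo: "act ?y po = po"
  proof -
    have "act (inv w) po = pinf" using act_inv(1)[OF w(1) pinf] w(2) by simp
    then have "act ?y po = act w (act v pinf)" using act_mult w(1) vS po pinf act_closed by simp
    then show ?thesis using U_pinf[OF U_P[OF Z_U[OF v(1)]]] w(2) by simp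
  qed
  have zi: "act z pinf = pinf" "act z' pinf = pinf" using U_pinf[OF U_P[OF Z_U]] z z' by auto
  obtain h where h: "h \<in> M" "h \<otimes> z \<otimes> inv h = ?y"
    using involutions_conj[OF M z(2) ne(1) Z_square[OF z(1)] pinf zi(1) v(3) yn ySS po yo pinf_po] by blast
  obtain h' where h': "h' \<in> M" "h' \<otimes> z' \<otimes> inv h' = ?y"
    using involutions_conj[OF M z'(2) ne(2) Z_square[OF z'(1)] pinf zi(2) v(3) yn ySS po yo pinf_po] by blast
  have c: "h \<in> carrier S" "h' \<in> carrier S" "z \<in> carrier S" "z' \<in> carrier S" using h h' MS z z' by auto
  let ?p = "inv h' \<otimes> h"
  have pM: "?p \<in> M" using h h' Mm Mi by blast
  have pS: "?p \<in> carrier S" using MS pM by blast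
  have "?p \<otimes> z \<otimes> inv ?p = inv h' \<otimes> (h \<otimes> z \<otimes> inv h) \<otimes> h'" using c by (simp add: inv_mult_group m_assoc)
  also have "\<dots> = inv h' \<otimes> (h' \<otimes> z' \<otimes> inv h') \<otimes> h'" using h h' by simp
  also have "\<dots> = z'" using c by (simp add: m_assoc inv_solve_left')
  finally have pz: "?p \<otimes> z \<otimes> inv ?p = z'" .
  have "act ?p pinf = pinf"
  proof (rule ccontr)
    assume n: "act ?p pinf \<noteq> pinf"
    have "act z' (act ?p pinf) = act (?p \<otimes> z \<otimes> inv ?p) (act ?p pinf)" using pz by simp
    also have "\<dots> = act ?p (act z (act (inv ?p) (act ?p pinf)))" using pS c(3) pinf act_closed by (simp add: act_mult)
    also have "\<dots> = act ?p pinf" using act_inv(1)[OF pS pinf] zi by simp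
    finally have "z' = \<one>" by (rule involution_fix_unique[OF c(4) Z_square[OF z'(1)] act_closed[OF pS pinf] _ pinf zi(2) n])
    then show False using ne by blast
  qed
  then have pP: "?p \<in> P" unfolding P_def using pS by simp
  have "y = tp ?p ^ (q + 1) * x" using bp_conj[OF pP z(1)] pz z(3) z'(3) by simp
  then show ?thesis unfolding C_def using pP pM by blast
qed

lemma A_scale: "t \<in> C \<Longrightarrow> x \<in> A \<Longrightarrow> t ^ (q + 1) * x \<in> A"
proof -
  assume "t \<in> C" "x \<in> A"
  then obtain p z where pz: "p \<in> P" "p \<in> M" "t = tp p" "z \<in> Z" "z \<in> M" "x = bp z" unfolding A_def C_def by blast
  have "p \<otimes> z \<otimes> inv p \<in> Z \<inter> M" using Z_conj[OF pz(1,4)] Mm Mi pz by blast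
  then show ?thesis using bp_conj[OF pz(1,4)] pz unfolding A_def by force
qed

text \<open>By \<open>A_transitive\<close> the norms of \<open>C\<close> act simply transitively on
  the nonzero elements of \<open>A\<close>.\<close>

lemma card_A_norm: "card A - 1 = card ((\<lambda>t. t ^ (q + 1)) ` C)"
proof -
  obtain x where x: "x \<in> A" "x \<noteq> 0" using A_nontrivial by blast
  have "A - {0} = (\<lambda>s. s * x) ` ((\<lambda>t. t ^ (q + 1)) ` C)"
  proof
    show "A - {0} \<subseteq> (\<lambda>s. s * x) ` ((\<lambda>t. t ^ (q + 1)) ` C)" using A_transitive[OF x] by (auto simp: image_image)
    show "(\<lambda>s. s * x) ` ((\<lambda>t. t ^ (q + 1)) ` C) \<subseteq> A - {0}"
    proof clarify
      fix t assume t: "t \<in> C"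
      then have "t \<noteq> 0" using C.D0 by blast
      then show "t ^ (q + 1) * x \<in> A - {0}" using A_scale[OF t x(1)] x(2) by simp
    qed
  qed
  moreover have "inj_on (\<lambda>s. s * x) ((\<lambda>t. t ^ (q + 1)) ` C)" using x(2) by (simp add: inj_on_def)
  ultimately have "card (A - {0}) = card ((\<lambda>t. t ^ (q + 1)) ` C)" by (simp add: card_image)
  then show ?thesis using A_0 by simp
qed

text \<open>Otherwise Z lies in M, and transitivity of M puts every conjugate of Z into M, which
  \<open>overgroup_Z\<close> excludes.\<close>

lemma A_not_Fq: "A \<noteq> Fq"
proof
  assume AF: "A = Fq"
  have ZM: "z \<in> M" if z: "z \<in> Z" for z
  proof -
    have "bp z \<in> A" using bp_Z[OF z] AF by simp
    then obtain z' where "z' \<in> Z" "z' \<in> M" "bp z = bp z'" unfolding A_def by blast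
    then show ?thesis using bp_Z_inj[OF z] by simp
  qed
  have "M = carrier S"
  proof (rule overgroup_Z[OF M])
    fix g z assume g: "g \<in> carrier S" and z: "z \<in> Z"
    obtain h where h: "h \<in> M" "act h pinf = act g pinf" using M_trans[OF act_closed[OF g pinf]] by blast
    have hS: "h \<in> carrier S" using MS h by blast
    let ?p = "inv h \<otimes> g"
    have "act ?p pinf = pinf" using act_mult[OF inv_closed[OF hS] g pinf] h(2)[symmetric] act_inv(1)[OF hS pinf] by simp
    then have pP: "?p \<in> P" unfolding P_def using hS g by simp
    have "h \<otimes> (?p \<otimes> z \<otimes> inv ?p) \<otimes> inv h \<in> M" using ZM[OF Z_conj[OF pP z]] Mm Mi h by blast
    moreover have "h \<otimes> (?p \<otimes> z \<otimes> inv ?p) \<otimes> inv h = (h \<otimes> ?p) \<otimes> z \<otimes> inv (h \<otimes> ?p)"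
      using hS P_carrier[OF pP] Z_carrier[OF z] by (simp only: inv_mult_group m_assoc m_closed inv_closed)
    moreover have "h \<otimes> ?p = g" using hS g by (simp add: m_assoc[symmetric])
    ultimately show "g \<otimes> z \<otimes> inv g \<in> M" by simp
  qed
  then show False using MnS by blast
qed

lemma Ab_0: "0 \<in> Ab" unfolding Ab_def using M1 U_one ap_one by force

lemma Ab_add: "x \<in> Ab \<Longrightarrow> y \<in> Ab \<Longrightarrow> x + y \<in> Ab"
proof -
  assume "x \<in> Ab" "y \<in> Ab"
  then obtain u v where uv: "u \<in> U" "u \<in> M" "v \<in> U" "v \<in> M" "x = ap u" "y = ap v" unfolding Ab_def by blast
  then have "x + y = ap (u \<otimes> v)" using ap_mult by simp
  moreover have "u \<otimes> v \<in> U \<inter> M" using uv Mm U_mult by blast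
  ultimately show ?thesis unfolding Ab_def by blast
qed

lemma Ab_scale: "t \<in> C \<Longrightarrow> x \<in> Ab \<Longrightarrow> t ^ (2 * q - 1) * x \<in> Ab"
proof -
  assume "t \<in> C" "x \<in> Ab"
  then obtain p z where pz: "p \<in> P" "p \<in> M" "t = tp p" "z \<in> U" "z \<in> M" "x = ap z" unfolding Ab_def C_def by blast
  have "p \<otimes> z \<otimes> inv p \<in> U \<inter> M" using U_conj[OF pz(1,4)] Mm Mi pz by blast
  then show ?thesis using ap_conj[OF pz(1,4)] pz unfolding Ab_def by force
qed

lemma Ab_norm: "x \<in> Ab \<Longrightarrow> x * cj x \<in> A"
proof -
  assume "x \<in> Ab"
  then obtain u where u: "u \<in> U" "u \<in> M" "x = ap u" unfolding Ab_def by blast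
  have "u \<otimes> u \<in> Z \<inter> M" "bp (u \<otimes> u) = x * cj x" using U_square[OF u(1)] Mm u by (auto simp: mult.commute)
  then show ?thesis unfolding A_def by force
qed

text \<open>The expression is the coordinate of the commutator of two elements of M \<inter> U,
  which lies in M \<inter> Z.\<close>

lemma Ab_comm: "x \<in> Ab \<Longrightarrow> y \<in> Ab \<Longrightarrow> cj x * y + cj y * x \<in> A"
proof -
  assume "x \<in> Ab" "y \<in> Ab"
  then obtain u v where uv: "u \<in> U" "u \<in> M" "v \<in> U" "v \<in> M" "x = ap u" "y = ap v" unfolding Ab_def by blast
  let ?z = "u \<otimes> v \<otimes> inv (v \<otimes> u)"
  have c: "u \<in> carrier S" "v \<in> carrier S" using uv U_carrier by auto
  have zU: "?z \<in> U" by (intro U_mult U_inv uv)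
  have "ap ?z = 0" using ap_mult[OF U_mult[OF uv(1,3)] U_inv[OF U_mult[OF uv(3,1)]]] ap_inv[OF U_mult[OF uv(3,1)]]
      ap_mult[OF uv(1,3)] ap_mult[OF uv(3,1)] by (simp add: add.commute)
  then have zZ: "?z \<in> Z" unfolding Z_def using zU by simp
  have zM: "?z \<in> M" using Mm Mi uv by blast
  have "?z \<otimes> (v \<otimes> u) = u \<otimes> v" using c by (simp add: m_assoc)
  then have "bp ?z + bp (v \<otimes> u) = bp (u \<otimes> v)" using bp_Z_mult[OF zZ U_mult[OF uv(3,1)]] by simp
  then have "bp ?z = bp (v \<otimes> u) + bp (u \<otimes> v)" by (metis add.commute add_cancel)
  also have "\<dots> = (bp v + bp u + cj y * x) + (bp u + bp v + cj x * y)"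
    using bp_mult[OF uv(3,1)] bp_mult[OF uv(1,3)] uv by simp
  also have "\<dots> = (bp v + bp v) + (bp u + bp u) + (cj x * y + cj y * x)" by (simp only: ac_simps)
  finally have "bp ?z = cj x * y + cj y * x" by simp
  then show ?thesis unfolding A_def using zZ zM by force
qed

text \<open>Fix a nonzero x in \<open>Ab\<close>. The additive map sending y to its commutator with
  x has values in \<open>A\<close>. On its kernel cj y = y cj x / x, so the norm of y determines y^2
  and hence y; and norms lie in \<open>A\<close> by \<open>Ab_norm\<close>.\<close>

lemma card_Ab_le: "card Ab \<le> card A * card A"
proof (cases "Ab = {0}")
  case True
  have "card A \<ge> 1" using A_0 by (metis One_nat_def Suc_leI card_gt_0_iff empty_iff finite)
  then show ?thesis using True by simp
next
  case False
  then obtain x where x: "x \<in> Ab" "x \<noteq> 0" using Ab_0 by blast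
  let ?f = "\<lambda>y. cj x * y + cj y * x"
  let ?K = "{y\<in>Ab. ?f y = 0}"
  have fadd: "?f (y + z) = ?f y + ?f z" for y z by (simp add: cj_add algebra_simps)
  have "card Ab = card (?f ` Ab) * card ?K"
  proof (rule card_fibers)
    fix t assume "t \<in> ?f ` Ab"
    then obtain y where y: "y \<in> Ab" "t = ?f y" by blast
    have "bij_betw ((+) y) ?K {z\<in>Ab. ?f z = t}"
    proof (rule bij_betw_byWitness[of _ "(+) y"])
      show "(+) y ` ?K \<subseteq> {z\<in>Ab. ?f z = t}"
      proof clarify
        fix z assume "z \<in> Ab" "?f z = 0"
        then show "y + z \<in> Ab \<and> ?f (y + z) = t" using Ab_add y fadd[of y z] by simp
      qed
      show "(+) y ` {z\<in>Ab. ?f z = t} \<subseteq> ?K"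
      proof clarify
        fix z assume "z \<in> Ab" "t = ?f z"
        then show "y + z \<in> Ab \<and> ?f (y + z) = 0" using Ab_add y fadd[of y z] by simp
      qed
    qed auto
    then show "card {z\<in>Ab. ?f z = t} = card ?K" by (rule bij_betw_same_card[THEN sym])
  qed simp
  moreover have "card (?f ` Ab) \<le> card A" by (rule card_mono) (use Ab_comm[OF x(1)] in auto)
  moreover have "card ?K \<le> card A"
  proof (rule card_inj_on_le[of "\<lambda>y. y * cj y"])
    show "(\<lambda>y. y * cj y) ` ?K \<subseteq> A" using Ab_norm by blast
    show "inj_on (\<lambda>y. y * cj y) ?K"
    proof (rule inj_onI)
      fix y z assume yz: "y \<in> ?K" "z \<in> ?K" "y * cj y = z * cj z"
      have e: "cj y * x = cj x * y" "cj z * x = cj x * z" using yz by auto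
      have "y * (cj y * x) = z * (cj z * x)" using yz(3) by (simp add: mult.assoc[symmetric])
      then have "y * (cj x * y) = z * (cj x * z)" unfolding e .
      then have "cj x * (y * y) = cj x * (z * z)" by (simp only: ac_simps)
      then have "y * y = z * z" using x(2) by simp
      then have "(y + z) * (y + z) = 0" by (simp add: algebra_simps)
      then show "y = z" by simp
    qed
  qed simp
  ultimately show ?thesis by (simp add: mult_le_mono)
qed

lemma card_UM: "card (U \<inter> M) = card Ab * card A"
  unfolding card_A Ab_def
proof (rule card_fibers)
  show "finite (U \<inter> M)" using finM by simp
  fix t assume "t \<in> ap ` (U \<inter> M)"
  then obtain u where u: "u \<in> U" "u \<in> M" "t = ap u" by blast
  have uS: "u \<in> carrier S" using u U_carrier by blast
  have "bij_betw (\<lambda>z. u \<otimes> z) (Z \<inter> M) {x \<in> U \<inter> M. ap x = t}"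
  proof (rule bij_betw_byWitness[of _ "\<lambda>x. inv u \<otimes> x"])
    show "\<forall>z\<in>Z \<inter> M. inv u \<otimes> (u \<otimes> z) = z" using uS MS by (simp add: m_assoc[symmetric])
    show "\<forall>x\<in>{x \<in> U \<inter> M. ap x = t}. u \<otimes> (inv u \<otimes> x) = x" using uS MS by (simp add: m_assoc[symmetric])
    show "(\<lambda>z. u \<otimes> z) ` (Z \<inter> M) \<subseteq> {x \<in> U \<inter> M. ap x = t}" using u U_mult Mm ap_mult unfolding Z_def by auto
    show "(\<lambda>x. inv u \<otimes> x) ` {x \<in> U \<inter> M. ap x = t} \<subseteq> Z \<inter> M"
      using u U_mult U_inv Mm Mi ap_mult ap_inv unfolding Z_def by auto
  qed
  then show "card {x \<in> U \<inter> M. ap x = t} = card (Z \<inter> M)" by (rule bij_betw_same_card[THEN sym])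
qed

lemma card_PM: "card (P \<inter> M) = card C * card (U \<inter> M)"
  unfolding C_def
proof (rule card_fibers)
  show "finite (P \<inter> M)" using finM by simp
  fix t assume "t \<in> tp ` (P \<inter> M)"
  then obtain u where u: "u \<in> P" "u \<in> M" "t = tp u" by blast
  have uS: "u \<in> carrier S" using u P_carrier by blast
  have "bij_betw (\<lambda>z. u \<otimes> z) (U \<inter> M) {x \<in> P \<inter> M. tp x = t}"
  proof (rule bij_betw_byWitness[of _ "\<lambda>x. inv u \<otimes> x"])
    show "\<forall>z\<in>U \<inter> M. inv u \<otimes> (u \<otimes> z) = z" using uS MS by (simp add: m_assoc[symmetric])
    show "\<forall>x\<in>{x \<in> P \<inter> M. tp x = t}. u \<otimes> (inv u \<otimes> x) = x" using uS MS by (simp add: m_assoc[symmetric])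
    show "(\<lambda>z. u \<otimes> z) ` (U \<inter> M) \<subseteq> {x \<in> P \<inter> M. tp x = t}" using u P_mult Mm tp_mult unfolding U_def by auto
    show "(\<lambda>x. inv u \<otimes> x) ` {x \<in> P \<inter> M. tp x = t} \<subseteq> U \<inter> M"
      using u P_mult P_inv Mm Mi tp_mult tp_inv tp_nz unfolding U_def by auto
  qed
  then show "card {x \<in> P \<inter> M. tp x = t} = card (U \<inter> M)" by (rule bij_betw_same_card[THEN sym])
qed

lemma card_M: "card M = (q^3 + 1) * (card C * (card Ab * card A))"
proof -
  have "{g\<in>M. act g pinf = pinf} = P \<inter> M" unfolding P_def using MS by blast
  then show ?thesis using subgroup_orbit[OF M M_trans pinf] card_PM card_UM by simp
qed

text \<open>The index bound and the three layers of M \<inter> P supply the hypotheses of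
  \<open>index_arithmetic\<close>; 72 = 9 * 4 * 2 is the order of M \<inter> P.\<close>

lemma exceptional: "q = 8 \<and> card M = 513 * 72"
proof -
  have q0: "0 < q" using q_ge by simp
  have le: "q * q - 1 \<le> card C * card Ab * card A"
  proof -
    have "(q^3 + 1) * ((q^2 - 1) * q^3) \<le> q^3 * ((q^3 + 1) * (card C * (card Ab * card A)))"
      using card_le card_S card_P card_M by simp
    then have "((q^3 + 1) * q^3) * (q^2 - 1) \<le> ((q^3 + 1) * q^3) * (card C * card Ab * card A)" by (simp only: ac_simps)
    then have "q^2 - 1 \<le> card C * card Ab * card A" using q0 by (simp only: mult_le_cancel1) simp
    then show ?thesis by (simp add: power2_eq_square)
  qed
  have c23: "q^3 = 2 ^ (m * 3)" using q by (simp add: power_mult)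
  have dvdU: "card (U \<inter> M) dvd 2 ^ (m * 3)"
    using card_subgroup_dvd[OF subgroups_Inter_pair[OF U_sub M] U_sub] card_U c23 by simp
  have "card A dvd 2 ^ (m * 3)" using dvdU card_UM by (metis dvd_mult_right)
  then obtain k where k: "card A = 2 ^ k" using divides_primepow_nat[OF two_is_prime_nat] by blast
  have "card Ab dvd 2 ^ (m * 3)" using dvdU card_UM by (metis dvd_mult_left)
  then obtain j where j: "card Ab = 2 ^ j" using divides_primepow_nat[OF two_is_prime_nat] by blast
  have A2: "card A \<noteq> 1"
  proof
    assume "card A = 1"
    then obtain y where "A = {y}" using card_1_singletonE by blast
    then show False using A_nontrivial A_0 by auto
  qed
  have k1: "1 \<le> k" using k A2 by (cases k) auto
  have "card A < card Fq" using A_Fq A_not_Fq by (intro psubset_card_mono) auto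
  then have "(2::nat) ^ k < 2 ^ m" using k card_Fq q by simp
  then have km: "k < m" by simp
  have N: "mult_subgroup ((\<lambda>t. t ^ (q + 1)) ` C)" by (rule C.power_image)
  have "card ((\<lambda>t. t ^ (q + 1)) ` C) dvd card (Fq - {0})"
  proof (rule mult_subgroup.card_dvd[OF N])
    fix d y assume "d \<in> (\<lambda>t. t ^ (q + 1)) ` C" "y \<in> Fq - {0}"
    then obtain t where t: "t \<in> C" "d = t ^ (q + 1)" by blast
    have "d \<in> Fq" using Fq_norm[of t] t unfolding norm_power by simp
    moreover have "d \<noteq> 0" using t C.D0 by auto
    ultimately show "d * y \<in> Fq - {0}" using \<open>y \<in> Fq - {0}\<close> Fq_mult by auto
  qed auto
  then have Qq: "card A - 1 dvd q - 1" using card_A_norm card_Fq Fq_0 by simp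
  let ?c2 = "card {t\<in>C. t ^ (q + 1) = 1}"
  have cc2: "card C = (card A - 1) * ?c2" using C.card_power[of "q + 1"] card_A_norm by simp
  have c2q: "?c2 dvd q + 1"
  proof -
    have "?c2 dvd card {t::'k. t ^ (q + 1) = 1}"
    proof (rule mult_subgroup.card_dvd[OF C.power_kernel])
      fix d y assume "d \<in> {t\<in>C. t ^ (q + 1) = 1}" "y \<in> {t::'k. t ^ (q + 1) = 1}"
      then have "d ^ (q + 1) = 1" "y ^ (q + 1) = 1" by (simp_all only: mem_Collect_eq)
      then have "(d * y) ^ (q + 1) = 1" by (simp only: power_mult_distrib mult_1_left)
      then show "d * y \<in> {t. t ^ (q + 1) = 1}" by (simp only: mem_Collect_eq)
    qed auto
    then show ?thesis using norm_count by simp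
  qed
  let ?d = "card ((\<lambda>t. t ^ (2 * q - 1)) ` C)" and ?\<kappa> = "card {t\<in>C. t ^ (2 * q - 1) = 1}"
  have cd: "card C = ?d * ?\<kappa>" by (rule C.card_power)
  have dAb: "?d dvd card Ab - 1"
  proof -
    have "?d dvd card (Ab - {0})"
    proof (rule mult_subgroup.card_dvd[OF C.power_image])
      fix d y assume "d \<in> (\<lambda>t. t ^ (2 * q - 1)) ` C" "y \<in> Ab - {0}"
      then obtain t where t: "t \<in> C" "d = t ^ (2 * q - 1)" by blast
      then have "t \<noteq> 0" using C.D0 by blast
      then show "d * y \<in> Ab - {0}" using Ab_scale[OF t(1)] t \<open>y \<in> Ab - {0}\<close> by auto
    qed auto
    then show ?thesis using Ab_0 by simp
  qed
  have sub3: "{t\<in>C. t ^ (2 * q - 1) = 1} \<subseteq> {t. t ^ 3 = 1}" using cube_root C.D0 by auto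
  have k3: "?\<kappa> \<le> 3"
  proof -
    have "?\<kappa> \<le> card {t::'k. t ^ 3 = 1}" by (rule card_mono[OF _ sub3]) simp
    also have "\<dots> \<le> 3" by (rule card_roots_of_unity) simp
    finally show ?thesis .
  qed
  \<comment> \<open>If q = 3 r + 1, then 2q - 1 = 6 r + 1, and t^3 = 1 turns t^(2q - 1) into
    t.\<close>
  have kq: "?\<kappa> = 1" if q3: "q mod 3 = 1"
  proof -
    have "t = 1" if t: "t \<in> {t\<in>C. t ^ (2 * q - 1) = 1}" for t
    proof -
      have t3: "t ^ 3 = 1" "t ^ (2 * q - 1) = 1" using t sub3 by auto
      have "q = 3 * (q div 3) + 1" using q3 by (metis mult_div_mod_eq)
      then obtain r where r: "q = 3 * r + 1" by blast
      have "2 * q - 1 = 3 * (2 * r) + 1" using r by simp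
      then have "t ^ (2 * q - 1) = (t ^ 3) ^ (2 * r) * t" by (simp only: power_add power_mult power_one_right)
      then show ?thesis using t3 by simp
    qed
    then have "{t\<in>C. t ^ (2 * q - 1) = 1} = {1}" using C.D1 by auto
    then show ?thesis by simp
  qed
  have "q = 8 \<and> card A = 2 \<and> card C = 9 \<and> card Ab = 4"
    by (rule index_arithmetic[OF q k k1 km Qq j card_Ab_le cc2 c2q cd dAb k3 kq le])
  then show ?thesis using card_M by simp
qed

end

section \<open>Finite subgroups, involutions, and subgroups of prime order\<close>

lemma (in group) finite_subgroupI:
  assumes "H \<subseteq> carrier G" "finite H" "\<one> \<in> H" "\<And>x y. x \<in> H \<Longrightarrow> y \<in> H \<Longrightarrow> x \<otimes> y \<in> H"
  shows "subgroup H G"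
proof (rule subgroupI[OF assms(1)])
  show "H \<noteq> {}" using assms(3) by blast
  show "x \<otimes> y \<in> H" if "x \<in> H" "y \<in> H" for x y using assms(4) that .
  fix x assume x: "x \<in> H"
  have xG: "x \<in> carrier G" using x assms(1) by blast
  have "inj_on (\<lambda>y. y \<otimes> x) H" using xG assms(1) by (auto simp: inj_on_def subset_iff)
  moreover have "(\<lambda>y. y \<otimes> x) ` H \<subseteq> H" using assms(4) x by blast
  ultimately have "(\<lambda>y. y \<otimes> x) ` H = H" using endo_inj_surj[OF assms(2)] by blast
  then obtain y where y: "y \<in> H" "y \<otimes> x = \<one>" using assms(3) by (metis (no_types, lifting) imageE)
  then have "inv x = y" using inv_equality[of y x] xG assms(1) by blast
  then show "inv x \<in> H" using y by simp
qed

text \<open>Inversion would pair off the nontrivial elements if none of them were an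
  involution.\<close>

lemma (in group) involution_exists:
  assumes N: "subgroup N G" "finite N" "even (card N)"
  shows "\<exists>x\<in>N. x \<noteq> \<one> \<and> x \<otimes> x = \<one>"
proof (rule ccontr)
  assume no: "\<not> ?thesis"
  have NG: "x \<in> carrier G" if "x \<in> N" for x using subgroup.mem_carrier[OF N(1) that] .
  have "even (card (N - {\<one>}))"
  proof (rule even_card_involution[of _ "\<lambda>x. inv x"])
    show "finite (N - {\<one>})" using N(2) by simp
    fix x assume x: "x \<in> N - {\<one>}"
    then have xG: "x \<in> carrier G" using NG by blast
    show "inv (inv x) = x" using xG by simp
    show "inv x \<noteq> x"
    proof
      assume "inv x = x"
      then have "x \<otimes> x = \<one>" using r_inv[OF xG] by simp
      then show False using no x by blast
    qed
    have "inv x \<noteq> \<one>" using x xG by (metis inv_inv inv_one Diff_iff singletonI)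
    then show "inv x \<in> N - {\<one>}" using x subgroup.m_inv_closed[OF N(1)] by blast
  qed
  moreover have "card N = Suc (card (N - {\<one>}))" using card_Suc_Diff1[OF N(2) subgroup.one_closed[OF N(1)]] by simp
  ultimately show False using N(3) by simp
qed

lemma (in group) prime_order_subgroup_Int:
  assumes Y: "subgroup Y G" "card Y = p" and p: "prime (p::nat)" and H: "subgroup H G" and x: "x \<in> Y" "x \<in> H" "x \<noteq> \<one>"
  shows "Y \<subseteq> H"
proof -
  have fin: "finite Y" using Y(2) p card.infinite not_prime_0 by metis
  have "card (Y \<inter> H) dvd p" using card_subgroup_dvd[OF subgroups_Inter_pair[OF Y(1) H] Y(1)] Y(2) by simp
  moreover have "card (Y \<inter> H) \<noteq> 1"
  proof
    assume "card (Y \<inter> H) = 1"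
    then obtain z where z: "Y \<inter> H = {z}" using card_1_singletonE by blast
    have "x \<in> Y \<inter> H" "\<one> \<in> Y \<inter> H" using x subgroup.one_closed[OF Y(1)] subgroup.one_closed[OF H] by auto
    then show False using x(3) unfolding z by simp
  qed
  ultimately have "card (Y \<inter> H) = card Y" using p Y(2) prime_nat_iff by blast
  then have "Y \<inter> H = Y" using card_subset_eq[OF fin, of "Y \<inter> H"] by blast
  then show ?thesis by blast
qed

context unitary3
begin

lemma two_transitive: assumes "x \<in> Om" "y \<in> Om" "x \<noteq> y"
  shows "\<exists>k\<in>carrier S. act k x = pinf \<and> act k y = po"
proof -
  obtain g where g: "g \<in> carrier S" "act g pinf = x" using Om_trans[OF assms(1)] by blast
  have gi: "inv g \<in> carrier S" using g by simp
  have yO: "act (inv g) y \<in> Om" using act_closed[OF gi assms(2)] .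
  have "act (inv g) y \<noteq> pinf"
  proof
    assume "act (inv g) y = pinf"
    then have "act g (act (inv g) y) = x" using g by simp
    then show False using act_inv(2)[OF g(1) assms(2)] assms(3) by simp
  qed
  then obtain u where u: "u \<in> U" "act u po = act (inv g) y" using U_regular[OF yO] by blast
  have uS: "u \<in> carrier S" "inv u \<in> carrier S" using U_carrier u by auto
  have "act (inv u \<otimes> inv g) x = pinf"
    using act_mult[OF uS(2) gi assms(1)] act_inv(1)[OF g(1) pinf] g(2) U_pinf[OF U_P[OF U_inv[OF u(1)]]] by simp
  moreover have "act (inv u \<otimes> inv g) y = po"
    using act_mult[OF uS(2) gi assms(2)] u(2)[symmetric] act_inv(1)[OF uS(1) po] by simp
  ultimately show ?thesis using uS gi by blast
qed

text \<open>The entry \<open>tp\<close> has square 1, so t lies in U; its square has the norm of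
  \<open>ap t\<close> as coordinate, which forces \<open>ap t\<close> = 0.\<close>

lemma involution_pinf: assumes "t \<in> carrier S" "t \<otimes> t = \<one>" "act t pinf = pinf" shows "t \<in> Z"
proof -
  have tP: "t \<in> P" unfolding P_def using assms by simp
  have "tp t * tp t = 1" using tp_mult[OF tP tP] tp_one assms by simp
  then have "(tp t + 1) * (tp t + 1) = 0" by (simp add: algebra_simps)
  then have tU: "t \<in> U" unfolding U_def using tP by simp
  then have "cj (ap t) * ap t = 0" using U_square[OF tU] assms bp_one by simp
  then have "ap t = 0" by simp
  then show ?thesis unfolding Z_def using tU by simp
qed

lemma card_stab: "x \<in> Om \<Longrightarrow> card {g\<in>carrier S. act g x = x} = card P"
proof -
  assume x: "x \<in> Om"
  have "(q^3 + 1) * card {g\<in>carrier S. act g x = x} = (q^3 + 1) * card P"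
    using subgroup_orbit[OF subgroup_self Om_trans x] card_S by simp
  then show ?thesis by (simp only: mult_cancel1) simp
qed

end

context unitary3_subgroup
begin

text \<open>A subgroup of order 19 has an involution x in its normaliser in M. For a generator g, the product of
  the involutions x and its conjugate by g lies in the subgroup but preserves a set of nine points, hence
  fixes one of them.\<close>

lemma impossible: False
proof -
  \<comment> \<open>The number 513 * 72 equals 19 * 1944 with 1944 = 8 * 243, so 19 divides the
    order of M exactly once.\<close>
  have q8: "q = 8" and cM: "card M = 19 * 1944" using exceptional by auto
  have cP: "card P = 63 * 512" using card_P q8 by simp
  have p19: "prime (19::nat)" by simp
  let ?GM = "S\<lparr>carrier := M\<rparr>"
  have "\<exists>H. subgroup H ?GM \<and> card H = 19 ^ 1"
    by (rule sylow_thm[OF p19 subgroup.subgroup_is_group[OF M is_group], of 1 1944]) (use cM finM in \<open>auto simp: order_def\<close>)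
  then obtain Y where Y0: "subgroup Y ?GM" "card Y = 19" by auto
  have Y: "subgroup Y S" using incl_subgroup[OF M Y0(1)] .
  have YM: "Y \<subseteq> M" using subgroup.subset[OF Y0(1)] by simp
  have YS: "y \<in> carrier S" if "y \<in> Y" for y using subgroup.mem_carrier[OF Y that] .
  have finY: "finite Y" using finite_subset[OF YM finM] .
  \<comment> \<open>A point stabiliser in S has order 63 * 512, which is prime to 19.\<close>
  have free: "y = \<one>" if y: "y \<in> Y" and x: "x \<in> Om" "act y x = x" for y x
  proof (rule ccontr)
    assume "y \<noteq> \<one>"
    then have "Y \<subseteq> {g\<in>carrier S. act g x = x}"
      by (intro prime_order_subgroup_Int[OF Y Y0(2) p19 stab_subgroup[OF x(1) subgroup_self] y]) (use YS y x in auto)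
    then have "card Y dvd card {g\<in>carrier S. act g x = x}"
      by (rule card_subgroup_dvd[OF Y stab_subgroup[OF x(1) subgroup_self]])
    then have "19 dvd (63 * 512 :: nat)" using card_stab[OF x(1)] Y0(2) cP by simp
    then show False by simp
  qed
  define cg where "cg g A = (\<lambda>y. g \<otimes> y \<otimes> inv g) ` A" for g and A :: "'g set"
  have cg_mult: "cg (g \<otimes> h) A = cg g (cg h A)" if "g \<in> carrier S" "h \<in> carrier S" "A \<subseteq> carrier S" for g h A
    unfolding cg_def image_image
  proof (rule image_cong[OF refl])
    fix y assume "y \<in> A"
    then have "y \<in> carrier S" using that by blast
    then show "g \<otimes> h \<otimes> y \<otimes> inv (g \<otimes> h) = g \<otimes> (h \<otimes> y \<otimes> inv h) \<otimes> inv g" using that by (simp add: inv_mult_group m_assoc)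
  qed
  have cg_one: "cg \<one> A = A" if "A \<subseteq> carrier S" for A
  proof -
    have "cg \<one> A = (\<lambda>y. y) ` A" unfolding cg_def by (rule image_cong[OF refl]) (use that in auto)
    then show ?thesis by simp
  qed
  \<comment> \<open>The conjugates of Y in M. Their number modulo 19 gives the Sylow congruence,
    from which the parity of the normaliser N is read off.\<close>
  define O1 where "O1 = (\<lambda>g. cg g Y) ` M"
  have sub: "A \<subseteq> carrier S" if "A \<in> O1" for A using that YS MS unfolding O1_def cg_def by auto
  have O1st: "cg g A \<in> O1" if g: "g \<in> M" and A: "A \<in> O1" for g A
  proof -
    obtain h where h: "h \<in> M" "A = cg h Y" using A unfolding O1_def by blast
    have "cg g A = cg (g \<otimes> h) Y" using cg_mult[OF MS[OF g] MS[OF h(1)]] h YS by auto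
    then show ?thesis unfolding O1_def using Mm[OF g h(1)] by blast
  qed
  have ac: "acts_on S M O1 cg" unfolding acts_on_def
    using O1st cg_one[OF sub] cg_mult[OF MS MS sub] by blast
  have YO: "Y \<in> O1" unfolding O1_def using cg_one[of Y] YS M1 by (metis image_eqI subsetI)
  have finO: "finite O1" unfolding O1_def using finM by simp
  define N where "N = {g\<in>M. cg g Y = Y}"
  have "card ((\<lambda>g. cg g Y) ` M) * card N = card M" unfolding N_def
    by (rule acts_on_orbit_stabilizer[OF ac M YO])
  then have oN: "card O1 * card N = 19 * 1944" using cM unfolding O1_def by simp
  have YSs: "Y \<subseteq> carrier S" using YS by blast
  have N: "subgroup N S"
  proof (rule finite_subgroupI)
    show "N \<subseteq> carrier S" unfolding N_def using MS by blast
    show "finite N" unfolding N_def using finM by simp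
    show "\<one> \<in> N" unfolding N_def using M1 cg_one[OF YSs] by simp
    show "x \<otimes> y \<in> N" if "x \<in> N" "y \<in> N" for x y
      using that Mm cg_mult[OF MS MS YSs] unfolding N_def by auto
  qed
  have cgY: "cg y Y \<subseteq> Y" if y: "y \<in> Y" for y
    unfolding cg_def using subgroup.m_closed[OF Y] subgroup.m_inv_closed[OF Y] y by blast
  have cgcard: "card (cg g A) = card A" if "g \<in> carrier S" "A \<subseteq> carrier S" for g A
    unfolding cg_def
  proof (rule card_image, rule inj_onI)
    fix x y assume "x \<in> A" "y \<in> A" "g \<otimes> x \<otimes> inv g = g \<otimes> y \<otimes> inv g"
    then show "x = y" using that conjugation_is_inj[of g x y] by blast
  qed
  have cgsub: "subgroup (cg g A) S" if g: "g \<in> carrier S" and A: "subgroup A S" for g A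
  proof (rule finite_subgroupI)
    note AS = subgroup.mem_carrier[OF A]
    show "cg g A \<subseteq> carrier S" unfolding cg_def using g AS by auto
    show "finite (cg g A)" unfolding cg_def using finite_subset[OF subgroup.subset[OF A] finS] by simp
    have "\<one> = g \<otimes> \<one> \<otimes> inv g" using g by simp
    then show "\<one> \<in> cg g A" unfolding cg_def using subgroup.one_closed[OF A] by blast
    show "x \<otimes> y \<in> cg g A" if xy: "x \<in> cg g A" "y \<in> cg g A" for x y
    proof -
      obtain b c where bc: "b \<in> A" "x = g \<otimes> b \<otimes> inv g" "c \<in> A" "y = g \<otimes> c \<otimes> inv g" using xy unfolding cg_def by blast
      have "x \<otimes> y = g \<otimes> (b \<otimes> c) \<otimes> inv g" using bc g AS by (simp add: m_assoc inv_solve_left')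
      then show ?thesis unfolding cg_def using subgroup.m_closed[OF A bc(1,3)] by blast
    qed
  qed
  have O1sub: "subgroup A S" "card A = 19" "A \<subseteq> M" if A: "A \<in> O1" for A
  proof -
    obtain h where h: "h \<in> M" "A = cg h Y" using A unfolding O1_def by blast
    show "subgroup A S" "card A = 19" using cgsub[OF MS[OF h(1)] Y] cgcard[OF MS[OF h(1)] YSs] h Y0(2) by auto
    show "A \<subseteq> M" using h YM Mm Mi unfolding cg_def by blast
  qed
  \<comment> \<open>If Y normalised another conjugate A, then Y A would be a subgroup of order 19^2,
    which does not divide the order of M.\<close>
  have fixY: "{A\<in>O1. \<forall>y\<in>Y. cg y A = A} = {Y}"
  proof
    show "{Y} \<subseteq> {A\<in>O1. \<forall>y\<in>Y. cg y A = A}"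
    proof -
      have "cg y Y = Y" if "y \<in> Y" for y using card_subset_eq[OF finY cgY[OF that]] cgcard[OF YS[OF that] YSs] by simp
      then show ?thesis using YO by simp
    qed
    show "{A\<in>O1. \<forall>y\<in>Y. cg y A = A} \<subseteq> {Y}"
    proof
      fix A assume "A \<in> {A\<in>O1. \<forall>y\<in>Y. cg y A = A}"
      then have A: "A \<in> O1" "\<And>y. y \<in> Y \<Longrightarrow> cg y A = A" by auto
      note A' = O1sub[OF A(1)]
      have AS: "x \<in> carrier S" if "x \<in> A" for x using subgroup.mem_carrier[OF A'(1) that] .
      have finA: "finite A" using finite_subset[OF A'(3) finM] .
      show "A \<in> {Y}"
      proof (cases "\<exists>x\<in>Y. x \<in> A \<and> x \<noteq> \<one>")
        case True
        then obtain x where x: "x \<in> Y" "x \<in> A" "x \<noteq> \<one>" by blast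
        have "Y \<subseteq> A" by (rule prime_order_subgroup_Int[OF Y Y0(2) p19 A'(1) x])
        then have "Y = A" using card_subset_eq[OF finA] A'(2) Y0(2) by simp
        then show ?thesis by simp
      next
        case False
        let ?H = "(\<lambda>(y, x). y \<otimes> x) ` (Y \<times> A)"
        have HM: "?H \<subseteq> M" using YM A'(3) Mm by auto
        have inj: "inj_on (\<lambda>(y, x). y \<otimes> x) (Y \<times> A)"
        proof (rule inj_onI, clarify)
          fix u x v y assume h: "u \<in> Y" "x \<in> A" "v \<in> Y" "y \<in> A" "u \<otimes> x = v \<otimes> y"
          have c: "u \<in> carrier S" "v \<in> carrier S" "x \<in> carrier S" "y \<in> carrier S" using h YS AS by auto
          have "inv v \<otimes> (u \<otimes> x) = y" using h(5) c by (simp add: m_assoc[symmetric])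
          then have e: "inv v \<otimes> u = y \<otimes> inv x" using c by (metis inv_solve_right m_assoc m_closed inv_closed)
          moreover have "inv v \<otimes> u \<in> Y" using subgroup.m_closed[OF Y] subgroup.m_inv_closed[OF Y] h by blast
          moreover have "y \<otimes> inv x \<in> A" using subgroup.m_closed[OF A'(1)] subgroup.m_inv_closed[OF A'(1)] h by blast
          ultimately have e: "inv v \<otimes> u = \<one>" "y \<otimes> inv x = \<one>" using False by auto
          have "u = v" using e(1) c by (metis inv_equality inv_inv inv_closed)
          moreover have "y = x" using e(2) c by (metis inv_equality inv_inv inv_closed)
          ultimately show "u = v \<and> x = y" by simp
        qed
        have cH: "card ?H = 19 * 19" using card_image[OF inj] Y0(2) A'(2) by (simp add: card_cartesian_product)
        have "subgroup ?H S"
        proof (rule finite_subgroupI)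
          show "?H \<subseteq> carrier S" using HM MS by blast
          show "finite ?H" using finY finA by simp
          have "\<one> = \<one> \<otimes> \<one>" by simp
          then show "\<one> \<in> ?H" using subgroup.one_closed[OF Y] subgroup.one_closed[OF A'(1)] by force
          fix h k assume "h \<in> ?H" "k \<in> ?H"
          then obtain u x v y where h: "u \<in> Y" "x \<in> A" "v \<in> Y" "y \<in> A" "h = u \<otimes> x" "k = v \<otimes> y" by auto
          have c: "u \<in> carrier S" "v \<in> carrier S" "x \<in> carrier S" "y \<in> carrier S" using h YS AS by auto
          have iv: "inv v \<in> Y" using subgroup.m_inv_closed[OF Y h(3)] .
          have "inv v \<otimes> x \<otimes> inv (inv v) \<in> cg (inv v) A" unfolding cg_def using h(2) by blast
          then have x': "inv v \<otimes> x \<otimes> v \<in> A" using A(2)[OF iv] c by simp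
          have "(u \<otimes> v) \<otimes> ((inv v \<otimes> x \<otimes> v) \<otimes> y) = u \<otimes> (v \<otimes> inv v) \<otimes> x \<otimes> (v \<otimes> y)"
            using c by (simp only: m_assoc m_closed inv_closed)
          then have "h \<otimes> k = (u \<otimes> v) \<otimes> ((inv v \<otimes> x \<otimes> v) \<otimes> y)" unfolding h(5,6) using c by simp
          moreover have "u \<otimes> v \<in> Y" using subgroup.m_closed[OF Y h(1,3)] .
          moreover have "(inv v \<otimes> x \<otimes> v) \<otimes> y \<in> A" using subgroup.m_closed[OF A'(1) x' h(4)] .
          ultimately show "h \<otimes> k \<in> ?H" by force
        qed
        then have "card ?H dvd card M" by (rule card_subgroup_dvd[OF _ M HM])
        then have "(19 * 19 :: nat) dvd 19 * 1944" using cH cM by simp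
        then show ?thesis by simp
      qed
    qed
  qed
  have acY: "acts_on S Y O1 cg" by (rule acts_on_subset[OF ac YM])
  have "[card O1 = card {A\<in>O1. \<forall>y\<in>Y. cg y A = A}] (mod 19)"
    by (rule p_group_fixed_points[OF p19 _ acY Y finO, of 1]) (use Y0(2) in simp)
  then have o1: "card O1 mod 19 = 1" unfolding fixY by (simp add: cong_def)
  have "Y \<subseteq> N" unfolding N_def using YM fixY by blast
  then have "19 dvd card N" using card_subgroup_dvd[OF Y N] Y0(2) by simp
  then obtain n' where n': "card N = 19 * n'" by blast
  then have on: "card O1 * n' = 1944" using oN by (simp add: mult.commute)
  \<comment> \<open>Otherwise 8 divides the number of conjugates, which is then 8 times 3^i with i
    <= 5; modulo 19 these are 8, 5, 15, 7, 2, 6, never 1.\<close>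
  have "even (card N)"
  proof (rule ccontr)
    assume "odd (card N)"
    then have "odd n'" using n' by simp
    then have "coprime (2 ^ 3) n'" by (simp only: coprime_power_left_iff coprime_left_2_iff_odd) simp
    moreover have "2 ^ 3 dvd card O1 * n'" using on by simp
    ultimately have "2 ^ 3 dvd card O1" by (metis coprime_dvd_mult_left_iff)
    then obtain o' where o': "card O1 = 8 * o'" by auto
    then have "o' * n' = 243" using on by (simp add: mult.commute)
    then have "o' dvd 243" using dvd_triv_left by metis
    then have "o' dvd 3 ^ 5" by simp
    then obtain i where i: "i \<le> 5" "o' = 3 ^ i" using divides_primepow_nat[of 3 o' 5] by auto
    have "i = 0 \<or> i = 1 \<or> i = 2 \<or> i = 3 \<or> i = 4 \<or> i = 5" using i(1) by auto
    then show False using o1 o' i(2) by auto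
  qed
  then obtain x where x: "x \<in> N" "x \<noteq> \<one>" "x \<otimes> x = \<one>" using involution_exists[OF N] finite_subset[OF subgroup.subset[OF N] finS] by blast
  have xS: "x \<in> carrier S" using subgroup.mem_carrier[OF N x(1)] .
  have xi: "inv x = x" using inv_equality[OF x(3) xS xS] .
  have "Y \<noteq> {\<one>}" using Y0(2) by auto
  then obtain g where g: "g \<in> Y" "g \<noteq> \<one>" using subgroup.one_closed[OF Y] by blast
  have gS: "g \<in> carrier S" "inv g \<in> carrier S" using YS g by auto
  have "\<exists>p\<in>Om. act x p = p"
  proof (rule ccontr)
    assume no: "\<not> ?thesis"
    have "even (card Om)"
    proof (rule even_card_involution[OF finOm])
      fix y assume y: "y \<in> Om"
      show "act x y \<in> Om" using act_closed[OF xS y] .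
      show "act x (act x y) = y" using act_mult[OF xS xS y] x(3) act_one[OF y] by simp
      show "act x y \<noteq> y" using no y by blast
    qed
    then show False using card_Om q_even by simp
  qed
  then obtain p where p: "p \<in> Om" "act x p = p" by blast
  have gp: "act g p \<in> Om" "act g p \<noteq> p" using act_closed[OF gS(1) p(1)] free[OF g(1) p(1)] g(2) by auto
  let ?y = "g \<otimes> x \<otimes> inv g"
  have yS: "?y \<in> carrier S" using gS xS by simp
  have yy: "?y \<otimes> ?y = \<one>"
  proof -
    have "?y \<otimes> ?y = g \<otimes> (x \<otimes> x) \<otimes> inv g" using gS xS by (simp add: m_assoc inv_solve_left')
    then show ?thesis using x(3) gS by simp
  qed
  have ygp: "act ?y (act g p) = act g p"
    using act_mult gS xS gp p act_closed act_inv(1)[OF gS(1) p(1)] by simp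
  let ?c = "x \<otimes> ?y"
  \<comment> \<open>x (g x g^-1) = (x g x) g^-1, and x normalises Y.\<close>
  have cY: "?c \<in> Y"
  proof -
    have "x \<otimes> g \<otimes> inv x \<in> cg x Y" unfolding cg_def using g by blast
    then have "x \<otimes> g \<otimes> x \<in> Y" using x(1) xi unfolding N_def by auto
    then have "x \<otimes> g \<otimes> x \<otimes> inv g \<in> Y" using subgroup.m_closed[OF Y] subgroup.m_inv_closed[OF Y g(1)] by blast
    then show ?thesis using xS gS by (simp add: m_assoc)
  qed
  \<comment> \<open>Otherwise x would equal its conjugate by g and fix both p and g p.\<close>
  have cn: "?c \<noteq> \<one>"
  proof
    assume c1: "?c = \<one>"
    have e: "?y = x" by (rule trans[OF inv_equality[OF yy yS yS, symmetric] inv_equality[OF c1 yS xS]])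
    have "act x (act g p) = act g p" using ygp unfolding e .
    then have "x = \<one>" by (rule involution_fix_unique[OF xS x(3) gp(1) _ p gp(2)])
    then show False using x(2) by blast
  qed
  \<comment> \<open>Moving p and g p to \<open>pinf\<close> and \<open>po\<close> puts x into Z and
    its conjugate into w Z w. Both preserve \<open>L\<close>, so the product \<open>?c\<close>
    preserves the preimage of \<open>L\<close> under k.\<close>
  obtain k where k: "k \<in> carrier S" "act k p = pinf" "act k (act g p) = po" using two_transitive[OF p(1) gp(1) gp(2)[symmetric]] by blast
  have ki: "inv k \<in> carrier S" using k by simp
  define L' where "L' = {z\<in>Om. act k z \<in> L}"
  let ?x = "k \<otimes> x \<otimes> inv k" and ?z = "k \<otimes> ?y \<otimes> inv k"
  have kp: "act (inv k) pinf = p" "act (inv k) po = act g p" using k act_inv(1)[OF k(1)] p gp by auto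
  have sq: "(k \<otimes> t \<otimes> inv k) \<otimes> (k \<otimes> t \<otimes> inv k) = \<one>" if t: "t \<in> carrier S" "t \<otimes> t = \<one>" for t
  proof -
    have "(k \<otimes> t \<otimes> inv k) \<otimes> (k \<otimes> t \<otimes> inv k) = k \<otimes> (t \<otimes> t) \<otimes> inv k" using k t(1) by (simp add: m_assoc inv_solve_left')
    then show ?thesis using t k by simp
  qed
  have xZ: "?x \<in> Z"
  proof (rule involution_pinf)
    show "?x \<in> carrier S" using k xS by simp
    show "?x \<otimes> ?x = \<one>" by (rule sq[OF xS x(3)])
    show "act ?x pinf = pinf" using act_mult k xS ki pinf p kp act_closed by simp
  qed
  have zS: "?z \<in> carrier S" using k yS by simp
  have zZ: "w \<otimes> ?z \<otimes> w \<in> Z"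
  proof (rule involution_pinf)
    show "w \<otimes> ?z \<otimes> w \<in> carrier S" using w zS by simp
    have "(w \<otimes> ?z \<otimes> w) \<otimes> (w \<otimes> ?z \<otimes> w) = w \<otimes> ?z \<otimes> (w \<otimes> w) \<otimes> ?z \<otimes> w" using w(1) zS by (simp only: m_assoc m_closed)
    also have "\<dots> = w \<otimes> (?z \<otimes> ?z) \<otimes> w" using w zS by (simp only: w(3) r_one m_assoc m_closed)
    also have "\<dots> = \<one>" using sq[OF yS yy] w by simp
    finally show "(w \<otimes> ?z \<otimes> w) \<otimes> (w \<otimes> ?z \<otimes> w) = \<one>" .
    have "act ?z po = po" using act_mult k yS ki po gp kp ygp act_closed by simp
    moreover have "act w po = pinf" using act_inv(1)[OF w(1) pinf] w w_inv by simp
    ultimately show "act (w \<otimes> ?z \<otimes> w) pinf = pinf" using act_mult w zS pinf po act_closed by simp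
  qed
  have zL: "act ?z y \<in> L" if y: "y \<in> L" for y
  proof -
    have yO: "y \<in> Om" using y L(1) by blast
    have "?z = w \<otimes> (w \<otimes> ?z \<otimes> w) \<otimes> w"
    proof -
      have "w \<otimes> (w \<otimes> ?z \<otimes> w) \<otimes> w = (w \<otimes> w) \<otimes> ?z \<otimes> (w \<otimes> w)" using w(1) zS by (simp only: m_assoc m_closed)
      then show ?thesis using w(3) zS by simp
    qed
    then have "act ?z y = act (w \<otimes> (w \<otimes> ?z \<otimes> w) \<otimes> w) y" by simp
    also have "\<dots> = act w (act (w \<otimes> ?z \<otimes> w) (act w y))" using act_mult[of "w \<otimes> (w \<otimes> ?z \<otimes> w)" w y] act_mult[of w "w \<otimes> ?z \<otimes> w" "act w y"] w zS yO act_closed by simp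
    finally show ?thesis using L(4)[OF zZ L(5)[OF y]] L(5) by simp
  qed
  have cL': "act ?c y \<in> L'" if y: "y \<in> L'" for y
  proof -
    have yO: "y \<in> Om" and yL: "act k y \<in> L" using y unfolding L'_def by auto
    have kO: "act k y \<in> Om" using act_closed[OF k(1) yO] .
    have "act ?x (act ?z (act k y)) = act (?x \<otimes> (?z \<otimes> k)) y"
      using act_mult[OF zS k(1) yO] act_mult[of ?x "?z \<otimes> k" y] zS k xS ki yO by simp
    also have "?x \<otimes> (?z \<otimes> k) = k \<otimes> ?c" using k(1) xS gS by (simp add: m_assoc inv_solve_left')
    also have "act (k \<otimes> ?c) y = act k (act ?c y)" using act_mult[OF k(1) _ yO] xS yS by simp
    finally have "act k (act ?c y) = act ?x (act ?z (act k y))" by simp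
    then have "act k (act ?c y) \<in> L" using L(4)[OF xZ zL[OF yL]] by simp
    then show ?thesis unfolding L'_def using act_closed[OF _ yO] xS yS by simp
  qed
  let ?K = "{h\<in>Y. \<forall>y\<in>L'. act h y \<in> L'}"
  have L'O: "L' \<subseteq> Om" unfolding L'_def by blast
  have K: "subgroup ?K S"
  proof (rule finite_subgroupI)
    show "?K \<subseteq> carrier S" using YS by blast
    show "finite ?K" using finY by simp
    show "\<one> \<in> ?K" using subgroup.one_closed[OF Y] act_one L'O by auto
    show "h \<otimes> h' \<in> ?K" if "h \<in> ?K" "h' \<in> ?K" for h h'
      using that subgroup.m_closed[OF Y] act_mult[OF YS YS] L'O by auto
  qed
  \<comment> \<open>The stabiliser of \<open>L'\<close> in Y is nontrivial, hence all of Y; but a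
    group of order 19 acting on 9 points has a fixed point.\<close>
  have "Y \<subseteq> ?K" by (rule prime_order_subgroup_Int[OF Y Y0(2) p19 K cY _ cn]) (use cY cL' in blast)
  then have "acts_on S Y L' act" using acts_on_subset[OF acts YSs] L'O unfolding acts_on_def by blast
  moreover have "card L' = 9"
  proof -
    have "bij_betw (act k) L' L"
    proof (rule bij_betw_byWitness[of _ "act (inv k)"])
      show "\<forall>a\<in>L'. act (inv k) (act k a) = a" using act_inv(1)[OF k(1)] L'O by blast
      show "\<forall>a\<in>L. act k (act (inv k) a) = a" using act_inv(2)[OF k(1)] L(1) by blast
      show "act k ` L' \<subseteq> L" unfolding L'_def by blast
      show "act (inv k) ` L \<subseteq> L'" unfolding L'_def using act_inv(2)[OF k(1)] L(1) act_closed[OF ki] by auto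
    qed
    then show ?thesis using bij_betw_same_card L(3) q8 by fastforce
  qed
  moreover have "finite L'" using finite_subset[OF L'O finOm] .
  ultimately have "[card L' = card {y\<in>L'. \<forall>h\<in>Y. act h y = y}] (mod 19)"
    by (intro p_group_fixed_points[OF p19 _ _ Y, of 1]) (use Y0(2) in auto)
  then have "card {y\<in>L'. \<forall>h\<in>Y. act h y = y} \<noteq> 0" using \<open>card L' = 9\<close> by (auto simp: cong_def)
  then have "{y\<in>L'. \<forall>h\<in>Y. act h y = y} \<noteq> {}" by (metis card.empty)
  then obtain y where "y \<in> L'" "\<forall>h\<in>Y. act h y = y" by blast
  then show False using free[OF g(1)] g L'O by blast
qed

end

section \<open>The subgroup theorem and recognition of the action\<close>

context unitary3
begin

text \<open>If some conjugate of M meets U trivially, \<open>no_complement\<close> applies to that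
  conjugate. Otherwise every conjugate contains a nontrivial u in U, and u or its square is a
  nontrivial element of Z.\<close>

theorem large_subgroup:
  assumes M: "subgroup M S" and le: "card (carrier S) \<le> q^3 * card M"
  shows "M = carrier S"
proof (rule ccontr)
  assume ne: "M \<noteq> carrier S"
  show False
  proof (cases "\<exists>g\<in>carrier S. \<forall>u\<in>U. g \<otimes> u \<otimes> inv g \<in> M \<longrightarrow> u = \<one>")
    case True
    then obtain g where g: "g \<in> carrier S" "\<forall>u\<in>U. g \<otimes> u \<otimes> inv g \<in> M \<longrightarrow> u = \<one>" by blast
    show False by (rule no_complement[OF conj_subgroup(1)[OF g(1) M]]) (use g le conj_subgroup(2)[OF g(1) M] in auto)
  next
    case False
    have "\<exists>z\<in>Z. z \<noteq> \<one> \<and> g \<otimes> z \<otimes> inv g \<in> M" if g: "g \<in> carrier S" for g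
    proof -
      obtain u where u: "u \<in> U" "u \<noteq> \<one>" "g \<otimes> u \<otimes> inv g \<in> M" using False g by blast
      have uS: "u \<in> carrier S" using U_carrier u by blast
      show ?thesis
      proof (cases "ap u = 0")
        case True then show ?thesis using u unfolding Z_def by blast
      next
        case False
        have "(g \<otimes> u \<otimes> inv g) \<otimes> (g \<otimes> u \<otimes> inv g) \<in> M" using subgroup.m_closed[OF M u(3) u(3)] .
        moreover have "(g \<otimes> u \<otimes> inv g) \<otimes> (g \<otimes> u \<otimes> inv g) = g \<otimes> (u \<otimes> u) \<otimes> inv g" using g uS by (simp add: m_assoc inv_solve_left')
        moreover have "u \<otimes> u \<in> Z" "u \<otimes> u \<noteq> \<one>" using U_square[OF u(1)] False bp_one by auto
        ultimately show ?thesis by auto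
      qed
    qed
    then interpret sg: unitary3_subgroup m q T S Om act pinf po w P U Z tp ap bp L M
      by unfold_locales (use M ne le in \<open>auto simp: subgroup_def\<close>)
    show False by (rule sg.impossible)
  qed
qed

text \<open>The orbit of a moved point has more than q^3 elements, so it is B. The 2-group U fixes
  some \<open>b0\<close> since |B| is odd; the stabiliser of \<open>b0\<close> contains U and is
  proper, so it lies in P by \<open>overgroup_U\<close> and equals P by order. The action is
  therefore the one on cosets of P, and U is transitive off \<open>b0\<close> because S is the union
  of P and U w P.\<close>

theorem action_two_transitive:
  assumes ac: "acts_on S (carrier S) B a" and cB: "card B = q^3 + 1" and u0: "u0 \<in> U" "b1 \<in> B" "a u0 b1 \<noteq> b1"
  shows "\<exists>b0. two_transitive S B a U (q^3) (3 * m) b0"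
proof -
  have finB: "finite B" using cB card.infinite by fastforce
  have a_closed: "a g b \<in> B" if "g \<in> carrier S" "b \<in> B" for g b using ac that unfolding acts_on_def by blast
  have a_mult: "a (g \<otimes> h) b = a g (a h b)" if "g \<in> carrier S" "h \<in> carrier S" "b \<in> B" for g h b using ac that unfolding acts_on_def by blast
  have a_one: "a \<one> b = b" if "b \<in> B" for b using ac that unfolding acts_on_def by blast
  note a_inv = acts_on_inv[OF ac subgroup_self]
  have st: "subgroup {g\<in>carrier S. a g b = b} S" if b: "b \<in> B" for b
    by (rule finite_subgroupI) (use finS a_one a_mult b in auto)
  let ?O = "(\<lambda>g. a g b1) ` carrier S"
  have OB: "?O \<subseteq> B" using a_closed u0(2) by blast
  have os: "card ?O * card {g\<in>carrier S. a g b1 = b1} = card (carrier S)"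
    by (rule acts_on_orbit_stabilizer[OF ac subgroup_self u0(2)])
  have "\<not> card ?O \<le> q^3"
  proof
    assume "card ?O \<le> q^3"
    then have "card ?O * card {g\<in>carrier S. a g b1 = b1} \<le> q^3 * card {g\<in>carrier S. a g b1 = b1}" by (rule mult_le_mono1)
    then have "card (carrier S) \<le> q^3 * card {g\<in>carrier S. a g b1 = b1}" using os by simp
    then have "{g\<in>carrier S. a g b1 = b1} = carrier S" by (rule large_subgroup[OF st[OF u0(2)]])
    then show False using u0(3) U_carrier[OF u0(1)] by blast
  qed
  then have "card B \<le> card ?O" using cB by simp
  then have OB': "?O = B" by (rule card_seteq[OF finB OB])
  have c23: "q^3 = 2 ^ (3 * m)" using q by (simp add: power_mult[symmetric] mult.commute)
  have acU: "acts_on S U B a" by (rule acts_on_subset[OF ac subgroup.subset[OF U_sub]])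
  have "[card B = card {b\<in>B. \<forall>u\<in>U. a u b = b}] (mod 2)"
    by (rule p_group_fixed_points[OF two_is_prime_nat _ acU U_sub finB, of "3 * m"]) (use card_U c23 in simp)
  moreover have "odd (card B)" using cB q_even by simp
  ultimately have "card {b\<in>B. \<forall>u\<in>U. a u b = b} \<noteq> 0" by (metis cong_0_iff even_zero)
  then have "{b\<in>B. \<forall>u\<in>U. a u b = b} \<noteq> {}" by (metis card.empty)
  then obtain b0 where b0: "b0 \<in> B" "\<forall>u\<in>U. a u b0 = b0" by blast
  obtain g0 where g0: "g0 \<in> carrier S" "a g0 b1 = b0" using b0(1) OB' by auto
  have trans: "\<exists>g\<in>carrier S. a g b0 = b" if b: "b \<in> B" for b
  proof -
    obtain g where g: "g \<in> carrier S" "a g b1 = b" using b OB' by auto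
    have "a (inv g0) b0 = b1" using a_inv(1)[OF g0(1) u0(2)] g0(2) by simp
    then have "a (g \<otimes> inv g0) b0 = b" using a_mult[OF g(1) inv_closed[OF g0(1)] b0(1)] g(2) by simp
    then show ?thesis using g g0 by blast
  qed
  let ?H = "{g\<in>carrier S. a g b0 = b0}"
  have UH: "U \<subseteq> ?H" using b0 U_carrier by blast
  have "?H \<noteq> carrier S"
  proof
    assume h: "?H = carrier S"
    have "b = b0" if "b \<in> B" for b using trans[OF that] h by blast
    then have "b1 = b0" "a u0 b1 = b0" using u0(2) a_closed[OF U_carrier[OF u0(1)] u0(2)] by blast+
    then show False using u0(3) by simp
  qed
  then have HP: "?H \<subseteq> P" using overgroup_U[OF st[OF b0(1)] UH] by blast
  have "(\<lambda>g. a g b0) ` carrier S = B" using trans a_closed b0(1) by blast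
  then have "(q^3 + 1) * card ?H = (q^3 + 1) * card P"
    using acts_on_orbit_stabilizer[OF ac subgroup_self b0(1)] cB card_S by simp
  then have "card ?H = card P" by (simp only: mult_cancel1) simp
  then have HeP: "?H = P" by (rule card_subset_eq[OF finite_subset[OF subgroup.subset[OF P_sub] finS] HP])
  let ?c = "a w b0"
  have cB': "?c \<in> B" using a_closed w b0 by blast
  have Utr: "\<exists>u\<in>U. b = a u ?c" if b: "b \<in> B - {b0}" for b
  proof -
    have bB: "b \<in> B" using b by blast
    obtain g where g: "g \<in> carrier S" "a g b0 = b" using trans[OF bB] by blast
    have "g \<notin> P" using HeP g b by blast
    then have "act g pinf \<noteq> pinf" unfolding P_def using g by blast
    then obtain u where u: "u \<in> U" "act u po = act g pinf" using U_regular[OF act_closed[OF g(1) pinf]] by blast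
    have uS: "u \<in> carrier S" using U_carrier u by blast
    have uw: "u \<otimes> w \<in> carrier S" using uS w by simp
    have "act (inv (u \<otimes> w) \<otimes> g) pinf = act (inv (u \<otimes> w)) (act (u \<otimes> w) pinf)"
      using act_mult[OF inv_closed[OF uw] g(1) pinf] act_mult[OF uS w(1) pinf] w u by simp
    then have "inv (u \<otimes> w) \<otimes> g \<in> P" unfolding P_def using act_inv(1)[OF uw pinf] uw g by simp
    then have "a (inv (u \<otimes> w) \<otimes> g) b0 = b0" using HeP by blast
    then have "a (inv (u \<otimes> w)) b = b0" using a_mult[OF inv_closed[OF uw] g(1) b0(1)] g(2) by simp
    then have "a (u \<otimes> w) b0 = b" using a_inv(2)[OF uw bB] by simp
    then show ?thesis using a_mult[OF uS w(1) b0(1)] u by blast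
  qed
  have "two_transitive S B a U (q^3) (3 * m) b0"
  proof unfold_locales
    show "finite (carrier S)" by (rule finS)
    show "acts_on S (carrier S) B a" by (rule ac)
    show "finite B" by (rule finB)
    show "card B = q^3 + 1" by (rule cB)
    show "even (q^3)" using q_even q_ge by simp
    show "2 \<le> q^3" using q_ge power_increasing[of 1 3 q] by simp
    show "card U = 2 ^ (3 * m)" using card_U c23 by simp
    show "b0 \<in> B" by (rule b0(1))
    show "a u b0 = b0" if "u \<in> U" for u using b0 that by blast
    show "\<exists>g\<in>carrier S. a g b0 = b" if "b \<in> B" for b by (rule trans[OF that])
    show "M = carrier S" if "subgroup M S" "card (carrier S) \<le> q^3 * card M" for M by (rule large_subgroup[OF that])
    show "\<exists>u\<in>U. a u b = c" if bc: "b \<in> B - {b0}" "c \<in> B - {b0}" for b c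
    proof -
      obtain u v where uv: "u \<in> U" "b = a u ?c" "v \<in> U" "c = a v ?c" using Utr[OF bc(1)] Utr[OF bc(2)] by blast
      have uS: "u \<in> carrier S" "v \<in> carrier S" using U_carrier uv by auto
      have "a (inv u) b = ?c" using a_inv(1)[OF uS(1) cB'] uv(2) by simp
      then have "a (v \<otimes> inv u) b = c" using a_mult[OF uS(2) inv_closed[OF uS(1)]] bc(1) uv(4) by simp
      then show ?thesis using U_mult[OF uv(3) U_inv[OF uv(1)]] by blast
    qed
  qed (simp_all add: subgroup.subset[OF U_sub] subgroup.m_closed[OF U_sub] subgroup.one_closed[OF U_sub] subgroup.m_inv_closed[OF U_sub])
  then show ?thesis by blast
qed

end

section \<open>Matrices of size three\<close>

definition mat3 :: "'a \<Rightarrow> 'a \<Rightarrow> 'a \<Rightarrow> 'a \<Rightarrow> 'a \<Rightarrow> 'a \<Rightarrow> 'a \<Rightarrow> 'a \<Rightarrow> 'a \<Rightarrow> 'a::zero^3^3" where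
  "mat3 a b c d e f g h i = vector [vector [a, b, c], vector [d, e, f], vector [g, h, i]]"

lemma mat3_nth [simp]:
  "mat3 a b c d e f g h i $ 1 $ 1 = a" "mat3 a b c d e f g h i $ 1 $ 2 = b" "mat3 a b c d e f g h i $ 1 $ 3 = c"
  "mat3 a b c d e f g h i $ 2 $ 1 = d" "mat3 a b c d e f g h i $ 2 $ 2 = e" "mat3 a b c d e f g h i $ 2 $ 3 = f"
  "mat3 a b c d e f g h i $ 3 $ 1 = g" "mat3 a b c d e f g h i $ 3 $ 2 = h" "mat3 a b c d e f g h i $ 3 $ 3 = i"
  by (simp_all add: mat3_def)

lemma mat3_eq_iff: "A = B \<longleftrightarrow> (\<forall>i j. A $ i $ j = B $ i $ j)" for A B :: "'a^3^3"
  by (auto simp: vec_eq_iff)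

lemma matrix_mult_3: "(A ** B) $ i $ j = A $ i $ 1 * B $ 1 $ j + A $ i $ 2 * B $ 2 $ j + A $ i $ 3 * B $ 3 $ j"
  for A B :: "'a::semiring_1^3^3"
  by (simp add: matrix_matrix_mult_def sum_3)

lemma matrix_vec_3: "(A *v x) $ i = A $ i $ 1 * x $ 1 + A $ i $ 2 * x $ 2 + A $ i $ 3 * x $ 3"
  for A :: "'a::semiring_1^3^3"
  by (simp add: matrix_vector_mult_def sum_3)

lemma mat_one_3: "(mat 1 :: 'a::semiring_1^3^3) = mat3 1 0 0 0 1 0 0 0 1"
  by (simp add: mat3_eq_iff forall_3 mat_def)

definition dot :: "'a::comm_ring_1^3 \<Rightarrow> 'a^3 \<Rightarrow> 'a" where
  "dot x y = x $ 1 * y $ 1 + x $ 2 * y $ 2 + x $ 3 * y $ 3"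

lemma dot_transpose: "dot (A *v x) y = dot x (transpose A *v y)"
  by (simp add: dot_def matrix_vec_3 transpose_def algebra_simps)

section \<open>The matrix group\<close>

context hermitian_field
begin

definition fm :: "'k^3^3 \<Rightarrow> 'k^3^3" where "fm A = frob_mat q A"

lemma fm_nth [simp]: "fm A $ i $ j = cj (A $ i $ j)"
  by (simp add: fm_def frob_mat_def cj_def)

lemma fm_mult: "fm (A ** B) = fm A ** fm B"
  by (simp add: vec_eq_iff matrix_mult_3 cj_add cj_mult)

lemma fm_one: "fm (mat 1) = mat 1"
  by (simp add: mat3_eq_iff mat_def)

definition cjv :: "'k^3 \<Rightarrow> 'k^3" where "cjv x = (\<chi> i. cj (x $ i))"

lemma cjv_nth [simp]: "cjv x $ i = cj (x $ i)" by (simp add: cjv_def)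

lemma cjv_mult: "cjv (A *v x) = fm A *v cjv x"
  by (simp add: vec_eq_iff matrix_vec_3 cj_add cj_mult)

definition hf :: "'k^3^3 \<Rightarrow> 'k^3 \<Rightarrow> 'k^3 \<Rightarrow> 'k" where "hf J x y = dot x (J *v cjv y)"

lemma SU3_iff: "A \<in> SU3 q J \<longleftrightarrow> det A = 1 \<and> transpose A ** J ** fm A = J"
  by (simp add: SU3_def fm_def)

lemma hf_mult: "hf J (A *v x) (A *v y) = hf (transpose A ** J ** fm A) x y"
  by (simp add: hf_def dot_transpose cjv_mult matrix_vector_mul_assoc matrix_mul_assoc)

lemma hf_SU3: "A \<in> SU3 q J \<Longrightarrow> hf J (A *v x) (A *v y) = hf J x y"
  by (simp add: hf_mult SU3_iff)

text \<open>Turns the matrix equation defining SU_3 into values of the form on the columns of A, and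
  back.\<close>

lemma gram: "(transpose A ** J ** fm A) $ i $ j = hf J (column i A) (column j A)"
  by (simp add: hf_def dot_def matrix_mult_3 matrix_vec_3 transpose_def column_def algebra_simps)

lemma SU3_inverse:
  fixes J :: "'k^3^3" assumes "A \<in> SU3 q J"
  shows "\<exists>A'\<in>SU3 q J. A' ** A = mat 1 \<and> A ** A' = mat 1"
proof -
  have A: "det A = 1" "transpose A ** J ** fm A = J" using assms SU3_iff by auto
  then have "invertible A" by (simp add: invertible_det_nz)
  then obtain A' where A': "A ** A' = mat 1" "A' ** A = mat 1" unfolding invertible_def by blast
  have "det A * det A' = 1" using det_mul[of A A'] A' by simp
  then have d: "det A' = 1" using A by simp
  have "transpose A' ** J ** fm A' = transpose A' ** (transpose A ** J ** fm A) ** fm A'" using A by simp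
  also have "\<dots> = transpose (A ** A') ** J ** fm (A ** A')" by (simp add: matrix_transpose_mul fm_mult matrix_mul_assoc)
  also have "\<dots> = J" unfolding A' by (simp add: fm_one transpose_mat)
  finally have "A' \<in> SU3 q J" using d SU3_iff by blast
  then show ?thesis using A' by blast
qed

lemma SU3_mult: "A \<in> SU3 q J \<Longrightarrow> B \<in> SU3 q J \<Longrightarrow> A ** B \<in> SU3 q J" for J :: "'k^3^3"
proof -
  assume "A \<in> SU3 q J" "B \<in> SU3 q J"
  then have A: "det A = 1" "transpose A ** J ** fm A = J" "det B = 1" "transpose B ** J ** fm B = J" using SU3_iff by auto
  have "transpose (A ** B) ** J ** fm (A ** B) = transpose B ** (transpose A ** J ** fm A) ** fm B"
    by (simp add: matrix_transpose_mul fm_mult matrix_mul_assoc)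
  then show ?thesis using A SU3_iff by (simp add: det_mul)
qed

lemma SU3_one: "mat 1 \<in> SU3 q J" for J :: "'k^3^3"
  by (simp add: SU3_iff fm_one transpose_mat)

lemma SU3_group: "group (SU3_group q J)" for J :: "'k^3^3"
proof (rule groupI)
  show "x \<otimes>\<^bsub>SU3_group q J\<^esub> y \<in> carrier (SU3_group q J)" if "x \<in> carrier (SU3_group q J)" "y \<in> carrier (SU3_group q J)" for x y
    using SU3_mult that by (simp add: SU3_group_def)
  show "\<one>\<^bsub>SU3_group q J\<^esub> \<in> carrier (SU3_group q J)" using SU3_one by (simp add: SU3_group_def)
  show "x \<otimes>\<^bsub>SU3_group q J\<^esub> y \<otimes>\<^bsub>SU3_group q J\<^esub> z = x \<otimes>\<^bsub>SU3_group q J\<^esub> (y \<otimes>\<^bsub>SU3_group q J\<^esub> z)" for x y z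
    by (simp add: SU3_group_def matrix_mul_assoc)
  show "\<one>\<^bsub>SU3_group q J\<^esub> \<otimes>\<^bsub>SU3_group q J\<^esub> x = x" for x by (simp add: SU3_group_def)
  show "\<exists>y\<in>carrier (SU3_group q J). y \<otimes>\<^bsub>SU3_group q J\<^esub> x = \<one>\<^bsub>SU3_group q J\<^esub>" if "x \<in> carrier (SU3_group q J)" for x
    using SU3_inverse[of x J] that by (auto simp: SU3_group_def)
qed

definition J0 :: "'k^3^3" where "J0 = mat3 0 0 1 0 1 0 1 0 0"

definition G0 :: "('k^3^3) monoid" where "G0 = SU3_group q J0"

lemma G0_simps [simp]: "carrier G0 = SU3 q J0" "x \<otimes>\<^bsub>G0\<^esub> y = x ** y" "\<one>\<^bsub>G0\<^esub> = mat 1"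
  by (simp_all add: G0_def SU3_group_def)

sublocale G0: group G0 unfolding G0_def by (rule SU3_group)

lemma J0_nth [simp]: "J0 $ 1 $ 1 = 0" "J0 $ 1 $ 2 = 0" "J0 $ 1 $ 3 = 1" "J0 $ 2 $ 1 = 0" "J0 $ 2 $ 2 = 1" "J0 $ 2 $ 3 = 0"
  "J0 $ 3 $ 1 = 1" "J0 $ 3 $ 2 = 0" "J0 $ 3 $ 3 = 0"
  by (simp_all add: J0_def)

lemma hf_J0: "hf J0 x y = x $ 1 * cj (y $ 3) + x $ 2 * cj (y $ 2) + x $ 3 * cj (y $ 1)"
  by (simp add: hf_def dot_def matrix_vec_3 J0_def)

text \<open>The equation of \<open>XY\<close> is at once the unitarity of \<open>umat a b\<close>
  and the isotropy of \<open>pt a b\<close>. The middle entry of \<open>hmat\<close> makes the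
  determinant 1.\<close>

definition umat :: "'k \<Rightarrow> 'k \<Rightarrow> 'k^3^3" where "umat a b = mat3 1 (cj a) b 0 1 a 0 0 1"
definition hmat :: "'k \<Rightarrow> 'k^3^3" where "hmat t = mat3 t 0 0 0 (cj t / t) 0 0 0 (1 / cj t)"
definition wmat :: "'k^3^3" where "wmat = mat3 0 0 1 0 1 0 1 0 0"
definition e1 :: "'k^3" where "e1 = vector [1, 0, 0]"
definition pt :: "'k \<Rightarrow> 'k \<Rightarrow> 'k^3" where "pt a b = vector [b, a, 1]"
definition XY :: "('k \<times> 'k) set" where "XY = {(a, b). b + cj b = a * cj a}"

lemma vec_nth [simp]: "e1 $ 1 = 1" "e1 $ 2 = 0" "e1 $ 3 = 0" "pt a b $ 1 = b" "pt a b $ 2 = a" "pt a b $ 3 = 1"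
  by (simp_all add: e1_def pt_def)

lemma umat_SU3: "(a, b) \<in> XY \<Longrightarrow> umat a b \<in> SU3 q J0"
proof -
  assume "(a, b) \<in> XY"
  then have ab: "b + cj b = a * cj a" unfolding XY_def by simp
  then have ab': "b + (a * cj a + cj b) = 0" 
  proof -
    have "(b + cj b) + a * cj a = 0" using ab by simp
    then show ?thesis by (simp only: ac_simps)
  qed
  show ?thesis unfolding SU3_iff
    using ab' by (simp add: umat_def det_3 mat3_eq_iff forall_3 matrix_mult_3 transpose_def J0_def) (simp add: ac_simps)
qed

lemma hmat_SU3: "t \<noteq> 0 \<Longrightarrow> hmat t \<in> SU3 q J0"
  unfolding SU3_iff
  by (simp add: hmat_def det_3 mat3_eq_iff forall_3 matrix_mult_3 transpose_def J0_def cj_divide)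

lemma wmat_SU3: "wmat \<in> SU3 q J0"
  unfolding SU3_iff
  by (simp add: wmat_def det_3 mat3_eq_iff forall_3 matrix_mult_3 transpose_def J0_def)

lemma wmat_square: "wmat ** wmat = mat 1"
  by (simp add: wmat_def mat_one_3 mat3_eq_iff forall_3 matrix_mult_3)

lemma umat_mult: "umat a b ** umat c d = umat (a + c) (b + d + cj a * c)"
  by (simp add: umat_def mat3_eq_iff forall_3 matrix_mult_3 cj_add ac_simps)

text \<open>Projective points as sets of vectors: equality of points is equality of sets, and
  matrices act by image.\<close>

definition ln :: "'k^3 \<Rightarrow> ('k^3) set" where "ln v = range (\<lambda>c. c *s v)"
definition acl :: "'k^3^3 \<Rightarrow> ('k^3) set \<Rightarrow> ('k^3) set" where "acl A l = (\<lambda>x. A *v x) ` l"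
definition Omg :: "('k^3) set set" where "Omg = {ln v | v. v \<noteq> 0 \<and> hf J0 v v = 0}"

lemma acl_ln: "acl A (ln v) = ln (A *v v)"
  by (simp add: acl_def ln_def image_image vector_scalar_commute)

lemma ln_scale: "c \<noteq> 0 \<Longrightarrow> ln (c *s v) = ln v"
proof
  assume c: "c \<noteq> 0"
  show "ln (c *s v) \<subseteq> ln v" unfolding ln_def by (auto simp: vector_smult_assoc)
  show "ln v \<subseteq> ln (c *s v)"
  proof
    fix x assume "x \<in> ln v"
    then obtain d where "x = d *s v" unfolding ln_def by blast
    then have "x = (d / c) *s (c *s v)" using c by (simp add: vector_smult_assoc)
    then show "x \<in> ln (c *s v)" unfolding ln_def by blast
  qed
qed

lemma ln_eqD: "ln v = ln v' \<Longrightarrow> \<exists>c. v' = c *s v"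
proof -
  assume e: "ln v = ln v'"
  have "v' = 1 *s v'" by simp
  then have "v' \<in> ln v'" unfolding ln_def by blast
  then show ?thesis using e unfolding ln_def by auto
qed

lemma e1_pt: "ln e1 \<noteq> ln (pt a b)"
proof
  assume "ln e1 = ln (pt a b)"
  then obtain c where "pt a b = c *s e1" using ln_eqD by blast
  then have "pt a b $ 3 = (c *s e1) $ 3" by simp
  then show False by simp
qed

lemma pt_eq: "ln (pt a b) = ln (pt a' b') \<Longrightarrow> a = a' \<and> b = b'"
proof -
  assume "ln (pt a b) = ln (pt a' b')"
  then obtain c where c: "pt a' b' = c *s pt a b" using ln_eqD by blast
  have "pt a' b' $ 3 = (c *s pt a b) $ 3" using c by simp
  then have "c = 1" by simp
  then have "pt a' b' = pt a b" using c by simp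
  then have "pt a' b' $ 1 = pt a b $ 1" "pt a' b' $ 2 = pt a b $ 2" by simp_all
  then show ?thesis by simp
qed

text \<open>An isotropic vector with third coordinate 0 has second coordinate of norm 0, so it is a
  multiple of \<open>e1\<close>; any other can be scaled to third coordinate 1.\<close>

lemma Omg_alt: "Omg = insert (ln e1) ((\<lambda>(a, b). ln (pt a b)) ` XY)"
proof
  show "Omg \<subseteq> insert (ln e1) ((\<lambda>(a, b). ln (pt a b)) ` XY)"
  proof
    fix l assume "l \<in> Omg"
    then obtain v where v: "l = ln v" "v \<noteq> 0" "hf J0 v v = 0" unfolding Omg_def by blast
    show "l \<in> insert (ln e1) ((\<lambda>(a, b). ln (pt a b)) ` XY)"
    proof (cases "v $ 3 = 0")
      case True
      then have v2: "v $ 2 = 0" using v(3) by (simp add: hf_J0)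
      then have v1: "v $ 1 \<noteq> 0" using v(2) True by (auto simp: vec_eq_iff forall_3)
      have "v = v $ 1 *s e1" using True v2 by (simp add: vec_eq_iff forall_3)
      then have "ln v = ln e1" using ln_scale[OF v1, of e1] by simp
      then show ?thesis using v by simp
    next
      case False
      let ?a = "v $ 2 / v $ 3" and ?b = "v $ 1 / v $ 3"
      have ve: "v = v $ 3 *s pt ?a ?b" using False by (simp add: vec_eq_iff forall_3)
      have c3: "cj (v $ 3) \<noteq> 0" using False by simp
      have "hf J0 v v = v $ 3 * cj (v $ 3) * (?b + ?a * cj ?a + cj ?b)"
        using False c3 by (simp add: hf_J0 cj_divide field_simps)
      then have "?b + ?a * cj ?a + cj ?b = 0" using v(3) False c3 by simp
      then have "?b + cj ?b + ?a * cj ?a = 0" by (simp only: ac_simps)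
      then have "(?a, ?b) \<in> XY" unfolding XY_def by simp
      moreover have "l = ln (pt ?a ?b)" using v(1) ln_scale[OF False, of "pt ?a ?b"] ve by simp
      ultimately show ?thesis by blast
    qed
  qed
  show "insert (ln e1) ((\<lambda>(a, b). ln (pt a b)) ` XY) \<subseteq> Omg"
  proof
    fix l assume "l \<in> insert (ln e1) ((\<lambda>(a, b). ln (pt a b)) ` XY)"
    then consider "l = ln e1" | a b where "(a, b) \<in> XY" "l = ln (pt a b)" by blast
    then show "l \<in> Omg"
    proof cases
      case 1
      have "e1 \<noteq> 0" "hf J0 e1 e1 = 0" by (auto simp: vec_eq_iff forall_3 hf_J0)
      then show ?thesis unfolding Omg_def using 1 by blast
    next
      case 2
      have "b + a * cj a + cj b = 0" using 2(1) unfolding XY_def by (simp add: add.commute[of b] add.assoc)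
      then have "pt a b \<noteq> 0" "hf J0 (pt a b) (pt a b) = 0" by (auto simp: vec_eq_iff forall_3 hf_J0)
      then show ?thesis unfolding Omg_def using 2(2) by blast
    qed
  qed
qed

lemma card_XY: "card XY = q ^ 3"
proof -
  have "XY = (SIGMA a:UNIV. {b. b + cj b = a * cj a})" unfolding XY_def by auto
  then have "card XY = (\<Sum>a\<in>(UNIV::'k set). card {b. b + cj b = a * cj a})"
    by (simp only:) (rule card_SigmaI, simp_all)
  also have "\<dots> = (\<Sum>a\<in>(UNIV::'k set). q)" using trace_count[OF Fq_norm] by simp
  also have "\<dots> = q ^ 3" using cardK by (simp add: power2_eq_square power3_eq_cube)
  finally show ?thesis .
qed

lemma card_Omg: "card Omg = q ^ 3 + 1"
proof -
  have inj: "inj_on (\<lambda>(a, b). ln (pt a b)) XY" using pt_eq by (auto simp: inj_on_def)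
  have "ln e1 \<notin> (\<lambda>(a, b). ln (pt a b)) ` XY" using e1_pt by auto
  then have "card Omg = Suc (card ((\<lambda>(a, b). ln (pt a b)) ` XY))" unfolding Omg_alt by simp
  then show ?thesis using card_image[OF inj] card_XY by simp
qed

definition P0 :: "('k^3^3) set" where "P0 = {g\<in>SU3 q J0. acl g (ln e1) = ln e1}"
definition U0 :: "('k^3^3) set" where "U0 = {g\<in>P0. g $ 1 $ 1 = 1}"
definition Z0 :: "('k^3^3) set" where "Z0 = {u\<in>U0. u $ 2 $ 3 = 0}"
definition L0 :: "('k^3) set set" where "L0 = insert (ln e1) ((\<lambda>b. ln (pt 0 b)) ` Fq)"

lemma P0_iff: "g \<in> P0 \<longleftrightarrow> g \<in> SU3 q J0 \<and> g $ 2 $ 1 = 0 \<and> g $ 3 $ 1 = 0"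
proof -
  have "acl g (ln e1) = ln e1 \<longleftrightarrow> g $ 2 $ 1 = 0 \<and> g $ 3 $ 1 = 0" if g: "g \<in> SU3 q J0"
  proof
    assume "acl g (ln e1) = ln e1"
    then obtain c where "g *v e1 = c *s e1" using ln_eqD[of e1 "g *v e1"] unfolding acl_ln by auto
    then have "(g *v e1) $ 2 = (c *s e1) $ 2" "(g *v e1) $ 3 = (c *s e1) $ 3" by simp_all
    then show "g $ 2 $ 1 = 0 \<and> g $ 3 $ 1 = 0" by (simp add: matrix_vec_3)
  next
    assume z: "g $ 2 $ 1 = 0 \<and> g $ 3 $ 1 = 0"
    have n: "g $ 1 $ 1 \<noteq> 0"
    proof
      assume "g $ 1 $ 1 = 0"
      then have "det g = 0" using z by (simp add: det_3)
      then show False using g SU3_iff by simp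
    qed
    have "g *v e1 = g $ 1 $ 1 *s e1" using z by (simp add: vec_eq_iff forall_3 matrix_vec_3)
    then show "acl g (ln e1) = ln e1" unfolding acl_ln using ln_scale[OF n] by simp
  qed
  then show ?thesis unfolding P0_def by blast
qed

text \<open>The first column is a multiple of \<open>e1\<close>; its products with columns 2 and 3
  determine the last row, and the determinant gives the middle entry.\<close>

lemma P0_struct: assumes "g \<in> P0"
  shows "g $ 1 $ 1 \<noteq> 0" "g $ 2 $ 1 = 0" "g $ 3 $ 1 = 0" "g $ 3 $ 2 = 0" "g $ 3 $ 3 = 1 / cj (g $ 1 $ 1)"
    "g $ 2 $ 2 = cj (g $ 1 $ 1) / g $ 1 $ 1"
proof -
  have g: "g \<in> SU3 q J0" "g $ 2 $ 1 = 0" "g $ 3 $ 1 = 0" using assms P0_iff by auto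
  then have d: "det g = 1" and gr: "\<And>i j. hf J0 (column i g) (column j g) = J0 $ i $ j"
    using SU3_iff[of g J0] gram[of g J0] by auto
  show z: "g $ 2 $ 1 = 0" "g $ 3 $ 1 = 0" using g by auto
  have h13: "g $ 1 $ 1 * cj (g $ 3 $ 3) = 1" using gr[of 1 3] z by (simp add: hf_J0 column_def)
  then show n: "g $ 1 $ 1 \<noteq> 0" by auto
  have h12: "g $ 1 $ 1 * cj (g $ 3 $ 2) = 0" using gr[of 1 2] z by (simp add: hf_J0 column_def)
  then show z32: "g $ 3 $ 2 = 0" using n by simp
  have "cj (g $ 1 $ 1 * cj (g $ 3 $ 3)) = 1" using h13 by simp
  then have h31: "cj (g $ 1 $ 1) * g $ 3 $ 3 = 1" by (simp add: cj_mult)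
  then show g33: "g $ 3 $ 3 = 1 / cj (g $ 1 $ 1)" using n by (simp add: field_simps)
  have "g $ 1 $ 1 * g $ 2 $ 2 * g $ 3 $ 3 = 1" using d z z32 by (simp add: det_3)
  then show "g $ 2 $ 2 = cj (g $ 1 $ 1) / g $ 1 $ 1" using n unfolding g33 by (simp add: field_simps)
qed

lemma umat_U0: "(a, b) \<in> XY \<Longrightarrow> umat a b \<in> U0"
  unfolding U0_def P0_iff using umat_SU3 by (simp add: umat_def)

lemma U0_umat: assumes "g \<in> U0" shows "g = umat (g $ 2 $ 3) (g $ 1 $ 3)" "(g $ 2 $ 3, g $ 1 $ 3) \<in> XY"
proof -
  have g: "g \<in> P0" "g $ 1 $ 1 = 1" using assms unfolding U0_def by auto
  note s = P0_struct[OF g(1)]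
  have e: "g $ 3 $ 3 = 1" "g $ 2 $ 2 = 1" using s g(2) by auto
  have gr: "\<And>i j. hf J0 (column i g) (column j g) = J0 $ i $ j"
    using g(1) SU3_iff[of g J0] gram[of g J0] P0_iff by auto
  have "g $ 1 $ 2 + cj (g $ 2 $ 3) = 0" using gr[of 2 3] s e by (simp add: hf_J0 column_def)
  then have g12: "g $ 1 $ 2 = cj (g $ 2 $ 3)" by simp
  show "g = umat (g $ 2 $ 3) (g $ 1 $ 3)" using s g(2) e g12 by (simp add: umat_def mat3_eq_iff forall_3)
  have "g $ 1 $ 3 + g $ 2 $ 3 * cj (g $ 2 $ 3) + cj (g $ 1 $ 3) = 0" using gr[of 3 3] e by (simp add: hf_J0 column_def)
  then have "g $ 1 $ 3 + cj (g $ 1 $ 3) + g $ 2 $ 3 * cj (g $ 2 $ 3) = 0" by (simp only: ac_simps)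
  then show "(g $ 2 $ 3, g $ 1 $ 3) \<in> XY" unfolding XY_def by simp
qed

lemma U0_E: assumes "g \<in> U0" obtains a b where "(a, b) \<in> XY" "g = umat a b"
  using U0_umat[OF assms] by blast

lemma umat_nth [simp]: "umat a b $ 2 $ 3 = a" "umat a b $ 1 $ 3 = b" by (simp_all add: umat_def)

lemma umat_pt: "umat a b *v pt c d = pt (a + c) (b + d + cj a * c)"
  by (simp add: umat_def vec_eq_iff forall_3 matrix_vec_3 ac_simps)

lemma wmat_vec: "(wmat *v x) $ 1 = x $ 3" "(wmat *v x) $ 2 = x $ 2" "(wmat *v x) $ 3 = x $ 1"
  by (simp_all add: wmat_def matrix_vec_3)

lemma wmat_e1: "wmat *v e1 = pt 0 0"
  by (simp add: vec_eq_iff forall_3 wmat_vec)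

lemma acl_acts: "acts_on G0 (carrier G0) Omg acl"
  unfolding acts_on_def
proof (intro conjI ballI)
  fix A l assume A: "A \<in> carrier G0" and l: "l \<in> Omg"
  then obtain v where v: "l = ln v" "v \<noteq> 0" "hf J0 v v = 0" unfolding Omg_def by blast
  obtain A' where A': "A' ** A = mat 1" using SU3_inverse[of A J0] A by auto
  have "A *v v \<noteq> 0"
  proof
    assume "A *v v = 0"
    then have "A' *v (A *v v) = 0" by simp
    then show False using v(2) A' by (simp add: matrix_vector_mul_assoc)
  qed
  moreover have "hf J0 (A *v v) (A *v v) = 0" using hf_SU3 A v(3) by simp
  ultimately show "acl A l \<in> Omg" unfolding v(1) acl_ln Omg_def by blast
next
  show "acl \<one>\<^bsub>G0\<^esub> l = l" for l by (simp add: acl_def)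
  show "acl (g \<otimes>\<^bsub>G0\<^esub> h) l = acl g (acl h l)" for g h l by (simp add: acl_def image_image matrix_vector_mul_assoc)
qed

lemma P0_mult: assumes "g \<in> P0" "h \<in> P0"
  shows "g ** h \<in> P0 \<and> (g ** h) $ 1 $ 1 = g $ 1 $ 1 * h $ 1 $ 1"
proof -
  have "g ** h \<in> SU3 q J0" using assms by (intro SU3_mult) (simp_all add: P0_def)
  then show ?thesis
    by (simp add: P0_iff matrix_mult_3 P0_struct(2,3,4)[OF assms(1)] P0_struct(2,3)[OF assms(2)])
qed

text \<open>Entries of v p = p u are compared, so no inverse has to be computed. As p has diagonal
  t, t^(q - 1), t^(-q), the factors are t^(q - 1) t^q = t^(2q - 1) and t t^q = t^(q + 1).\<close>

lemma conj_facts: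
  assumes p: "p \<in> P0" and u: "u \<in> U0"
  defines "v \<equiv> p \<otimes>\<^bsub>G0\<^esub> u \<otimes>\<^bsub>G0\<^esub> inv\<^bsub>G0\<^esub> p"
  shows "v $ 2 $ 3 = (p $ 1 $ 1) ^ (2 * q - 1) * u $ 2 $ 3"
    and "u $ 2 $ 3 = 0 \<Longrightarrow> v $ 1 $ 3 = (p $ 1 $ 1) ^ (q + 1) * u $ 1 $ 3"
proof -
  let ?i = "inv\<^bsub>G0\<^esub> p"
  have pS: "p \<in> carrier G0" using p P0_iff by simp
  have uP: "u \<in> P0" "u $ 1 $ 1 = 1" using u unfolding U0_def by auto
  have iS: "?i \<in> SU3 q J0" using G0.inv_closed[OF pS] by simp
  have ip: "?i ** p = mat 1" "p ** ?i = mat 1" using G0.l_inv[OF pS] G0.r_inv[OF pS] by simp_all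
  have iP: "?i \<in> P0"
  proof -
    have "acl ?i (acl p (ln e1)) = ln e1" unfolding acl_def by (simp add: image_image matrix_vector_mul_assoc ip)
    then show ?thesis using p iS unfolding P0_def by simp
  qed
  have "(p ** ?i) $ 1 $ 1 = 1" using ip by (simp add: mat_def)
  then have t1: "p $ 1 $ 1 * ?i $ 1 $ 1 = 1" using P0_mult[OF p iP] by simp
  have vU: "v \<in> U0" unfolding U0_def v_def using P0_mult P0_mult[OF p uP(1)] iP t1 uP(2) by simp
  have vp: "v ** p = p ** u" unfolding v_def by (simp add: matrix_mul_assoc[symmetric] ip)
  note ps = P0_struct[OF p]
  let ?t = "p $ 1 $ 1"
  have vn: "v $ 2 $ 1 = 0" "v $ 2 $ 2 = 1" "v $ 1 $ 1 = 1" "v $ 1 $ 2 = cj (v $ 2 $ 3)"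
  proof -
    obtain a b where "v = umat a b" using U0_E[OF vU] by blast
    then show "v $ 2 $ 1 = 0" "v $ 2 $ 2 = 1" "v $ 1 $ 1 = 1" "v $ 1 $ 2 = cj (v $ 2 $ 3)" by (simp_all add: umat_def)
  qed
  have u33: "u $ 3 $ 3 = 1"
  proof -
    obtain a b where "u = umat a b" using U0_E[OF u] by blast
    then show ?thesis by (simp add: umat_def)
  qed
  note vn = vn u33
  have "(v ** p) $ 2 $ 3 = (p ** u) $ 2 $ 3" using vp by simp
  then have "p $ 2 $ 3 + v $ 2 $ 3 * p $ 3 $ 3 = p $ 2 $ 2 * u $ 2 $ 3 + p $ 2 $ 3"
    using ps vn by (simp add: matrix_mult_3)
  then have "v $ 2 $ 3 * p $ 3 $ 3 = p $ 2 $ 2 * u $ 2 $ 3" by (metis add.commute add_left_cancel)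
  then have "v $ 2 $ 3 = (cj ?t * cj ?t / ?t) * u $ 2 $ 3" unfolding ps(5,6) using ps(1) by (simp add: field_simps)
  moreover have "cj ?t * cj ?t / ?t = ?t ^ (2 * q - 1)"
  proof -
    have "?t ^ (2 * q) = ?t * ?t ^ (2 * q - 1)" using q_ge by (simp add: power_eq_if)
    moreover have "cj ?t * cj ?t = ?t ^ (2 * q)" unfolding cj_def by (simp only: power_add[symmetric] mult_2)
    ultimately show ?thesis using ps(1) by simp
  qed
  ultimately show "v $ 2 $ 3 = ?t ^ (2 * q - 1) * u $ 2 $ 3" by simp
  then have v0: "v $ 2 $ 3 = 0" if "u $ 2 $ 3 = 0" using that by simp
  show "v $ 1 $ 3 = ?t ^ (q + 1) * u $ 1 $ 3" if u0: "u $ 2 $ 3 = 0"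
  proof -
    have "(v ** p) $ 1 $ 3 = (p ** u) $ 1 $ 3" using vp by simp
    then have "p $ 1 $ 3 + v $ 1 $ 3 * p $ 3 $ 3 = ?t * u $ 1 $ 3 + p $ 1 $ 3"
      using ps vn u0 v0[OF u0] by (simp add: matrix_mult_3)
    then have "v $ 1 $ 3 * p $ 3 $ 3 = ?t * u $ 1 $ 3" by (metis add.commute add_left_cancel)
    then have "v $ 1 $ 3 = (?t * cj ?t) * u $ 1 $ 3" unfolding ps(5) using ps(1) by (simp add: field_simps)
    then show ?thesis unfolding norm_power .
  qed
qed

theorem unitary3_SU3:
  "unitary3 m q G0 Omg acl (ln e1) (ln (pt 0 0)) wmat P0 U0 Z0 (\<lambda>g. g $ 1 $ 1) (\<lambda>g. g $ 2 $ 3) (\<lambda>g. g $ 1 $ 3) L0"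
proof unfold_locales
  show "finite (carrier G0)" by simp
  show "acts_on G0 (carrier G0) Omg acl" by (rule acl_acts)
  show "card Omg = q ^ 3 + 1" by (rule card_Omg)
  have XY0: "(0, 0) \<in> XY" unfolding XY_def by simp
  show "ln e1 \<in> Omg" "ln (pt 0 0) \<in> Omg" using Omg_alt XY0 by auto
  show "ln e1 \<noteq> ln (pt 0 0)" by (rule e1_pt)
  show "P0 = {g \<in> carrier G0. acl g (ln e1) = ln e1}" by (simp add: P0_def)
  show "wmat \<in> carrier G0" using wmat_SU3 by simp
  show "acl wmat (ln e1) = ln (pt 0 0)" by (simp add: acl_ln wmat_e1)
  show "wmat \<otimes>\<^bsub>G0\<^esub> wmat = \<one>\<^bsub>G0\<^esub>" by (simp add: wmat_square)
  show "(g \<otimes>\<^bsub>G0\<^esub> h) $ 1 $ 1 = g $ 1 $ 1 * h $ 1 $ 1" if "g \<in> P0" "h \<in> P0" for g h using P0_mult[OF that] by simp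
  show "g $ 1 $ 1 \<noteq> 0" if "g \<in> P0" for g using P0_struct[OF that] by blast
  show "\<exists>h\<in>P0. h $ 1 $ 1 = t \<and> acl h (ln (pt 0 0)) = ln (pt 0 0)" if t: "t \<noteq> 0" for t
  proof (intro bexI conjI)
    show "hmat t \<in> P0" using hmat_SU3[OF t] P0_iff by (simp add: hmat_def)
    show "hmat t $ 1 $ 1 = t" by (simp add: hmat_def)
    have "hmat t *v pt 0 0 = (1 / cj t) *s pt 0 0" by (simp add: vec_eq_iff forall_3 matrix_vec_3 hmat_def)
    then show "acl (hmat t) (ln (pt 0 0)) = ln (pt 0 0)" unfolding acl_ln using ln_scale[of "1 / cj t"] t by simp
  qed
  show "U0 = {g \<in> P0. g $ 1 $ 1 = 1}" by (simp add: U0_def)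
  have act_po: "acl u (ln (pt 0 0)) = ln (pt (u $ 2 $ 3) (u $ 1 $ 3))" if u: "u \<in> U0" for u
  proof -
    obtain a b where "u = umat a b" using U0_E[OF u] by blast
    then show ?thesis by (simp add: acl_ln umat_pt)
  qed
  show "\<exists>!u. u \<in> U0 \<and> acl u (ln (pt 0 0)) = x" if x: "x \<in> Omg" "x \<noteq> ln e1" for x
  proof -
    obtain a b where ab: "(a, b) \<in> XY" "x = ln (pt a b)" using x Omg_alt by auto
    show ?thesis
    proof (rule ex1I[of _ "umat a b"])
      show "umat a b \<in> U0 \<and> acl (umat a b) (ln (pt 0 0)) = x" using umat_U0[OF ab(1)] act_po ab(2) by simp
      fix u assume u: "u \<in> U0 \<and> acl u (ln (pt 0 0)) = x"
      then have "ln (pt (u $ 2 $ 3) (u $ 1 $ 3)) = ln (pt a b)" using act_po[of u] ab(2) by metis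
      then have "u $ 2 $ 3 = a \<and> u $ 1 $ 3 = b" by (rule pt_eq)
      moreover obtain a' b' where "u = umat a' b'" using U0_E u by blast
      ultimately show "u = umat a b" by simp
    qed
  qed
  have um: "u ** v = umat (u $ 2 $ 3 + v $ 2 $ 3) (u $ 1 $ 3 + v $ 1 $ 3 + cj (u $ 2 $ 3) * v $ 2 $ 3)"
    if uv: "u \<in> U0" "v \<in> U0" for u v
  proof -
    obtain a b where "u = umat a b" using U0_E[OF uv(1)] by blast
    moreover obtain c d where "v = umat c d" using U0_E[OF uv(2)] by blast
    ultimately show ?thesis by (simp add: umat_mult)
  qed
  show "(u \<otimes>\<^bsub>G0\<^esub> v) $ 2 $ 3 = u $ 2 $ 3 + v $ 2 $ 3" if "u \<in> U0" "v \<in> U0" for u v using um[OF that] by simp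
  show "(u \<otimes>\<^bsub>G0\<^esub> v) $ 1 $ 3 = u $ 1 $ 3 + v $ 1 $ 3 + cj (u $ 2 $ 3) * v $ 2 $ 3" if "u \<in> U0" "v \<in> U0" for u v using um[OF that] by simp
  show "bij_betw (\<lambda>u. (u $ 2 $ 3, u $ 1 $ 3)) U0 {(a, b). b + cj b = a * cj a}"
    unfolding XY_def[symmetric]
  proof (rule bij_betw_byWitness[of _ "\<lambda>(a, b). umat a b"])
    show "\<forall>u\<in>U0. (\<lambda>(a, b). umat a b) (u $ 2 $ 3, u $ 1 $ 3) = u" using U0_umat(1)[symmetric] by simp
    show "\<forall>x\<in>XY. ((\<lambda>(a, b). umat a b) x $ 2 $ 3, (\<lambda>(a, b). umat a b) x $ 1 $ 3) = x" by auto
    show "(\<lambda>u. (u $ 2 $ 3, u $ 1 $ 3)) ` U0 \<subseteq> XY" using U0_umat(2) by auto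
    show "(\<lambda>(a, b). umat a b) ` XY \<subseteq> U0" using umat_U0 by auto
  qed
  show "Z0 = {u \<in> U0. u $ 2 $ 3 = 0}" by (simp add: Z0_def)
  show "(p \<otimes>\<^bsub>G0\<^esub> u \<otimes>\<^bsub>G0\<^esub> inv\<^bsub>G0\<^esub> p) $ 2 $ 3 = p $ 1 $ 1 ^ (2 * q - 1) * u $ 2 $ 3" if "p \<in> P0" "u \<in> U0" for p u
    by (rule conj_facts(1)[OF that])
  show "(p \<otimes>\<^bsub>G0\<^esub> z \<otimes>\<^bsub>G0\<^esub> inv\<^bsub>G0\<^esub> p) $ 1 $ 3 = p $ 1 $ 1 ^ (q + 1) * z $ 1 $ 3" if "p \<in> P0" "z \<in> Z0" for p z
    using conj_facts(2)[OF that(1), of z] that(2) unfolding Z0_def by blast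
  show "\<exists>u\<in>U0. \<exists>v\<in>U0. wmat \<otimes>\<^bsub>G0\<^esub> u \<otimes>\<^bsub>G0\<^esub> wmat \<otimes>\<^bsub>G0\<^esub> v \<otimes>\<^bsub>G0\<^esub> wmat \<in> P0 \<and>
      (wmat \<otimes>\<^bsub>G0\<^esub> u \<otimes>\<^bsub>G0\<^esub> wmat \<otimes>\<^bsub>G0\<^esub> v \<otimes>\<^bsub>G0\<^esub> wmat) $ 1 $ 1 = t" if t: "t \<noteq> 0" for t
  proof -
    \<comment> \<open>With a of norm t + cj t, both (a, t) and (a/t, 1/t) satisfy the equation of
      \<open>XY\<close>. The word sends \<open>e1\<close> to \<open>pt 0 0\<close>, then to
      \<open>pt a t\<close>, to t times \<open>pt (a/t) (1/t)\<close>, to t times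
      \<open>pt 0 0\<close>, and finally to t times \<open>e1\<close>.\<close>
    obtain a where a: "a * cj a = t + cj t" using norm_ex[OF Fq_trace] by blast
    have ct: "cj t \<noteq> 0" using t by simp
    have XYv: "(a, t) \<in> XY" unfolding XY_def using a by simp
    have "1 / t + cj (1 / t) = (t + cj t) / (t * cj t)" using t ct by (simp add: cj_divide field_simps)
    also have "\<dots> = (a / t) * cj (a / t)" using a by (simp add: cj_divide)
    finally have XYu: "(a / t, 1 / t) \<in> XY" unfolding XY_def by simp
    let ?u1 = "umat (a / t) (1 / t)"
    have u1: "?u1 \<in> carrier G0" using umat_SU3[OF XYu] by simp
    define u where "u = inv\<^bsub>G0\<^esub> ?u1"
    have uu: "u ** ?u1 = mat 1" unfolding u_def using G0.l_inv[OF u1] by simp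
    have uS: "u \<in> SU3 q J0" unfolding u_def using G0.inv_closed[OF u1] by simp
    have u1P: "?u1 \<in> P0" "?u1 $ 1 $ 1 = 1" using umat_U0[OF XYu] unfolding U0_def by auto
    have uP: "u \<in> P0"
    proof -
      have "acl u (acl ?u1 (ln e1)) = ln e1" unfolding acl_def by (simp add: image_image matrix_vector_mul_assoc uu)
      then show ?thesis using u1P(1) uS unfolding P0_def by simp
    qed
    have "(u ** ?u1) $ 1 $ 1 = 1" using uu by (simp add: mat_def)
    then have uU: "u \<in> U0" unfolding U0_def using P0_mult[OF uP u1P(1)] u1P(2) uP by simp
    let ?p = "wmat ** u ** wmat ** umat a t ** wmat"
    have "umat a t *v (wmat *v e1) = pt a t" unfolding wmat_e1 umat_pt by simp
    moreover have "wmat *v pt a t = t *s pt (a / t) (1 / t)" using t by (simp add: vec_eq_iff forall_3 wmat_vec)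
    moreover have "pt (a / t) (1 / t) = ?u1 *v pt 0 0" unfolding umat_pt by simp
    moreover have "u *v (t *s (?u1 *v pt 0 0)) = t *s pt 0 0" by (simp add: vector_scalar_commute matrix_vector_mul_assoc uu)
    moreover have "wmat *v (t *s pt 0 0) = t *s e1" by (simp add: vec_eq_iff forall_3 wmat_vec)
    ultimately have pe: "?p *v e1 = t *s e1" by (simp add: matrix_vector_mul_assoc[symmetric])
    have pS: "?p \<in> SU3 q J0" by (intro SU3_mult wmat_SU3 uS umat_SU3 XYv)
    have "(?p *v e1) $ 1 = t" "(?p *v e1) $ 2 = 0" "(?p *v e1) $ 3 = 0" unfolding pe by simp_all
    then have "?p $ 1 $ 1 = t" "?p $ 2 $ 1 = 0" "?p $ 3 $ 1 = 0" by (simp_all add: matrix_vec_3)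
    then have "?p \<in> P0" "?p $ 1 $ 1 = t" using pS P0_iff by auto
    then show ?thesis using uU umat_U0[OF XYv] by (intro bexI[of _ u] bexI[of _ "umat a t"]) simp_all
  qed
  have Zum: "umat 0 b \<in> Z0" if "b \<in> Fq" for b
  proof -
    have "(0, b) \<in> XY" using that unfolding XY_def Fq_def by simp
    then show ?thesis unfolding Z0_def using umat_U0 by simp
  qed
  show "\<exists>x\<in>Z0. wmat = x \<otimes>\<^bsub>G0\<^esub> (wmat \<otimes>\<^bsub>G0\<^esub> x \<otimes>\<^bsub>G0\<^esub> wmat) \<otimes>\<^bsub>G0\<^esub> x"
  proof -
    \<comment> \<open>Multiplying out produces the numerals 2 and 3, which are 0 and 1 in
      characteristic 2.\<close>
    have two: "(2::'k) = 0" using add_self[of 1] by (simp only: one_add_one)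
    have "(3::'k) = 2 + 1" by simp
    then have three: "(3::'k) = 1" unfolding two by simp
    show ?thesis
      by (rule bexI[OF _ Zum[OF Fq_1]])
        (simp add: wmat_def umat_def mat3_eq_iff forall_3 matrix_mult_3 two three)
  qed
  show "\<exists>x\<in>Z0. \<exists>y\<in>Z0. x \<otimes>\<^bsub>G0\<^esub> (wmat \<otimes>\<^bsub>G0\<^esub> y \<otimes>\<^bsub>G0\<^esub> wmat) \<otimes>\<^bsub>G0\<^esub> x \<otimes>\<^bsub>G0\<^esub> wmat \<in> P0 \<and>
      (x \<otimes>\<^bsub>G0\<^esub> (wmat \<otimes>\<^bsub>G0\<^esub> y \<otimes>\<^bsub>G0\<^esub> wmat) \<otimes>\<^bsub>G0\<^esub> x \<otimes>\<^bsub>G0\<^esub> wmat) $ 1 $ 1 = s" if s: "s \<in> Fq" "s \<noteq> 0" for s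
  proof -
    have si: "inverse s \<in> Fq" using Fq_inverse[OF s(1)] .
    \<comment> \<open>An identity of SL_2 in coordinates 1 and 3: the word is the diagonal matrix
      with entries s, 1, 1/s.\<close>
    let ?x = "umat 0 s" and ?y = "umat 0 (inverse s)"
    have xS: "?x \<in> SU3 q J0" "?y \<in> SU3 q J0" using Zum[OF s(1)] Zum[OF si] unfolding Z0_def U0_def P0_def by auto
    let ?p = "?x ** (wmat ** ?y ** wmat) ** ?x ** wmat"
    have "?p \<in> SU3 q J0" by (intro SU3_mult wmat_SU3 xS)
    moreover have "?p = mat3 s 0 0 0 1 0 0 0 (inverse s)"
      using s(2) by (simp add: wmat_def umat_def mat3_eq_iff forall_3 matrix_mult_3)
    ultimately have "?p \<in> P0" "?p $ 1 $ 1 = s" using P0_iff by auto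
    then show ?thesis using Zum[OF s(1)] Zum[OF si] by (intro bexI[of _ ?x] bexI[of _ ?y]) simp_all
  qed
  show "L0 \<subseteq> Omg"
  proof -
    have "(0, b) \<in> XY" if "b \<in> Fq" for b using that unfolding XY_def Fq_def by simp
    then show ?thesis unfolding L0_def Omg_alt by force
  qed
  show "ln e1 \<in> L0" unfolding L0_def by simp
  show "card L0 = q + 1"
  proof -
    have inj: "inj_on (\<lambda>b. ln (pt 0 b)) Fq" using pt_eq by (auto simp: inj_on_def)
    have "ln e1 \<notin> (\<lambda>b. ln (pt 0 b)) ` Fq" using e1_pt by auto
    then show ?thesis unfolding L0_def using card_image[OF inj] card_Fq by simp
  qed
  show "acl z x \<in> L0" if z: "z \<in> Z0" and x: "x \<in> L0" for z x
  proof -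
    have zU: "z \<in> U0" "z $ 2 $ 3 = 0" using z unfolding Z0_def by auto
    have bF: "z $ 1 $ 3 \<in> Fq" using U0_umat(2)[OF zU(1)] zU(2) unfolding XY_def Fq_def by simp
    obtain a b where "z = umat a b" using U0_E[OF zU(1)] by blast
    then have zz: "umat 0 (z $ 1 $ 3) = z" using zU(2) by simp
    consider "x = ln e1" | b where "b \<in> Fq" "x = ln (pt 0 b)" using x unfolding L0_def by blast
    then show ?thesis
    proof cases
      case 1
      then show ?thesis using zU unfolding U0_def P0_def L0_def by simp
    next
      case 2
      have "acl z x = ln (pt 0 (z $ 1 $ 3 + b))" unfolding 2(2) acl_ln using umat_pt[of 0 "z $ 1 $ 3" 0 b] zz by simp
      then show ?thesis unfolding L0_def using Fq_add[OF bF 2(1)] by simp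
    qed
  qed
  show "acl wmat x \<in> L0" if x: "x \<in> L0" for x
  proof -
    consider "x = ln e1" | "x = ln (pt 0 0)" | b where "b \<in> Fq" "b \<noteq> 0" "x = ln (pt 0 b)" using x unfolding L0_def by blast
    then show ?thesis
    proof cases
      case 1
      then show ?thesis using Fq_0 unfolding L0_def by (simp add: acl_ln wmat_e1)
    next
      case 2
      have "wmat *v pt 0 0 = e1" by (simp add: vec_eq_iff forall_3 wmat_vec)
      then show ?thesis unfolding L0_def 2 acl_ln by simp
    next
      case 3
      \<comment> \<open>On this line w inverts the coordinate b and exchanges 0 with
        infinity.\<close>
      have "wmat *v pt 0 b = b *s pt 0 (inverse b)" using 3(2) by (simp add: vec_eq_iff forall_3 wmat_vec)
      then have "acl wmat x = ln (pt 0 (inverse b))" unfolding 3(3) acl_ln using ln_scale[OF 3(2)] by simp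
      then show ?thesis unfolding L0_def using Fq_inverse[OF 3(1)] by simp
    qed
  qed
qed

end

section \<open>Reduction of an arbitrary Hermitian form to the antidiagonal one\<close>

lemma matrix_kernel_ex: "det A = 0 \<Longrightarrow> \<exists>x. x \<noteq> 0 \<and> A *v x = 0" for A :: "'a::field^'n^'n"
  using invertible_det_nz[of A] invertible_left_inverse[of A] matrix_left_invertible_ker[of A] by blast

text \<open>The matrix with rows a, b, 0 is singular.\<close>

lemma common_orthogonal_ex:
  fixes a b :: "'a::field^3"
  shows "\<exists>y. y \<noteq> 0 \<and> dot y a = 0 \<and> dot y b = 0"
proof -
  let ?A = "mat3 (a $ 1) (a $ 2) (a $ 3) (b $ 1) (b $ 2) (b $ 3) 0 0 0"
  have "det ?A = 0" by (simp add: det_3)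
  then obtain y where y: "y \<noteq> 0" "?A *v y = 0" using matrix_kernel_ex by blast
  have "(?A *v y) $ 1 = 0" "(?A *v y) $ 2 = 0" unfolding y(2) by simp_all
  then have "dot y a = 0" "dot y b = 0" by (simp_all add: matrix_vec_3 dot_def mult.commute)
  then show ?thesis using y(1) by blast
qed

lemma (in group) group_center_normal: "group_center G \<lhd> G"
proof -
  have c: "z \<in> carrier G" "z \<otimes> g = g \<otimes> z" if "z \<in> group_center G" "g \<in> carrier G" for z g
    using that unfolding group_center_def by auto
  have sub: "subgroup (group_center G) G"
  proof (rule subgroupI)
    show "group_center G \<subseteq> carrier G" unfolding group_center_def by blast
    have "\<one> \<in> group_center G" unfolding group_center_def by simp
    then show "group_center G \<noteq> {}" by blast
    show "inv z \<in> group_center G" if z: "z \<in> group_center G" for z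
    proof -
      have zc: "z \<in> carrier G" using c(1)[OF z one_closed] .
      have "inv z \<otimes> g = g \<otimes> inv z" if g: "g \<in> carrier G" for g
      proof -
        have "inv z \<otimes> g = inv z \<otimes> (g \<otimes> z) \<otimes> inv z" using zc g by (simp add: m_assoc)
        also have "\<dots> = inv z \<otimes> (z \<otimes> g) \<otimes> inv z" using c(2)[OF z g] by simp
        also have "\<dots> = (inv z \<otimes> z) \<otimes> g \<otimes> inv z" using zc g by (simp only: m_assoc m_closed inv_closed)
        also have "\<dots> = g \<otimes> inv z" using zc g by simp
        finally show ?thesis .
      qed
      then show ?thesis unfolding group_center_def using zc by simp
    qed
    show "y \<otimes> z \<in> group_center G" if yz: "y \<in> group_center G" "z \<in> group_center G" for y z
    proof -
      have k: "y \<in> carrier G" "z \<in> carrier G" using c(1)[OF yz(1) one_closed] c(1)[OF yz(2) one_closed] .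
      have "y \<otimes> z \<otimes> g = g \<otimes> (y \<otimes> z)" if g: "g \<in> carrier G" for g
      proof -
        have "y \<otimes> z \<otimes> g = y \<otimes> (z \<otimes> g)" using k g by (simp add: m_assoc)
        also have "\<dots> = y \<otimes> (g \<otimes> z)" using c(2)[OF yz(2) g] by simp
        also have "\<dots> = (y \<otimes> g) \<otimes> z" using k g by (simp add: m_assoc)
        also have "\<dots> = (g \<otimes> y) \<otimes> z" using c(2)[OF yz(1) g] by simp
        also have "\<dots> = g \<otimes> (y \<otimes> z)" using k g by (simp add: m_assoc)
        finally show ?thesis .
      qed
      then show ?thesis unfolding group_center_def using k by simp
    qed
  qed
  have "x \<otimes> z \<otimes> inv x \<in> group_center G" if x: "x \<in> carrier G" and z: "z \<in> group_center G" for x z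
  proof -
    have "x \<otimes> z \<otimes> inv x = z \<otimes> x \<otimes> inv x" using c(2)[OF z x] by simp
    also have "\<dots> = z" using x c(1)[OF z x] by (simp add: m_assoc)
    finally show ?thesis using z by simp
  qed
  then show ?thesis using normal_inv_iff sub by blast
qed

context hermitian_field
begin

lemma hf_add: "hf J (x + y) z = hf J x z + hf J y z" "hf J x (y + z) = hf J x y + hf J x z"
  by (simp_all add: hf_def dot_def matrix_vec_3 cj_add algebra_simps)

lemma hf_smult: "hf J (c *s x) y = c * hf J x y" "hf J x (c *s y) = cj c * hf J x y"
  by (simp_all add: hf_def dot_def matrix_vec_3 cj_mult algebra_simps)

lemma hf_0 [simp]: "hf J 0 y = 0" by (simp add: hf_def dot_def)

lemma hf_cj: assumes "transpose J = fm J" shows "cj (hf J x y) = hf J y x"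
proof -
  have "cj (J $ i $ j) = J $ j $ i" for i j
  proof -
    have "transpose J $ i $ j = fm J $ i $ j" using assms by simp
    then show ?thesis by (simp add: transpose_def)
  qed
  then show ?thesis by (simp add: hf_def dot_def matrix_vec_3 cj_add cj_mult algebra_simps)
qed

lemma det_fm: "det (fm A) = cj (det A)"
  by (simp add: det_3 cj_add cj_mult minus_add)

text \<open>For orthogonal anisotropic vectors \<open>e1\<close> and y, some multiple of y has the
  same value of the form as \<open>e1\<close>, because the norm is onto F_q; in characteristic 2
  their sum is then isotropic.\<close>

lemma isotropic_ex:
  assumes J: "transpose J = fm J"
  shows "\<exists>e. e \<noteq> 0 \<and> hf J e e = 0"
proof -
  have x0: "e1 \<noteq> 0" by (auto simp: vec_eq_iff forall_3)
  obtain y where y: "y \<noteq> 0" "dot y (J *v cjv e1) = 0" using common_orthogonal_ex by blast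
  have yx: "hf J y e1 = 0" using y(2) by (simp add: hf_def)
  have xy: "hf J e1 y = 0" using hf_cj[OF J, of y e1] yx by simp
  consider "hf J e1 e1 = 0" | "hf J y y = 0" | "hf J e1 e1 \<noteq> 0" "hf J y y \<noteq> 0" by blast
  then show ?thesis
  proof cases
    case 3
    have "hf J v v \<in> Fq" for v using hf_cj[OF J, of v v] unfolding Fq_def by simp
    then have "hf J e1 e1 * inverse (hf J y y) \<in> Fq" by (intro Fq_mult Fq_inverse)
    then obtain t where t: "t * cj t = hf J e1 e1 * inverse (hf J y y)" using norm_ex by blast
    let ?z = "e1 + t *s y"
    have "hf J ?z ?z = hf J e1 e1 + t * cj t * hf J y y" by (simp add: hf_add hf_smult xy yx)
    also have "\<dots> = 0" unfolding t using 3 by simp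
    finally have "hf J ?z ?z = 0" .
    moreover have "hf J ?z e1 \<noteq> 0" using 3 by (simp add: hf_add hf_smult yx)
    then have "?z \<noteq> 0" using hf_0 by metis
    ultimately show ?thesis by blast
  qed (use x0 y in blast)+
qed

definition cols :: "'k^3 \<Rightarrow> 'k^3 \<Rightarrow> 'k^3 \<Rightarrow> 'k^3^3" where
  "cols x y z = mat3 (x $ 1) (y $ 1) (z $ 1) (x $ 2) (y $ 2) (z $ 2) (x $ 3) (y $ 3) (z $ 3)"

lemma cols_column: "column 1 (cols x y z) = x" "column 2 (cols x y z) = y" "column 3 (cols x y z) = z"
  by (simp_all add: cols_def column_def vec_eq_iff forall_3)

lemma cols_vec: "cols x y z *v v = v $ 1 *s x + v $ 2 *s y + v $ 3 *s z"
  by (simp add: cols_def vec_eq_iff forall_3 matrix_vec_3 mult.commute)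

text \<open>A hyperbolic pair e, f together with an orthogonal vector d, scaled to norm 1, has Gram
  matrix \<open>J0\<close>.\<close>

lemma hermitian_standard_basis:
  assumes nd: "nondeg_hermitian q J"
  shows "\<exists>M. det M \<noteq> 0 \<and> transpose M ** J ** fm M = J0"
proof -
  have J: "transpose J = fm J" and dJ: "det J \<noteq> 0" using nd unfolding nondeg_hermitian_def fm_def by auto
  note c = hf_cj[OF J]
  have hFq: "hf J v v \<in> Fq" for v using c[of v v] unfolding Fq_def by simp
  obtain e where e: "e \<noteq> 0" "hf J e e = 0" using isotropic_ex[OF J] by blast
  obtain f0 where f0: "hf J e f0 \<noteq> 0"
  proof -
    obtain i where i: "e $ i \<noteq> 0" using e(1) by (auto simp: vec_eq_iff)
    obtain J' where J': "J ** J' = mat 1" using dJ invertible_det_nz[of J] unfolding invertible_def by blast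
    \<comment> \<open>By nondegeneracy J times the conjugate of y can be prescribed; a unit vector
      picks out a nonzero coordinate of e.\<close>
    let ?y = "cjv (J' *v axis i 1)"
    have "cjv ?y = J' *v axis i 1" by (simp add: vec_eq_iff)
    then have "J *v cjv ?y = axis i 1" by (simp add: matrix_vector_mul_assoc J')
    then have "hf J e ?y = dot e (axis i 1)" by (simp add: hf_def)
    also have "\<dots> = e $ i" using exhaust_3[of i] by (auto simp: dot_def axis_def)
    finally show ?thesis using that i by metis
  qed
  define f1 where "f1 = cj (inverse (hf J e f0)) *s f0"
  have ef1: "hf J e f1 = 1" unfolding f1_def using f0 by (simp add: hf_smult)
  have f1e: "hf J f1 e = 1" using c[of e f1] ef1 by simp
  \<comment> \<open>Adding b e changes the value of the form at \<open>f1\<close> by the trace of b,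
    and the trace takes every value in F_q.\<close>
  obtain b where b: "b + cj b = hf J f1 f1" using trace_ex[OF hFq] by blast
  define f where "f = f1 + b *s e"
  have ef: "hf J e f = 1" unfolding f_def by (simp add: hf_add hf_smult e(2) ef1)
  have fe: "hf J f e = 1" using c[of e f] ef by simp
  have "hf J f f = hf J f1 f1 + (b + cj b)" unfolding f_def by (simp add: hf_add hf_smult e(2) ef1 f1e ac_simps)
  then have ff: "hf J f f = 0" using b by simp
  obtain d where d: "d \<noteq> 0" "dot d (J *v cjv e) = 0" "dot d (J *v cjv f) = 0" using common_orthogonal_ex by blast
  have de: "hf J d e = 0" "hf J d f = 0" using d by (simp_all add: hf_def)
  have ed: "hf J e d = 0" "hf J f d = 0" using c[of d e] c[of d f] de by simp_all
  let ?M = "cols e d f"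
  have "det ?M \<noteq> 0"
  proof
    assume "det ?M = 0"
    then obtain x where x: "x \<noteq> 0" "?M *v x = 0" using matrix_kernel_ex by blast
    then have s: "x $ 1 *s e + x $ 2 *s d + x $ 3 *s f = 0" by (simp add: cols_vec)
    have "hf J (x $ 1 *s e + x $ 2 *s d + x $ 3 *s f) e = x $ 3"
      "hf J (x $ 1 *s e + x $ 2 *s d + x $ 3 *s f) f = x $ 1"
      by (simp_all add: hf_add hf_smult e(2) de ef fe ff)
    then have x13: "x $ 3 = 0" "x $ 1 = 0" unfolding s by simp_all
    then have "x $ 2 *s d = 0" using s by simp
    then have "x $ 2 = 0" using d(1) by (simp add: vec_eq_iff) blast
    then show False using x(1) x13 by (simp add: vec_eq_iff forall_3)
  qed
  then have "det (transpose ?M ** J ** fm ?M) \<noteq> 0" using dJ by (simp add: det_mul det_transpose det_fm)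
  moreover have "transpose ?M ** J ** fm ?M = mat3 0 0 1 0 (hf J d d) 0 1 0 0"
    by (simp add: mat3_eq_iff forall_3 gram cols_column e(2) de ed ef fe ff)
  ultimately have dd: "hf J d d \<noteq> 0" by (simp add: det_3)
  obtain t where t: "t * cj t = inverse (hf J d d)" using norm_ex[OF Fq_inverse[OF hFq]] by blast
  let ?d = "t *s d"
  let ?N = "cols e ?d f"
  have "hf J ?d ?d = t * cj t * hf J d d" by (simp add: hf_smult)
  also have "\<dots> = 1" unfolding t using dd by simp
  finally have dd1: "hf J ?d ?d = 1" .
  have N: "transpose ?N ** J ** fm ?N = J0"
    unfolding mat3_eq_iff forall_3 gram cols_column dd1 by (simp add: hf_smult e(2) de ed ef fe ff)
  have "det (transpose ?N ** J ** fm ?N) \<noteq> 0" unfolding N by (simp add: det_3)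
  then have "det ?N \<noteq> 0" by (auto simp: det_mul det_transpose)
  then show ?thesis using N by blast
qed

text \<open>Composite of conjugation by a change of basis, the quotient by the center, and the given
  isomorphism read backwards. The element \<open>umat 0 1\<close> survives because it does not
  commute with \<open>wmat\<close>, so its conjugate is not central.\<close>

lemma PSU3_subgroup_hom:
  fixes J :: "'k^3^3"
  assumes nd: "nondeg_hermitian q J" and G: "group G'" and H: "subgroup H G'"
    and iso: "G'\<lparr>carrier := H\<rparr> \<cong> PSU3_group q J"
  shows "\<exists>\<theta>\<in>hom G0 G'. \<theta> (umat 0 1) \<noteq> \<one>\<^bsub>G'\<^esub>"
proof -
  let ?S = "SU3_group q J" and ?H = "G'\<lparr>carrier := H\<rparr>"
  let ?Z = "group_center ?S"
  interpret S: group ?S by (rule SU3_group)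
  interpret Z: normal ?Z ?S by (rule S.group_center_normal)
  interpret G: group G' by (rule G)
  interpret H: group ?H by (rule subgroup.subgroup_is_group[OF H G])
  interpret Q: group "PSU3_group q J" unfolding PSU3_group_def by (rule Z.factorgroup_is_group)
  obtain \<psi> where psi: "\<psi> \<in> iso ?H (PSU3_group q J)" using iso unfolding is_iso_def by blast
  define \<eta> where "\<eta> = inv_into (carrier ?H) \<psi>"
  have eta: "\<eta> \<in> iso (PSU3_group q J) ?H" unfolding \<eta>_def by (rule H.iso_set_sym[OF psi])
  then have eta_hom: "\<eta> \<in> hom (PSU3_group q J) ?H" and eta_inj: "inj_on \<eta> (carrier (PSU3_group q J))"
    by (auto simp: iso_def bij_betw_def)
  have proj: "(\<lambda>x. ?Z #>\<^bsub>?S\<^esub> x) \<in> hom ?S (PSU3_group q J)"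
    unfolding PSU3_group_def by (rule Z.r_coset_hom_Mod)
  obtain M where M: "det M \<noteq> 0" "transpose M ** J ** fm M = J0" using hermitian_standard_basis[OF nd] by blast
  obtain M' where M': "M ** M' = mat 1" "M' ** M = mat 1"
    using M(1) invertible_det_nz[of M] unfolding invertible_def by blast
  define C where "C A = M ** A ** M'" for A
  have C_mult: "C (A ** A') = C A ** C A'" for A A'
  proof -
    have "C A ** C A' = M ** A ** (M' ** M) ** A' ** M'" unfolding C_def by (simp only: matrix_mul_assoc)
    also have "\<dots> = C (A ** A')" unfolding M' C_def by (simp add: matrix_mul_assoc)
    finally show ?thesis by simp
  qed
  have C_inv: "M' ** C A ** M = A" for A
  proof -
    have "M' ** C A ** M = (M' ** M) ** A ** (M' ** M)" unfolding C_def by (simp only: matrix_mul_assoc)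
    then show ?thesis unfolding M' by simp
  qed
  have C_SU3: "C A \<in> SU3 q J" if A: "A \<in> SU3 q J0" for A
  proof -
    have a: "det A = 1" "transpose A ** J0 ** fm A = J0" using A SU3_iff by auto
    have "det M * det M' = 1" using det_mul[of M M'] M' by simp
    then have "det (C A) = 1" unfolding C_def using a by (simp add: det_mul)
    moreover have "transpose (C A) ** J ** fm (C A)
      = transpose M' ** (transpose A ** (transpose M ** J ** fm M) ** fm A) ** fm M'"
      unfolding C_def by (simp add: matrix_transpose_mul fm_mult matrix_mul_assoc)
    moreover have "\<dots> = transpose M' ** (transpose M ** J ** fm M) ** fm M'" unfolding M(2) a ..
    moreover have "\<dots> = transpose (M ** M') ** J ** fm (M ** M')"
      by (simp add: matrix_transpose_mul fm_mult matrix_mul_assoc)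
    moreover have "\<dots> = J" unfolding M' by (simp add: fm_one transpose_mat)
    ultimately show ?thesis unfolding SU3_iff by simp
  qed
  have C_hom: "C \<in> hom G0 ?S"
    by (rule homI) (use C_SU3 C_mult in \<open>auto simp: SU3_group_def\<close>)
  define \<theta> where "\<theta> = \<eta> \<circ> ((\<lambda>x. ?Z #>\<^bsub>?S\<^esub> x) \<circ> C)"
  have "\<theta> \<in> hom G0 ?H" unfolding \<theta>_def by (rule hom_compose[OF hom_compose[OF C_hom proj] eta_hom])
  then have th: "\<theta> \<in> hom G0 G'" using subgroup.subset[OF H] by (auto simp: hom_def)
  have "(0, 1) \<in> XY" unfolding XY_def by simp
  then have uS: "umat 0 1 \<in> SU3 q J0" by (rule umat_SU3)
  have "\<theta> (umat 0 1) \<noteq> \<one>\<^bsub>G'\<^esub>"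
  proof
    let ?u = "umat 0 1"
    assume "\<theta> ?u = \<one>\<^bsub>G'\<^esub>"
    then have "\<eta> (?Z #>\<^bsub>?S\<^esub> C ?u) = \<one>\<^bsub>?H\<^esub>" unfolding \<theta>_def by simp
    moreover have "\<eta> \<one>\<^bsub>PSU3_group q J\<^esub> = \<one>\<^bsub>?H\<^esub>" by (rule hom_one[OF eta_hom Q.is_group H.is_group])
    moreover have Cu: "C ?u \<in> carrier ?S" using C_SU3[OF uS] by (simp add: SU3_group_def)
    moreover have "?Z #>\<^bsub>?S\<^esub> C ?u \<in> carrier (PSU3_group q J)" using proj Cu unfolding hom_def by blast
    ultimately have "?Z #>\<^bsub>?S\<^esub> C ?u = \<one>\<^bsub>PSU3_group q J\<^esub>"
      using inj_onD[OF eta_inj] Q.one_closed by metis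
    then have "?Z #>\<^bsub>?S\<^esub> C ?u = ?Z" by (simp add: PSU3_group_def FactGroup_def)
    then have "C ?u \<in> ?Z" using S.coset_join1[OF _ Cu Z.subgroup_axioms] by blast
    moreover have "C wmat \<in> carrier ?S" using C_SU3[OF wmat_SU3] by (simp add: SU3_group_def)
    ultimately have "C ?u ** C wmat = C wmat ** C ?u" unfolding group_center_def by (auto simp: SU3_group_def)
    then have "?u ** wmat = wmat ** ?u" using C_inv C_mult by metis
    then have "(?u ** wmat) $ 1 $ 1 = (wmat ** ?u) $ 1 $ 1" by simp
    then show False by (simp add: matrix_mult_3 wmat_def umat_def)
  qed
  then show ?thesis using th by blast
qed

end

section \<open>Transfer to the given permutation group\<close>

theorem theorem4p4:
  fixes m q :: nat and B :: "'b set" and G' :: "('g, 'z) monoid_scheme"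
    and \<phi> :: "'g \<Rightarrow> 'b \<Rightarrow> 'b" and J :: "'k::{field,finite}^3^3"
  assumes "m > 1" and "q = 2 ^ m"
    and "finite B" and "card B = q ^ 3 + 1"
    and "group G'" and "group_action G' B \<phi>" and "inj_on \<phi> (carrier G')"
    and "CARD('k) = q ^ 2" and "nondeg_hermitian q J"
    and "\<exists>H. subgroup H G' \<and> G'\<lparr>carrier := H\<rparr> \<cong> PSU3_group q J"
  shows "very_simple_F2 G' (QB B) (rep_QB B \<phi>)"
proof -
  interpret K: hermitian_field m q "TYPE('k)" using assms(1,2,8) by unfold_locales
  interpret G: group G' by fact
  interpret A: group_action G' B \<phi> by fact
  obtain \<theta> where th: "\<theta> \<in> hom K.G0 G'" "\<theta> (K.umat 0 1) \<noteq> \<one>\<^bsub>G'\<^esub>"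
    using K.PSU3_subgroup_hom[OF assms(9,5)] assms(10) by blast
  interpret th: group_hom K.G0 G' \<theta> by unfold_locales (rule th(1))
  define a where "a g b = \<phi> (\<theta> g) b" for g b
  have tc: "\<theta> g \<in> carrier G'" if "g \<in> carrier K.G0" for g using th.hom_closed[OF that] .
  have ac: "acts_on K.G0 (carrier K.G0) B a"
    unfolding acts_on_def
  proof (intro conjI ballI)
    show "a g b \<in> B" if "g \<in> carrier K.G0" "b \<in> B" for g b
      unfolding a_def using A.element_image[OF tc[OF that(1)] that(2) refl] .
    show "a \<one>\<^bsub>K.G0\<^esub> b = b" if "b \<in> B" for b
      unfolding a_def th.hom_one A.id_eq_one[symmetric] using that by simp
    show "a (g \<otimes>\<^bsub>K.G0\<^esub> h) b = a g (a h b)" if "g \<in> carrier K.G0" "h \<in> carrier K.G0" "b \<in> B" for g h b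
      unfolding a_def th.hom_mult[OF that(1,2)] using A.composition_rule[OF that(3) tc[OF that(1)] tc[OF that(2)]] .
  qed
  have "(0, 1) \<in> K.XY" unfolding K.XY_def by simp
  then have uU: "K.umat 0 1 \<in> K.U0" and uG: "K.umat 0 1 \<in> carrier K.G0"
    using K.umat_U0 K.umat_SU3 by auto
  \<comment> \<open>Faithfulness of \<phi> turns the nontrivial image of \<open>K.umat 0 1\<close>
    into a point moved by an element of U, which is what recognising the action requires.\<close>
  have "\<exists>b1\<in>B. a (K.umat 0 1) b1 \<noteq> b1"
  proof (rule ccontr)
    assume "\<not> (\<exists>b1\<in>B. a (K.umat 0 1) b1 \<noteq> b1)"
    then have "\<phi> (\<theta> (K.umat 0 1)) b = b" if "b \<in> B" for b using that unfolding a_def by blast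
    then have "\<phi> (\<theta> (K.umat 0 1)) = (\<lambda>b\<in>B. b)"
      using A.bij_prop0[OF tc[OF uG]] unfolding Bij_def by (intro extensionalityI[of _ B]) auto
    also have "\<dots> = \<phi> \<one>\<^bsub>G'\<^esub>" by (rule A.id_eq_one)
    finally show False using inj_onD[OF assms(7)] tc[OF uG] th(2) by blast
  qed
  then obtain b1 where b1: "b1 \<in> B" "a (K.umat 0 1) b1 \<noteq> b1" by blast
  obtain b0 where tt: "two_transitive K.G0 B a K.U0 (q^3) (3 * m) b0"
    using unitary3.action_two_transitive[OF K.unitary3_SU3 ac assms(4) uU b1] by blast
  interpret T: two_transitive K.G0 B a K.U0 "q^3" "3 * m" b0 by (rule tt)
  \<comment> \<open>The inverse permutation, taken by \<open>inv_into\<close> in the given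
    representation, is the action of the inverse group element.\<close>
  have rep: "rep_QB B \<phi> (\<theta> g) h = T.rh g h" if g: "g \<in> carrier K.G0" and h: "h \<in> QB B" for g h
  proof
    fix b
    have "inv_into B (\<phi> (\<theta> g)) b = a (inv\<^bsub>K.G0\<^esub> g) b" if b: "b \<in> B"
    proof (rule inv_into_f_eq)
      show "inj_on (\<phi> (\<theta> g)) B" by (rule A.inj_prop[OF tc[OF g]])
      show "a (inv\<^bsub>K.G0\<^esub> g) b \<in> B" using T.a_closed[OF K.G0.inv_closed[OF g] b] .
      show "\<phi> (\<theta> g) (a (inv\<^bsub>K.G0\<^esub> g) b) = b" using T.a_inv(2)[OF g b] unfolding a_def .
    qed
    then show "rep_QB B \<phi> (\<theta> g) h b = T.rh g h b" using h by (simp add: rep_QB_def perm_act_def T.rh_def)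
  qed
  show ?thesis
    unfolding very_simple_F2_def
  proof (intro allI impI, elim conjE)
    fix R :: "(('b \<Rightarrow> bit) \<Rightarrow> 'b \<Rightarrow> bit) set"
    let ?V = "QB B"
    assume R: "R \<subseteq> End_F2 ?V" and one: "(\<lambda>v\<in>?V. v) \<in> R"
      and smult: "\<forall>c::bit. \<forall>f\<in>R. (\<lambda>v\<in>?V. \<lambda>b. c * f v b) \<in> R"
      and plus: "\<forall>f\<in>R. \<forall>g\<in>R. (\<lambda>v\<in>?V. \<lambda>x. f v x + g v x) \<in> R"
      and comp: "\<forall>f\<in>R. \<forall>g\<in>R. compose ?V f g \<in> R"
      and conj: "\<forall>\<sigma>\<in>carrier G'. \<forall>f\<in>R. compose ?V (rep_QB B \<phi> \<sigma>) (compose ?V f (rep_QB B \<phi> (inv\<^bsub>G'\<^esub> \<sigma>))) \<in> R"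
    have cl: "f v \<in> ?V" if "f \<in> R" "v \<in> ?V" for f v using R that unfolding End_F2_def by auto
    have ex: "f \<in> extensional ?V" if "f \<in> R" for f using R that unfolding End_F2_def by (auto simp: PiE_def)
    \<comment> \<open>Stability under conjugation by G' gives stability under the image of SU_3.
      Elements of R act as themselves, hence the identity in the place of \<open>ap\<close>.\<close>
    interpret P: perm_algebra K.G0 B a K.U0 "q^3" "3 * m" b0 R "\<lambda>r. r"
    proof unfold_locales
      fix r s v w g assume r: "r \<in> R"
      show "v \<in> ?V \<Longrightarrow> r v \<in> ?V" using cl[OF r] .
      show "r (v + w) = r v + r w" if "v \<in> ?V" "w \<in> ?V"
        using R r that unfolding End_F2_def plus_fun_def by auto
      show "\<exists>t\<in>R. \<forall>v\<in>?V. t v = r v + s v" if s: "s \<in> R"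
        by (rule bexI[of _ "\<lambda>v\<in>?V. \<lambda>x. r v x + s v x"]) (use plus r s in \<open>auto simp: plus_fun_def\<close>)
      show "\<exists>t\<in>R. \<forall>v\<in>?V. t v = r (s v)" if s: "s \<in> R"
        by (rule bexI[of _ "compose ?V r s"]) (use comp r s in \<open>auto simp: compose_eq\<close>)
      show "\<exists>t\<in>R. \<forall>v\<in>?V. t v = T.rh g (r (T.rh (inv\<^bsub>K.G0\<^esub> g) v))" if g: "g \<in> carrier K.G0"
      proof (intro bexI ballI)
        show "compose ?V (rep_QB B \<phi> (\<theta> g)) (compose ?V r (rep_QB B \<phi> (inv\<^bsub>G'\<^esub> (\<theta> g)))) \<in> R"
          using conj tc[OF g] r by blast
        fix v assume v: "v \<in> ?V"
        note gi = K.G0.inv_closed[OF g]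
        have "rep_QB B \<phi> (inv\<^bsub>G'\<^esub> (\<theta> g)) v = T.rh (inv\<^bsub>K.G0\<^esub> g) v"
          using rep[OF gi v] th.hom_inv[OF g] by simp
        moreover have "r (T.rh (inv\<^bsub>K.G0\<^esub> g) v) \<in> ?V" using cl[OF r T.rh_QB[OF gi v]] .
        ultimately show "compose ?V (rep_QB B \<phi> (\<theta> g)) (compose ?V r (rep_QB B \<phi> (inv\<^bsub>G'\<^esub> (\<theta> g)))) v
            = T.rh g (r (T.rh (inv\<^bsub>K.G0\<^esub> g) v))"
          using v rep[OF g] by (simp add: compose_eq)
      qed
    next
      show "\<exists>i\<in>R. \<forall>v\<in>?V. i v = v" by (rule bexI[OF _ one]) simp
    qed
    from P.scalar_or_full
    show "R = {\<lambda>v\<in>?V. \<lambda>b. c * v b | c::bit. True} \<or> R = End_F2 ?V"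
    proof
      assume sc: "\<forall>r\<in>R. (\<forall>v\<in>?V. r v = 0) \<or> (\<forall>v\<in>?V. r v = v)"
      have "R = {\<lambda>v\<in>?V. \<lambda>b. c * v b | c::bit. True}"
      proof
        show "R \<subseteq> {\<lambda>v\<in>?V. \<lambda>b. c * v b | c::bit. True}"
        proof
          fix r assume r: "r \<in> R"
          have "\<exists>c::bit. \<forall>v\<in>?V. r v = (\<lambda>b. c * v b)"
            using sc r by (metis mult_zero_left mult_1 zero_fun_def)
          then obtain c :: bit where "\<forall>v\<in>?V. r v = (\<lambda>b. c * v b)" by blast
          then have "r = (\<lambda>v\<in>?V. \<lambda>b. c * v b)" using ex[OF r] by (intro extensionalityI[of _ ?V]) auto
          then show "r \<in> {\<lambda>v\<in>?V. \<lambda>b. c * v b | c::bit. True}" by blast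
        qed
        show "{\<lambda>v\<in>?V. \<lambda>b. c * v b | c::bit. True} \<subseteq> R"
        proof clarify
          fix c :: bit
          have "(\<lambda>v\<in>?V. \<lambda>b. c * (\<lambda>v\<in>?V. v) v b) \<in> R" using smult one by blast
          moreover have "(\<lambda>v\<in>?V. \<lambda>b. c * (\<lambda>v\<in>?V. v) v b) = (\<lambda>v\<in>?V. \<lambda>b. c * v b)" by (rule restrict_ext) simp
          ultimately show "(\<lambda>v\<in>?V. \<lambda>b. c * v b) \<in> R" by simp
        qed
      qed
      then show ?thesis ..
    next
      assume full: "\<forall>f. (\<forall>x\<in>?V. f x \<in> ?V) \<and> (\<forall>x\<in>?V. \<forall>y\<in>?V. f (x + y) = f x + f y) \<longrightarrow> (\<exists>r\<in>R. \<forall>v\<in>?V. r v = f v)"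
      have "End_F2 ?V \<subseteq> R"
      proof
        fix f assume f: "f \<in> End_F2 ?V"
        then have fx: "f \<in> extensional ?V" unfolding End_F2_def by (auto simp: PiE_def)
        have "(\<forall>x\<in>?V. f x \<in> ?V) \<and> (\<forall>x\<in>?V. \<forall>y\<in>?V. f (x + y) = f x + f y)"
          using f unfolding End_F2_def plus_fun_def by auto
        then obtain r where r: "r \<in> R" "\<forall>v\<in>?V. r v = f v" using full by blast
        have "r = f" by (rule extensionalityI[OF ex[OF r(1)] fx]) (use r(2) in blast)
        then show "f \<in> R" using r(1) by simp
      qed
      then show ?thesis using R by blast
    qed
  qed
qed

end
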